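(* Let $(Y^7,\varphi)$ be a torsion-free $G_2$ manifold and let $(B_\tau^\bullet,D)$ be the weighted coefficient complex at the minimal standard embedding (as defined in the context). In every degree $k$, $$H^k(B_\tau,D)\cong H^k(G_1,d_1)\oplus H^k(E,e)\oplus H^k(G_0,d_0).$$ With the coefficient action retained (i.e. as modules over $S=\mathbb R[\epsilon]/(\epsilon^2)$, with $\epsilon$ acting by zero on $H^k(E,e)$), this is equivalently $$H^k(B_\tau,D)\cong\bigl(H^k(G,d)\otimes_{\mathbb R}S\bigr)\oplus H^k(E,e).$$
   Context: Geometry. $Y$ is a smooth seven-manifold with a positive three-form $\varphi$ (a $G_2$ structure), with associated metric $g$ and orientation, normalized so that locally there is an oriented $g$-orthonormal coframe with $\varphi=e^{123}+e^{145}+e^{167}+e^{246}-e^{257}-e^{347}-e^{356}$; $\psi=*\varphi$. Torsion-free means $\mathrm d\varphi=0$ and $\mathrm d\psi=0$; equivalently the Levi-Civita connection $\nabla$ preserves $\varphi$ and $\psi$. No compactness or full holonomy is assumed. $R(X,Y)=[\nabla_X,\nabla_Y]-\nabla_{[X,Y]}$ is the Riemann curvature, regarded as an $\operatorname{End}(TY)$-valued two-form. Minimal standard embedding means that the gauge bundle is $V=TY$, its connection is $\nabla$, its curvature is $F=R$, and $H=0$. $(e_i)$ denotes a local $g$-orthonormal frame. Canonical complexes. $\Lambda^2=\Lambda^2_7\oplus\Lambda^2_{14}$ with $\Lambda^2_7=\{\iota_X\varphi\}$, $\Lambda^2_{14}=\{\eta:\eta\wedge\psi=0\}$, and $\Lambda^3_1=\mathbb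 R\varphi\subset\Lambda^3$. Put $\Lambda^0_{\rm can}=\Lambda^0$, $\Lambda^1_{\rm can}=\Lambda^1$, $\Lambda^2_{\rm can}=\Lambda^2_7$, $\Lambda^3_{\rm can}=\Lambda^3_1$, and zero in other degrees; $\Pi_k:\Lambda^k\to\Lambda^k_{\rm can}$ is the orthogonal projection ($\Pi_0,\Pi_1$ identities, $\Pi_4=0$). For a bundle $W$ with connection, $\mathcal C^k(W)=\Gamma(\Lambda^k_{\rm can}T^*Y\otimes W)$ and $\check{\mathrm d}_W^k=\Pi_{k+1}\mathrm d_W|_{\mathcal C^k(W)}$, where $\mathrm d_W$ is the exterior covariant derivative. $E=\operatorname{End}_0(TY)$ is the trace-free endomorphism bundle; $T^*Y$ and $E$ carry the connections induced by $\nabla$. Coefficient complex. $\epsilon$ is a formal parameter with $\epsilon^2=0$, $S=\mathbb R[\epsilon]/(\epsilon^2)$. $G^\bullet=\mathcal C^\bullet(T^*Y)$ with $d=\check{\mathrm d}_{T^*Y}$; $E^\bullet=\mathcal C^\bullet(E)$ with $e=\check{\mathrm d}_E$; $B_\tau^\bullet=(G^\bullet\otimes_{\mathbb R}S)\oplus E^\bullet$ as $S$-module with $\epsilon E^\bullet=0$. As real spaces $G_0^\bullet=G^\bullet$, $G_1^\bullet=\epsilon G^\bullet$; elements of $B_\tau^k=G_1^k\oplus E^k\oplus G_0^k$ are triples $(\epsilon x,a,m)$, with $d_0m=dm$, $d_1(\epsilon x)=\epsilon\,dx$, and multiplication by $\epsilon$ acts by $(\epsilon x,a,m)\mapsto(\epsilon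 m,0,0)$. The ($S$-linear) differential is $$D^k=\begin{pmatrix}d_1^k&b^k&c^k\\0&e^k&f^k\\0&0&d_0^k\end{pmatrix}\quad\text{on }G_1^k\oplus E^k\oplus G_0^k,$$ with all maps out of degree $3$ zero. Couplings. For a $T^*Y$-valued form $m$ write $m_X=m(\cdot,X)$ for the evaluation of the $T^*Y$ factor on $X$. $\tau(S,T)=\operatorname{tr}_7(ST)$ is the real matrix trace on $TY$; for matrix-valued forms $\tau(\alpha\wedge\beta)$ is the trace of the wedge–matrix product in the displayed order. $\iota_ZR$ is the $\operatorname{End}(TY)$-valued one-form $X\mapsto R(Z,X)$. For $m\in\Omega^p(Y,T^*Y)$, $\mathcal B(m)\in\Omega^p(Y,\operatorname{End}(TY))$ is defined by $g(X,\mathcal B(m)Y)=(\nabla_Xm)_Y$. On unrestricted forms, $$\mathfrak f m=\sum_j(\iota_{e_j}R)\wedge m_{e_j},\quad(\mathfrak b a)(Z)=-\tfrac{\epsilon}{4}\tau(\iota_ZR\wedge a),\quad(\mathfrak c m)(Z)=-\tfrac{\epsilon}{2}\tau(\iota_ZR\wedge\mathcal B(m)),$$ where $(\cdot)(Z)$ is evaluation of the $T^*Y$ factor; and $f^k=\Pi_{k+1}\mathfrak f:G_0^k\to E^{k+1}$, $b^k=\Pi_{k+1}\mathfrak b:E^k\to G_1^{k+1}$, $c^k=\Pi_{k+1}\mathfrak c:G_0^k\to G_1^{k+1}$. *)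

theory Defs
  imports "HOL-Analysis.Analysis" "HOL-Algebra.Module" "HOL-Algebra.AbelCoset"
begin

section \<open>Modules, complexes and cohomology\<close>

text \<open>
  Modules are \<open>HOL-Algebra\<close> records; their fields \<^const>\<open>monoid.mult\<close> and \<^const>\<open>one\<close>
  play no role and are left \<^const>\<open>undefined\<close>.
\<close>

definition real_ring :: "real ring" where
  "real_ring = \<lparr>carrier = UNIV, monoid.mult = (*), one = 1, ring.zero = 0, add = (+)\<rparr>"

text \<open>The dual numbers \<open>S = \<real>[\<epsilon>]/(\<epsilon>\<^sup>2)\<close>; the pair \<open>(s, t)\<close> stands for \<open>s + t\<epsilon>\<close>.\<close>

definition dual_ring :: "(real \<times> real) ring" where
  "dual_ring = \<lparr>carrier = UNIV,
     monoid.mult = (\<lambda>(s, t) (s', t'). (s * s', s * t' + t * s')),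
     one = (1, 0), ring.zero = (0, 0),
     add = (\<lambda>(s, t) (s', t'). (s + s', t + t'))\<rparr>"

definition restrict_scalars :: "('s \<Rightarrow> 'r) \<Rightarrow> ('r, 'a) module \<Rightarrow> ('s, 'a) module" where
  "restrict_scalars h M = \<lparr>carrier = carrier M, monoid.mult = undefined, one = undefined,
     ring.zero = \<zero>\<^bsub>M\<^esub>, add = add M, smult = (\<lambda>r. smult M (h r))\<rparr>"

definition dsum_module :: "('r, 'a) module \<Rightarrow> ('r, 'b) module \<Rightarrow> ('r, 'a \<times> 'b) module" where
  "dsum_module M N = \<lparr>carrier = carrier M \<times> carrier N, monoid.mult = undefined, one = undefined,
     ring.zero = (\<zero>\<^bsub>M\<^esub>, \<zero>\<^bsub>N\<^esub>),
     add = (\<lambda>(x, y) (x', y'). (x \<oplus>\<^bsub>M\<^esub> x', y \<oplus>\<^bsub>N\<^esub> y')),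
     smult = (\<lambda>r (x, y). (r \<odot>\<^bsub>M\<^esub> x, r \<odot>\<^bsub>N\<^esub> y))\<rparr>"

text \<open>
  \<open>M \<otimes>\<^sub>\<real> S\<close>: since \<open>S\<close> is free over \<open>\<real>\<close> on \<open>1, \<epsilon>\<close>, its elements are uniquely
  \<open>m \<otimes> 1 + x \<otimes> \<epsilon>\<close>, encoded as \<open>(m, x)\<close>.
\<close>

definition base_change :: "(real, 'a) module \<Rightarrow> (real \<times> real, 'a \<times> 'a) module" where
  "base_change M = \<lparr>carrier = carrier M \<times> carrier M, monoid.mult = undefined, one = undefined,
     ring.zero = (\<zero>\<^bsub>M\<^esub>, \<zero>\<^bsub>M\<^esub>),
     add = (\<lambda>(m, x) (m', x'). (m \<oplus>\<^bsub>M\<^esub> m', x \<oplus>\<^bsub>M\<^esub> x')),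
     smult = (\<lambda>(s, t) (m, x). (s \<odot>\<^bsub>M\<^esub> m, (s \<odot>\<^bsub>M\<^esub> x) \<oplus>\<^bsub>M\<^esub> (t \<odot>\<^bsub>M\<^esub> m)))\<rparr>"

text \<open>The real subspace \<open>\<epsilon>M\<close> of \<open>M \<otimes>\<^sub>\<real> S\<close>.\<close>

definition eps_part :: "(real, 'a) module \<Rightarrow> (real, 'a \<times> 'a) module" where
  "eps_part M = (restrict_scalars (\<lambda>r. (r, 0)) (base_change M))
     \<lparr>carrier := {\<zero>\<^bsub>M\<^esub>} \<times> carrier M\<rparr>"

definition quotient_module :: "('r, 'a) module \<Rightarrow> 'a set \<Rightarrow> ('r, 'a set) module" where
  "quotient_module M N = \<lparr>carrier = a_rcosets\<^bsub>M\<^esub> N, monoid.mult = undefined, one = undefined,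
     ring.zero = N, add = set_add M,
     smult = (\<lambda>r A. \<Union>a\<in>A. N +>\<^bsub>M\<^esub> (r \<odot>\<^bsub>M\<^esub> a))\<rparr>"

text \<open>Complexes start in degree zero; their terms in negative degrees vanish.\<close>

definition cocycles :: "(nat \<Rightarrow> ('r, 'a) module) \<Rightarrow> (nat \<Rightarrow> 'a \<Rightarrow> 'a) \<Rightarrow> nat \<Rightarrow> 'a set" where
  "cocycles C d k = {x \<in> carrier (C k). d k x = \<zero>\<^bsub>C (Suc k)\<^esub>}"

definition coboundaries :: "(nat \<Rightarrow> ('r, 'a) module) \<Rightarrow> (nat \<Rightarrow> 'a \<Rightarrow> 'a) \<Rightarrow> nat \<Rightarrow> 'a set" where
  "coboundaries C d k = (case k of 0 \<Rightarrow> {\<zero>\<^bsub>C 0\<^esub>} | Suc j \<Rightarrow> d j ` carrier (C j))"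

definition cohomology ::
  "(nat \<Rightarrow> ('r, 'a) module) \<Rightarrow> (nat \<Rightarrow> 'a \<Rightarrow> 'a) \<Rightarrow> nat \<Rightarrow> ('r, 'a set) module" where
  "cohomology C d k = quotient_module ((C k)\<lparr>carrier := cocycles C d k\<rparr>) (coboundaries C d k)"

definition module_isomorphic :: "'r ring \<Rightarrow> ('r, 'a) module \<Rightarrow> ('r, 'b) module \<Rightarrow> bool" where
  "module_isomorphic R M N \<longleftrightarrow> Module.module R M \<and> Module.module R N \<and>
     (\<exists>h. bij_betw h (carrier M) (carrier N) \<and>
        (\<forall>x\<in>carrier M. \<forall>y\<in>carrier M. h (x \<oplus>\<^bsub>M\<^esub> y) = h x \<oplus>\<^bsub>N\<^esub> h y) \<and>
        (\<forall>r\<in>carrier R. \<forall>x\<in>carrier M. h (r \<odot>\<^bsub>M\<^esub> x) = r \<odot>\<^bsub>N\<^esub> h x))"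

section \<open>Smooth seven-manifolds\<close>

primrec Ck_on :: "nat \<Rightarrow> 'a::real_normed_vector set \<Rightarrow> ('a \<Rightarrow> 'b::real_normed_vector) \<Rightarrow> bool" where
  "Ck_on 0 S f = continuous_on S f"
| "Ck_on (Suc n) S f = ((\<forall>x\<in>S. f differentiable (at x)) \<and>
     (\<forall>v. Ck_on n S (\<lambda>x. frechet_derivative f (at x) v)))"

text \<open>Only used for open \<open>S\<close>.\<close>

definition smooth_on :: "'a::real_normed_vector set \<Rightarrow> ('a \<Rightarrow> 'b::real_normed_vector) \<Rightarrow> bool" where
  "smooth_on S f \<longleftrightarrow> (\<forall>n. Ck_on n S f)"

type_synonym vec7 = "real^7"
type_synonym 'y chart = "'y set \<times> ('y \<Rightarrow> vec7)"

definition inv_chart :: "'y chart \<Rightarrow> vec7 \<Rightarrow> 'y" where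
  "inv_chart c = inv_into (fst c) (snd c)"

definition smooth_atlas :: "'y::topological_space chart set \<Rightarrow> bool" where
  "smooth_atlas A \<longleftrightarrow>
     (\<Union>c\<in>A. fst c) = UNIV \<and>
     (\<forall>c\<in>A. open (fst c) \<and> open (snd c ` fst c) \<and>
        homeomorphism (fst c) (snd c ` fst c) (snd c) (inv_chart c)) \<and>
     (\<forall>c\<in>A. \<forall>c'\<in>A. smooth_on (snd c ` (fst c \<inter> fst c')) (snd c' \<circ> inv_chart c))"

text \<open>
  The tangent space at \<open>x\<close> is modelled on \<^typ>\<open>vec7\<close>: a vector \<open>v\<close> at \<open>x\<close> stands for the
  tangent vector with components \<open>v\<close> in a chart \<open>pref A x\<close> around \<open>x\<close> chosen once and for all.
  Components in another chart \<open>c\<close> are obtained by the Jacobian of the transition map.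
  Vector fields are thus functions \<^typ>\<open>'y \<Rightarrow> vec7\<close>. Their smoothness has to be tested in charts,
  as \<open>pref A x\<close> varies with \<open>x\<close>. Vector fields on an open set \<open>U\<close> are total functions whose
  values outside \<open>U\<close> do not matter.
\<close>

definition pref :: "'y chart set \<Rightarrow> 'y \<Rightarrow> 'y chart" where
  "pref A x = (SOME c. c \<in> A \<and> x \<in> fst c)"

definition to_chart :: "'y chart set \<Rightarrow> 'y chart \<Rightarrow> 'y \<Rightarrow> vec7 \<Rightarrow> vec7" where
  "to_chart A c y v =
     frechet_derivative (snd c \<circ> inv_chart (pref A y)) (at (snd (pref A y) y)) v"

definition from_chart :: "'y chart set \<Rightarrow> 'y chart \<Rightarrow> 'y \<Rightarrow> vec7 \<Rightarrow> vec7" where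
  "from_chart A c y w = frechet_derivative (snd (pref A y) \<circ> inv_chart c) (at (snd c y)) w"

text \<open>
  Extension of a tangent vector \<open>w\<close> at \<open>x\<close> to the vector field on the domain of \<open>pref A x\<close> with
  constant components there. Any two such extensions (for the same \<open>x\<close>) commute.
\<close>

definition ext :: "'y chart set \<Rightarrow> 'y \<Rightarrow> vec7 \<Rightarrow> 'y \<Rightarrow> vec7" where
  "ext A x w = (\<lambda>y. from_chart A (pref A x) y w)"

text \<open>Directional derivative at \<open>x\<close> of a function along the tangent vector \<open>v\<close>.\<close>

definition dirD :: "'y chart set \<Rightarrow> 'y \<Rightarrow> vec7 \<Rightarrow> ('y \<Rightarrow> 'b::real_normed_vector) \<Rightarrow> 'b" where
  "dirD A x v h = frechet_derivative (h \<circ> inv_chart (pref A x)) (at (snd (pref A x) x)) v"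

definition lie_bracket :: "'y chart set \<Rightarrow> ('y \<Rightarrow> vec7) \<Rightarrow> ('y \<Rightarrow> vec7) \<Rightarrow> 'y \<Rightarrow> vec7" where
  "lie_bracket A X Y x =
     dirD A x (X x) (\<lambda>y. to_chart A (pref A x) y (Y y)) -
     dirD A x (Y x) (\<lambda>y. to_chart A (pref A x) y (X y))"

definition smooth_fun :: "'y chart set \<Rightarrow> 'y set \<Rightarrow> ('y \<Rightarrow> real) \<Rightarrow> bool" where
  "smooth_fun A U h \<longleftrightarrow> (\<forall>c\<in>A. smooth_on (snd c ` (U \<inter> fst c)) (h \<circ> inv_chart c))"

definition smooth_vf :: "'y chart set \<Rightarrow> 'y set \<Rightarrow> ('y \<Rightarrow> vec7) \<Rightarrow> bool" where
  "smooth_vf A U X \<longleftrightarrow>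
     (\<forall>c\<in>A. smooth_on (snd c ` (U \<inter> fst c)) ((\<lambda>y. to_chart A c y (X y)) \<circ> inv_chart c))"

text \<open>
  Covectors are encoded by their components, so that a covector \<open>s\<close> takes the value \<open>s \<bullet> v\<close> on a
  vector \<open>v\<close>; here \<open>\<bullet>\<close> is the duality pairing and unrelated to the Riemannian metric.
  Endomorphisms of the tangent space are matrices.
\<close>

definition smooth_cov :: "'y chart set \<Rightarrow> 'y set \<Rightarrow> ('y \<Rightarrow> vec7) \<Rightarrow> bool" where
  "smooth_cov A U s \<longleftrightarrow> (\<forall>X. smooth_vf A U X \<longrightarrow> smooth_fun A U (\<lambda>y. s y \<bullet> X y))"

definition smooth_end :: "'y chart set \<Rightarrow> 'y set \<Rightarrow> ('y \<Rightarrow> real^7^7) \<Rightarrow> bool" where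
  "smooth_end A U s \<longleftrightarrow> (\<forall>X. smooth_vf A U X \<longrightarrow> smooth_vf A U (\<lambda>y. s y *v X y))"

section \<open>Differential forms\<close>

text \<open>
  A \<open>p\<close>-form at a point is a function on lists of vectors, alternating multilinear on lists of
  length \<open>p\<close> and zero on all other lists. Form-valued fields have type
  \<^typ>\<open>'y \<Rightarrow> vec7 list \<Rightarrow> 'w\<close>.
\<close>

definition alt_form :: "nat \<Rightarrow> (vec7 list \<Rightarrow> real) \<Rightarrow> bool" where
  "alt_form p \<omega> \<longleftrightarrow>
     (\<forall>vs. length vs \<noteq> p \<longrightarrow> \<omega> vs = 0) \<and>
     (\<forall>vs i. length vs = p \<and> i < p \<longrightarrow> linear (\<lambda>v. \<omega> (vs[i := v]))) \<and>
     (\<forall>vs i j. length vs = p \<and> i < j \<and> j < p \<and> vs ! i = vs ! j \<longrightarrow> \<omega> vs = 0)"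

text \<open>\<open>sec U s\<close> says that \<open>s\<close> is a smooth section over \<open>U\<close> of the coefficient bundle.\<close>

definition smooth_form ::
  "'y::topological_space chart set \<Rightarrow> ('y set \<Rightarrow> ('y \<Rightarrow> 'w) \<Rightarrow> bool) \<Rightarrow> nat \<Rightarrow>
     ('y \<Rightarrow> vec7 list \<Rightarrow> 'w) \<Rightarrow> bool" where
  "smooth_form A sec p \<alpha> \<longleftrightarrow>
     (\<forall>U Xs. open U \<and> length Xs = p \<and> (\<forall>X\<in>set Xs. smooth_vf A U X) \<longrightarrow>
        sec U (\<lambda>y. \<alpha> y (map (\<lambda>X. X y) Xs)))"

text \<open>Insertion of the first vector.\<close>

definition interior_mult :: "vec7 \<Rightarrow> (vec7 list \<Rightarrow> 'w) \<Rightarrow> vec7 list \<Rightarrow> 'w" where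
  "interior_mult v \<omega> = (\<lambda>vs. \<omega> (v # vs))"

definition omit :: "nat \<Rightarrow> 'v list \<Rightarrow> 'v list" where
  "omit i vs = take i vs @ drop (Suc i) vs"

text \<open>
  The wedge product of a one-form with a form, the coefficients being multiplied by \<open>mul\<close>:
  \<open>(\<theta> \<and> \<alpha>)(v\<^sub>0, \<dots>, v\<^sub>p) = \<Sum>\<^sub>i (-1)\<^sup>i mul (\<theta> v\<^sub>i) (\<alpha>(v\<^sub>0, .., v\<^sub>p without v\<^sub>i))\<close>.
\<close>

definition wedge1 ::
  "('u \<Rightarrow> 'w \<Rightarrow> 'z::real_vector) \<Rightarrow> (vec7 \<Rightarrow> 'u) \<Rightarrow> (vec7 list \<Rightarrow> 'w) \<Rightarrow> vec7 list \<Rightarrow> 'z" where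
  "wedge1 mul \<theta> \<alpha> vs = (\<Sum>i<length vs. (-1) ^ i *\<^sub>R mul (\<theta> (vs ! i)) (\<alpha> (omit i vs)))"

definition covector_wedge :: "vec7 list \<Rightarrow> vec7 list \<Rightarrow> real" where
  "covector_wedge ts vs =
     (\<Sum>\<pi> | \<pi> permutes {..<length ts}.
        of_int (sign \<pi>) * (\<Prod>r<length ts. (ts ! r) \<bullet> (vs ! \<pi> r)))"

text \<open>
  The exterior covariant derivative for a connection \<open>D\<close>, where \<open>D x v s\<close> is the derivative at \<open>x\<close>
  of the section \<open>s\<close> along \<open>v\<close>: the invariant formula evaluated on the extensions \<^const>\<open>ext\<close>,
  whose Lie brackets vanish.
\<close>

definition ext_cov_deriv ::
  "'y chart set \<Rightarrow> ('y \<Rightarrow> vec7 \<Rightarrow> ('y \<Rightarrow> 'w) \<Rightarrow> 'w::real_vector) \<Rightarrow>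
     ('y \<Rightarrow> vec7 list \<Rightarrow> 'w) \<Rightarrow> 'y \<Rightarrow> vec7 list \<Rightarrow> 'w" where
  "ext_cov_deriv A D \<alpha> x vs =
     (\<Sum>i<length vs. (-1) ^ i *\<^sub>R
        D x (vs ! i) (\<lambda>y. \<alpha> y (map (\<lambda>v. ext A x v y) (omit i vs))))"

section \<open>Metric, \<open>G\<^sub>2\<close> structure and Levi-Civita connection\<close>

definition riemannian_metric ::
  "'y::topological_space chart set \<Rightarrow> ('y \<Rightarrow> vec7 \<Rightarrow> vec7 \<Rightarrow> real) \<Rightarrow> bool" where
  "riemannian_metric A g \<longleftrightarrow>
     (\<forall>x. bilinear (g x) \<and> (\<forall>u v. g x u v = g x v u) \<and> (\<forall>v. v \<noteq> 0 \<longrightarrow> g x v v > 0)) \<and>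
     (\<forall>U X Y. open U \<and> smooth_vf A U X \<and> smooth_vf A U Y \<longrightarrow>
        smooth_fun A U (\<lambda>y. g y (X y) (Y y)))"

text \<open>
  A \<open>g\<close>-orthonormal basis of the tangent space at \<open>x\<close>. It is only used in expressions which do not
  depend on the choice.
\<close>

definition onb :: "('y \<Rightarrow> vec7 \<Rightarrow> vec7 \<Rightarrow> real) \<Rightarrow> 'y \<Rightarrow> 7 \<Rightarrow> vec7" where
  "onb g x = (SOME e. \<forall>i j. g x (e i) (e j) = (if i = j then 1 else 0))"

text \<open>Inner product of \<open>p\<close>-forms for which the \<open>e\<^sup>I\<close>, \<open>I\<close> increasing, are orthonormal.\<close>

definition form_inner ::
  "(7 \<Rightarrow> vec7) \<Rightarrow> nat \<Rightarrow> (vec7 list \<Rightarrow> real) \<Rightarrow> (vec7 list \<Rightarrow> real) \<Rightarrow> real" where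
  "form_inner e p \<alpha> \<beta> = (\<Sum>I | length I = p. \<alpha> (map e I) * \<beta> (map e I)) / fact p"

text \<open>Hodge star of a \<open>p\<close>-form in index notation: \<open>\<alpha>\<close> contracted into the first \<open>p\<close> slots of \<open>vol\<close>.\<close>

definition hodge_star ::
  "(7 \<Rightarrow> vec7) \<Rightarrow> (vec7 list \<Rightarrow> real) \<Rightarrow> nat \<Rightarrow> (vec7 list \<Rightarrow> real) \<Rightarrow> vec7 list \<Rightarrow> real" where
  "hodge_star e vol p \<alpha> vs = (\<Sum>I | length I = p. \<alpha> (map e I) * vol (map e I @ vs)) / fact p"

text \<open>
  \<open>\<phi>\<close> is a positive three-form with associated metric \<open>g\<close> and orientation; the latter is given
  by the Riemannian volume form \<open>vol\<close>. The covector fields \<open>\<theta> 1, \<dots>, \<theta> 7\<close> are the oriented orthonormal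
  coframe on \<open>U\<close>. They are indexed by the type \<^typ>\<open>7\<close>, in which \<open>7\<close> is the same index as \<open>0\<close>.
\<close>

definition g2_structure ::
  "'y::topological_space chart set \<Rightarrow> ('y \<Rightarrow> vec7 list \<Rightarrow> real) \<Rightarrow>
     ('y \<Rightarrow> vec7 \<Rightarrow> vec7 \<Rightarrow> real) \<Rightarrow> ('y \<Rightarrow> vec7 list \<Rightarrow> real) \<Rightarrow> bool" where
  "g2_structure A \<phi> g vol \<longleftrightarrow>
     smooth_form A (smooth_fun A) 3 \<phi> \<and> (\<forall>x. alt_form 3 (\<phi> x)) \<and>
     riemannian_metric A g \<and>
     smooth_form A (smooth_fun A) 7 vol \<and> (\<forall>x. alt_form 7 (vol x)) \<and>
     (\<forall>x. \<exists>U (\<theta> :: 7 \<Rightarrow> 'y \<Rightarrow> vec7). open U \<and> x \<in> U \<and> (\<forall>i. smooth_cov A U (\<theta> i)) \<and>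
        (\<forall>y\<in>U. let e = (\<lambda>I vs. covector_wedge (map (\<lambda>i. \<theta> i y) I) vs) in
           (\<forall>u v. g y u v = (\<Sum>i\<in>UNIV. (\<theta> i y \<bullet> u) * (\<theta> i y \<bullet> v))) \<and>
           (\<forall>vs. length vs = 7 \<longrightarrow> vol y vs = e [1,2,3,4,5,6,7] vs) \<and>
           (\<forall>vs. length vs = 3 \<longrightarrow> \<phi> y vs =
              e [1,2,3] vs + e [1,4,5] vs + e [1,6,7] vs + e [2,4,6] vs
              - e [2,5,7] vs - e [3,4,7] vs - e [3,5,6] vs)))"

definition torsion_free ::
  "'y chart set \<Rightarrow> ('y \<Rightarrow> vec7 list \<Rightarrow> real) \<Rightarrow>
     ('y \<Rightarrow> vec7 \<Rightarrow> vec7 \<Rightarrow> real) \<Rightarrow> ('y \<Rightarrow> vec7 list \<Rightarrow> real) \<Rightarrow> bool" where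
  "torsion_free A \<phi> g vol \<longleftrightarrow>
     (let \<psi> = (\<lambda>x. hodge_star (onb g x) (vol x) 3 (\<phi> x)) in
        (\<forall>x vs. ext_cov_deriv A (dirD A) \<phi> x vs = 0) \<and>
        (\<forall>x vs. ext_cov_deriv A (dirD A) \<psi> x vs = 0))"

text \<open>
  \<open>nab X Y\<close> is \<open>\<nabla>\<^sub>X Y\<close>. The axioms are imposed for vector fields on arbitrary open sets; this
  includes the locality of \<open>\<nabla>\<close>, as \<open>f\<close> is arbitrary outside \<open>U\<close>.
\<close>

definition levi_civita ::
  "'y::topological_space chart set \<Rightarrow> ('y \<Rightarrow> vec7 \<Rightarrow> vec7 \<Rightarrow> real) \<Rightarrow>
     (('y \<Rightarrow> vec7) \<Rightarrow> ('y \<Rightarrow> vec7) \<Rightarrow> 'y \<Rightarrow> vec7) \<Rightarrow> bool" where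
  "levi_civita A g nab \<longleftrightarrow>
     (\<forall>U X Y Z f. open U \<and> smooth_vf A U X \<and> smooth_vf A U Y \<and> smooth_vf A U Z \<and> smooth_fun A U f \<longrightarrow>
        smooth_vf A U (nab X Y) \<and>
        (\<forall>x\<in>U.
           nab (\<lambda>y. X y + Y y) Z x = nab X Z x + nab Y Z x \<and>
           nab (\<lambda>y. f y *\<^sub>R X y) Y x = f x *\<^sub>R nab X Y x \<and>
           nab X (\<lambda>y. Y y + Z y) x = nab X Y x + nab X Z x \<and>
           nab X (\<lambda>y. f y *\<^sub>R Y y) x = dirD A x (X x) f *\<^sub>R Y x + f x *\<^sub>R nab X Y x \<and>
           nab X Y x - nab Y X x = lie_bracket A X Y x \<and>
           dirD A x (X x) (\<lambda>y. g y (Y y) (Z y)) = g x (nab X Y x) (Z x) + g x (Y x) (nab X Z x)))"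

text \<open>
  The induced connections, by the Leibniz rule for the evaluation on the extension of a
  tangent vector \<open>w\<close>.
\<close>

definition conn_cov ::
  "'y chart set \<Rightarrow> (('y \<Rightarrow> vec7) \<Rightarrow> ('y \<Rightarrow> vec7) \<Rightarrow> 'y \<Rightarrow> vec7) \<Rightarrow>
     'y \<Rightarrow> vec7 \<Rightarrow> ('y \<Rightarrow> vec7) \<Rightarrow> vec7" where
  "conn_cov A nab x v s =
     (\<chi> i. let w = axis i 1 in
        dirD A x v (\<lambda>y. s y \<bullet> ext A x w y) - s x \<bullet> nab (ext A x v) (ext A x w) x)"

definition conn_end ::
  "'y chart set \<Rightarrow> (('y \<Rightarrow> vec7) \<Rightarrow> ('y \<Rightarrow> vec7) \<Rightarrow> 'y \<Rightarrow> vec7) \<Rightarrow>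
     'y \<Rightarrow> vec7 \<Rightarrow> ('y \<Rightarrow> real^7^7) \<Rightarrow> real^7^7" where
  "conn_end A nab x v s =
     matrix (\<lambda>w. nab (ext A x v) (\<lambda>y. s y *v ext A x w y) x
                 - s x *v nab (ext A x v) (ext A x w) x)"

text \<open>\<open>(\<nabla>\<^sub>X m)(vs)\<close> for a form \<open>m\<close> with values in the cotangent bundle.\<close>

definition conn_cov_form ::
  "'y chart set \<Rightarrow> (('y \<Rightarrow> vec7) \<Rightarrow> ('y \<Rightarrow> vec7) \<Rightarrow> 'y \<Rightarrow> vec7) \<Rightarrow>
     ('y \<Rightarrow> vec7 list \<Rightarrow> vec7) \<Rightarrow> 'y \<Rightarrow> vec7 \<Rightarrow> vec7 list \<Rightarrow> vec7" where
  "conn_cov_form A nab m x X vs =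
     conn_cov A nab x X (\<lambda>y. m y (map (\<lambda>v. ext A x v y) vs))
     - (\<Sum>i<length vs. m x (vs[i := nab (ext A x X) (ext A x (vs ! i)) x]))"

definition curvature ::
  "'y chart set \<Rightarrow> (('y \<Rightarrow> vec7) \<Rightarrow> ('y \<Rightarrow> vec7) \<Rightarrow> 'y \<Rightarrow> vec7) \<Rightarrow>
     'y \<Rightarrow> vec7 \<Rightarrow> vec7 \<Rightarrow> real^7^7" where
  "curvature A nab x u v =
     matrix (\<lambda>w. let X = ext A x u; Y = ext A x v; Z = ext A x w in
        nab X (nab Y Z) x - nab Y (nab X Z) x - nab (lie_bracket A X Y) Z x)"

section \<open>Canonical complexes\<close>

definition can_forms :: "('y \<Rightarrow> vec7 list \<Rightarrow> real) \<Rightarrow> nat \<Rightarrow> 'y \<Rightarrow> (vec7 list \<Rightarrow> real) set" where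
  "can_forms \<phi> k x =
     (if k \<le> 1 then {\<omega>. alt_form k \<omega>}
      else if k = 2 then {interior_mult v (\<phi> x) |v. True}
      else if k = 3 then {\<lambda>vs. r * \<phi> x vs |r. True}
      else {\<lambda>_. 0})"

text \<open>The orthogonal projection \<open>\<Pi>\<^sub>k\<close>, first for scalar-valued forms, then tensored with the identity.\<close>

definition can_proj0 ::
  "('y \<Rightarrow> vec7 list \<Rightarrow> real) \<Rightarrow> ('y \<Rightarrow> vec7 \<Rightarrow> vec7 \<Rightarrow> real) \<Rightarrow> nat \<Rightarrow> 'y \<Rightarrow>
     (vec7 list \<Rightarrow> real) \<Rightarrow> vec7 list \<Rightarrow> real" where
  "can_proj0 \<phi> g k x \<omega> =
     (THE \<beta>. \<beta> \<in> can_forms \<phi> k x \<and>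
        (\<forall>\<gamma>\<in>can_forms \<phi> k x. form_inner (onb g x) k (\<lambda>vs. \<omega> vs - \<beta> vs) \<gamma> = 0))"

definition can_proj ::
  "('y \<Rightarrow> vec7 list \<Rightarrow> real) \<Rightarrow> ('y \<Rightarrow> vec7 \<Rightarrow> vec7 \<Rightarrow> real) \<Rightarrow> nat \<Rightarrow>
     ('y \<Rightarrow> vec7 list \<Rightarrow> 'w::euclidean_space) \<Rightarrow> 'y \<Rightarrow> vec7 list \<Rightarrow> 'w" where
  "can_proj \<phi> g k \<alpha> x vs = (\<Sum>b\<in>Basis. can_proj0 \<phi> g k x (\<lambda>us. \<alpha> x us \<bullet> b) vs *\<^sub>R b)"

definition can_cochains ::
  "'y::topological_space chart set \<Rightarrow> ('y \<Rightarrow> vec7 list \<Rightarrow> real) \<Rightarrow>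
     ('y set \<Rightarrow> ('y \<Rightarrow> 'w) \<Rightarrow> bool) \<Rightarrow> nat \<Rightarrow> ('y \<Rightarrow> vec7 list \<Rightarrow> 'w::euclidean_space) set" where
  "can_cochains A \<phi> sec k =
     {\<alpha>. smooth_form A sec k \<alpha> \<and> (\<forall>x. \<forall>b\<in>Basis. (\<lambda>vs. \<alpha> x vs \<bullet> b) \<in> can_forms \<phi> k x)}"

definition form_module ::
  "('y \<Rightarrow> vec7 list \<Rightarrow> 'w::real_vector) set \<Rightarrow> (real, 'y \<Rightarrow> vec7 list \<Rightarrow> 'w) module" where
  "form_module C = \<lparr>carrier = C, monoid.mult = undefined, one = undefined,
     ring.zero = (\<lambda>x vs. 0), add = (\<lambda>\<alpha> \<beta> x vs. \<alpha> x vs + \<beta> x vs),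
     smult = (\<lambda>r \<alpha> x vs. r *\<^sub>R \<alpha> x vs)\<rparr>"

definition G_mod ::
  "'y::topological_space chart set \<Rightarrow> ('y \<Rightarrow> vec7 list \<Rightarrow> real) \<Rightarrow> nat \<Rightarrow>
     (real, 'y \<Rightarrow> vec7 list \<Rightarrow> vec7) module" where
  "G_mod A \<phi> k = form_module (can_cochains A \<phi> (smooth_cov A) k)"

definition E_mod ::
  "'y::topological_space chart set \<Rightarrow> ('y \<Rightarrow> vec7 list \<Rightarrow> real) \<Rightarrow> nat \<Rightarrow>
     (real, 'y \<Rightarrow> vec7 list \<Rightarrow> real^7^7) module" where
  "E_mod A \<phi> k = form_module
     {a \<in> can_cochains A \<phi> (smooth_end A) k. \<forall>x vs. trace (a x vs) = 0}"

definition d_map where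
  "d_map A \<phi> g nab k m = can_proj \<phi> g (Suc k) (ext_cov_deriv A (conn_cov A nab) m)"

definition e_map where
  "e_map A \<phi> g nab k a = can_proj \<phi> g (Suc k) (ext_cov_deriv A (conn_end A nab) a)"

section \<open>Couplings and the weighted coefficient complex\<close>

definition B_op ::
  "'y chart set \<Rightarrow> ('y \<Rightarrow> vec7 \<Rightarrow> vec7 \<Rightarrow> real) \<Rightarrow>
     (('y \<Rightarrow> vec7) \<Rightarrow> ('y \<Rightarrow> vec7) \<Rightarrow> 'y \<Rightarrow> vec7) \<Rightarrow>
     ('y \<Rightarrow> vec7 list \<Rightarrow> vec7) \<Rightarrow> 'y \<Rightarrow> vec7 list \<Rightarrow> real^7^7" where
  "B_op A g nab m x vs =
     (THE M. \<forall>X Y. g x X (M *v Y) = conn_cov_form A nab m x X vs \<bullet> Y)"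

definition f_op ::
  "'y chart set \<Rightarrow> ('y \<Rightarrow> vec7 \<Rightarrow> vec7 \<Rightarrow> real) \<Rightarrow>
     (('y \<Rightarrow> vec7) \<Rightarrow> ('y \<Rightarrow> vec7) \<Rightarrow> 'y \<Rightarrow> vec7) \<Rightarrow>
     ('y \<Rightarrow> vec7 list \<Rightarrow> vec7) \<Rightarrow> 'y \<Rightarrow> vec7 list \<Rightarrow> real^7^7" where
  "f_op A g nab m x vs =
     (\<Sum>j\<in>UNIV. wedge1 (\<lambda>M r. r *\<^sub>R M) (curvature A nab x (onb g x j))
                   (\<lambda>us. m x us \<bullet> onb g x j) vs)"

text \<open>
  The coefficients of \<open>\<epsilon>\<close> in the couplings with values in \<open>\<epsilon>G\<close>; the \<open>i\<close>-th component is the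
  evaluation of the cotangent factor on \<open>Z = axis i 1\<close>.
\<close>

definition b_op ::
  "'y chart set \<Rightarrow> (('y \<Rightarrow> vec7) \<Rightarrow> ('y \<Rightarrow> vec7) \<Rightarrow> 'y \<Rightarrow> vec7) \<Rightarrow>
     ('y \<Rightarrow> vec7 list \<Rightarrow> real^7^7) \<Rightarrow> 'y \<Rightarrow> vec7 list \<Rightarrow> vec7" where
  "b_op A nab a x vs =
     (\<chi> i. - (1/4) * wedge1 (\<lambda>M N. trace (M ** N)) (curvature A nab x (axis i 1)) (a x) vs)"

definition c_op ::
  "'y chart set \<Rightarrow> ('y \<Rightarrow> vec7 \<Rightarrow> vec7 \<Rightarrow> real) \<Rightarrow>
     (('y \<Rightarrow> vec7) \<Rightarrow> ('y \<Rightarrow> vec7) \<Rightarrow> 'y \<Rightarrow> vec7) \<Rightarrow>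
     ('y \<Rightarrow> vec7 list \<Rightarrow> vec7) \<Rightarrow> 'y \<Rightarrow> vec7 list \<Rightarrow> vec7" where
  "c_op A g nab m x vs =
     (\<chi> i. - (1/2) * wedge1 (\<lambda>M N. trace (M ** N)) (curvature A nab x (axis i 1))
                       (B_op A g nab m x) vs)"

text \<open>
  \<open>B\<^sub>\<tau> = (G \<otimes>\<^sub>\<real> S) \<oplus> E\<close> with \<open>\<epsilon>E = 0\<close>; the triple \<open>(\<epsilon>x, a, m)\<close> is encoded as \<open>((m, x), a)\<close>.
\<close>

definition B_tau ::
  "'y::topological_space chart set \<Rightarrow> ('y \<Rightarrow> vec7 list \<Rightarrow> real) \<Rightarrow> nat \<Rightarrow>
     (real \<times> real,
      (('y \<Rightarrow> vec7 list \<Rightarrow> vec7) \<times> ('y \<Rightarrow> vec7 list \<Rightarrow> vec7)) \<times> ('y \<Rightarrow> vec7 list \<Rightarrow> real^7^7)) module"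
  where "B_tau A \<phi> k = dsum_module (base_change (G_mod A \<phi> k)) (restrict_scalars fst (E_mod A \<phi> k))"

definition D_map where
  "D_map A \<phi> g nab k =
     (\<lambda>((m, x), a).
        ((d_map A \<phi> g nab k m,
          \<lambda>y vs. d_map A \<phi> g nab k x y vs
                + can_proj \<phi> g (Suc k) (b_op A nab a) y vs
                + can_proj \<phi> g (Suc k) (c_op A g nab m) y vs),
         \<lambda>y vs. e_map A \<phi> g nab k a y vs + can_proj \<phi> g (Suc k) (f_op A g nab m) y vs))"

text \<open>The differential \<open>\<epsilon>x \<mapsto> \<epsilon> dx\<close> of \<open>G\<^sub>1 = \<epsilon>G\<close>.\<close>

definition d1_map where
  "d1_map A \<phi> g nab k = apsnd (d_map A \<phi> g nab k)"

end

theory Submission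
  imports Defs
begin

text \<open>
  The differential \<open>D\<close> is conjugate to the diagonal one. There are homotopies
  \<open>\<sigma>: G\<^sub>0\<^sup>k \<rightarrow> E\<^sup>k\<close> and \<open>\<beta>: E\<^sup>k \<rightarrow> G\<^sub>1\<^sup>k\<close> of degree zero with
  \<open>f = \<sigma> d - e \<sigma>\<close>, \<open>b = \<beta> e - d \<beta>\<close> and \<open>c = - b \<sigma>\<close> (lemmas \<open>f_null\<close>, \<open>b_null\<close>, \<open>c_null\<close>).
  The unipotent, \<open>S\<close>-linear automorphism \<open>(\<epsilon>x, a, m) \<mapsto> (\<epsilon>(x + \<beta> a), a + \<sigma> m, m)\<close> therefore
  carries \<open>diag(d\<^sub>1, e, d\<^sub>0)\<close> to \<open>D\<close>, and cohomology splits (\<open>split_cohomology\<close>).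

  The homotopies are first-order operators. In an orthonormal frame, up to the canonical projection,
  \<open>g(X, (\<sigma> m) Y) = (\<nabla>\<^sub>Y m)\<^sub>X - (\<nabla>\<^sub>X m)\<^sub>Y\<close> and
  \<open>(\<beta> a)(Z) = 1/4 \<Sum>\<^sub>j g(e\<^sub>j, (\<nabla>\<^sub>j a) Z) - g(Z, (\<nabla>\<^sub>j a) e\<^sub>j)\<close>.
  The commutator of \<open>\<sigma>\<close> with the differential is a contraction of commutators \<open>[\<nabla>\<^sub>i, \<nabla>\<^sub>j]\<close>.
  By the Ricci identity (\<open>ricci_identity\<close>) it is algebraic in the curvature. The curvature acting on
  the form indices contributes nothing and the first Bianchi identity turns the rest into \<open>f\<close>; the
  case of \<open>b\<close> is similar (\<open>f_homotopy\<close>, \<open>b_homotopy\<close>). The identity \<open>c = - b \<sigma>\<close> only uses that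
  \<open>R(Z, X)\<close> is skew: in \<open>\<tau>(R(Z, X) \<B>(m))\<close> only the skew part of \<open>\<B>(m)\<close> counts, and this is
  \<open>- \<sigma> m / 2\<close>.

  Two facts about the curvature enter. By the theorem of Fernandez and Gray (\<open>Om_stab\<close>) the
  three-form is parallel, so that \<open>R\<close> has its values in the stabiliser \<open>\<Lambda>\<^sup>2\<^sub>1\<^sub>4\<close> of the
  three-form (\<open>curvature_g2\<close>). With the pair symmetry this yields \<open>\<phi>\<^sub>a\<^sub>b\<^sub>c R\<^sub>b\<^sub>c = 0\<close>, with the Bianchi
  identity also \<open>\<phi>\<^sub>a\<^sub>b\<^sub>c R\<^sub>k\<^sub>b\<^sub>c\<^sub>q = 0\<close> (\<open>R_contract\<close>), and then Ricci flatness (\<open>R_ricci\<close>). The same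
  facts show that the canonical complexes are complexes (\<open>curl_grad\<close>, \<open>div_curl\<close>).

  Computations take place in canonical coordinates with respect to an adapted frame: a canonical form
  of degree \<open>2\<close> or \<open>3\<close> is determined by its contraction with the three-form, and the projected
  differentials become gradient, curl and divergence (\<open>ccf_d\<close>). As the three-form is parallel, these
  contractions commute with \<open>\<nabla>\<close>. Both coefficient bundles are treated at once by testing their sections
  with multilinear functionals of tangent vectors, which turns bundle-valued forms into tensors.
\<close>

section \<open>Smooth functions on open sets\<close>

lemma Ck_on_subset: "Ck_on n S f ==> T \<subseteq> S ==> Ck_on n T f"
 by (induction n arbitrary: f) (auto intro: continuous_on_subset)

lemma Ck_on_cong:
 assumes "open S" "\<And>x. x \<in> S ==> f x = g x" "Ck_on n S f"
 shows "Ck_on n S g"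
 using assms
proof (induction n arbitrary: f g)
 case 0
 then show ?case by (auto cong: continuous_on_cong)
next
 case (Suc n)
 have d: "f differentiable (at x)" if "x \<in> S" for x using Suc that by auto
 have e: "frechet_derivative f (at x) = frechet_derivative g (at x)" if "x \<in> S" for x
  by (rule frechet_derivative_transform_within_open[OF d[OF that] Suc.prems(1) that Suc.prems(2)])
 have "g differentiable (at x)" if "x \<in> S" for x
 proof -
  have "(f has_derivative frechet_derivative f (at x)) (at x)"
   using d[OF that] frechet_derivative_works by blast
  then have "(g has_derivative frechet_derivative f (at x)) (at x)"
   by (rule has_derivative_transform_within_open[OF _ Suc.prems(1) that Suc.prems(2)])
  then show ?thesis unfolding differentiable_def by blast
 qed
 moreover have "Ck_on n S (%x. frechet_derivative g (at x) v)" for v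
  by (rule Suc.IH[of "%x. frechet_derivative f (at x) v"]) (use Suc.prems e in auto)
 ultimately show ?case by simp
qed

lemma Ck_on_Suc_D: "Ck_on (Suc n) S f ==> Ck_on n S f"
proof (induction n arbitrary: f)
 case 0
 then show ?case
  by (auto intro!: continuous_at_imp_continuous_on differentiable_imp_continuous_within)
next
 case (Suc n)
 have "Ck_on n S (%x. frechet_derivative f (at x) v)" for v
  using Suc.prems by (intro Suc.IH) simp
 with Suc.prems show ?case by simp
qed

lemma frechet_derivative_eqI:
 "(f has_derivative f') (at x) ==> frechet_derivative f (at x) v = f' v"
 using frechet_derivative_at by metis

lemma Ck_on_const: "Ck_on n S (%x. c)"
 by (induction n arbitrary: c) auto

lemma Ck_on_bounded_linear:
 assumes "open S" "bounded_linear h" "Ck_on n S f"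
 shows "Ck_on n S (%x. h (f x))"
 using assms(3)
proof (induction n arbitrary: f)
 case 0
 then show ?case
  using assms(2) by (auto intro: bounded_linear.continuous_on)
next
 case (Suc n)
 have h: "((%x. h (f x)) has_derivative (%v. h (frechet_derivative f (at x) v))) (at x)"
  if "x \<in> S" for x
  by (rule bounded_linear.has_derivative[OF assms(2)])
    (use Suc.prems that in "auto simp flip: frechet_derivative_works")
 have "Ck_on n S (%x. frechet_derivative (%x. h (f x)) (at x) v)" for v
  by (rule Ck_on_cong[OF assms(1) _ Suc.IH[of "%x. frechet_derivative f (at x) v"]])
    (use Suc.prems in "auto simp: frechet_derivative_eqI[OF h]")
 moreover have "(%x. h (f x)) differentiable (at x)" if "x \<in> S" for x
  using h[OF that] unfolding differentiable_def by blast
 ultimately show ?case by simp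
qed

lemma Ck_on_add:
 assumes "open S" "Ck_on n S f" "Ck_on n S g"
 shows "Ck_on n S (%x. f x + g x)"
 using assms(2,3)
proof (induction n arbitrary: f g)
 case 0
 then show ?case by (auto intro: continuous_intros)
next
 case (Suc n)
 have h: "((%x. f x + g x) has_derivative
   (%v. frechet_derivative f (at x) v + frechet_derivative g (at x) v)) (at x)"
  if "x \<in> S" for x
  by (rule has_derivative_add) (use Suc.prems that in "auto simp flip: frechet_derivative_works")
 have "Ck_on n S (%x. frechet_derivative (%x. f x + g x) (at x) v)" for v
  by (rule Ck_on_cong[OF assms(1) _ Suc.IH[of "%x. frechet_derivative f (at x) v"
      "%x. frechet_derivative g (at x) v"]])
    (use Suc.prems in "auto simp: frechet_derivative_eqI[OF h]")
 moreover have "(%x. f x + g x) differentiable (at x)" if "x \<in> S" for x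
  using h[OF that] unfolding differentiable_def by blast
 ultimately show ?case by simp
qed

lemma Ck_on_bilinear:
 assumes "open S" "bounded_bilinear b" "Ck_on n S f" "Ck_on n S g"
 shows "Ck_on n S (%x. b (f x) (g x))"
 using assms(3,4)
proof (induction n arbitrary: f g)
 case 0
 then show ?case using assms(2) by (auto intro: bounded_bilinear.continuous_on)
next
 case (Suc n)
 have h: "((%x. b (f x) (g x)) has_derivative
   (%v. b (f x) (frechet_derivative g (at x) v) + b (frechet_derivative f (at x) v) (g x))) (at x)"
  if "x \<in> S" for x
  by (rule bounded_bilinear.FDERIV[OF assms(2)])
    (use Suc.prems that in "auto simp flip: frechet_derivative_works")
 have "Ck_on n S (%x. frechet_derivative (%x. b (f x) (g x)) (at x) v)" for v
 proof (rule Ck_on_cong[OF assms(1)])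
  show "Ck_on n S (%x. b (f x) (frechet_derivative g (at x) v)
    + b (frechet_derivative f (at x) v) (g x))"
   by (intro Ck_on_add assms Suc.IH) (use Suc.prems Ck_on_Suc_D in auto)
 qed (use Suc.prems in "auto simp: frechet_derivative_eqI[OF h]")
 moreover have "(%x. b (f x) (g x)) differentiable (at x)" if "x \<in> S" for x
  using h[OF that] unfolding differentiable_def by blast
 ultimately show ?case by simp
qed

lemma Ck_on_sum:
 assumes "open S" "\<And>i. i \<in> I ==> Ck_on n S (f i)"
 shows "Ck_on n S (%x. \<Sum>i\<in>I. f i x)"
 using assms(2)
 by (induction I rule: infinite_finite_induct) (auto intro: Ck_on_const Ck_on_add assms(1))

lemma Ck_on_compose:
 fixes g :: "'a::real_normed_vector => 'b::euclidean_space"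
 assumes "open S" "open T" "g ` S \<subseteq> T" "Ck_on n S g" "Ck_on n T f"
 shows "Ck_on n S (%x. f (g x))"
 using assms(4,5)
proof (induction n arbitrary: f)
 case 0
 then show ?case using assms(3) by (auto intro: continuous_on_compose2)
next
 case (Suc n)
 have fd: "(f has_derivative frechet_derivative f (at (g x))) (at (g x))" if "x \<in> S" for x
  using Suc.prems assms(3) that frechet_derivative_works by (metis Ck_on.simps(2) image_subset_iff)
 have h: "((%x. f (g x)) has_derivative
   (%v. frechet_derivative f (at (g x)) (frechet_derivative g (at x) v))) (at x)"
  if "x \<in> S" for x
  by (rule has_derivative_compose[of g "frechet_derivative g (at x)" x UNIV f, OF _ fd[OF that]])
    (use Suc.prems that in "auto simp flip: frechet_derivative_works")
 have e: "frechet_derivative (%x. f (g x)) (at x) v =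
   (\<Sum>b\<in>Basis. (frechet_derivative g (at x) v \<bullet> b) *\<^sub>R frechet_derivative f (at (g x)) b)"
  if "x \<in> S" for x v
 proof -
  have l: "linear (frechet_derivative f (at (g x)))"
   using fd[OF that] has_derivative_linear by blast
  have "frechet_derivative (%x. f (g x)) (at x) v =
    frechet_derivative f (at (g x)) (frechet_derivative g (at x) v)"
   using frechet_derivative_at[OF h[OF that]] by metis
  also have "... = frechet_derivative f (at (g x))
    (\<Sum>b\<in>Basis. (frechet_derivative g (at x) v \<bullet> b) *\<^sub>R b)"
   by (simp add: euclidean_representation)
  finally show ?thesis by (simp add: linear_sum[OF l] linear_scale[OF l])
 qed
 have "Ck_on n S (%x. frechet_derivative (%x. f (g x)) (at x) v)" for v
 proof (rule Ck_on_cong[OF assms(1)])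
  show "Ck_on n S (%x. \<Sum>b\<in>Basis. (frechet_derivative g (at x) v \<bullet> b) *\<^sub>R
    frechet_derivative f (at (g x)) b)"
   using Suc.prems Ck_on_Suc_D[OF Suc.prems(1)]
   by (intro Ck_on_sum Ck_on_bilinear[OF _ bounded_bilinear_scaleR] assms(1) Suc.IH
    Ck_on_bounded_linear[OF _ bounded_linear_inner_left]) auto
 qed (use e in auto)
 moreover have "(%x. f (g x)) differentiable (at x)" if "x \<in> S" for x
  using h[OF that] unfolding differentiable_def by blast
 ultimately show ?case by simp
qed

lemma Ck_on_inverse:
 fixes f :: "'a::real_normed_vector => real"
 assumes "open S" "\<And>x. x \<in> S ==> f x \<noteq> 0" "Ck_on n S f"
 shows "Ck_on n S (%x. inverse (f x))"
 using assms(3)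
proof (induction n)
 case 0
 then show ?case using assms(2) by (auto intro!: continuous_intros)
next
 case (Suc n)
 have h: "((%x. inverse (f x)) has_derivative
   (%v. - (inverse (f x) * frechet_derivative f (at x) v * inverse (f x)))) (at x)"
  if "x \<in> S" for x
  by (rule Deriv.has_derivative_inverse) (use Suc.prems that assms(2) in "auto simp flip: frechet_derivative_works")
 have ck: "Ck_on n S f" using Ck_on_Suc_D[OF Suc.prems] .
 have "Ck_on n S (%x. frechet_derivative (%x. inverse (f x)) (at x) v)" for v
 proof (rule Ck_on_cong[OF assms(1)])
  show "Ck_on n S (%x. - (inverse (f x) * frechet_derivative f (at x) v * inverse (f x)))"
   by (intro Ck_on_bounded_linear[OF _ bounded_linear_minus[OF bounded_linear_ident]]
     Ck_on_bilinear[OF _ bounded_bilinear_mult] assms Suc.IH ck)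
     (use Suc.prems in auto)
 qed (use Suc.prems in "auto simp: frechet_derivative_eqI[OF h]")
 moreover have "(%x. inverse (f x)) differentiable (at x)" if "x \<in> S" for x
  using h[OF that] unfolding differentiable_def by blast
 ultimately show ?case by simp
qed

lemma Ck_on_local:
 assumes "\<And>x. x \<in> S ==> \<exists>T. open T \<and> x \<in> T \<and> Ck_on n T f"
 shows "Ck_on n S f"
 using assms
proof (induction n arbitrary: f)
 case 0
 then show ?case
  by (metis Ck_on.simps(1) continuous_at_imp_continuous_on continuous_on_eq_continuous_at)
next
 case (Suc n)
 have "f differentiable (at x)" if "x \<in> S" for x using Suc.prems[OF that] by auto
 moreover have "Ck_on n S (%x. frechet_derivative f (at x) v)" for v
  by (rule Suc.IH) (use Suc.prems in fastforce)
 ultimately show ?case by simp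
qed

lemma smooth_on_subset: "smooth_on S f ==> T \<subseteq> S ==> smooth_on T f"
 unfolding smooth_on_def using Ck_on_subset by blast

lemma smooth_on_cong:
 "open S ==> (\<And>x. x \<in> S ==> f x = g x) ==> smooth_on S f ==> smooth_on S g"
 unfolding smooth_on_def using Ck_on_cong by blast

lemma smooth_on_const: "smooth_on S (%x. c)"
 unfolding smooth_on_def using Ck_on_const by blast

lemma smooth_on_add:
 "open S ==> smooth_on S f ==> smooth_on S g ==> smooth_on S (%x. f x + g x)"
 unfolding smooth_on_def using Ck_on_add by blast

lemma smooth_on_bounded_linear:
 "open S ==> bounded_linear h ==> smooth_on S f ==> smooth_on S (%x. h (f x))"
 unfolding smooth_on_def by (simp add: Ck_on_bounded_linear)

lemma smooth_on_bilinear: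
 "open S ==> bounded_bilinear b ==> smooth_on S f ==> smooth_on S g ==>
  smooth_on S (%x. b (f x) (g x))"
 unfolding smooth_on_def by (simp add: Ck_on_bilinear)

lemma smooth_on_sum:
 "open S ==> (\<And>i. i \<in> I ==> smooth_on S (f i)) ==> smooth_on S (%x. \<Sum>i\<in>I. f i x)"
 unfolding smooth_on_def by (blast intro: Ck_on_sum)

lemma smooth_on_compose:
 fixes g :: "'a::real_normed_vector => 'b::euclidean_space"
 shows "open S ==> open T ==> g ` S \<subseteq> T ==> smooth_on S g ==> smooth_on T f ==>
  smooth_on S (%x. f (g x))"
 unfolding smooth_on_def by (metis Ck_on_compose)

lemma smooth_on_inverse:
 fixes f :: "'a::real_normed_vector => real"
 shows "open S ==> (\<And>x. x \<in> S ==> f x \<noteq> 0) ==> smooth_on S f ==> smooth_on S (%x. inverse (f x))"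
 unfolding smooth_on_def using Ck_on_inverse by blast

lemma smooth_on_diff:
 assumes "open S" "smooth_on S f" "smooth_on S g"
 shows "smooth_on S (%x. f x - g x)"
 using smooth_on_add[OF assms(1,2) smooth_on_bounded_linear[OF assms(1)
   bounded_linear_minus[OF bounded_linear_ident] assms(3)]] by simp

lemma smooth_on_local:
 "(\<And>x. x \<in> S ==> \<exists>T. open T \<and> x \<in> T \<and> smooth_on T f) ==> smooth_on S f"
 unfolding smooth_on_def by (meson Ck_on_local)

lemma smooth_on_differentiable: "smooth_on S f ==> x \<in> S ==> f differentiable (at x)"
 unfolding smooth_on_def by (metis Ck_on.simps(2))

lemma smooth_on_frechet_derivative:
 "smooth_on S f ==> smooth_on S (%x. frechet_derivative f (at x) v)"
 unfolding smooth_on_def by (metis Ck_on.simps(2))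

lemma smooth_on_ident: "open S ==> smooth_on S (%x. x)"
 unfolding smooth_on_def
proof
 fix n assume "open S" show "Ck_on n S (%x. x)" by (cases n) (auto simp: Ck_on_const)
qed

lemma smooth_on_vec_iff:
 fixes f :: "'a::real_normed_vector => real^'n"
 assumes "open S"
 shows "smooth_on S f \<longleftrightarrow> (\<forall>i. smooth_on S (%x. f x $ i))"
proof
 assume "smooth_on S f"
 then show "\<forall>i. smooth_on S (%x. f x $ i)"
  using smooth_on_bounded_linear[OF assms bounded_linear_vec_nth] by blast
next
 assume a: "\<forall>i. smooth_on S (%x. f x $ i)"
 have "smooth_on S (%x. \<Sum>i\<in>UNIV. (f x $ i) *\<^sub>R axis i (1::real))"
  using a by (intro smooth_on_sum smooth_on_bilinear[OF _ bounded_bilinear_scaleR] assms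
    smooth_on_const) auto
 moreover have "(\<Sum>i\<in>UNIV. (f x $ i) *\<^sub>R axis i (1::real)) = f x" for x
  using basis_expansion[of "f x"] by (simp add: scalar_mult_eq_scaleR)
 ultimately show "smooth_on S f" by (simp only:)
qed

text \<open>
 The second difference of \<open>f\<close> over a small parallelogram can be computed with the mean value
 theorem in two orders, which evaluates both mixed derivatives at nearby points.
\<close>

lemma second_difference_mvt:
 fixes f :: "'a::real_normed_vector => real"
 assumes f: "smooth_on (ball x r) f" and h: "0 < h" "h * (norm v + norm w) < r"
 shows "\<exists>p. norm (p - x) \<le> h * (norm v + norm w) \<and>
  f (x + h *\<^sub>R v + h *\<^sub>R w) - f (x + h *\<^sub>R v) - (f (x + h *\<^sub>R w) - f x) =
  h * (h * frechet_derivative (%y. frechet_derivative f (at y) v) (at p) w)"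
proof -
 have nrm: "norm (s *\<^sub>R v + t *\<^sub>R w) \<le> h * (norm v + norm w)"
  if "0 \<le> s" "s \<le> h" "0 \<le> t" "t \<le> h" for s t
 proof -
  have "norm (s *\<^sub>R v + t *\<^sub>R w) \<le> s * norm v + t * norm w"
   using norm_triangle_ineq[of "s *\<^sub>R v" "t *\<^sub>R w"] that by simp
  also have "... \<le> h * norm v + h * norm w"
   by (intro add_mono mult_right_mono) (use that in auto)
  finally show ?thesis by (simp add: distrib_left)
 qed
 have inb: "x + s *\<^sub>R v + t *\<^sub>R w \<in> ball x r" if "0 \<le> s" "s \<le> h" "0 \<le> t" "t \<le> h" for s t
 proof -
  have "dist x (x + s *\<^sub>R v + t *\<^sub>R w) = norm (s *\<^sub>R v + t *\<^sub>R w)"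
   by (metis add.assoc add_diff_cancel_left' dist_commute dist_norm)
  with nrm[OF that] h show ?thesis by simp
 qed
 have deriv: "((%s. F (y + s *\<^sub>R u)) has_field_derivative
   frechet_derivative F (at (y + s *\<^sub>R u)) u) (at s)"
  if "smooth_on (ball x r) F" "y + s *\<^sub>R u \<in> ball x r" for F :: "'a => real" and y u s
 proof -
  have d: "(F has_derivative frechet_derivative F (at (y + s *\<^sub>R u))) (at (y + s *\<^sub>R u))"
   using smooth_on_differentiable[OF that] frechet_derivative_works by blast
  have g: "((%s. y + s *\<^sub>R u) has_derivative (%k. k *\<^sub>R u)) (at s)"
   by (auto intro!: derivative_eq_intros)
  have "((%s. F (y + s *\<^sub>R u)) has_derivative
    (%k. frechet_derivative F (at (y + s *\<^sub>R u)) (k *\<^sub>R u))) (at s)"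
   by (rule has_derivative_compose[OF g d])
  moreover have "frechet_derivative F (at (y + s *\<^sub>R u)) (k *\<^sub>R u) =
    k * frechet_derivative F (at (y + s *\<^sub>R u)) u" for k
   using linear_scale[OF has_derivative_linear[OF d]] by simp
  ultimately show ?thesis by (simp add: has_field_derivative_def mult_commute_abs)
 qed
 let ?D = "%y. frechet_derivative f (at y) v"
 have "\<exists>s>0. s < h \<and>
   (f (x + h *\<^sub>R w + h *\<^sub>R v) - f (x + h *\<^sub>R v)) - (f (x + h *\<^sub>R w + 0 *\<^sub>R v) - f (x + 0 *\<^sub>R v)) =
   (h - 0) * (?D (x + h *\<^sub>R w + s *\<^sub>R v) - ?D (x + s *\<^sub>R v))"
 proof (rule MVT2[OF h(1)])
  fix s assume s: "0 \<le> s" "s \<le> h"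
  show "DERIV (%s. f (x + h *\<^sub>R w + s *\<^sub>R v) - f (x + s *\<^sub>R v)) s :>
    ?D (x + h *\<^sub>R w + s *\<^sub>R v) - ?D (x + s *\<^sub>R v)"
   using inb[of s h] inb[of s 0] s h
   by (intro DERIV_diff deriv f) (auto simp: algebra_simps)
 qed
 then obtain s where s: "0 < s" "s < h"
  and es: "f (x + h *\<^sub>R v + h *\<^sub>R w) - f (x + h *\<^sub>R v) - (f (x + h *\<^sub>R w) - f x) =
   h * (?D (x + s *\<^sub>R v + h *\<^sub>R w) - ?D (x + s *\<^sub>R v))"
  by (auto simp: algebra_simps)
 have "\<exists>t>0. t < h \<and> ?D (x + s *\<^sub>R v + h *\<^sub>R w) - ?D (x + s *\<^sub>R v + 0 *\<^sub>R w) =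
   (h - 0) * frechet_derivative ?D (at (x + s *\<^sub>R v + t *\<^sub>R w)) w"
 proof (rule MVT2[OF h(1)])
  fix t assume "0 \<le> t" "t \<le> h"
  then show "DERIV (%t. ?D (x + s *\<^sub>R v + t *\<^sub>R w)) t :>
    frechet_derivative ?D (at (x + s *\<^sub>R v + t *\<^sub>R w)) w"
   using inb[of s t] s by (intro deriv smooth_on_frechet_derivative f) auto
 qed
 then obtain t where t: "0 < t" "t < h"
  and et: "?D (x + s *\<^sub>R v + h *\<^sub>R w) - ?D (x + s *\<^sub>R v) =
   h * frechet_derivative ?D (at (x + s *\<^sub>R v + t *\<^sub>R w)) w"
  by auto
 show ?thesis
  by (rule exI[of _ "x + s *\<^sub>R v + t *\<^sub>R w"])
    (use nrm[of s t] s t es et in "simp add: add.assoc")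
qed

lemma frechet_derivative_commute:
 fixes f :: "'a::real_normed_vector => real"
 assumes "open S" "x \<in> S" "smooth_on S f"
 shows "frechet_derivative (%y. frechet_derivative f (at y) v) (at x) w =
  frechet_derivative (%y. frechet_derivative f (at y) w) (at x) v"
proof -
 obtain r where r: "0 < r" "ball x r \<subseteq> S" using assms openE by blast
 have f: "smooth_on (ball x r) f" using smooth_on_subset assms(3) r(2) by blast
 let ?P = "%v w y. frechet_derivative (%y. frechet_derivative f (at y) v) (at y) w"
 have cont: "isCont (?P v w) x" for v w
  using smooth_on_differentiable[OF smooth_on_frechet_derivative[OF
    smooth_on_frechet_derivative[OF f]], of x v w] r
  by (simp add: differentiable_imp_continuous_within)
 show ?thesis
 proof (rule ccontr)
  assume ne: "?P v w x \<noteq> ?P w v x"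
  define e where "e = \<bar>?P v w x - ?P w v x\<bar> / 2"
  have e: "0 < e" using ne by (simp add: e_def)
  obtain d1 where d1: "0 < d1" "\<And>y. dist y x < d1 ==> dist (?P v w y) (?P v w x) < e"
   using cont[of v w] e unfolding continuous_at_eps_delta by blast
  obtain d2 where d2: "0 < d2" "\<And>y. dist y x < d2 ==> dist (?P w v y) (?P w v x) < e"
   using cont[of w v] e unfolding continuous_at_eps_delta by blast
  define m where "m = min r (min d1 d2)"
  define h where "h = m / (norm v + norm w + 1)"
  have m: "0 < m" "m \<le> r" "m \<le> d1" "m \<le> d2" using r d1 d2 by (auto simp: m_def)
  have N: "0 < norm v + norm w + 1" by (simp add: add_nonneg_pos)
  have h: "0 < h" using m N by (simp add: h_def)
  have "h * (norm v + norm w + 1) = m" using N by (simp add: h_def)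
  then have hm: "h * (norm v + norm w) < m" using h by (simp add: algebra_simps)
  obtain p where p: "norm (p - x) \<le> h * (norm v + norm w)"
   "f (x + h *\<^sub>R v + h *\<^sub>R w) - f (x + h *\<^sub>R v) - (f (x + h *\<^sub>R w) - f x) = h * (h * ?P v w p)"
   using second_difference_mvt[OF f h, of v w] hm m by auto
  obtain q where q: "norm (q - x) \<le> h * (norm w + norm v)"
   "f (x + h *\<^sub>R w + h *\<^sub>R v) - f (x + h *\<^sub>R w) - (f (x + h *\<^sub>R v) - f x) = h * (h * ?P w v q)"
   using second_difference_mvt[OF f h, of w v] hm m by (auto simp: add.commute)
  have "h * (h * ?P v w p) = h * (h * ?P w v q)"
   using p(2) q(2) by (simp add: algebra_simps)
  then have "?P v w p = ?P w v q" using h by simp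
  moreover have "dist (?P v w p) (?P v w x) < e"
   by (rule d1) (use p hm m in "auto simp: dist_norm")
  moreover have "dist (?P w v q) (?P w v x) < e"
   by (rule d2) (use q hm m in "auto simp: dist_norm add.commute")
  ultimately show False unfolding e_def dist_real_def by (auto simp: abs_if split: if_splits)
 qed
qed

subsection \<open>A bump function\<close>

text \<open>Closed under differentiation, whence all of these functions are smooth.\<close>

definition flat_exp :: "nat => real => real" where
 "flat_exp n t = (if t \<le> 0 then 0 else exp (- inverse t) / t ^ n)"

lemma flat_exp_tendsto_0: "(flat_exp n \<longlongrightarrow> 0) (at 0)"
proof -
 have "((%s::real. s ^ n / exp s) \<longlongrightarrow> 0) at_top" by (rule tendsto_power_div_exp_0)
 then have "((%t::real. inverse t ^ n / exp (inverse t)) \<longlongrightarrow> 0) (at_right 0)"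
  by (rule filterlim_compose[OF _ filterlim_inverse_at_top_right])
 then have "(flat_exp n \<longlongrightarrow> 0) (at_right 0)"
  by (rule Lim_transform_eventually)
    (auto simp: flat_exp_def eventually_at_filter exp_minus field_simps power_inverse)
 moreover have "(flat_exp n \<longlongrightarrow> 0) (at_left 0)"
  by (rule Lim_transform_eventually[OF tendsto_const])
    (auto simp: flat_exp_def eventually_at_filter)
 ultimately show ?thesis using filterlim_split_at by blast
qed

lemma flat_exp_deriv:
 "(flat_exp n has_field_derivative (flat_exp (n + 2) t - n * flat_exp (n + 1) t)) (at t)"
proof (cases t "0::real" rule: linorder_cases)
 case less
 have "((%t. 0) has_field_derivative 0) (at t)" by simp
 then have "(flat_exp n has_field_derivative 0) (at t)"
  by (rule has_field_derivative_transform_within_open[of _ _ _ "{..<0}"])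
    (use less in "auto simp: flat_exp_def")
 with less show ?thesis by (simp add: flat_exp_def)
next
 case equal
 have "((%h. (flat_exp n (0 + h) - flat_exp n 0) / h) \<longlongrightarrow> 0) (at 0)"
  by (rule Lim_transform_eventually[OF flat_exp_tendsto_0[of "Suc n"]])
    (auto simp: flat_exp_def eventually_at_filter)
 with equal show ?thesis by (simp add: DERIV_def flat_exp_def)
next
 case greater
 have i: "(inverse has_field_derivative - ((inverse t)\<^sup>2)) (at t)"
  using DERIV_inverse[of t UNIV] greater by (simp add: numeral_2_eq_2)
 have e: "((%t. exp (- inverse t)) has_field_derivative exp (- inverse t) * (inverse t)\<^sup>2) (at t)"
  using DERIV_chain2[OF DERIV_exp[of "- inverse t"] DERIV_minus[OF i]] by simp
 have "((%t. exp (- inverse t) / t ^ n) has_field_derivative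
   (flat_exp (n + 2) t - n * flat_exp (n + 1) t)) (at t)"
  using DERIV_mult[OF e DERIV_power[OF i, of n]] greater
  by (cases n) (auto simp: flat_exp_def divide_inverse power2_eq_square power_inverse algebra_simps)
 then show ?thesis
  by (rule has_field_derivative_transform_within_open[of _ _ _ "{0<..}"])
    (use greater in "auto simp: flat_exp_def")
qed

lemma smooth_flat_exp: "smooth_on UNIV (flat_exp n)"
proof -
 have "Ck_on k UNIV (flat_exp n)" for k
 proof (induction k arbitrary: n)
  case 0
  show ?case
   by (auto intro!: continuous_at_imp_continuous_on DERIV_isCont[OF flat_exp_deriv])
 next
  case (Suc k)
  have h: "(flat_exp n has_derivative (%v. (flat_exp (n + 2) t - n * flat_exp (n + 1) t) * v)) (at t)" for t
   using flat_exp_deriv by (simp add: has_field_derivative_def)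
  have "Ck_on k UNIV (%t. (flat_exp (n + 2) t + (- real n) * flat_exp (n + 1) t) * v)" for v
   by (intro Ck_on_bilinear[OF _ bounded_bilinear_mult] Ck_on_add Ck_on_const Suc.IH open_UNIV)
  then have "Ck_on k UNIV (%t. (flat_exp (n + 2) t - n * flat_exp (n + 1) t) * v)" for v
   by simp
  moreover have "(%t. (flat_exp (n + 2) t - n * flat_exp (n + 1) t) * v) =
    (%t. frechet_derivative (flat_exp n) (at t) v)" for v
   using frechet_derivative_at[OF h] by (metis (no_types))
  moreover have "flat_exp n differentiable (at t)" for t
   using h[of t] unfolding differentiable_def by blast
  ultimately show ?case by simp
 qed
 then show ?thesis by (simp add: smooth_on_def)
qed

text \<open>A smooth function on the vector space which is positive exactly on the ball.\<close>

lemma bump_exists: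
 fixes p :: "'a::euclidean_space"
 assumes "0 < r"
 obtains \<rho> :: "'a => real"
 where "smooth_on UNIV \<rho>" "\<And>u. u \<in> ball p r ==> \<rho> u \<noteq> 0" "\<And>u. u \<notin> ball p r ==> \<rho> u = 0"
proof
 let ?q = "%u. r\<^sup>2 - (u - p) \<bullet> (u - p)"
 let ?r = "%u. flat_exp 0 (?q u)"
 have "smooth_on UNIV ?q"
  by (intro smooth_on_diff smooth_on_bilinear[OF _ bounded_bilinear_inner] smooth_on_const
    smooth_on_ident open_UNIV)
 then show "smooth_on UNIV ?r"
  by (rule smooth_on_compose[of UNIV UNIV ?q "flat_exp 0", rotated 3]) (simp_all add: smooth_flat_exp)
 have "?q u = r\<^sup>2 - (dist p u)\<^sup>2" for u
  by (simp add: dist_norm norm_minus_commute flip: power2_norm_eq_inner)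
 moreover have "(dist p u)\<^sup>2 < r\<^sup>2 \<longleftrightarrow> dist p u < r" for u
  using assms power2_less_imp_less[of "dist p u" r] power_strict_mono[of "dist p u" r 2] by auto
 ultimately have q: "?q u \<le> 0 \<longleftrightarrow> u \<notin> ball p r" for u
  by (simp add: not_less) (metis not_less)
 show "u \<in> ball p r ==> ?r u \<noteq> 0" "u \<notin> ball p r ==> ?r u = 0" for u
  using q[of u] by (auto simp: flat_exp_def simp del: mem_ball)
qed

text \<open>Summation over the index set of the coordinates and frames.\<close>

abbreviation Sum7 :: "(7 => 'a::comm_monoid_add) => 'a" (binder "\<Sigma>" 10) where
 "Sum7 f == sum f UNIV"

section \<open>Germs of smooth functions and vector fields\<close>

locale atlas =
 fixes A :: "'y::t2_space chart set"
 assumes smooth_atlas: "smooth_atlas A"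
begin

lemma chart_open: "c \<in> A ==> open (fst c)" "c \<in> A ==> open (snd c ` fst c)"
 and chart_homeomorphism: "c \<in> A ==> homeomorphism (fst c) (snd c ` fst c) (snd c) (inv_chart c)"
 using smooth_atlas by (auto simp: smooth_atlas_def)

lemma inv_chart_chart: "c \<in> A ==> y \<in> fst c ==> inv_chart c (snd c y) = y"
 using chart_homeomorphism homeomorphism_apply1 by blast

lemma pref_in: "pref A x \<in> A" and in_pref: "x \<in> fst (pref A x)"
proof -
 have "x \<in> (\<Union>c\<in>A. fst c)" using smooth_atlas unfolding smooth_atlas_def by simp
 then have "\<exists>c. c \<in> A \<and> x \<in> fst c" by blast
 then have "pref A x \<in> A \<and> x \<in> fst (pref A x)" unfolding pref_def by (rule someI_ex)
 then show "pref A x \<in> A" "x \<in> fst (pref A x)" by auto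
qed

lemma chart_image_open:
 assumes "c \<in> A" "open U"
 shows "open (snd c ` (U \<inter> fst c))"
proof -
 have "snd c ` (U \<inter> fst c) = snd c ` fst c \<inter> inv_chart c -` U"
  using inv_chart_chart[OF assms(1)] by (auto simp: image_iff)
 moreover have "open (snd c ` fst c \<inter> inv_chart c -` U)"
  using chart_homeomorphism[OF assms(1)] chart_open(2)[OF assms(1)] assms(2)
  by (intro continuous_open_preimage) (auto simp: homeomorphism_def)
 ultimately show ?thesis by simp
qed

lemma chart_preimage_open:
 assumes "c \<in> A" "open S"
 shows "open {y \<in> fst c. snd c y \<in> S}"
proof -
 have "{y \<in> fst c. snd c y \<in> S} = fst c \<inter> snd c -` S" by auto
 moreover have "open (fst c \<inter> snd c -` S)"
  using chart_homeomorphism[OF assms(1)] chart_open(1)[OF assms(1)] assms(2)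
  by (intro continuous_open_preimage) (auto simp: homeomorphism_def)
 ultimately show ?thesis by simp
qed

subsection \<open>Jacobians of the transition maps\<close>

definition jac :: "'y chart => 'y chart => 'y => vec7 => vec7" where
 "jac c c' y = frechet_derivative (snd c' \<circ> inv_chart c) (at (snd c y))"

lemma transition_smooth:
 "c \<in> A ==> c' \<in> A ==> smooth_on (snd c ` (fst c \<inter> fst c')) (snd c' \<circ> inv_chart c)"
 using smooth_atlas by (auto simp: smooth_atlas_def)

lemma transition_deriv:
 assumes "c \<in> A" "c' \<in> A" "y \<in> fst c" "y \<in> fst c'"
 shows "((snd c' \<circ> inv_chart c) has_derivative jac c c' y) (at (snd c y))"
 using smooth_on_differentiable[OF transition_smooth[OF assms(1,2)], of "snd c y"] assms
 unfolding jac_def frechet_derivative_works[symmetric] by auto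

lemma jac_linear:
 "c \<in> A ==> c' \<in> A ==> y \<in> fst c ==> y \<in> fst c' ==> linear (jac c c' y)"
 using transition_deriv has_derivative_linear by blast

lemma jac_id:
 assumes "c \<in> A" "y \<in> fst c"
 shows "jac c c y v = v"
proof -
 have "((snd c \<circ> inv_chart c) has_derivative (%v. v)) (at (snd c y))"
  by (rule has_derivative_transform_within_open[OF has_derivative_ident chart_open(2)[OF assms(1)]])
    (use assms inv_chart_chart[OF assms(1)] in auto)
 then show ?thesis unfolding jac_def by (rule frechet_derivative_eqI)
qed

lemma jac_comp:
 assumes "c \<in> A" "c' \<in> A" "c'' \<in> A" "y \<in> fst c" "y \<in> fst c'" "y \<in> fst c''"
 shows "jac c' c'' y (jac c c' y v) = jac c c'' y v"
proof -
 have e: "(snd c' \<circ> inv_chart c) (snd c y) = snd c' y"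
  using inv_chart_chart[OF assms(1,4)] by simp
 have "((%u. (snd c'' \<circ> inv_chart c') ((snd c' \<circ> inv_chart c) u)) has_derivative
   (%v. jac c' c'' y (jac c c' y v))) (at (snd c y))"
  by (rule has_derivative_compose[of "snd c' \<circ> inv_chart c" "jac c c' y" "snd c y" UNIV
     "snd c'' \<circ> inv_chart c'"])
    (use transition_deriv assms e in auto)
 then have "((snd c'' \<circ> inv_chart c) has_derivative
   (%v. jac c' c'' y (jac c c' y v))) (at (snd c y))"
  by (rule has_derivative_transform_within_open[OF _ chart_image_open[OF assms(1), of "fst c'"]])
    (use assms chart_open(1)[OF assms(2)] inv_chart_chart[OF assms(1)] inv_chart_chart[OF assms(2)] in auto)
 then have "jac c c'' y v = jac c' c'' y (jac c c' y v)"
  unfolding jac_def[of c c''] by (rule frechet_derivative_eqI)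
 then show ?thesis by simp
qed

lemma to_chart_jac: "to_chart A c y v = jac (pref A y) c y v"
 and from_chart_jac: "from_chart A c y v = jac c (pref A y) y v"
 by (simp_all add: to_chart_def from_chart_def jac_def)

lemma to_chart_pref: "to_chart A (pref A y) y v = v"
 by (simp add: to_chart_jac jac_id pref_in in_pref)

lemma to_chart_from_chart:
 assumes "c \<in> A" "c' \<in> A" "y \<in> fst c" "y \<in> fst c'"
 shows "to_chart A c' y (from_chart A c y v) = jac c c' y v"
 using assms by (simp add: to_chart_jac from_chart_jac jac_comp pref_in in_pref)

lemma from_chart_to_chart:
 assumes "c \<in> A" "y \<in> fst c"
 shows "from_chart A c y (to_chart A c y v) = v"
 using assms by (simp add: to_chart_jac from_chart_jac jac_comp jac_id pref_in in_pref)

lemma linear_to_chart: "c \<in> A ==> y \<in> fst c ==> linear (to_chart A c y)"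
 and linear_from_chart: "c \<in> A ==> y \<in> fst c ==> linear (from_chart A c y)"
 using jac_linear pref_in in_pref by (simp_all add: to_chart_jac[abs_def] from_chart_jac[abs_def])

lemma ext_self: "ext A x w x = w"
 by (simp add: ext_def from_chart_jac jac_id pref_in in_pref)

lemma linear_ext: "y \<in> fst (pref A x) ==> linear (%w. ext A x w y)"
 unfolding ext_def using linear_from_chart[OF pref_in] by simp

lemma eventually_pref: "\<forall>\<^sub>F y in nhds x. y \<in> fst (pref A x)"
 using chart_open(1)[OF pref_in] in_pref by (auto simp: eventually_nhds)

subsection \<open>Germs of functions\<close>

definition smf :: "'y => ('y => real) => bool" where
 "smf x f \<longleftrightarrow> (\<exists>U. open U \<and> x \<in> U \<and> smooth_fun A U f)"

lemma smooth_fun_subset: "smooth_fun A U f ==> V \<subseteq> U ==> smooth_fun A V f"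
 unfolding smooth_fun_def by (meson Int_mono image_mono order_refl smooth_on_subset)

lemma smf_chart:
 assumes c: "c \<in> A" "x \<in> fst c"
 shows "smf x f \<longleftrightarrow> (\<exists>S. open S \<and> snd c x \<in> S \<and> smooth_on S (f \<circ> inv_chart c))"
proof
 assume "smf x f"
 then obtain U where "open U" "x \<in> U" "smooth_fun A U f" by (auto simp: smf_def)
 then show "\<exists>S. open S \<and> snd c x \<in> S \<and> smooth_on S (f \<circ> inv_chart c)"
  using c chart_image_open[OF c(1)] by (intro exI[of _ "snd c ` (U \<inter> fst c)"]) (auto simp: smooth_fun_def)
next
 assume "\<exists>S. open S \<and> snd c x \<in> S \<and> smooth_on S (f \<circ> inv_chart c)"
 then obtain S where S: "open S" "snd c x \<in> S" "smooth_on S (f \<circ> inv_chart c)" by auto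
 define U where "U = {y \<in> fst c. snd c y \<in> S}"
 have U: "open U" "x \<in> U" using chart_preimage_open[OF c(1) S(1)] c S by (auto simp: U_def)
 have "smooth_on (snd c' ` (U \<inter> fst c')) (f \<circ> inv_chart c')" if c': "c' \<in> A" for c'
 proof -
  have o: "open (snd c' ` (U \<inter> fst c'))" using chart_image_open[OF c' U(1)] .
  have "smooth_on (snd c' ` (U \<inter> fst c')) (%u. (f \<circ> inv_chart c) ((snd c \<circ> inv_chart c') u))"
  proof (rule smooth_on_compose[OF o S(1) _ _ S(3)])
   show "(snd c \<circ> inv_chart c') ` snd c' ` (U \<inter> fst c') \<subseteq> S"
    using inv_chart_chart[OF c'] by (auto simp: U_def)
   show "smooth_on (snd c' ` (U \<inter> fst c')) (snd c \<circ> inv_chart c')"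
    by (rule smooth_on_subset[OF transition_smooth[OF c' c(1)]]) (auto simp: U_def)
  qed
  then show ?thesis
   by (rule smooth_on_cong[OF o, rotated])
     (use inv_chart_chart[OF c'] inv_chart_chart[OF c(1)] in "auto simp: U_def")
 qed
 then show "smf x f" unfolding smf_def smooth_fun_def using U by blast
qed

lemma smooth_on_chart_iff:
 assumes c: "c \<in> A" and U: "open U"
 shows "smooth_on (snd c ` (U \<inter> fst c)) (f \<circ> inv_chart c) \<longleftrightarrow> (\<forall>x\<in>U \<inter> fst c. smf x f)"
proof
 assume "smooth_on (snd c ` (U \<inter> fst c)) (f \<circ> inv_chart c)"
 then show "\<forall>x\<in>U \<inter> fst c. smf x f" using smf_chart[OF c] chart_image_open[OF c U] by blast
next
 assume "\<forall>x\<in>U \<inter> fst c. smf x f"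
 then show "smooth_on (snd c ` (U \<inter> fst c)) (f \<circ> inv_chart c)"
  using smf_chart[OF c] by (intro smooth_on_local) blast
qed

lemma smooth_fun_iff:
 assumes "open U" shows "smooth_fun A U f \<longleftrightarrow> (\<forall>x\<in>U. smf x f)"
proof
 assume "smooth_fun A U f" then show "\<forall>x\<in>U. smf x f" using assms by (auto simp: smf_def)
next
 assume "\<forall>x\<in>U. smf x f"
 then show "smooth_fun A U f" using smooth_on_chart_iff[OF _ assms] by (auto simp: smooth_fun_def)
qed

lemma smf_eventually: "smf x f ==> \<forall>\<^sub>F y in nhds x. smf y f"
 unfolding eventually_nhds by (auto simp: smf_def)

lemma smf_cong:
 assumes "smf x f" "\<forall>\<^sub>F y in nhds x. f y = g y"
 shows "smf x g"
proof -
 obtain S where S: "open S" "snd (pref A x) x \<in> S" "smooth_on S (f \<circ> inv_chart (pref A x))"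
  using assms(1) smf_chart[OF pref_in in_pref] by auto
 obtain V where V: "open V" "x \<in> V" "\<And>y. y \<in> V ==> f y = g y"
  using assms(2) by (auto simp: eventually_nhds)
 let ?T = "S \<inter> snd (pref A x) ` (V \<inter> fst (pref A x))"
 have o: "open ?T" using S(1) chart_image_open[OF pref_in V(1)] by auto
 have "smooth_on ?T (g \<circ> inv_chart (pref A x))"
  by (rule smooth_on_cong[OF o _ smooth_on_subset[OF S(3)]])
    (use V inv_chart_chart[OF pref_in] in auto)
 then show ?thesis using smf_chart[OF pref_in in_pref] o S(2) V(2) in_pref by blast
qed

lemma smf_common_chart:
 assumes "smf x f" "smf x g"
 obtains S where "open S" "snd (pref A x) x \<in> S" "smooth_on S (f \<circ> inv_chart (pref A x))"
  "smooth_on S (g \<circ> inv_chart (pref A x))"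
proof -
 obtain S where "open S" "snd (pref A x) x \<in> S" "smooth_on S (f \<circ> inv_chart (pref A x))"
  using assms(1) smf_chart[OF pref_in in_pref] by auto
 moreover obtain T where "open T" "snd (pref A x) x \<in> T" "smooth_on T (g \<circ> inv_chart (pref A x))"
  using assms(2) smf_chart[OF pref_in in_pref] by auto
 ultimately show ?thesis by (intro that[of "S \<inter> T"]) (auto intro: smooth_on_subset)
qed

lemma smf_const: "smf x (%y. r)"
 by (auto simp: smf_def smooth_fun_def comp_def smooth_on_const intro!: exI[of _ UNIV])

lemma smf_add: "smf x f ==> smf x g ==> smf x (%y. f y + g y)"
 by (erule smf_common_chart)
   (auto simp: smf_chart[OF pref_in in_pref] comp_def intro!: smooth_on_add)

lemma smf_mult: "smf x f ==> smf x g ==> smf x (%y. f y * g y)"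
 by (erule smf_common_chart)
   (auto simp: smf_chart[OF pref_in in_pref] comp_def
    intro!: smooth_on_bilinear[OF _ bounded_bilinear_mult])

lemma smf_uminus: "smf x f ==> smf x (%y. - f y)"
 using smf_mult[OF smf_const[of x "- 1"]] by simp

lemma smf_diff: "smf x f ==> smf x g ==> smf x (%y. f y - g y)"
 using smf_add[OF _ smf_uminus] by simp

lemma smf_sum: "(\<And>i. i \<in> I ==> smf x (f i)) ==> smf x (%y. \<Sum>i\<in>I. f i y)"
 by (induction I rule: infinite_finite_induct) (auto intro: smf_const smf_add)

lemma smf_prod: "(\<And>i. i \<in> I ==> smf x (f i)) ==> smf x (%y. \<Prod>i\<in>I. f i y)"
 by (induction I rule: infinite_finite_induct) (auto intro: smf_const smf_mult)

lemma smf_inverse: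
 assumes "smf x f" "f x \<noteq> 0"
 shows "smf x (%y. inverse (f y))"
proof -
 let ?c = "pref A x"
 obtain S where S: "open S" "snd ?c x \<in> S" "smooth_on S (f \<circ> inv_chart ?c)"
  using assms(1) smf_chart[OF pref_in in_pref] by auto
 have "continuous_on S (f \<circ> inv_chart ?c)"
  using S(3) unfolding smooth_on_def by (metis Ck_on.simps(1))
 then have "open (S \<inter> (f \<circ> inv_chart ?c) -` (- {0}))"
  using S(1) by (intro continuous_open_preimage) auto
 moreover have "smooth_on (S \<inter> (f \<circ> inv_chart ?c) -` (- {0})) (%u. inverse ((f \<circ> inv_chart ?c) u))"
  by (rule smooth_on_inverse[OF calculation _ smooth_on_subset[OF S(3)]]) auto
 ultimately show ?thesis unfolding smf_chart[OF pref_in in_pref]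
  using S(2) assms(2) inv_chart_chart[OF pref_in in_pref]
  by (intro exI[of _ "S \<inter> (f \<circ> inv_chart ?c) -` (- {0})"]) (auto simp: comp_def)
qed

subsection \<open>Directional derivatives\<close>

lemma dirD_chart:
 assumes c: "c \<in> A" "x \<in> fst c" and f: "smf x f"
 shows "dirD A x v f = frechet_derivative (f \<circ> inv_chart c) (at (snd c x)) (to_chart A c x v)"
proof -
 let ?p = "pref A x"
 obtain S where S: "open S" "snd c x \<in> S" "smooth_on S (f \<circ> inv_chart c)"
  using f smf_chart[OF c] by auto
 have e: "(snd c \<circ> inv_chart ?p) (snd ?p x) = snd c x"
  using inv_chart_chart[OF pref_in in_pref] by simp
 have d: "((f \<circ> inv_chart c) has_derivative frechet_derivative (f \<circ> inv_chart c) (at (snd c x)))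
   (at (snd c x))"
  using smooth_on_differentiable[OF S(3,2)] frechet_derivative_works by blast
 have "((%u. (f \<circ> inv_chart c) ((snd c \<circ> inv_chart ?p) u)) has_derivative
   (%v. frechet_derivative (f \<circ> inv_chart c) (at (snd c x)) (jac ?p c x v))) (at (snd ?p x))"
  by (rule has_derivative_compose[of "snd c \<circ> inv_chart ?p" "jac ?p c x" "snd ?p x" UNIV
     "f \<circ> inv_chart c", OF transition_deriv[OF pref_in c(1) in_pref c(2)]])
    (unfold e, rule d)
 then have "((f \<circ> inv_chart ?p) has_derivative
   (%v. frechet_derivative (f \<circ> inv_chart c) (at (snd c x)) (jac ?p c x v))) (at (snd ?p x))"
  by (rule has_derivative_transform_within_open[OF _ chart_image_open[OF pref_in, of "fst c"]])
    (use c chart_open(1)[OF c(1)] inv_chart_chart[OF c(1)] inv_chart_chart[OF pref_in] in_pref in auto)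
 then show ?thesis unfolding dirD_def to_chart_jac by (rule frechet_derivative_eqI)
qed

lemma smf_has_derivative:
 assumes "smf x f"
 shows "((f \<circ> inv_chart (pref A x)) has_derivative (%v. dirD A x v f)) (at (snd (pref A x) x))"
proof -
 obtain S where "open S" "snd (pref A x) x \<in> S" "smooth_on S (f \<circ> inv_chart (pref A x))"
  using assms smf_chart[OF pref_in in_pref] by auto
 then show ?thesis
  using smooth_on_differentiable unfolding dirD_def frechet_derivative_works[symmetric] by blast
qed

lemma smf_isCont: "smf x f ==> isCont f x"
proof -
 assume f: "smf x f"
 have "isCont (f \<circ> inv_chart (pref A x)) (snd (pref A x) x)"
  using smf_has_derivative[OF f] has_derivative_continuous by blast
 moreover have "isCont (snd (pref A x)) x"
  using chart_homeomorphism[OF pref_in, of x] chart_open(1)[OF pref_in] in_pref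
  by (auto simp: homeomorphism_def continuous_on_eq_continuous_at)
 ultimately have "isCont (%y. (f \<circ> inv_chart (pref A x)) (snd (pref A x) y)) x"
  using isCont_o2 by blast
 then show ?thesis
  by (rule isCont_cong[THEN iffD1, rotated])
    (rule eventually_mono[OF eventually_pref], simp add: inv_chart_chart[OF pref_in])
qed

lemma dirD_eqI:
 "((f \<circ> inv_chart (pref A x)) has_derivative D) (at (snd (pref A x) x)) ==> dirD A x v f = D v"
 unfolding dirD_def by (rule frechet_derivative_eqI)

lemma linear_dirD: "smf x f ==> linear (%v. dirD A x v f)"
 using smf_has_derivative has_derivative_linear by blast

lemma dirD_sum_left:
 "smf x f ==> dirD A x (\<Sum>i\<in>I. r i *\<^sub>R v i) f = (\<Sum>i\<in>I. r i * dirD A x (v i) f)"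
 using linear_sum[OF linear_dirD, of x f "%i. r i *\<^sub>R v i" I] linear_scale[OF linear_dirD, of x f] by simp

lemma dirD_const: "dirD A x v (%y. r) = 0"
 by (simp add: dirD_def comp_def)

lemma dirD_add:
 assumes "smf x f" "smf x g"
 shows "dirD A x v (%y. f y + g y) = dirD A x v f + dirD A x v g"
 by (rule dirD_eqI)
   (use has_derivative_add[OF assms[THEN smf_has_derivative]] in "simp add: comp_def")

lemma dirD_mult:
 assumes "smf x f" "smf x g"
 shows "dirD A x v (%y. f y * g y) = f x * dirD A x v g + dirD A x v f * g x"
 by (rule dirD_eqI)
   (use has_derivative_mult[OF assms[THEN smf_has_derivative]] inv_chart_chart[OF pref_in in_pref]
    in "simp add: comp_def")

lemma dirD_cmult: "smf x f ==> dirD A x v (%y. r * f y) = r * dirD A x v f"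
 using dirD_mult[OF smf_const[of x r]] by (simp add: dirD_const)

lemma dirD_diff:
 "smf x f ==> smf x g ==> dirD A x v (%y. f y - g y) = dirD A x v f - dirD A x v g"
 using dirD_add[of x f "%y. (- 1) * g y"] dirD_cmult[of x g v "- 1"] smf_uminus by simp

lemma dirD_sum:
 "(\<And>i. i \<in> I ==> smf x (f i)) ==> dirD A x v (%y. \<Sum>i\<in>I. f i y) = (\<Sum>i\<in>I. dirD A x v (f i))"
 by (induction I rule: infinite_finite_induct) (auto simp: dirD_const dirD_add smf_sum)

lemma dirD_cong:
 fixes f g :: "'y => 'b::real_normed_vector"
 assumes "\<forall>\<^sub>F y in nhds x. f y = g y"
 shows "dirD A x v f = dirD A x v g"
proof -
 let ?c = "pref A x"
 obtain V where V: "open V" "x \<in> V" "\<And>y. y \<in> V ==> f y = g y"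
  using assms by (auto simp: eventually_nhds)
 have o: "open (snd ?c ` (V \<inter> fst ?c))" "snd ?c x \<in> snd ?c ` (V \<inter> fst ?c)"
  using chart_image_open[OF pref_in V(1)] V(2) in_pref by auto
 have e: "(f \<circ> inv_chart ?c) u = (g \<circ> inv_chart ?c) u" if "u \<in> snd ?c ` (V \<inter> fst ?c)" for u
  using that V inv_chart_chart[OF pref_in] by auto
 have "(f \<circ> inv_chart ?c has_derivative D) (at (snd ?c x)) \<longleftrightarrow>
   (g \<circ> inv_chart ?c has_derivative D) (at (snd ?c x))" for D
  using has_derivative_transform_within_open[of "f \<circ> inv_chart ?c" D _ UNIV _ "g \<circ> inv_chart ?c", OF _ o e]
   has_derivative_transform_within_open[of "g \<circ> inv_chart ?c" D _ UNIV _ "f \<circ> inv_chart ?c", OF _ o e[symmetric]]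
  by blast
 then show ?thesis by (simp add: dirD_def frechet_derivative_def)
qed

lemma dirD_vec_nth:
 fixes h :: "'y => vec7"
 assumes "\<And>a. smf x (%y. h y $ a)"
 shows "dirD A x v h $ a = dirD A x v (%y. h y $ a)"
proof -
 have "((%u. \<Sigma> a. ((%y. h y $ a) \<circ> inv_chart (pref A x)) u *\<^sub>R axis a (1::real)) has_derivative
   (%v. \<Sigma> a. dirD A x v (%y. h y $ a) *\<^sub>R axis a 1)) (at (snd (pref A x) x))"
  by (intro has_derivative_sum has_derivative_scaleR_left smf_has_derivative assms)
 moreover have "(\<Sigma> a. w a *\<^sub>R axis a (1::real)) = (\<chi> a. w a)" for w :: "7 => real"
  using basis_expansion[of "\<chi> a. w a"] by (simp add: scalar_mult_eq_scaleR)
 ultimately have "((h \<circ> inv_chart (pref A x)) has_derivative (%v. \<chi> a. dirD A x v (%y. h y $ a)))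
   (at (snd (pref A x) x))"
  by (simp add: comp_def vec_lambda_eta)
 then have "dirD A x v h = (\<chi> a. dirD A x v (%y. h y $ a))" by (rule dirD_eqI)
 then show ?thesis by simp
qed

text \<open>Partial derivatives in the chart \<^term>\<open>pref A x\<close>.\<close>

definition part :: "'y => 7 => ('y => real) => 'y => real" where
 "part x a f y = frechet_derivative (f \<circ> inv_chart (pref A x)) (at (snd (pref A x) y)) (axis a 1)"

lemma vec7_expand: "v = (\<Sigma> a. (v $ a) *\<^sub>R axis a (1::real))" for v :: vec7
 using basis_expansion[of v] by (simp add: scalar_mult_eq_scaleR)

lemma dirD_part:
 assumes "y \<in> fst (pref A x)" "smf y f"
 shows "dirD A y v f = (\<Sigma> a. to_chart A (pref A x) y v $ a * part x a f y)"
proof -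
 let ?c = "pref A x"
 obtain S where S: "open S" "snd ?c y \<in> S" "smooth_on S (f \<circ> inv_chart ?c)"
  using assms smf_chart[OF pref_in] by auto
 then have l: "linear (frechet_derivative (f \<circ> inv_chart ?c) (at (snd ?c y)))"
  using smooth_on_differentiable linear_frechet_derivative by blast
 have "dirD A y v f = frechet_derivative (f \<circ> inv_chart ?c) (at (snd ?c y))
   (\<Sigma> a. (to_chart A ?c y v $ a) *\<^sub>R axis a 1)"
  using dirD_chart[OF pref_in assms] vec7_expand by metis
 then show ?thesis by (simp add: linear_sum[OF l] linear_scale[OF l] part_def)
qed

lemma part_chart:
 assumes "open S" "S \<subseteq> snd (pref A x) ` fst (pref A x)" "u \<in> S"
 shows "(part x a f \<circ> inv_chart (pref A x)) u = frechet_derivative (f \<circ> inv_chart (pref A x)) (at u) (axis a 1)"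
 using assms inv_chart_chart[OF pref_in] by (auto simp: part_def)

lemma smf_shrink:
 assumes "smf y f" "y \<in> fst (pref A x)"
 obtains S where "open S" "snd (pref A x) y \<in> S" "S \<subseteq> snd (pref A x) ` fst (pref A x)"
  "smooth_on S (f \<circ> inv_chart (pref A x))"
proof -
 obtain S where "open S" "snd (pref A x) y \<in> S" "smooth_on S (f \<circ> inv_chart (pref A x))"
  using assms smf_chart[OF pref_in] by auto
 then show ?thesis
  using assms chart_open(2)[OF pref_in, of x]
  by (intro that[of "S \<inter> snd (pref A x) ` fst (pref A x)"]) (auto intro: smooth_on_subset)
qed

lemma smf_part: "smf y f ==> y \<in> fst (pref A x) ==> smf y (part x a f)"
proof (erule smf_shrink, assumption)
 fix S assume S: "open S" "snd (pref A x) y \<in> S" "S \<subseteq> snd (pref A x) ` fst (pref A x)"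
  "smooth_on S (f \<circ> inv_chart (pref A x))" and y: "y \<in> fst (pref A x)"
 have "smooth_on S (part x a f \<circ> inv_chart (pref A x))"
  by (rule smooth_on_cong[OF S(1) _ smooth_on_frechet_derivative[OF S(4), of "axis a 1"]])
    (use part_chart[OF S(1,3)] in auto)
 then show "smf y (part x a f)" using smf_chart[OF pref_in y] S by blast
qed

lemma part_commute:
 assumes "smf x f" shows "part x a (part x b f) x = part x b (part x a f) x"
proof (rule smf_shrink[OF assms in_pref])
 fix S assume S: "open S" "snd (pref A x) x \<in> S" "S \<subseteq> snd (pref A x) ` fst (pref A x)"
  "smooth_on S (f \<circ> inv_chart (pref A x))"
 have *: "part x a (part x b f) x = frechet_derivative
   (%u. frechet_derivative (f \<circ> inv_chart (pref A x)) (at u) (axis b 1)) (at (snd (pref A x) x)) (axis a 1)"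
  for a b
 proof -
  have d: "(%u. frechet_derivative (f \<circ> inv_chart (pref A x)) (at u) (axis b 1))
    differentiable (at (snd (pref A x) x))"
   using smooth_on_differentiable[OF smooth_on_frechet_derivative[OF S(4)] S(2)] .
  show ?thesis unfolding part_def[of x a]
   using frechet_derivative_transform_within_open[OF d S(1,2), of "part x b f \<circ> inv_chart (pref A x)"]
    part_chart[OF S(1,3)] by metis
 qed
 show ?thesis unfolding * by (rule frechet_derivative_commute[OF S(1,2,4)])
qed

subsection \<open>Germs of vector fields\<close>

definition smv :: "'y => ('y => vec7) => bool" where
 "smv x X \<longleftrightarrow> (\<exists>U. open U \<and> x \<in> U \<and> smooth_vf A U X)"

lemma smooth_vf_comp:
 assumes "open U"
 shows "smooth_vf A U X \<longleftrightarrow>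
  (\<forall>c\<in>A. \<forall>x\<in>U \<inter> fst c. \<forall>a. smf x (%y. to_chart A c y (X y) $ a))"
proof -
 have "smooth_on (snd c ` (U \<inter> fst c)) ((%y. to_chart A c y (X y)) \<circ> inv_chart c) \<longleftrightarrow>
   (\<forall>x\<in>U \<inter> fst c. \<forall>a. smf x (%y. to_chart A c y (X y) $ a))" if c: "c \<in> A" for c
 proof -
  have "smooth_on (snd c ` (U \<inter> fst c)) ((%y. to_chart A c y (X y)) \<circ> inv_chart c) \<longleftrightarrow>
   (\<forall>a. smooth_on (snd c ` (U \<inter> fst c)) ((%y. to_chart A c y (X y) $ a) \<circ> inv_chart c))"
   by (subst smooth_on_vec_iff[OF chart_image_open[OF c assms]]) (simp add: comp_def)
  then show ?thesis using smooth_on_chart_iff[OF c assms] by blast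
 qed
 then show ?thesis by (simp add: smooth_vf_def)
qed

lemma smf_jac:
 assumes "c \<in> A" "c' \<in> A" "x \<in> fst c" "x \<in> fst c'"
 shows "smf x (%y. jac c c' y v $ b)"
proof -
 let ?S = "snd c ` (fst c \<inter> fst c')"
 have o: "open ?S" using chart_image_open[OF assms(1) chart_open(1)[OF assms(2)]] by (simp add: Int_commute)
 have "smooth_on ?S (%u. frechet_derivative (snd c' \<circ> inv_chart c) (at u) v $ b)"
  by (rule smooth_on_vec_iff[OF o, THEN iffD1, rule_format, OF
     smooth_on_frechet_derivative[OF transition_smooth[OF assms(1,2)]]])
 then have "smooth_on ?S ((%y. jac c c' y v $ b) \<circ> inv_chart c)"
  by (rule smooth_on_cong[OF o, rotated]) (use inv_chart_chart[OF assms(1)] in "auto simp: jac_def")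
 then show ?thesis using smf_chart[OF assms(1,3)] o assms by blast
qed

lemma to_chart_change:
 assumes "c \<in> A" "c' \<in> A" "y \<in> fst c" "y \<in> fst c'"
 shows "to_chart A c' y v $ b = (\<Sigma> a. to_chart A c y v $ a * jac c c' y (axis a 1) $ b)"
proof -
 have "to_chart A c' y v = jac c c' y (to_chart A c y v)"
  using assms by (simp add: to_chart_jac jac_comp pref_in in_pref)
 also have "... = jac c c' y (\<Sigma> a. (to_chart A c y v $ a) *\<^sub>R axis a 1)"
  using vec7_expand by metis
 finally show ?thesis
  by (simp add: linear_sum[OF jac_linear[OF assms]] linear_scale[OF jac_linear[OF assms]])
qed

lemma smv_chart:
 assumes c: "c \<in> A" "x \<in> fst c"
 shows "smv x X \<longleftrightarrow> (\<forall>a. smf x (%y. to_chart A c y (X y) $ a))"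
proof
 assume "smv x X" then show "\<forall>a. smf x (%y. to_chart A c y (X y) $ a)"
  using c smooth_vf_comp by (auto simp: smv_def)
next
 assume "\<forall>a. smf x (%y. to_chart A c y (X y) $ a)"
 then have "\<forall>\<^sub>F z in nhds x. \<forall>a. smf z (%y. to_chart A c y (X y) $ a)"
  using smf_eventually by (simp add: eventually_all_finite)
 then obtain V where V: "open V" "x \<in> V" "\<And>z a. z \<in> V ==> smf z (%y. to_chart A c y (X y) $ a)"
  by (auto simp: eventually_nhds)
 have "smf z (%y. to_chart A c' y (X y) $ b)" if "c' \<in> A" "z \<in> V \<inter> fst c \<inter> fst c'" for c' z b
 proof (rule smf_cong)
  show "smf z (%y. \<Sigma> a. to_chart A c y (X y) $ a * jac c c' y (axis a 1) $ b)"
   using that c V by (intro smf_sum smf_mult smf_jac) auto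
  show "\<forall>\<^sub>F y in nhds z. (\<Sigma> a. to_chart A c y (X y) $ a * jac c c' y (axis a 1) $ b) =
    to_chart A c' y (X y) $ b"
   unfolding eventually_nhds
   using that c chart_open(1)[OF c(1)] chart_open(1)[OF that(1)] to_chart_change[OF c(1) that(1)]
   by (intro exI[of _ "fst c \<inter> fst c'"]) auto
 qed
 then have "smooth_vf A (V \<inter> fst c) X" using open_Int[OF V(1) chart_open(1)[OF c(1)]] by (subst smooth_vf_comp) auto
 then show "smv x X" unfolding smv_def using open_Int[OF V(1) chart_open(1)[OF c(1)]] V c by (intro exI[of _ "V \<inter> fst c"]) auto
qed

lemma smooth_vf_iff:
 assumes "open U" shows "smooth_vf A U X \<longleftrightarrow> (\<forall>x\<in>U. smv x X)"
proof
 assume "smooth_vf A U X" then show "\<forall>x\<in>U. smv x X" using assms by (auto simp: smv_def)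
next
 assume "\<forall>x\<in>U. smv x X"
 then show "smooth_vf A U X" using smv_chart by (auto simp: smooth_vf_comp[OF assms])
qed

lemma smv_eventually: "smv x X ==> \<forall>\<^sub>F y in nhds x. smv y X"
 unfolding eventually_nhds by (auto simp: smv_def)

lemma smv_comp: "smv x X ==> x \<in> fst (pref A z) ==> smf x (%y. to_chart A (pref A z) y (X y) $ a)"
 using smv_chart[OF pref_in] by blast

lemma smv_cong:
 assumes "smv x X" "\<forall>\<^sub>F y in nhds x. X y = Y y" shows "smv x Y"
proof -
 have "smf x (%y. to_chart A (pref A x) y (Y y) $ a)" for a
  by (rule smf_cong[OF smv_comp[OF assms(1) in_pref]]) (rule eventually_mono[OF assms(2)], simp)
 then show ?thesis using smv_chart[OF pref_in in_pref] by blast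
qed

lemma smv_linear_comb:
 assumes "smf x f" "smv x X" "smv x Y" shows "smv x (%y. f y *\<^sub>R X y + Y y)"
proof -
 let ?c = "pref A x"
 have "smf x (%y. to_chart A ?c y (f y *\<^sub>R X y + Y y) $ a)" for a
 proof (rule smf_cong)
  show "smf x (%y. f y * to_chart A ?c y (X y) $ a + to_chart A ?c y (Y y) $ a)"
   by (intro smf_add smf_mult smv_comp assms in_pref)
  show "\<forall>\<^sub>F y in nhds x. f y * to_chart A ?c y (X y) $ a + to_chart A ?c y (Y y) $ a =
    to_chart A ?c y (f y *\<^sub>R X y + Y y) $ a"
   using eventually_pref
   by eventually_elim (simp add: linear_add linear_scale linear_to_chart pref_in)
 qed
 then show ?thesis using smv_chart[OF pref_in in_pref] by blast
qed

lemma smv_zero: "smv x (%y. 0)"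
proof -
 have "smf x (%y. to_chart A (pref A x) y 0 $ a)" for a
  by (rule smf_cong[OF smf_const[of x 0]], rule eventually_mono[OF eventually_pref])
    (simp add: linear_0 linear_to_chart pref_in)
 then show ?thesis using smv_chart[OF pref_in in_pref] by blast
qed

lemma smv_add: "smv x X ==> smv x Y ==> smv x (%y. X y + Y y)"
 using smv_linear_comb[OF smf_const[of x 1]] by simp

lemma smv_scale: "smf x f ==> smv x X ==> smv x (%y. f y *\<^sub>R X y)"
 using smv_linear_comb[OF _ _ smv_zero] by simp

lemma smv_diff: "smv x X ==> smv x Y ==> smv x (%y. X y - Y y)"
 using smv_linear_comb[OF smf_const[of x "- 1"], of Y X] by simp

lemma smv_sum: "(\<And>i. i \<in> I ==> smv x (X i)) ==> smv x (%y. \<Sum>i\<in>I. X i y)"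
 by (induction I rule: infinite_finite_induct) (auto intro: smv_zero smv_add)

lemma to_chart_ext: "y \<in> fst (pref A x) ==> to_chart A (pref A x) y (ext A x w y) = w"
 unfolding ext_def using to_chart_from_chart[OF pref_in pref_in] jac_id[OF pref_in] by simp

lemma smv_ext: "y \<in> fst (pref A x) ==> smv y (ext A x w)"
proof -
 assume y: "y \<in> fst (pref A x)"
 have "smf y (%z. to_chart A (pref A x) z (ext A x w z) $ a)" for a
  by (rule smf_cong[OF smf_const[of y "w $ a"]])
    (use chart_open(1)[OF pref_in] y to_chart_ext in
     \<open>auto simp: eventually_nhds intro!: exI[of _ "fst (pref A x)"]\<close>)
 then show ?thesis using smv_chart[OF pref_in y] by blast
qed

lemma ext_expand:
 assumes "y \<in> fst (pref A x)"
 shows "v = (\<Sigma> a. (to_chart A (pref A x) y v $ a) *\<^sub>R ext A x (axis a 1) y)"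
proof -
 have "v = from_chart A (pref A x) y (to_chart A (pref A x) y v)"
  using from_chart_to_chart[OF pref_in assms] by simp
 also have "... = from_chart A (pref A x) y (\<Sigma> a. (to_chart A (pref A x) y v $ a) *\<^sub>R axis a 1)"
  using vec7_expand by metis
 finally show ?thesis
  by (simp add: ext_def linear_sum[OF linear_from_chart[OF pref_in assms]]
    linear_scale[OF linear_from_chart[OF pref_in assms]])
qed

lemma smf_dirD:
 assumes "smf x f" "smv x X" shows "smf x (%y. dirD A y (X y) f)"
proof (rule smf_cong)
 show "smf x (%y. \<Sigma> a. to_chart A (pref A x) y (X y) $ a * part x a f y)"
  by (intro smf_sum smf_mult smv_comp assms in_pref smf_part)
 show "\<forall>\<^sub>F y in nhds x. (\<Sigma> a. to_chart A (pref A x) y (X y) $ a * part x a f y) = dirD A y (X y) f"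
  using eventually_pref smf_eventually[OF assms(1)] by eventually_elim (simp add: dirD_part)
qed

lemma dirD_lie_bracket:
 assumes f: "smf x f" and X: "smv x X" and Y: "smv x Y"
 shows "dirD A x (X x) (%y. dirD A y (Y y) f) - dirD A x (Y x) (%y. dirD A y (X y) f) =
  dirD A x (lie_bracket A X Y x) f"
proof -
 let ?c = "%X a y. to_chart A (pref A x) y (X y) $ a"
 have 1: "dirD A x (X x) (%y. dirD A y (Y y) f) =
   (\<Sigma> a. dirD A x (X x) (?c Y a) * part x a f x) +
   (\<Sigma> a b. Y x $ a * (X x $ b * part x b (part x a f) x))"
  if X: "smv x X" and Y: "smv x Y" for X Y
 proof -
  have "dirD A x (X x) (%y. dirD A y (Y y) f) = dirD A x (X x) (%y. \<Sigma> a. ?c Y a y * part x a f y)"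
   by (rule dirD_cong) (use eventually_pref smf_eventually[OF f] in "eventually_elim, simp add: dirD_part")
  also have "... = (\<Sigma> a. ?c Y a x * dirD A x (X x) (part x a f) + dirD A x (X x) (?c Y a) * part x a f x)"
   by (subst dirD_sum) (auto intro!: smf_mult smv_comp Y in_pref smf_part f
     simp: dirD_mult smv_comp[OF Y in_pref] smf_part[OF f in_pref])
  also have "... = (\<Sigma> a. Y x $ a * (\<Sigma> b. X x $ b * part x b (part x a f) x) +
    dirD A x (X x) (?c Y a) * part x a f x)"
   by (simp add: to_chart_pref dirD_part[OF in_pref smf_part[OF f in_pref]])
  finally show ?thesis by (simp add: sum.distrib sum_distrib_left)
 qed
 have 2: "(\<Sigma> a b. Y x $ a * (X x $ b * part x b (part x a f) x)) =
  (\<Sigma> a b. X x $ a * (Y x $ b * part x b (part x a f) x))"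
  by (subst sum.swap) (simp add: part_commute[OF f] mult.left_commute)
 have "dirD A x (lie_bracket A X Y x) f =
   (\<Sigma> a. (dirD A x (X x) (?c Y a) - dirD A x (Y x) (?c X a)) * part x a f x)"
  by (simp add: dirD_part[OF in_pref f] to_chart_pref lie_bracket_def dirD_vec_nth
    smv_comp[OF X in_pref] smv_comp[OF Y in_pref])
 then show ?thesis using 1[OF X Y] 1[OF Y X] 2 by (simp add: sum_subtractf left_diff_distrib)
qed

lemma lie_bracket_ext:
 assumes "y \<in> fst (pref A x)"
 shows "lie_bracket A (ext A x u) (ext A x v) y = 0"
proof -
 have *: "dirD A y w (%z. to_chart A (pref A y) z (ext A x v z)) $ a =
   dirD A y w (%z. jac (pref A x) (pref A y) z v $ a)" for w v a
 proof -
  have ev: "\<forall>\<^sub>F z in nhds y. z \<in> fst (pref A x)"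
   using chart_open(1)[OF pref_in] assms by (auto simp: eventually_nhds)
  have "dirD A y w (%z. to_chart A (pref A y) z (ext A x v z)) $ a =
    dirD A y w (%z. to_chart A (pref A y) z (ext A x v z) $ a)"
   by (rule dirD_vec_nth[OF smv_comp[OF smv_ext[OF assms] in_pref]])
  also have "... = dirD A y w (%z. jac (pref A x) (pref A y) z v $ a)"
   by (rule dirD_cong) (use ev eventually_pref in "eventually_elim,
     simp add: ext_def to_chart_from_chart[OF pref_in pref_in]")
  finally show ?thesis .
 qed
 \<comment> \<open>Both derivatives are second derivatives of the transition map.\<close>
 let ?\<tau> = "snd (pref A y) \<circ> inv_chart (pref A x)"
 let ?S = "snd (pref A x) ` (fst (pref A x) \<inter> fst (pref A y))"
 have o: "open ?S" and yS: "snd (pref A x) y \<in> ?S"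
  using chart_image_open[OF pref_in chart_open(1)[OF pref_in]] assms in_pref by (auto simp: Int_commute)
 have \<tau>: "smooth_on ?S (%u. ?\<tau> u $ a)" for a
  using transition_smooth[OF pref_in pref_in] smooth_on_vec_iff[OF o] by blast
 have dj: "jac (pref A x) (pref A y) z v $ a =
   frechet_derivative (%u. ?\<tau> u $ a) (at (snd (pref A x) z)) v"
  if "z \<in> fst (pref A x)" "z \<in> fst (pref A y)" for z v a
  using frechet_derivative_eqI[OF bounded_linear.has_derivative[OF bounded_linear_vec_nth
    transition_deriv[OF pref_in pref_in that]], of a v] by simp
 have **: "dirD A y (ext A x u y) (%z. jac (pref A x) (pref A y) z v $ a) =
   frechet_derivative (%u'. frechet_derivative (%u. ?\<tau> u $ a) (at u') v) (at (snd (pref A x) y)) u"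
  for u v a
 proof -
  have "dirD A y (ext A x u y) (%z. jac (pref A x) (pref A y) z v $ a) =
   frechet_derivative ((%z. jac (pref A x) (pref A y) z v $ a) \<circ> inv_chart (pref A x)) (at (snd (pref A x) y)) u"
   using dirD_chart[OF pref_in assms smf_jac[OF pref_in pref_in assms in_pref]] to_chart_ext[OF assms]
   by simp
  also have "... = frechet_derivative (%u'. frechet_derivative (%u. ?\<tau> u $ a) (at u') v) (at (snd (pref A x) y)) u"
  proof -
   have d: "(%u'. frechet_derivative (%u. ?\<tau> u $ a) (at u') v) differentiable at (snd (pref A x) y)"
    by (rule smooth_on_differentiable[OF smooth_on_frechet_derivative[OF \<tau>] yS])
   have "frechet_derivative (%u'. frechet_derivative (%u. ?\<tau> u $ a) (at u') v) (at (snd (pref A x) y)) =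
    frechet_derivative ((%z. jac (pref A x) (pref A y) z v $ a) \<circ> inv_chart (pref A x)) (at (snd (pref A x) y))"
    by (rule frechet_derivative_transform_within_open[OF d o yS])
      (use dj inv_chart_chart[OF pref_in] in auto)
   then show ?thesis by metis
  qed
  finally show ?thesis .
 qed
 have "lie_bracket A (ext A x u) (ext A x v) y $ a = 0" for a
  unfolding lie_bracket_def vector_minus_component * **
  using frechet_derivative_commute[OF o yS \<tau>] by simp
 then show ?thesis by (simp add: vec_eq_iff)
qed

subsection \<open>Germs of covector and endomorphism fields\<close>

definition smc :: "'y => ('y => vec7) => bool" where
 "smc x s \<longleftrightarrow> (\<forall>Z. smv x Z \<longrightarrow> smf x (%y. s y \<bullet> Z y))"

definition sme :: "'y => ('y => real^7^7) => bool" where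
 "sme x s \<longleftrightarrow> (\<forall>Z. smv x Z \<longrightarrow> smv x (%y. s y *v Z y))"

lemma smooth_covI: "open U ==> (\<And>x. x \<in> U ==> smc x s) ==> smooth_cov A U s"
 by (auto simp: smooth_cov_def smc_def smooth_fun_iff smooth_vf_iff)

lemma smooth_endI: "open U ==> (\<And>x. x \<in> U ==> sme x s) ==> smooth_end A U s"
 by (auto simp: smooth_end_def sme_def smooth_vf_iff)

text \<open>
 The definition of a smooth covector field on \<open>U\<close> tests it on vector fields that are smooth on all of
 \<open>U\<close>. A germ of a vector field becomes one of these when it is multiplied by a bump function; this
 is where the Hausdorff property enters.
\<close>

lemma smv_globalize:
 assumes "smv x Z"
 obtains \<rho> Z' where "\<And>y. smv y Z'" "smf x \<rho>" "\<rho> x \<noteq> 0" "\<forall>\<^sub>F y in nhds x. Z' y = \<rho> y *\<^sub>R Z y"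
proof -
 let ?c = "pref A x"
 obtain V0 where V0: "open V0" "x \<in> V0" "smooth_vf A V0 Z" using assms by (auto simp: smv_def)
 define V where "V = V0 \<inter> fst ?c"
 have V: "open V" "x \<in> V" "V \<subseteq> fst ?c" "\<And>y. y \<in> V ==> smv y Z"
  using V0 chart_open(1)[OF pref_in] in_pref smooth_vf_iff[OF V0(1)] by (auto simp: V_def)
 have "open (snd ?c ` V)" using chart_image_open[OF pref_in V(1)] V(3) by (metis Int_absorb2)
 then obtain r where r: "0 < r" "cball (snd ?c x) r \<subseteq> snd ?c ` V"
  using V(2) open_contains_cball by blast
 obtain h :: "vec7 => real" where h: "smooth_on UNIV h" "\<And>u. u \<in> ball (snd ?c x) r ==> h u \<noteq> 0"
  "\<And>u. u \<notin> ball (snd ?c x) r ==> h u = 0" using bump_exists[OF r(1)] by blast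
 define \<rho> where "\<rho> y = h (snd ?c y)" for y
 define Z' where "Z' y = (if y \<in> V then \<rho> y *\<^sub>R Z y else 0)" for y
 have smr: "smf y \<rho>" if "y \<in> V" for y
 proof -
  have y: "y \<in> fst ?c" using that V(3) by auto
  have "smooth_on (snd ?c ` fst ?c) (\<rho> \<circ> inv_chart ?c)"
   by (rule smooth_on_cong[OF chart_open(2)[OF pref_in] _ smooth_on_subset[OF h(1) subset_UNIV]])
     (use inv_chart_chart[OF pref_in] in "auto simp: \<rho>_def")
  then show ?thesis using smf_chart[OF pref_in y] chart_open(2)[OF pref_in] y by blast
 qed
 define K where "K = inv_chart ?c ` cball (snd ?c x) r"
 have "continuous_on (cball (snd ?c x) r) (inv_chart ?c)"
  using chart_homeomorphism[OF pref_in, of x] r(2) V(3) unfolding homeomorphism_def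
  by (meson continuous_on_subset image_mono order_trans)
 then have K: "closed K" unfolding K_def by (intro compact_imp_closed compact_continuous_image compact_cball)
 have KV: "K \<subseteq> V" using r(2) V(3) inv_chart_chart[OF pref_in] by (fastforce simp: K_def)
 have "smv y Z'" for y
 proof (cases "y \<in> V")
  case True
  have "smv y (%y. \<rho> y *\<^sub>R Z y)" using smv_scale smr V(4) True by blast
  then show ?thesis
   by (rule smv_cong) (use V(1) True in "auto simp: eventually_nhds Z'_def")
 next
  case False
  have "Z' z = 0" if "z \<in> - K" for z
  proof (cases "z \<in> V")
   case True
   have "snd ?c z \<notin> ball (snd ?c x) r"
   proof
    assume "snd ?c z \<in> ball (snd ?c x) r"
    then have "inv_chart ?c (snd ?c z) \<in> K" unfolding K_def by (intro imageI) auto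
    with that True V(3) show False by (auto simp: inv_chart_chart[OF pref_in])
   qed
   then show ?thesis using h(3) by (simp add: Z'_def \<rho>_def)
  qed (simp add: Z'_def)
  then have "\<forall>\<^sub>F z in nhds y. 0 = Z' z"
   unfolding eventually_nhds using K KV False by (intro exI[of _ "- K"]) auto
  then show ?thesis by (rule smv_cong[OF smv_zero])
 qed
 moreover have "\<rho> x \<noteq> 0" using h(2) r(1) by (simp add: \<rho>_def)
 moreover have "\<forall>\<^sub>F y in nhds x. Z' y = \<rho> y *\<^sub>R Z y"
  using V by (auto simp: eventually_nhds Z'_def)
 ultimately show ?thesis using that smr V(2) by blast
qed

lemma smooth_covD:
 assumes "smooth_cov A U s" "open U" "x \<in> U" shows "smc x s"
 unfolding smc_def
proof (intro allI impI)
 fix Z assume "smv x Z"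
 then obtain \<rho> Z' where Z': "\<And>y. smv y Z'" "smf x \<rho>" "\<rho> x \<noteq> 0" "\<forall>\<^sub>F y in nhds x. Z' y = \<rho> y *\<^sub>R Z y"
  by (rule smv_globalize) blast
 have "smf x (%y. s y \<bullet> Z' y)"
  using assms Z'(1) smooth_vf_iff[OF assms(2)] smooth_fun_iff[OF assms(2)]
  by (auto simp: smooth_cov_def)
 then have "smf x (%y. inverse (\<rho> y) * (s y \<bullet> Z' y))"
  using smf_mult smf_inverse Z' by blast
 moreover have "\<forall>\<^sub>F y in nhds x. inverse (\<rho> y) * (s y \<bullet> Z' y) = s y \<bullet> Z y"
 proof -
  have "(\<rho> \<longlongrightarrow> \<rho> x) (nhds x)" using smf_isCont[OF Z'(2)] by (simp add: isCont_def tendsto_at_iff_tendsto_nhds)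
  then have "\<forall>\<^sub>F y in nhds x. \<rho> y \<noteq> 0" using Z'(3) by (rule tendsto_imp_eventually_ne)
  then show ?thesis using Z'(4)
   by eventually_elim simp
 qed
 ultimately show "smf x (%y. s y \<bullet> Z y)" by (rule smf_cong)
qed

end

section \<open>Alternating multilinear forms on lists\<close>

definition mlin :: "nat => (vec7 list => real) => bool" where
 "mlin n \<omega> \<longleftrightarrow> (\<forall>vs i. length vs = n \<and> i < n \<longrightarrow> linear (%v. \<omega> (vs[i := v])))"

definition swap_alt :: "nat => ('v list => real) => bool" where
 "swap_alt p F \<longleftrightarrow>
   (\<forall>as u w cs. length as + length cs + 2 = p \<longrightarrow> F (as @ u # w # cs) = - F (as @ w # u # cs))"

lemma mlin_linear: "mlin n \<omega> ==> length vs = n ==> i < n ==> linear (%v. \<omega> (vs[i := v]))"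
 by (auto simp: mlin_def)

lemma mlin_append:
 assumes "mlin n \<omega>" "length as + length bs + 1 = n"
 shows "linear (%v. \<omega> (as @ v # bs))"
proof -
 have "linear (%v. \<omega> ((as @ 0 # bs)[length as := v]))" using assms by (intro mlin_linear) auto
 then show ?thesis by (simp add: list_update_append)
qed

lemma alt_form_mlin: "alt_form p \<omega> ==> mlin p \<omega>"
 by (auto simp: alt_form_def mlin_def)

lemma alt_form_swap:
 assumes "alt_form p \<omega>" shows "swap_alt p \<omega>"
 unfolding swap_alt_def
proof (intro allI impI)
 fix as cs :: "vec7 list" and u w
 assume l: "length as + length cs + 2 = p"
 have z: "\<omega> (as @ v # v # cs) = 0" for v
 proof -
  have "(as @ v # v # cs) ! length as = (as @ v # v # cs) ! Suc (length as)"
   by (simp add: nth_append)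
  moreover have "length (as @ v # v # cs) = p" "length as < Suc (length as)" "Suc (length as) < p"
   using l by auto
  ultimately show ?thesis using assms unfolding alt_form_def by blast
 qed
 have 1: "linear (%v. \<omega> (as @ v # b # cs))" for b
  by (rule mlin_append[OF alt_form_mlin[OF assms]]) (use l in auto)
 have 2: "linear (%v. \<omega> (as @ b # v # cs))" for b
  using mlin_append[OF alt_form_mlin[OF assms], of "as @ [b]" cs] l by auto
 have "\<omega> (as @ (u + w) # (u + w) # cs) = \<omega> (as @ u # (u + w) # cs) + \<omega> (as @ w # (u + w) # cs)"
  by (rule linear_add[OF 1])
 then show "\<omega> (as @ u # w # cs) = - \<omega> (as @ w # u # cs)"
  by (simp add: z linear_add[OF 2])
qed

lemma swap_altD:
 "swap_alt p F ==> length as + length cs + 2 = p ==> F (as @ u # w # cs) = - F (as @ w # u # cs)"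
 unfolding swap_alt_def by blast

lemma swap_alt_move:
 assumes "swap_alt p F" "length as + length bs + length cs + 1 = p"
 shows "F (as @ u # bs @ cs) = (- 1) ^ length bs * F (as @ bs @ u # cs)"
 using assms(2)
proof (induction bs arbitrary: as)
 case (Cons b bs)
 have "F (as @ u # b # bs @ cs) = - F (as @ b # u # bs @ cs)"
  by (rule swap_altD[OF assms(1)]) (use Cons.prems in simp)
 also have "F (as @ b # u # bs @ cs) = (- 1) ^ length bs * F ((as @ [b]) @ bs @ u # cs)"
  using Cons.IH[of "as @ [b]"] Cons.prems by simp
 finally show ?case by simp
qed simp

lemma sum_lessThan_add:
 fixes h :: "nat => real" shows "(\<Sum>r<p + q. h r) = (\<Sum>r<p. h r) + (\<Sum>r<q. h (p + r))"
 by (induction q) auto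

lemma sum_skip:
 fixes h :: "nat => real"
 assumes "i \<le> p"
 shows "(\<Sum>r<p. h (if r < i then r else Suc r)) = (\<Sum>j<Suc p. if j = i then 0 else h j)"
proof -
 have "(\<Sum>j<Suc p. if j = i then 0 else h j) = (\<Sum>j\<in>{..<Suc p} - {i}. h j)"
  by (rule sum.mono_neutral_cong_right) auto
 also have "... = (\<Sum>r<p. h (if r < i then r else Suc r))"
  by (rule sum.reindex_bij_witness[where i = "%r. if r < i then r else Suc r"
     and j = "%j. if j < i then j else j - 1"]) (use assms in auto)
 finally show ?thesis by simp
qed

text \<open>
 The Christoffel terms in the slots of a form cancel when the covariant derivative is
 antisymmetrised: the term for the pair \<open>(i, j)\<close> differs from that for \<open>(j, i)\<close> by moving one
 vector past those in between.
\<close>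

lemma symmetric_slots_cancel:
 fixes F :: "'v list => real"
 assumes F: "swap_alt p F" and N: "\<And>u v. N u v = N v u" and l: "length vs = Suc p"
 shows "(\<Sum>i<Suc p. (- 1) ^ i * (\<Sum>r<p. F ((omit i vs)[r := N (vs ! i) (omit i vs ! r)]))) = 0"
proof -
 define b where "b i j = (if j = i then 0 else (- 1) ^ i *
   F ((omit i vs)[(if j < i then j else j - 1) := N (vs ! i) (vs ! j)]))" for i j :: nat
 have anti: "b i j = - b j i" if "i < j" "j < Suc p" for i j
 proof -
  define as where "as = take i vs"
  define bs where "bs = take (j - i - 1) (drop (Suc i) vs)"
  define cs where "cs = drop (Suc j) vs"
  have lens: "length as = i" "length bs = j - i - 1" using that l by (auto simp: as_def bs_def)
  have vs: "vs = as @ vs ! i # bs @ vs ! j # cs"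
  proof -
   have "drop (Suc i) vs = bs @ drop (j - i - 1) (drop (Suc i) vs)"
    unfolding bs_def by (simp only: append_take_drop_id)
   also have "drop (j - i - 1) (drop (Suc i) vs) = drop j vs" using that by simp
   also have "drop j vs = vs ! j # cs" unfolding cs_def using that l by (simp add: Cons_nth_drop_Suc)
   finally have "drop (Suc i) vs = bs @ vs ! j # cs" .
   then show ?thesis unfolding as_def using that l by (metis Suc_lessD id_take_nth_drop less_trans_Suc)
  qed
  have lc: "length as + length bs + length cs + 1 = p" using that l lens by (auto simp: cs_def)
  let ?n = "N (vs ! i) (vs ! j)"
  define a b' where "a = vs ! i" and "b' = vs ! j"
  have vs': "vs = as @ a # bs @ b' # cs" using vs by (simp add: a_def b'_def)
  have ji: "j = i + 1 + length bs" using that lens by simp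
  have o1: "(omit i vs)[j - 1 := ?n] = as @ bs @ ?n # cs"
   unfolding omit_def using lens ji by (subst (1 2) vs') (simp add: list_update_append)
  have o2: "(omit j vs)[i := ?n] = as @ ?n # bs @ cs"
   unfolding omit_def using lens ji by (subst (1 2) vs') (simp add: list_update_append)
  have "b j i = (- 1) ^ j * F (as @ ?n # bs @ cs)"
   unfolding b_def using that o2 N[of "vs ! j"] by simp
  also have "... = (- 1) ^ j * (- 1) ^ length bs * F (as @ bs @ ?n # cs)"
   by (simp add: swap_alt_move[OF F lc])
  also have "(- 1) ^ j * (- 1) ^ length bs = - ((- 1) ^ i :: real)"
   unfolding ji by (simp add: power_add flip: power_mult_distrib)
  also have "- ((- 1) ^ i) * F (as @ bs @ ?n # cs) = - b i j"
   unfolding b_def using that o1 by simp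
  finally show ?thesis by simp
 qed
 have anti': "b i j = - b j i" if "i < Suc p" "j < Suc p" for i j
  using anti[of i j] anti[of j i] that by (cases i j rule: linorder_cases) (auto simp: b_def)
 have "(\<Sum>i<Suc p. (- 1) ^ i * (\<Sum>r<p. F ((omit i vs)[r := N (vs ! i) (omit i vs ! r)]))) =
   (\<Sum>i<Suc p. \<Sum>j<Suc p. b i j)"
 proof (rule sum.cong[OF refl])
  fix i assume i: "i \<in> {..<Suc p}"
  have "(\<Sum>r<p. F ((omit i vs)[r := N (vs ! i) (omit i vs ! r)])) =
    (\<Sum>r<p. (%j. F ((omit i vs)[(if j < i then j else j - 1) := N (vs ! i) (vs ! j)]))
     (if r < i then r else Suc r))"
   by (rule sum.cong) (use i l in "auto simp: omit_def nth_append")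
  also have "... = (\<Sum>j<Suc p. if j = i then 0 else
    F ((omit i vs)[(if j < i then j else j - 1) := N (vs ! i) (vs ! j)]))"
   by (rule sum_skip) (use i in auto)
  finally show "(- 1) ^ i * (\<Sum>r<p. F ((omit i vs)[r := N (vs ! i) (omit i vs ! r)])) =
    (\<Sum>j<Suc p. b i j)"
   by (simp only: sum_distrib_left) (rule sum.cong, auto simp: b_def)
 qed
 also have "... = 0"
 proof -
  have "(\<Sum>i<Suc p. \<Sum>j<Suc p. b i j) = (\<Sum>i<Suc p. \<Sum>j<Suc p. - b j i)"
   by (intro sum.cong refl anti') auto
  also have "... = - (\<Sum>i<Suc p. \<Sum>j<Suc p. b i j)"
   by (subst sum.swap) (simp only: sum_negf)
  finally show ?thesis by linarith
 qed
 finally show ?thesis .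
qed

section \<open>The Levi-Civita connection on germs\<close>

locale lc_atlas = atlas A for A :: "'y::t2_space chart set" +
 fixes g :: "'y => vec7 => vec7 => real"
  and nab :: "('y => vec7) => ('y => vec7) => 'y => vec7"
 assumes metric: "riemannian_metric A g"
  and levi_civita: "levi_civita A g nab"
begin

lemma g_bilinear: "bilinear (g x)" and g_sym: "g x u v = g x v u" and g_pos: "v \<noteq> 0 ==> g x v v > 0"
 using metric by (auto simp: riemannian_metric_def)

lemma g_linear: "linear (%v. g x u v)" "linear (%u. g x u v)"
 using g_bilinear by (auto simp: bilinear_def)

lemma common_nbhd:
 assumes "smv x X" "smv x Y" "smv x Z" "smf x f"
 obtains U where "open U" "x \<in> U" "smooth_vf A U X" "smooth_vf A U Y" "smooth_vf A U Z" "smooth_fun A U f"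
proof -
 have "\<forall>\<^sub>F y in nhds x. smv y X \<and> smv y Y \<and> smv y Z \<and> smf y f"
  using assms smv_eventually smf_eventually by (simp add: eventually_conj_iff)
 then show ?thesis unfolding eventually_nhds using that by (auto simp: smooth_vf_iff smooth_fun_iff)
qed

lemma smf_g: assumes "smv x X" "smv x Y" shows "smf x (%y. g y (X y) (Y y))"
 using common_nbhd[OF assms smv_zero smf_const] metric smooth_fun_iff
 by (metis riemannian_metric_def)

lemma lc_axioms:
 assumes "smv x X" "smv x Y" "smv x Z" "smf x f"
 shows "smv x (nab X Y)"
  "nab (%y. X y + Y y) Z x = nab X Z x + nab Y Z x"
  "nab (%y. f y *\<^sub>R X y) Y x = f x *\<^sub>R nab X Y x"
  "nab X (%y. Y y + Z y) x = nab X Y x + nab X Z x"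
  "nab X (%y. f y *\<^sub>R Y y) x = dirD A x (X x) f *\<^sub>R Y x + f x *\<^sub>R nab X Y x"
  "nab X Y x - nab Y X x = lie_bracket A X Y x"
  "dirD A x (X x) (%y. g y (Y y) (Z y)) = g x (nab X Y x) (Z x) + g x (Y x) (nab X Z x)"
proof -
 obtain U where U: "open U" "x \<in> U" "smooth_vf A U X" "smooth_vf A U Y" "smooth_vf A U Z" "smooth_fun A U f"
  using common_nbhd[OF assms] .
 note lc = levi_civita[unfolded levi_civita_def, rule_format, OF conjI[OF U(1) conjI[OF U(3) conjI[OF U(4) conjI[OF U(5,6)]]]]]
 show "smv x (nab X Y)" using lc U(1,2) smooth_vf_iff by blast
 show "nab (%y. X y + Y y) Z x = nab X Z x + nab Y Z x"
  "nab (%y. f y *\<^sub>R X y) Y x = f x *\<^sub>R nab X Y x"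
  "nab X (%y. Y y + Z y) x = nab X Y x + nab X Z x"
  "nab X (%y. f y *\<^sub>R Y y) x = dirD A x (X x) f *\<^sub>R Y x + f x *\<^sub>R nab X Y x"
  "nab X Y x - nab Y X x = lie_bracket A X Y x"
  "dirD A x (X x) (%y. g y (Y y) (Z y)) = g x (nab X Y x) (Z x) + g x (Y x) (nab X Z x)"
  using lc U(2) by blast+
qed

lemma smv_nab: "smv x X ==> smv x Y ==> smv x (nab X Y)"
 using lc_axioms(1) smv_zero smf_const by blast

lemma nab_add_left: "smv x X ==> smv x Y ==> smv x Z ==> nab (%y. X y + Y y) Z x = nab X Z x + nab Y Z x"
 using lc_axioms(2) smf_const by blast

lemma nab_scale_left: "smf x f ==> smv x X ==> smv x Y ==> nab (%y. f y *\<^sub>R X y) Y x = f x *\<^sub>R nab X Y x"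
 using lc_axioms(3) smv_zero by blast

lemma nab_add_right: "smv x X ==> smv x Y ==> smv x Z ==> nab X (%y. Y y + Z y) x = nab X Y x + nab X Z x"
 using lc_axioms(4) smf_const by blast

lemma nab_scale_right:
 "smf x f ==> smv x X ==> smv x Y ==>
  nab X (%y. f y *\<^sub>R Y y) x = dirD A x (X x) f *\<^sub>R Y x + f x *\<^sub>R nab X Y x"
 using lc_axioms(5) smv_zero by blast

lemma nab_torsion: "smv x X ==> smv x Y ==> nab X Y x - nab Y X x = lie_bracket A X Y x"
 using lc_axioms(6) smv_zero smf_const by blast

lemma nab_metric:
 "smv x X ==> smv x Y ==> smv x Z ==>
  dirD A x (X x) (%y. g y (Y y) (Z y)) = g x (nab X Y x) (Z x) + g x (Y x) (nab X Z x)"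
 using lc_axioms(7) smf_const by blast

subsection \<open>Tensoriality\<close>

text \<open>
 An expression that is linear over germs of functions in a vector field depends only on the value
 of the field at the point.
\<close>

lemma tensorial:
 fixes L :: "('y => vec7) => 'b::real_vector"
 assumes add: "\<And>Y Z. smv x Y ==> smv x Z ==> L (%y. Y y + Z y) = L Y + L Z"
  and scale: "\<And>f Y. smf x f ==> smv x Y ==> L (%y. f y *\<^sub>R Y y) = f x *\<^sub>R L Y"
  and Y: "smv x Y"
 shows "L Y = (\<Sigma> a. (Y x $ a) *\<^sub>R L (ext A x (axis a 1)))"
proof -
 have zero: "L (%y. 0) = 0" using scale[OF smf_const[of x 0] smv_zero] by simp
 have cong: "L Y' = L Z'" if ev: "\<forall>\<^sub>F y in nhds x. Y' y = Z' y" and s: "smv x Y'" "smv x Z'" for Y' Z'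
 proof -
  define f :: "'y => real" where "f y = (if Y' y = Z' y then 0 else 1)" for y
  have f: "smf x f" by (rule smf_cong[OF smf_const[of x 0]], rule eventually_mono[OF ev]) (simp add: f_def)
  have fx: "f x = 0" using eventually_nhds_x_imp_x[OF ev] by (simp add: f_def)
  have "L (%y. f y *\<^sub>R (Z' y - Y' y)) = 0" using scale[OF f smv_diff[OF s(2,1)]] fx by simp
  moreover have "(%y. f y *\<^sub>R (Z' y - Y' y)) = (%y. Z' y - Y' y)" by (auto simp: f_def)
  ultimately have "L (%y. Z' y - Y' y) = 0" by simp
  moreover have "L (%y. Y' y + (Z' y - Y' y)) = L Y' + L (%y. Z' y - Y' y)"
   by (rule add[OF s(1) smv_diff[OF s(2,1)]])
  ultimately show ?thesis by simp
 qed
 have sum: "L (%y. \<Sum>a\<in>I. X a y) = (\<Sum>a\<in>I. L (X a))" if "finite I" "\<And>a. smv x (X a)" for I and X :: "7 => 'y => vec7"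
  using that(1) by (induction I) (auto simp: zero add that(2) smv_sum)
 let ?c = "%a y. to_chart A (pref A x) y (Y y) $ a"
 have s: "smv x (%y. ?c a y *\<^sub>R ext A x (axis a 1) y)" for a
  by (intro smv_scale smv_comp[OF Y] in_pref smv_ext)
 have "L Y = L (%y. \<Sigma> a. ?c a y *\<^sub>R ext A x (axis a 1) y)"
  by (rule cong[OF _ Y smv_sum[OF s]]) (rule eventually_mono[OF eventually_pref], rule ext_expand)
 also have "... = (\<Sigma> a. L (%y. ?c a y *\<^sub>R ext A x (axis a 1) y))" by (rule sum) (use s in auto)
 also have "... = (\<Sigma> a. (Y x $ a) *\<^sub>R L (ext A x (axis a 1)))"
  using scale[OF smv_comp[OF Y in_pref] smv_ext[OF in_pref]] by (simp add: to_chart_pref)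
 finally show ?thesis .
qed

lemma tensorial_eq:
 fixes L :: "('y => vec7) => 'b::real_vector"
 assumes "\<And>Y Z. smv x Y ==> smv x Z ==> L (%y. Y y + Z y) = L Y + L Z"
  and "\<And>f Y. smf x f ==> smv x Y ==> L (%y. f y *\<^sub>R Y y) = f x *\<^sub>R L Y"
  and "smv x Y" "smv x Z" "Y x = Z x"
 shows "L Y = L Z"
 by (rule trans[OF tensorial[where L = L, OF assms(1,2,3), unfolded assms(5)]
    tensorial[where L = L, OF assms(1,2,4), symmetric]])

lemma nab_value:
 assumes "smv x X" "smv x X'" "X x = X' x" "smv x Y"
 shows "nab X Y x = nab X' Y x"
 by (rule tensorial_eq[where L = "%X. nab X Y x"])
   (use assms nab_add_left nab_scale_left in auto)

lemma nab_cong: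
 assumes "smv x X" "smv x Y" "\<forall>\<^sub>F y in nhds x. Y y = Y' y"
 shows "nab X Y x = nab X Y' x"
proof -
 define f :: "'y => real" where "f y = (if Y y = Y' y then 0 else 1)" for y
 have Y': "smv x Y'" by (rule smv_cong[OF assms(2,3)])
 have ev0: "\<forall>\<^sub>F y in nhds x. 0 = f y" by (rule eventually_mono[OF assms(3)]) (simp add: f_def)
 have f: "smf x f" by (rule smf_cong[OF smf_const[of x 0] ev0])
 have fx: "f x = 0" using eventually_nhds_x_imp_x[OF assms(3)] by (simp add: f_def)
 have "dirD A x (X x) f = 0" using dirD_cong[OF ev0, of "X x"] dirD_const[of x "X x" 0] by metis
 then have "nab X (%y. f y *\<^sub>R (Y' y - Y y)) x = 0"
  using nab_scale_right[OF f assms(1) smv_diff[OF Y' assms(2)]] fx by simp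
 moreover have "(%y. f y *\<^sub>R (Y' y - Y y)) = (%y. Y' y - Y y)" by (auto simp: f_def)
 ultimately have "nab X (%y. Y' y - Y y) x = 0" by simp
 moreover have "nab X (%y. Y y + (Y' y - Y y)) x = nab X Y x + nab X (%y. Y' y - Y y) x"
  by (rule nab_add_right[OF assms(1,2) smv_diff[OF Y' assms(2)]])
 ultimately show ?thesis by simp
qed

lemma nab_zero_right: "smv x X ==> nab X (%y. 0) x = 0"
 using nab_add_right[OF _ smv_zero smv_zero] by simp

lemma nab_sum_right:
 "finite I ==> smv x X ==> (\<And>i. i \<in> I ==> smv x (Y i)) ==> nab X (%y. \<Sum>i\<in>I. Y i y) x = (\<Sum>i\<in>I. nab X (Y i) x)"
 by (induction I rule: finite_induct) (auto simp: nab_zero_right nab_add_right smv_sum)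

lemma nab_ext_sym: "nab (ext A x u) (ext A x v) x = nab (ext A x v) (ext A x u) x"
 using nab_torsion[OF smv_ext[OF in_pref] smv_ext[OF in_pref], of x u v] lie_bracket_ext[OF in_pref]
 by simp

subsection \<open>Covariant derivatives of tensors\<close>

definition tensor :: "nat => ('y => vec7 list => real) => bool" where
 "tensor n T \<longleftrightarrow> (\<forall>y. mlin n (T y)) \<and>
   (\<forall>x Ys. length Ys = n \<and> (\<forall>Y\<in>set Ys. smv x Y) \<longrightarrow> smf x (%y. T y (map (%Y. Y y) Ys)))"

lemma tensor_mlin: "tensor n T ==> mlin n (T y)"
 and tensor_smf: "tensor n T ==> length Ys = n ==> (\<And>Y. Y \<in> set Ys ==> smv x Y) ==>
  smf x (%y. T y (map (%Y. Y y) Ys))"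
 by (auto simp: tensor_def)

definition nablaT :: "('y => vec7 list => real) => 'y => vec7 => vec7 list => real" where
 "nablaT T x v us = dirD A x v (%y. T y (map (%u. ext A x u y) us)) -
   (\<Sum>r<length us. T x (us[r := nab (ext A x v) (ext A x (us ! r)) x]))"

definition nabF :: "('y => vec7 list => real) => 'y => ('y => vec7) => ('y => vec7) list => real" where
 "nabF T x X Ys = dirD A x (X x) (%y. T y (map (%Y. Y y) Ys)) -
   (\<Sum>r<length Ys. T x ((map (%Y. Y x) Ys)[r := nab X (Ys ! r) x]))"

lemma nablaT_nabF: "nablaT T x v us = nabF T x (ext A x v) (map (ext A x) us)"
proof -
 have "map (%Y. Y x) (map (ext A x) us) = us" by (simp add: comp_def ext_self)
 then show ?thesis by (simp add: nablaT_def nabF_def comp_def ext_self)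
qed

text \<open>
 The derivatives of a factor \<open>f\<close> cancel by the Leibniz rules of \<open>dirD\<close> and \<open>nab\<close>.
\<close>

lemma nabF_slot_tensorial:
 assumes T: "tensor n T" and X: "smv x X" and l: "length Ys = n" "r < n"
  and Ys: "\<And>Y. Y \<in> set Ys ==> smv x Y"
 shows "smv x Y ==> smv x Z ==>
   nabF T x X (Ys[r := %y. Y y + Z y]) = nabF T x X (Ys[r := Y]) + nabF T x X (Ys[r := Z])"
  and "smf x f ==> smv x Y ==> nabF T x X (Ys[r := %y. f y *\<^sub>R Y y]) = f x *\<^sub>R nabF T x X (Ys[r := Y])"
proof -
 let ?v = "map (%Y. Y x) Ys"
 have lin: "linear (%v. T y (vs[r := v]))" if "length vs = n" for y vs
  using mlin_linear[OF tensor_mlin[OF T] that l(2)] .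
 have exp: "nabF T x X (Ys[r := Y]) = dirD A x (X x) (%y. T y ((map (%Y. Y y) Ys)[r := Y y])) -
   (T x (?v[r := nab X Y x]) + (\<Sum>s\<in>{..<n} - {r}. T x ((?v[s := nab X (Ys ! s) x])[r := Y x])))" for Y
 proof -
  have "(\<Sum>s<n. T x ((map (%Y. Y x) (Ys[r := Y]))[s := nab X (Ys[r := Y] ! s) x])) =
   T x (?v[r := nab X Y x]) + (\<Sum>s\<in>{..<n} - {r}. T x ((?v[s := nab X (Ys ! s) x])[r := Y x]))"
   using l by (subst sum.remove[of _ r]) (auto simp: map_update list_update_swap intro!: sum.cong)
  then show ?thesis using l by (simp add: nabF_def map_update)
 qed
 have sm: "smf x (%y. T y ((map (%Y. Y y) Ys)[r := Y y]))" if "smv x Y" for Y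
  using tensor_smf[OF T, of "Ys[r := Y]" x] l Ys that set_update_subset_insert[of Ys r Y]
  by (auto simp: map_update)
 {
  assume s: "smv x Y" "smv x Z"
  show "nabF T x X (Ys[r := %y. Y y + Z y]) = nabF T x X (Ys[r := Y]) + nabF T x X (Ys[r := Z])"
   unfolding exp using l
   by (simp add: linear_add[OF lin] nab_add_right[OF X s] dirD_add[OF sm[OF s(1)] sm[OF s(2)]] sum.distrib)
 next
  assume s: "smf x f" "smv x Y"
  show "nabF T x X (Ys[r := %y. f y *\<^sub>R Y y]) = f x *\<^sub>R nabF T x X (Ys[r := Y])"
   unfolding exp using l
   by (simp add: linear_add[OF lin] linear_scale[OF lin] nab_scale_right[OF s(1) X s(2)]
     dirD_mult[OF s(1) sm[OF s(2)]] sum_distrib_left algebra_simps)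
 }
qed

lemma nabF_slot:
 assumes "tensor n T" "smv x X" "length Ys = n" "r < n" "\<And>Y. Y \<in> set Ys ==> smv x Y"
  and Y: "smv x Y" "smv x Z" "Y x = Z x"
 shows "nabF T x X (Ys[r := Y]) = nabF T x X (Ys[r := Z])"
 by (rule tensorial_eq[where L = "%Y. nabF T x X (Ys[r := Y])", OF _ _ Y])
   (rule nabF_slot_tensorial[OF assms(1-5)]; assumption)+

lemma nablaT_fields:
 assumes T: "tensor n T" and X: "smv x X" and l: "length Ys = n"
  and Ys: "\<And>Y. Y \<in> set Ys ==> smv x Y"
 shows "nablaT T x (X x) (map (%Y. Y x) Ys) = nabF T x X Ys"
proof -
 let ?E = "map (%Y. ext A x (Y x)) Ys"
 have step: "nabF T x X (take j ?E @ drop j Ys) = nabF T x X Ys" if "j \<le> n" for j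
  using that
 proof (induction j)
  case (Suc j)
  let ?L = "take j ?E @ drop j Ys"
  have d: "drop j Ys = Ys ! j # drop (Suc j) Ys" using Suc.prems l by (simp add: Cons_nth_drop_Suc)
  have "?L[j := Ys ! j] = ?L" using Suc.prems l d by (simp add: list_update_append)
  moreover have "?L[j := ext A x ((Ys ! j) x)] = take (Suc j) ?E @ drop (Suc j) Ys"
   using Suc.prems l d by (simp add: list_update_append take_Suc_conv_app_nth)
  moreover have "nabF T x X (?L[j := ext A x ((Ys ! j) x)]) = nabF T x X (?L[j := Ys ! j])"
   by (rule nabF_slot[OF T X])
     (use Suc.prems l Ys smv_ext[OF in_pref] in "auto simp: ext_self dest!: in_set_takeD in_set_dropD")
  ultimately show ?case using Suc by simp
 qed simp
 have "nabF T x X Ys = nabF T x X ?E" using step[of n] l by simp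
 also have "... = nabF T x (ext A x (X x)) ?E"
  using nab_value[OF X smv_ext[OF in_pref] ext_self[symmetric] smv_ext[OF in_pref]]
  by (simp add: nabF_def ext_self)
 finally show ?thesis by (simp add: nablaT_nabF comp_def)
qed

lemma nablaT_slot_linear:
 assumes T: "tensor n T" and l: "length us = n" "r < n"
 shows "linear (%w. nablaT T x v (us[r := w]))"
proof -
 let ?Ys = "map (ext A x) us"
 have Ys: "Y \<in> set ?Ys ==> smv x Y" for Y using smv_ext[OF in_pref] by auto
 have "nablaT T x v (us[r := w]) =
   (\<Sigma> a. (w $ a) *\<^sub>R nabF T x (ext A x v) (?Ys[r := ext A x (axis a 1)]))" for w
 proof -
  have "nabF T x (ext A x v) (?Ys[r := ext A x w]) =
    (\<Sigma> a. (ext A x w x $ a) *\<^sub>R nabF T x (ext A x v) (?Ys[r := ext A x (axis a 1)]))"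
   by (rule tensorial[where L = "%Y. nabF T x (ext A x v) (?Ys[r := Y])"])
     (use l Ys in "auto intro!: nabF_slot_tensorial[OF T smv_ext[OF in_pref], unfolded real_scaleR_def] smv_ext[OF in_pref]")
  then show ?thesis by (simp add: nablaT_nabF map_update ext_self)
 qed
 then show ?thesis by (auto intro!: linearI simp: sum.distrib sum_distrib_left algebra_simps)
qed

lemma nablaT_linear:
 assumes T: "tensor n T" and l: "length us = n"
 shows "linear (%v. nablaT T x v us)"
proof -
 let ?Ys = "map (ext A x) us"
 have Ys: "smv x (ext A x u)" for u by (rule smv_ext[OF in_pref])
 have f: "smf x (%y. T y (map (%Y. Y y) ?Ys))" using l Ys by (intro tensor_smf[OF T]) auto
 have lin: "linear (%v. T y (us[r := v]))" if "r < n" for y r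
  using mlin_linear[OF tensor_mlin[OF T] l that] .
 have e: "nabF T x X ?Ys = dirD A x (X x) (%y. T y (map (%Y. Y y) ?Ys)) -
   (\<Sum>r<n. T x (us[r := nab X (ext A x (us ! r)) x]))" for X
  using l by (simp add: nabF_def comp_def ext_self)
 note dl = linear_dirD[OF f[unfolded map_map]]
 have "nablaT T x v us = (\<Sigma> a. (v $ a) *\<^sub>R nabF T x (ext A x (axis a 1)) ?Ys)" for v
 proof -
  have "nabF T x (ext A x v) ?Ys = (\<Sigma> a. (ext A x v x $ a) *\<^sub>R nabF T x (ext A x (axis a 1)) ?Ys)"
  proof (rule tensorial[where L = "%X. nabF T x X ?Ys"])
   fix X Y assume s: "smv x X" "smv x Y"
   show "nabF T x (%y. X y + Y y) ?Ys = nabF T x X ?Ys + nabF T x Y ?Ys"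
    unfolding e by (simp add: nab_add_left[OF s Ys] linear_add[OF lin] linear_add[OF dl] sum.distrib)
  next
   fix f X assume s: "smf x f" "smv x X"
   show "nabF T x (%y. f y *\<^sub>R X y) ?Ys = f x *\<^sub>R nabF T x X ?Ys"
    unfolding e
    by (simp add: nab_scale_left[OF s Ys] linear_scale[OF lin] linear_scale[OF dl] sum_distrib_left
      right_diff_distrib)
  qed (rule Ys)
  then show ?thesis by (simp add: nablaT_nabF ext_self)
 qed
 then show ?thesis by (auto intro!: linearI simp: sum.distrib sum_distrib_left algebra_simps)
qed

text \<open>Exterior derivatives are antisymmetrised covariant derivatives.\<close>

lemma nablaT_alternate:
 assumes F: "swap_alt p (%us. T x (us @ ts))" and l: "length vs = Suc p"
 shows "(\<Sum>i<Suc p. (- 1) ^ i * (dirD A x (vs ! i) (%y. T y (map (%u. ext A x u y) (omit i vs @ ts))) -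
   (\<Sum>r<length ts. T x (omit i vs @ ts[r := nab (ext A x (vs ! i)) (ext A x (ts ! r)) x])))) =
  (\<Sum>i<Suc p. (- 1) ^ i * nablaT T x (vs ! i) (omit i vs @ ts))"
proof -
 let ?N = "%u v. nab (ext A x u) (ext A x v) x"
 have split: "nablaT T x v (us @ ts) =
  dirD A x v (%y. T y (map (%u. ext A x u y) (us @ ts))) -
   (\<Sum>r<length ts. T x (us @ ts[r := ?N v (ts ! r)])) - (\<Sum>r<p. T x (us[r := ?N v (us ! r)] @ ts))"
  if "length us = p" for us v
 proof -
  have "(\<Sum>r<p + length ts. T x ((us @ ts)[r := ?N v ((us @ ts) ! r)])) =
   (\<Sum>r<p. T x ((us @ ts)[r := ?N v ((us @ ts) ! r)])) +
   (\<Sum>r<length ts. T x ((us @ ts)[p + r := ?N v ((us @ ts) ! (p + r))]))"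
   by (rule sum_lessThan_add)
  then show ?thesis using that by (simp add: nablaT_def list_update_append nth_append)
 qed
 have "length (omit i vs) = p" if "i < Suc p" for i using that l by (auto simp: omit_def)
 then have "(\<Sum>i<Suc p. (- 1) ^ i * nablaT T x (vs ! i) (omit i vs @ ts)) =
  (\<Sum>i<Suc p. (- 1) ^ i * (dirD A x (vs ! i) (%y. T y (map (%u. ext A x u y) (omit i vs @ ts))) -
   (\<Sum>r<length ts. T x (omit i vs @ ts[r := ?N (vs ! i) (ts ! r)])))) -
  (\<Sum>i<Suc p. (- 1) ^ i * (\<Sum>r<p. T x ((omit i vs)[r := ?N (vs ! i) (omit i vs ! r)] @ ts)))"
  unfolding sum_subtractf[symmetric] right_diff_distrib[symmetric] by (intro sum.cong) (auto simp: split)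
 then show ?thesis
  using symmetric_slots_cancel[where N = ?N, OF F nab_ext_sym l] by (simp only: diff_zero)
qed

subsection \<open>Induced connections\<close>

lemma conn_cov_apply:
 assumes s: "smc x s" and X: "smv x X" and Z: "smv x Z"
 shows "conn_cov A nab x (X x) s \<bullet> Z x = dirD A x (X x) (%y. s y \<bullet> Z y) - s x \<bullet> nab X Z x"
proof -
 let ?L = "%Z. dirD A x (X x) (%y. s y \<bullet> Z y) - s x \<bullet> nab X Z x"
 have sm: "smf x (%y. s y \<bullet> Z y)" if "smv x Z" for Z using s that by (auto simp: smc_def)
 have "?L Z = (\<Sigma> a. (Z x $ a) *\<^sub>R ?L (ext A x (axis a 1)))"
 proof (rule tensorial[where L = ?L, OF _ _ Z])
  fix Y Z assume "smv x Y" "smv x Z"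
  then show "?L (%y. Y y + Z y) = ?L Y + ?L Z"
   by (simp add: inner_add_right dirD_add sm nab_add_right X)
 next
  fix f Y assume "smf x f" "smv x Y"
  then show "?L (%y. f y *\<^sub>R Y y) = f x *\<^sub>R ?L Y"
   by (simp add: dirD_mult sm nab_scale_right X inner_add_right algebra_simps)
 qed
 moreover have "nab (ext A x (X x)) (ext A x w) x = nab X (ext A x w) x" for w
  by (rule nab_value[OF smv_ext[OF in_pref] X ext_self smv_ext[OF in_pref]])
 moreover have inner_Z: "conn_cov A nab x (X x) s \<bullet> Z x = (\<Sigma> a. Z x $ a * conn_cov A nab x (X x) s $ a)"
  by (simp add: inner_vec_def mult.commute)
 ultimately show ?thesis
  by (simp add: inner_Z conn_cov_def Let_def)
qed

lemma matrix_tensorial: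
 fixes L :: "('y => vec7) => vec7"
 assumes "\<And>Y Z. smv x Y ==> smv x Z ==> L (%y. Y y + Z y) = L Y + L Z"
  and "\<And>f Y. smf x f ==> smv x Y ==> L (%y. f y *\<^sub>R Y y) = f x *\<^sub>R L Y"
  and Z: "smv x Z"
 shows "matrix (%w. L (ext A x w)) *v Z x = L Z"
proof -
 have t: "L Y = (\<Sigma> a. (Y x $ a) *\<^sub>R L (ext A x (axis a 1)))" if "smv x Y" for Y
  by (rule tensorial[where L = L, OF assms(1,2) that])
 have "matrix (%w. L (ext A x w)) *v Z x = (\<Sigma> a. (Z x $ a) *\<^sub>R L (ext A x (axis a 1)))"
  by (simp add: matrix_mult_sum column_def matrix_def vec_lambda_eta scalar_mult_eq_scaleR)
 then show ?thesis using t[OF Z] by simp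
qed

lemma conn_end_apply:
 assumes s: "sme x s" and X: "smv x X" and Z: "smv x Z"
 shows "conn_end A nab x (X x) s *v Z x = nab X (%y. s y *v Z y) x - s x *v nab X Z x"
proof -
 let ?L = "%X Z. nab X (%y. s y *v Z y) x - s x *v nab X Z x"
 have sm: "smv x (%y. s y *v Z y)" if "smv x Z" for Z using s that by (auto simp: sme_def)
 have "matrix (%w. ?L (ext A x (X x)) (ext A x w)) *v Z x = ?L (ext A x (X x)) Z"
 proof (rule matrix_tensorial[OF _ _ Z])
  note E = smv_ext[OF in_pref, of x "X x"]
  fix Y Z assume "smv x Y" "smv x Z"
  then show "?L (ext A x (X x)) (%y. Y y + Z y) = ?L (ext A x (X x)) Y + ?L (ext A x (X x)) Z"
   by (simp add: matrix_vector_right_distrib sm nab_add_right E)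
 next
  note E = smv_ext[OF in_pref, of x "X x"]
  fix f Y assume "smf x f" "smv x Y"
  then show "?L (ext A x (X x)) (%y. f y *\<^sub>R Y y) = f x *\<^sub>R ?L (ext A x (X x)) Y"
   by (simp add: matrix_vector_mult_scaleR sm nab_scale_right E matrix_vector_right_distrib algebra_simps)
 qed
 then show ?thesis
  using nab_value[OF smv_ext[OF in_pref] X ext_self] sm[OF Z] Z by (simp add: conn_end_def)
qed

subsection \<open>Curvature\<close>

definition curvF :: "('y => vec7) => ('y => vec7) => ('y => vec7) => 'y => vec7" where
 "curvF X Y Z x = nab X (nab Y Z) x - nab Y (nab X Z) x - nab (lie_bracket A X Y) Z x"

lemma eventually_nab_torsion:
 assumes "smv x X" "smv x Y" shows "\<forall>\<^sub>F y in nhds x. nab X Y y - nab Y X y = lie_bracket A X Y y"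
 using smv_eventually[OF assms(1)] smv_eventually[OF assms(2)] by eventually_elim (rule nab_torsion)

lemma smv_lie_bracket: "smv x X ==> smv x Y ==> smv x (lie_bracket A X Y)"
 by (rule smv_cong[OF smv_diff[OF smv_nab smv_nab] eventually_nab_torsion])

lemma lie_bracket_value: "smv x X ==> smv x Y ==> lie_bracket A X Y x = nab X Y x - nab Y X x"
 using nab_torsion by simp

lemma curvF_swap: assumes "smv x X" "smv x Y" "smv x Z" shows "curvF Y X Z x = - curvF X Y Z x"
proof -
 have "nab (lie_bracket A Y X) Z x = nab (%y. (- 1) *\<^sub>R lie_bracket A X Y y) Z x"
  using assms by (intro nab_value smv_lie_bracket smv_scale smf_const) (simp_all add: lie_bracket_value)
 then show ?thesis
  using nab_scale_left[OF smf_const smv_lie_bracket[OF assms(1,2)] assms(3), of "- 1"]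
  by (simp add: curvF_def)
qed

lemma curvF_tensorial1:
 assumes Y: "smv x Y" and Z: "smv x Z"
 shows "smv x X ==> smv x X' ==> curvF (%y. X y + X' y) Y Z x = curvF X Y Z x + curvF X' Y Z x"
  and "smf x f ==> smv x X ==> curvF (%y. f y *\<^sub>R X y) Y Z x = f x *\<^sub>R curvF X Y Z x"
proof -
 assume s: "smv x X" "smv x X'"
 have 1: "nab Y (nab (%y. X y + X' y) Z) x = nab Y (nab X Z) x + nab Y (nab X' Z) x"
 proof -
  have "\<forall>\<^sub>F y in nhds x. nab (%y. X y + X' y) Z y = nab X Z y + nab X' Z y"
   using smv_eventually[OF s(1)] smv_eventually[OF s(2)] smv_eventually[OF Z]
   by eventually_elim (simp add: nab_add_left)
  then have "nab Y (nab (%y. X y + X' y) Z) x = nab Y (%y. nab X Z y + nab X' Z y) x"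
   by (rule nab_cong[OF Y smv_nab[OF smv_add[OF s] Z]])
  then show ?thesis using nab_add_right[OF Y smv_nab[OF s(1) Z] smv_nab[OF s(2) Z]] by simp
 qed
 have "nab (lie_bracket A (%y. X y + X' y) Y) Z x =
   nab (%y. lie_bracket A X Y y + lie_bracket A X' Y y) Z x"
  by (rule nab_value[OF _ _ _ Z])
    (auto intro!: smv_add smv_lie_bracket s Y simp: lie_bracket_value s Y smv_add nab_add_left nab_add_right)
 then show "curvF (%y. X y + X' y) Y Z x = curvF X Y Z x + curvF X' Y Z x"
  using nab_add_left[OF smv_lie_bracket[OF s(1) Y] smv_lie_bracket[OF s(2) Y] Z]
   nab_add_left[OF s smv_nab[OF Y Z]] 1 by (simp add: curvF_def)
next
 assume s: "smf x f" "smv x X"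
 have 1: "nab Y (nab (%y. f y *\<^sub>R X y) Z) x = dirD A x (Y x) f *\<^sub>R nab X Z x + f x *\<^sub>R nab Y (nab X Z) x"
 proof -
  have "\<forall>\<^sub>F y in nhds x. nab (%y. f y *\<^sub>R X y) Z y = f y *\<^sub>R nab X Z y"
   using smf_eventually[OF s(1)] smv_eventually[OF s(2)] smv_eventually[OF Z]
   by eventually_elim (simp add: nab_scale_left)
  then have "nab Y (nab (%y. f y *\<^sub>R X y) Z) x = nab Y (%y. f y *\<^sub>R nab X Z y) x"
   by (rule nab_cong[OF Y smv_nab[OF smv_scale[OF s] Z]])
  then show ?thesis using nab_scale_right[OF s(1) Y smv_nab[OF s(2) Z]] by simp
 qed
 define h where "h y = - dirD A y (Y y) f" for y
 have h: "smf x h" unfolding h_def[abs_def] by (intro smf_uminus smf_dirD s Y)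
 have "nab (lie_bracket A (%y. f y *\<^sub>R X y) Y) Z x =
   nab (%y. f y *\<^sub>R lie_bracket A X Y y + h y *\<^sub>R X y) Z x"
  by (rule nab_value[OF smv_lie_bracket[OF smv_scale[OF s] Y]
     smv_add[OF smv_scale[OF s(1) smv_lie_bracket[OF s(2) Y]] smv_scale[OF h s(2)]] _ Z])
    (simp add: h_def lie_bracket_value s Y smv_scale nab_scale_left nab_scale_right algebra_simps)
 also have "... = f x *\<^sub>R nab (lie_bracket A X Y) Z x + h x *\<^sub>R nab X Z x"
  using nab_add_left[OF smv_scale[OF s(1) smv_lie_bracket[OF s(2) Y]] smv_scale[OF h s(2)] Z]
   nab_scale_left[OF s(1) smv_lie_bracket[OF s(2) Y] Z] nab_scale_left[OF h s(2) Z] by simp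
 also have "... = f x *\<^sub>R nab (lie_bracket A X Y) Z x - dirD A x (Y x) f *\<^sub>R nab X Z x"
  by (simp add: h_def)
 finally show "curvF (%y. f y *\<^sub>R X y) Y Z x = f x *\<^sub>R curvF X Y Z x"
  using nab_scale_left[OF s smv_nab[OF Y Z]] 1 by (simp add: curvF_def algebra_simps)
qed

lemma curvF_tensorial3:
 assumes X: "smv x X" and Y: "smv x Y"
 shows "smv x Z ==> smv x Z' ==> curvF X Y (%y. Z y + Z' y) x = curvF X Y Z x + curvF X Y Z' x"
  and "smf x f ==> smv x Z ==> curvF X Y (%y. f y *\<^sub>R Z y) x = f x *\<^sub>R curvF X Y Z x"
proof -
 assume s: "smv x Z" "smv x Z'"
 have 1: "nab X (nab Y (%y. Z y + Z' y)) x = nab X (nab Y Z) x + nab X (nab Y Z') x"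
  if X: "smv x X" and Y: "smv x Y" for X Y
 proof -
  have "\<forall>\<^sub>F y in nhds x. nab Y (%y. Z y + Z' y) y = nab Y Z y + nab Y Z' y"
   using smv_eventually[OF s(1)] smv_eventually[OF s(2)] smv_eventually[OF Y]
   by eventually_elim (simp add: nab_add_right)
  then have "nab X (nab Y (%y. Z y + Z' y)) x = nab X (%y. nab Y Z y + nab Y Z' y) x"
   by (rule nab_cong[OF X smv_nab[OF Y smv_add[OF s]]])
  then show ?thesis using nab_add_right[OF X smv_nab[OF Y s(1)] smv_nab[OF Y s(2)]] by simp
 qed
 show "curvF X Y (%y. Z y + Z' y) x = curvF X Y Z x + curvF X Y Z' x"
  using 1[OF X Y] 1[OF Y X] nab_add_right[OF smv_lie_bracket[OF X Y] s] by (simp add: curvF_def)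
next
 assume s: "smf x f" "smv x Z"
 have 1: "nab X (nab Y (%y. f y *\<^sub>R Z y)) x =
   dirD A x (X x) (%y. dirD A y (Y y) f) *\<^sub>R Z x + dirD A x (Y x) f *\<^sub>R nab X Z x +
   (dirD A x (X x) f *\<^sub>R nab Y Z x + f x *\<^sub>R nab X (nab Y Z) x)"
  if X: "smv x X" and Y: "smv x Y" for X Y
 proof -
  have "\<forall>\<^sub>F y in nhds x. nab Y (%y. f y *\<^sub>R Z y) y = dirD A y (Y y) f *\<^sub>R Z y + f y *\<^sub>R nab Y Z y"
   using smf_eventually[OF s(1)] smv_eventually[OF s(2)] smv_eventually[OF Y]
   by eventually_elim (simp add: nab_scale_right)
  then have "nab X (nab Y (%y. f y *\<^sub>R Z y)) x = nab X (%y. dirD A y (Y y) f *\<^sub>R Z y + f y *\<^sub>R nab Y Z y) x"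
   by (rule nab_cong[OF X smv_nab[OF Y smv_scale[OF s]]])
  then show ?thesis
   using nab_add_right[OF X smv_scale[OF smf_dirD[OF s(1) Y] s(2)] smv_scale[OF s(1) smv_nab[OF Y s(2)]]]
    nab_scale_right[OF smf_dirD[OF s(1) Y] X s(2)] nab_scale_right[OF s(1) X smv_nab[OF Y s(2)]] by simp
 qed
 show "curvF X Y (%y. f y *\<^sub>R Z y) x = f x *\<^sub>R curvF X Y Z x"
  using nab_scale_right[OF s(1) smv_lie_bracket[OF X Y] s(2)] dirD_lie_bracket[OF s(1) X Y]
  by (simp add: curvF_def 1[OF X Y] 1[OF Y X] algebra_simps flip: scaleR_left_diff_distrib)
qed

lemma curvF_value:
 assumes "smv x X" "smv x Y" "smv x Z" "smv x X'" "smv x Y'" "smv x Z'"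
  "X x = X' x" "Y x = Y' x" "Z x = Z' x"
 shows "curvF X Y Z x = curvF X' Y' Z' x"
proof -
 have 1: "curvF X Y Z x = curvF X' Y Z x" if "smv x Y" "smv x Z" "smv x X" "smv x X'" "X x = X' x" for X X' Y Z
  by (rule tensorial_eq[where L = "%X. curvF X Y Z x"]) (use that curvF_tensorial1[OF that(1,2)] in auto)
 have 3: "curvF X Y Z x = curvF X Y Z' x" if "smv x X" "smv x Y" "smv x Z" "smv x Z'" "Z x = Z' x" for X Y Z Z'
  by (rule tensorial_eq[where L = "%Z. curvF X Y Z x"]) (use that curvF_tensorial3[OF that(1,2)] in auto)
 have "curvF X Y Z x = curvF X' Y Z x" by (rule 1) (use assms in auto)
 also have "... = - curvF Y X' Z x" using curvF_swap[of x X' Y Z] assms by simp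
 also have "curvF Y X' Z x = curvF Y' X' Z x" by (rule 1) (use assms in auto)
 also have "- curvF Y' X' Z x = curvF X' Y' Z x" using curvF_swap[of x X' Y' Z] assms by simp
 also have "... = curvF X' Y' Z' x" by (rule 3) (use assms in auto)
 finally show ?thesis .
qed

lemma curvature_apply:
 assumes "smv x X" "smv x Y" "smv x Z"
 shows "curvature A nab x (X x) (Y x) *v Z x = curvF X Y Z x"
proof -
 let ?L = "curvF (ext A x (X x)) (ext A x (Y x))"
 have "curvature A nab x (X x) (Y x) = matrix (%w. ?L (ext A x w) x)"
  by (simp add: curvature_def curvF_def Let_def)
 also have "... *v Z x = ?L Z x"
  by (rule matrix_tensorial[where L = "%Z. ?L Z x", OF _ _ assms(3)])
    (use curvF_tensorial3[OF smv_ext[OF in_pref] smv_ext[OF in_pref]] in auto)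
 also have "... = curvF X Y Z x"
  by (rule curvF_value) (use assms smv_ext[OF in_pref] ext_self in auto)
 finally show ?thesis .
qed

text \<open>In commuting fields, the first Bianchi identity is the vanishing of the torsion.\<close>

lemma bianchi:
 assumes "smv x X" "smv x Y" "smv x Z"
 shows "curvF X Y Z x + curvF Y Z X x + curvF Z X Y x = 0"
proof -
 let ?X = "ext A x (X x)" let ?Y = "ext A x (Y x)" let ?Z = "ext A x (Z x)"
 note e = smv_ext[OF in_pref, of x]
 have sw: "nab (ext A x u) (nab (ext A x v) (ext A x w)) x = nab (ext A x u) (nab (ext A x w) (ext A x v)) x"
  for u v w
 proof (rule nab_cong[OF e smv_nab[OF e e]])
  show "\<forall>\<^sub>F y in nhds x. nab (ext A x v) (ext A x w) y = nab (ext A x w) (ext A x v) y"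
   using eventually_pref
   by eventually_elim (use nab_torsion[OF smv_ext smv_ext] lie_bracket_ext in "metis eq_iff_diff_eq_0")
 qed
 have z: "nab (lie_bracket A (ext A x u) (ext A x v)) W x = 0" if "smv x W" for u v W
 proof -
  have "nab (lie_bracket A (ext A x u) (ext A x v)) W x = nab (%y. 0 *\<^sub>R (ext A x u) y) W x"
   by (rule nab_value[OF smv_lie_bracket[OF e e] smv_scale[OF smf_const e] _ that])
     (simp add: lie_bracket_ext[OF in_pref])
  then show ?thesis using nab_scale_left[OF smf_const[of x 0] e that] by simp
 qed
 have "curvF ?X ?Y ?Z x + curvF ?Y ?Z ?X x + curvF ?Z ?X ?Y x = 0"
  by (simp add: curvF_def z e sw[of "X x" "Z x"] sw[of "Y x" "X x"] sw[of "Z x" "Y x"])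
 moreover have "curvF ?X ?Y ?Z x = curvF X Y Z x" "curvF ?Y ?Z ?X x = curvF Y Z X x" "curvF ?Z ?X ?Y x = curvF Z X Y x"
  by (rule curvF_value; use assms e ext_self in auto)+
 ultimately show ?thesis by simp
qed

end

section \<open>Linear algebra of the \<open>G\<^sub>2\<close> three-form\<close>

text \<open>The index \<open>7\<close> is the element \<open>0\<close> of the type \<^typ>\<open>7\<close>.\<close>

lemma UNIV_7: "(UNIV :: 7 set) = {1, 2, 3, 4, 5, 6, 0}"
proof -
 have c: "card {1, 2, 3, 4, 5, 6, 0 :: 7} = 7" "CARD(7) = 7" by simp_all
 have "{1, 2, 3, 4, 5, 6, 0 :: 7} = UNIV"
  by (rule card_subset_eq) (simp_all only: finite subset_UNIV c)
 then show ?thesis by simp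
qed

lemma sum_7: "(\<Sigma> i. f i) = f 1 + f 2 + f 3 + f 4 + f 5 + f 6 + f 0" for f :: "7 => real"
 unfolding UNIV_7 by simp

lemma forall_7: "(\<forall>i. Q i) \<longleftrightarrow> Q 1 \<and> Q 2 \<and> Q 3 \<and> Q 4 \<and> Q 5 \<and> Q 6 \<and> Q 0" for Q :: "7 => bool"
proof -
 have "(\<forall>i. Q i) \<longleftrightarrow> (\<forall>i\<in>UNIV. Q i)" by simp
 then show ?thesis unfolding UNIV_7 by simp
qed

definition kd :: "7 => 7 => real" where
 "kd i j = (if i = j then 1 else 0)"

lemma kd_sym: "kd i j = kd j i" by (simp add: kd_def)

lemma sum_kd [simp]:
 "(\<Sigma> i. kd a i * f i) = f a" "(\<Sigma> i. kd i a * f i) = f a"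
 "(\<Sigma> i. f i * kd a i) = f a" "(\<Sigma> i. f i * kd i a) = f a"
 by (simp_all add: kd_def if_distrib if_distribR cong: if_cong)

lemma sum_kd_scaleR [simp]:
 fixes f :: "7 => 'a::real_vector"
 shows "(\<Sigma> i. kd a i *\<^sub>R f i) = f a" "(\<Sigma> i. kd i a *\<^sub>R f i) = f a"
proof -
 have "(\<Sigma> i. kd a i *\<^sub>R f i) = (\<Sigma> i. if i = a then f i else 0)"
  by (rule sum.cong) (auto simp: kd_def)
 then show "(\<Sigma> i. kd a i *\<^sub>R f i) = f a" by simp
 then show "(\<Sigma> i. kd i a *\<^sub>R f i) = f a" by (simp add: kd_sym)
qed

text \<open>The components of \<open>e\<^sup>a\<^sup>b\<^sup>c\<close>, and those of the three-form.\<close>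

definition vol3 :: "7 => 7 => 7 => 7 => 7 => 7 => real" where
 "vol3 a b c i j k = kd a i * (kd b j * kd c k - kd b k * kd c j)
   - kd a j * (kd b i * kd c k - kd b k * kd c i) + kd a k * (kd b i * kd c j - kd b j * kd c i)"

definition P :: "7 => 7 => 7 => real" where
 "P i j k = vol3 1 2 3 i j k + vol3 1 4 5 i j k + vol3 1 6 0 i j k + vol3 2 4 6 i j k
   - vol3 2 5 0 i j k - vol3 3 4 0 i j k - vol3 3 5 6 i j k"

lemma P_cyclic: "P j k i = P i j k"
 by (simp add: P_def vol3_def algebra_simps)

lemma P_swap12: "P j i k = - P i j k"
 by (simp add: P_def vol3_def algebra_simps)

lemma P_swap23: "P i k j = - P i j k"
 by (simp add: P_def vol3_def algebra_simps)

lemma P_swap13: "P k j i = - P i j k"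
 by (simp add: P_def vol3_def algebra_simps)

lemma P_table:
 shows "P 1 1 k = 0" "P 1 2 k = kd 3 k" "P 1 3 k = - kd 2 k" "P 1 4 k = kd 5 k" "P 1 5 k = - kd 4 k" "P 1 6 k = kd 0 k" "P 1 0 k = - kd 6 k"
  "P 2 1 k = - kd 3 k" "P 2 2 k = 0" "P 2 3 k = kd 1 k" "P 2 4 k = kd 6 k" "P 2 5 k = - kd 0 k" "P 2 6 k = - kd 4 k" "P 2 0 k = kd 5 k"
  "P 3 1 k = kd 2 k" "P 3 2 k = - kd 1 k" "P 3 3 k = 0" "P 3 4 k = - kd 0 k" "P 3 5 k = - kd 6 k" "P 3 6 k = kd 5 k" "P 3 0 k = kd 4 k"
  "P 4 1 k = - kd 5 k" "P 4 2 k = - kd 6 k" "P 4 3 k = kd 0 k" "P 4 4 k = 0" "P 4 5 k = kd 1 k" "P 4 6 k = kd 2 k" "P 4 0 k = - kd 3 k"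
  "P 5 1 k = kd 4 k" "P 5 2 k = kd 0 k" "P 5 3 k = kd 6 k" "P 5 4 k = - kd 1 k" "P 5 5 k = 0" "P 5 6 k = - kd 3 k" "P 5 0 k = - kd 2 k"
  "P 6 1 k = - kd 0 k" "P 6 2 k = kd 4 k" "P 6 3 k = - kd 5 k" "P 6 4 k = - kd 2 k" "P 6 5 k = kd 3 k" "P 6 6 k = 0" "P 6 0 k = kd 1 k"
  "P 0 1 k = kd 6 k" "P 0 2 k = - kd 5 k" "P 0 3 k = - kd 4 k" "P 0 4 k = kd 3 k" "P 0 5 k = kd 2 k" "P 0 6 k = - kd 1 k" "P 0 0 k = 0"
 unfolding P_def vol3_def by (simp_all add: kd_def)

lemma kd_eval: "kd i i = 1" "i \<noteq> j ==> kd i j = 0"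
 by (simp_all add: kd_def)

lemma P_P: "(\<Sigma> i j. P a i j * P b i j) = 6 * kd a b"
proof -
 have "\<forall>a b. (\<Sigma> i j. P a i j * P b i j) = 6 * kd a b"
  unfolding forall_7 by (simp add: sum_7[of "%i. \<Sigma> j. _ i j"] P_table sum_negf kd_eval)
 then show ?thesis by blast
qed

definition psi :: "7 => 7 => 7 => 7 => real" where
 "psi i j k l = (\<Sigma> e. P i j e * P k l e) - kd i k * kd j l + kd i l * kd j k"

text \<open>
 For a skew matrix \<open>A\<close>, \<open>tau A\<close> is its component in \<open>\<Lambda>\<^sup>2\<^sub>7\<close> and \<open>stab A\<close> is the derivative of the
 three-form under \<open>A\<close>. Each determines the other.
\<close>

definition skew :: "(7 => 7 => real) => bool" where
 "skew A \<longleftrightarrow> (\<forall>i j. A i j = - A j i)"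

definition tau :: "(7 => 7 => real) => 7 => real" where
 "tau A a = (\<Sigma> i j. P a i j * A i j)"

definition stab :: "(7 => 7 => real) => 7 => 7 => 7 => real" where
 "stab A a b c = (\<Sigma> q. A a q * P b c q) + (\<Sigma> q. A b q * P c a q) + (\<Sigma> q. A c q * P a b q)"

lemma skewD: "skew A ==> A i j = - A j i" unfolding skew_def by blast

lemma skew_diag: "skew A ==> A i i = 0" using skewD[of A i i] by simp

lemma skew_table:
 assumes "skew A"
 shows "A 1 1 = 0"
  "A 2 1 = - A 1 2" "A 2 2 = 0"
  "A 3 1 = - A 1 3" "A 3 2 = - A 2 3" "A 3 3 = 0"
  "A 4 1 = - A 1 4" "A 4 2 = - A 2 4" "A 4 3 = - A 3 4" "A 4 4 = 0"
  "A 5 1 = - A 1 5" "A 5 2 = - A 2 5" "A 5 3 = - A 3 5" "A 5 4 = - A 4 5" "A 5 5 = 0"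
  "A 6 1 = - A 1 6" "A 6 2 = - A 2 6" "A 6 3 = - A 3 6" "A 6 4 = - A 4 6" "A 6 5 = - A 5 6" "A 6 6 = 0"
  "A 0 1 = - A 1 0" "A 0 2 = - A 2 0" "A 0 3 = - A 3 0" "A 0 4 = - A 4 0" "A 0 5 = - A 5 0" "A 0 6 = - A 6 0" "A 0 0 = 0"
 using assms skew_diag[OF assms] unfolding skew_def by blast+

lemma tau_table:
 assumes "skew A"
 shows "tau A 1 = 2 * (A 2 3 + A 4 5 + A 6 0)"
  "tau A 2 = 2 * (- A 1 3 + A 4 6 - A 5 0)"
  "tau A 3 = 2 * (A 1 2 - A 4 0 - A 5 6)"
  "tau A 4 = 2 * (- A 1 5 - A 2 6 + A 3 0)"
  "tau A 5 = 2 * (A 1 4 + A 2 0 + A 3 6)"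
  "tau A 6 = 2 * (- A 1 0 + A 2 4 - A 3 5)"
  "tau A 0 = 2 * (A 1 6 - A 2 5 - A 3 4)"
 unfolding tau_def sum_7[of "%i. \<Sigma> j. _ i j"]
 by (simp_all add: P_table sum_negf skew_table[OF assms])

lemma stab_tau:
 assumes "skew A"
 shows "stab A a b c = (1/2) * (\<Sigma> l. tau A l * psi l a b c)"
proof -
 have e: "(\<Sigma> l. tau A l * psi l a b c) = tau A 1 * psi 1 a b c + tau A 2 * psi 2 a b c
   + tau A 3 * psi 3 a b c + tau A 4 * psi 4 a b c + tau A 5 * psi 5 a b c + tau A 6 * psi 6 a b c
   + tau A 0 * psi 0 a b c" for a b c
  by (rule sum_7)
 have "\<forall>a b c. stab A a b c = (1/2) * (\<Sigma> l. tau A l * psi l a b c)"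
  unfolding forall_7 e
  by (intro conjI) (simp_all add: tau_table[OF assms] stab_def psi_def P_table kd_eval sum_negf
    skew_table[OF assms])
 then show ?thesis by blast
qed

text \<open>The stabiliser of the three-form is \<open>\<Lambda>\<^sup>2\<^sub>1\<^sub>4\<close>.\<close>

lemma stab_iff_tau:
 assumes "skew A"
 shows "(\<forall>a b c. stab A a b c = 0) \<longleftrightarrow> (\<forall>a. tau A a = 0)"
proof
 assume "\<forall>a. tau A a = 0" then show "\<forall>a b c. stab A a b c = 0" by (simp add: stab_tau[OF assms])
next
 assume s: "\<forall>a b c. stab A a b c = 0"
 have "stab A 2 4 0 = 0" "stab A 1 4 0 = 0" "stab A 1 4 6 = 0" "stab A 1 2 0 = 0" "stab A 1 2 6 = 0"
  "stab A 1 2 5 = 0" "stab A 1 2 4 = 0" using s by blast+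
 then show "\<forall>a. tau A a = 0"
  unfolding forall_7 stab_tau[OF assms] sum_7
  by (simp add: psi_def P_table kd_eval sum_negf)
qed

text \<open>
 The algebra behind the theorem of Fernandez and Gray: \<open>\<nabla>\<phi>\<close> is determined by the tensor
 \<open>tau (\<omega> k) l\<close> in \<open>V \<otimes> V = 1 + 27 + 7 + 14\<close>. The closedness of \<open>\<phi>\<close> kills the first three
 parts, and its coclosedness the last two.
\<close>

lemma fernandez_gray_algebra:
 fixes \<omega> :: "7 => 7 => 7 => real"
 assumes skew: "\<And>k. skew (\<omega> k)"
  and closed: "\<And>a b c d. stab (\<omega> a) b c d - stab (\<omega> b) a c d + stab (\<omega> c) a b d - stab (\<omega> d) a b c = 0"
  and coclosed: "\<And>p q. p \<noteq> q ==> (\<Sigma> k. stab (\<omega> k) k p q) = 0"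
 shows "stab (\<omega> k) a b c = 0"
proof -
 let ?t = "%k l. tau (\<omega> k) l"
 note ev = stab_tau[OF skew] sum_7 psi_def P_table kd_eval sum_negf
 have h0: "- ?t 1 5 - ?t 2 6 + ?t 3 0 = 0" using closed[of 1 2 3 4] by (simp add: ev)
 have h1: "?t 1 4 + ?t 2 0 + ?t 3 6 = 0" using closed[of 1 2 3 5] by (simp add: ev)
 have h2: "- ?t 1 0 + ?t 2 4 - ?t 3 5 = 0" using closed[of 1 2 3 6] by (simp add: ev)
 have h3: "?t 1 6 - ?t 2 5 - ?t 3 4 = 0" using closed[of 1 2 3 0] by (simp add: ev)
 have h4: "- ?t 1 3 + ?t 4 6 - ?t 5 0 = 0" using closed[of 1 2 4 5] by (simp add: ev)
 have h5: "- ?t 2 3 - ?t 4 5 - ?t 6 0 = 0" using closed[of 1 2 4 6] by (simp add: ev)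
 have h6: "- ?t 1 1 - ?t 2 2 - ?t 4 4 - ?t 0 0 = 0" using closed[of 1 2 4 0] by (simp add: ev)
 have h7: "- ?t 1 1 - ?t 2 2 - ?t 5 5 - ?t 6 6 = 0" using closed[of 1 2 5 6] by (simp add: ev)
 have h8: "?t 2 3 - ?t 5 4 - ?t 0 6 = 0" using closed[of 1 2 5 0] by (simp add: ev)
 have h9: "- ?t 1 3 - ?t 6 4 + ?t 0 5 = 0" using closed[of 1 2 6 0] by (simp add: ev)
 have h10: "?t 1 2 - ?t 4 0 - ?t 5 6 = 0" using closed[of 1 3 4 5] by (simp add: ev)
 have h11: "- ?t 1 1 - ?t 3 3 - ?t 4 4 - ?t 6 6 = 0" using closed[of 1 3 4 6] by (simp add: ev)
 have h12: "- ?t 3 2 + ?t 4 5 - ?t 0 6 = 0" using closed[of 1 3 4 0] by (simp add: ev)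
 have h13: "- ?t 3 2 - ?t 5 4 + ?t 6 0 = 0" using closed[of 1 3 5 6] by (simp add: ev)
 have h14: "?t 1 1 + ?t 3 3 + ?t 5 5 + ?t 0 0 = 0" using closed[of 1 3 5 0] by (simp add: ev)
 have h15: "?t 1 2 + ?t 6 5 + ?t 0 4 = 0" using closed[of 1 3 6 0] by (simp add: ev)
 have h16: "- ?t 1 0 - ?t 4 2 + ?t 5 3 = 0" using closed[of 1 4 5 6] by (simp add: ev)
 have h17: "?t 1 6 + ?t 4 3 + ?t 5 2 = 0" using closed[of 1 4 5 0] by (simp add: ev)
 have h18: "- ?t 1 5 + ?t 6 2 - ?t 0 3 = 0" using closed[of 1 4 6 0] by (simp add: ev)
 have h19: "?t 1 4 - ?t 6 3 - ?t 0 2 = 0" using closed[of 1 5 6 0] by (simp add: ev)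
 have h20: "?t 2 2 + ?t 3 3 + ?t 4 4 + ?t 5 5 = 0" using closed[of 2 3 4 5] by (simp add: ev)
 have h21: "- ?t 2 1 - ?t 4 0 + ?t 6 5 = 0" using closed[of 2 3 4 6] by (simp add: ev)
 have h22: "?t 3 1 + ?t 4 6 + ?t 0 5 = 0" using closed[of 2 3 4 0] by (simp add: ev)
 have h23: "?t 3 1 - ?t 5 0 - ?t 6 4 = 0" using closed[of 2 3 5 6] by (simp add: ev)
 have h24: "?t 2 1 + ?t 5 6 - ?t 0 4 = 0" using closed[of 2 3 5 0] by (simp add: ev)
 have h25: "?t 2 2 + ?t 3 3 + ?t 6 6 + ?t 0 0 = 0" using closed[of 2 3 6 0] by (simp add: ev)
 have h26: "- ?t 2 0 + ?t 4 1 + ?t 6 3 = 0" using closed[of 2 4 5 6] by (simp add: ev)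
 have h27: "?t 2 6 - ?t 5 1 + ?t 0 3 = 0" using closed[of 2 4 5 0] by (simp add: ev)
 have h28: "- ?t 2 5 + ?t 4 3 - ?t 6 1 = 0" using closed[of 2 4 6 0] by (simp add: ev)
 have h29: "?t 2 4 + ?t 5 3 + ?t 0 1 = 0" using closed[of 2 5 6 0] by (simp add: ev)
 have h30: "- ?t 3 0 - ?t 5 1 - ?t 6 2 = 0" using closed[of 3 4 5 6] by (simp add: ev)
 have h31: "?t 3 6 - ?t 4 1 - ?t 0 2 = 0" using closed[of 3 4 5 0] by (simp add: ev)
 have h32: "- ?t 3 5 - ?t 4 2 + ?t 0 1 = 0" using closed[of 3 4 6 0] by (simp add: ev)
 have h33: "?t 3 4 - ?t 5 2 + ?t 6 1 = 0" using closed[of 3 5 6 0] by (simp add: ev)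
 have h34: "?t 4 4 + ?t 5 5 + ?t 6 6 + ?t 0 0 = 0" using closed[of 4 5 6 0] by (simp add: ev)
 have k0: "?t 4 0 + ?t 5 6 - ?t 6 5 - ?t 0 4 = 0" using coclosed[of 1 2] by (simp add: ev)
 have k1: "?t 4 6 - ?t 5 0 - ?t 6 4 + ?t 0 5 = 0" using coclosed[of 1 3] by (simp add: ev)
 have k2: "- ?t 2 0 - ?t 3 6 + ?t 6 3 + ?t 0 2 = 0" using coclosed[of 1 4] by (simp add: ev)
 have k3: "- ?t 2 6 + ?t 3 0 + ?t 6 2 - ?t 0 3 = 0" using coclosed[of 1 5] by (simp add: ev)
 have k4: "?t 2 5 + ?t 3 4 - ?t 4 3 - ?t 5 2 = 0" using coclosed[of 1 6] by (simp add: ev)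
 have k5: "?t 2 4 - ?t 3 5 - ?t 4 2 + ?t 5 3 = 0" using coclosed[of 1 0] by (simp add: ev)
 have k6: "- ?t 4 5 + ?t 5 4 - ?t 6 0 + ?t 0 6 = 0" using coclosed[of 2 3] by (simp add: ev)
 have k7: "?t 1 0 + ?t 3 5 - ?t 5 3 - ?t 0 1 = 0" using coclosed[of 2 4] by (simp add: ev)
 have k8: "?t 1 6 - ?t 3 4 + ?t 4 3 - ?t 6 1 = 0" using coclosed[of 2 5] by (simp add: ev)
 have k9: "- ?t 1 5 + ?t 3 0 + ?t 5 1 - ?t 0 3 = 0" using coclosed[of 2 6] by (simp add: ev)
 have k10: "- ?t 1 4 - ?t 3 6 + ?t 4 1 + ?t 6 3 = 0" using coclosed[of 2 0] by (simp add: ev)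
 have k11: "?t 1 6 - ?t 2 5 + ?t 5 2 - ?t 6 1 = 0" using coclosed[of 3 4] by (simp add: ev)
 have k12: "- ?t 1 0 + ?t 2 4 - ?t 4 2 + ?t 0 1 = 0" using coclosed[of 3 5] by (simp add: ev)
 have k13: "- ?t 1 4 - ?t 2 0 + ?t 4 1 + ?t 0 2 = 0" using coclosed[of 3 6] by (simp add: ev)
 have k14: "?t 1 5 + ?t 2 6 - ?t 5 1 - ?t 6 2 = 0" using coclosed[of 3 0] by (simp add: ev)
 have k15: "- ?t 2 3 + ?t 3 2 - ?t 6 0 + ?t 0 6 = 0" using coclosed[of 4 5] by (simp add: ev)
 have k16: "?t 1 3 - ?t 3 1 + ?t 5 0 - ?t 0 5 = 0" using coclosed[of 4 6] by (simp add: ev)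
 have k17: "?t 1 2 - ?t 2 1 - ?t 5 6 + ?t 6 5 = 0" using coclosed[of 4 0] by (simp add: ev)
 have k18: "?t 1 2 - ?t 2 1 - ?t 4 0 + ?t 0 4 = 0" using coclosed[of 5 6] by (simp add: ev)
 have k19: "- ?t 1 3 + ?t 3 1 + ?t 4 6 - ?t 6 4 = 0" using coclosed[of 5 0] by (simp add: ev)
 have k20: "- ?t 2 3 + ?t 3 2 - ?t 4 5 + ?t 5 4 = 0" using coclosed[of 6 0] by (simp add: ev)
 have "\<forall>k l. ?t k l = 0"
  unfolding forall_7 using h0 h1 h2 h3 h4 h5 h6 h7 h8 h9 h10 h11 h12 h13 h14 h15 h16 h17 h18 h19 h20 h21 h22 h23 h24 h25 h26 h27 h28 h29 h30 h31 h32 h33 h34 k0 k1 k2 k3 k4 k5 k6 k7 k8 k9 k10 k11 k12 k13 k14 k15 k16 k17 k18 k19 k20 by linarith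
 then show ?thesis by (simp add: stab_tau[OF skew])
qed

section \<open>Cohomology of isomorphic complexes\<close>

lemma cring_real_ring: "cring real_ring"
proof (rule cringI)
 show "abelian_group real_ring"
 proof (rule abelian_groupI)
  fix x assume "x \<in> carrier real_ring"
  show "\<exists>y\<in>carrier real_ring. y \<oplus>\<^bsub>real_ring\<^esub> x = \<zero>\<^bsub>real_ring\<^esub>"
   by (rule bexI[of _ "- x"]) (auto simp: real_ring_def)
 qed (auto simp: real_ring_def)
 show "comm_monoid real_ring" by (rule comm_monoidI) (auto simp: real_ring_def)
qed (auto simp: real_ring_def algebra_simps)

lemma cring_dual_ring: "cring dual_ring"
proof (rule cringI)
 show "abelian_group dual_ring"
 proof (rule abelian_groupI)
  fix x assume "x \<in> carrier dual_ring"
  show "\<exists>y\<in>carrier dual_ring. y \<oplus>\<^bsub>dual_ring\<^esub> x = \<zero>\<^bsub>dual_ring\<^esub>"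
   by (rule bexI[of _ "(- fst x, - snd x)"]) (auto simp: dual_ring_def split: prod.splits)
 qed (auto simp: dual_ring_def)
 show "comm_monoid dual_ring" by (rule comm_monoidI) (auto simp: dual_ring_def algebra_simps)
qed (auto simp: dual_ring_def algebra_simps)

lemma module_dsum:
 assumes M: "Module.module R M" and N: "Module.module R N"
 shows "Module.module R (dsum_module M N)"
proof -
 interpret M: Module.module R M by (rule M)
 interpret N: Module.module R N by (rule N)
 show ?thesis
 proof (rule moduleI)
  show "abelian_group (dsum_module M N)"
  proof (rule abelian_groupI)
   fix x assume "x \<in> carrier (dsum_module M N)"
   then show "\<exists>y\<in>carrier (dsum_module M N). y \<oplus>\<^bsub>dsum_module M N\<^esub> x = \<zero>\<^bsub>dsum_module M N\<^esub>"
    by (intro bexI[of _ "(\<ominus>\<^bsub>M\<^esub> fst x, \<ominus>\<^bsub>N\<^esub> snd x)"])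
      (auto simp: dsum_module_def M.l_neg N.l_neg)
  qed (auto simp: dsum_module_def M.a_ac N.a_ac)
 qed (auto simp: dsum_module_def M.smult_l_distr N.smult_l_distr M.smult_r_distr N.smult_r_distr
   M.smult_assoc1 N.smult_assoc1 intro: M.is_cring)
qed

lemma module_base_change:
 assumes M: "Module.module real_ring M"
 shows "Module.module dual_ring (base_change M)"
proof -
 interpret M: Module.module real_ring M by (rule M)
 have [simp]: "carrier real_ring = UNIV" "\<And>x y. x \<oplus>\<^bsub>real_ring\<^esub> y = x + y"
  "\<And>x y. x \<otimes>\<^bsub>real_ring\<^esub> y = x * y" "\<one>\<^bsub>real_ring\<^esub> = 1"
  by (auto simp: real_ring_def)
 have l: "(r + s) \<odot>\<^bsub>M\<^esub> x = r \<odot>\<^bsub>M\<^esub> x \<oplus>\<^bsub>M\<^esub> s \<odot>\<^bsub>M\<^esub> x" if "x \<in> carrier M" for r s x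
  using M.smult_l_distr[of r s x] that by simp
 have a: "(r * s) \<odot>\<^bsub>M\<^esub> x = r \<odot>\<^bsub>M\<^esub> (s \<odot>\<^bsub>M\<^esub> x)" if "x \<in> carrier M" for r s x
  using M.smult_assoc1[of r s x] that by simp
 have c: "r \<odot>\<^bsub>M\<^esub> x \<in> carrier M" if "x \<in> carrier M" for r x using M.smult_closed[of r x] that by simp
 have d: "r \<odot>\<^bsub>M\<^esub> (x \<oplus>\<^bsub>M\<^esub> y) = r \<odot>\<^bsub>M\<^esub> x \<oplus>\<^bsub>M\<^esub> r \<odot>\<^bsub>M\<^esub> y" if "x \<in> carrier M" "y \<in> carrier M" for r x y
  using M.smult_r_distr[of r x y] that by simp
 have o: "1 \<odot>\<^bsub>M\<^esub> x = x" if "x \<in> carrier M" for x using M.smult_one[of x] that by simp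
 have z: "0 \<odot>\<^bsub>M\<^esub> x = \<zero>\<^bsub>M\<^esub>" if "x \<in> carrier M" for x
  using M.smult_l_null[of x] that by (simp add: real_ring_def)
 show ?thesis
 proof (rule moduleI)
  show "abelian_group (base_change M)"
  proof (rule abelian_groupI)
   fix x assume "x \<in> carrier (base_change M)"
   then show "\<exists>y\<in>carrier (base_change M). y \<oplus>\<^bsub>base_change M\<^esub> x = \<zero>\<^bsub>base_change M\<^esub>"
    by (intro bexI[of _ "(\<ominus>\<^bsub>M\<^esub> fst x, \<ominus>\<^bsub>M\<^esub> snd x)"])
      (auto simp: base_change_def M.l_neg)
  qed (auto simp: base_change_def M.a_ac)
 qed (auto simp: base_change_def dual_ring_def cring_dual_ring[unfolded dual_ring_def] l a c d o z
   M.a_ac)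
qed

lemma module_restrict_scalars:
 assumes M: "Module.module R M" and S: "cring S" and h: "h \<in> ring_hom S R"
 shows "Module.module S (restrict_scalars h M)"
proof -
 interpret M: Module.module R M by (rule M)
 have hc: "r \<in> carrier S ==> h r \<in> carrier R" for r using h by (auto simp: ring_hom_def)
 show ?thesis
 proof (rule moduleI[OF S])
  show "abelian_group (restrict_scalars h M)"
  proof (rule abelian_groupI)
   fix x assume "x \<in> carrier (restrict_scalars h M)"
   then show "\<exists>y\<in>carrier (restrict_scalars h M).
     y \<oplus>\<^bsub>restrict_scalars h M\<^esub> x = \<zero>\<^bsub>restrict_scalars h M\<^esub>"
    by (intro bexI[of _ "\<ominus>\<^bsub>M\<^esub> x"]) (auto simp: restrict_scalars_def M.l_neg)
  qed (auto simp: restrict_scalars_def M.a_ac)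
 qed (auto simp: restrict_scalars_def hc ring_hom_add[OF h] ring_hom_mult[OF h] ring_hom_one[OF h]
   M.smult_l_distr M.smult_r_distr M.smult_assoc1)
qed

lemma real_to_dual_hom: "(%r. (r, 0)) \<in> ring_hom real_ring dual_ring"
 and dual_to_real_hom: "fst \<in> ring_hom dual_ring real_ring"
 by (auto simp: ring_hom_def real_ring_def dual_ring_def)

definition is_submodule :: "'r ring => ('r, 'a) module => 'a set => bool" where
 "is_submodule R M Z \<longleftrightarrow> Z \<subseteq> carrier M \<and> \<zero>\<^bsub>M\<^esub> \<in> Z \<and> (\<forall>x\<in>Z. \<forall>y\<in>Z. x \<oplus>\<^bsub>M\<^esub> y \<in> Z) \<and>
   (\<forall>r\<in>carrier R. \<forall>x\<in>Z. r \<odot>\<^bsub>M\<^esub> x \<in> Z)"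

lemma is_submodule_neg:
 assumes "Module.module R M" "is_submodule R M Z" "x \<in> Z" shows "\<ominus>\<^bsub>M\<^esub> x \<in> Z"
proof -
 interpret M: Module.module R M by (rule assms)
 have "x \<in> carrier M" using assms by (auto simp: is_submodule_def)
 then have "\<ominus>\<^bsub>M\<^esub> x = (\<ominus>\<^bsub>R\<^esub> \<one>\<^bsub>R\<^esub>) \<odot>\<^bsub>M\<^esub> x" by (simp add: M.smult_l_minus)
 then show ?thesis using assms by (auto simp: is_submodule_def)
qed

lemma module_restrict_carrier:
 assumes M: "Module.module R M" and Z: "is_submodule R M Z"
 shows "Module.module R (M\<lparr>carrier := Z\<rparr>)"
proof -
 interpret M: Module.module R M by (rule M)
 have sub: "x \<in> Z ==> x \<in> carrier M" for x using Z by (auto simp: is_submodule_def)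
 show ?thesis
 proof (rule moduleI)
  show "abelian_group (M\<lparr>carrier := Z\<rparr>)"
  proof (rule abelian_groupI)
   fix x assume x: "x \<in> carrier (M\<lparr>carrier := Z\<rparr>)"
   then show "\<exists>y\<in>carrier (M\<lparr>carrier := Z\<rparr>). y \<oplus>\<^bsub>M\<lparr>carrier := Z\<rparr>\<^esub> x = \<zero>\<^bsub>M\<lparr>carrier := Z\<rparr>\<^esub>"
    using is_submodule_neg[OF M Z] by (intro bexI[of _ "\<ominus>\<^bsub>M\<^esub> x"]) (auto simp: M.l_neg sub)
  qed (use Z sub in "auto simp: is_submodule_def M.a_ac")
 qed (use Z sub in "auto simp: is_submodule_def M.smult_l_distr M.smult_r_distr M.smult_assoc1
   intro: M.is_cring")
qed

locale submodule_quotient =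
 fixes R :: "'r ring" and M :: "('r, 'a) module" and N :: "'a set"
 assumes module: "Module.module R M" and sub: "is_submodule R M N"
begin

sublocale M: Module.module R M by (rule module)

lemma abelian_subgroup: "abelian_subgroup N M"
proof (rule abelian_subgroupI3[OF additive_subgroupI M.abelian_group_axioms])
 show "subgroup N (add_monoid M)"
  using sub is_submodule_neg[OF module sub]
  by (auto intro!: group.subgroupI M.a_group simp: is_submodule_def a_inv_def[symmetric])
qed

sublocale N: abelian_subgroup N M by (rule abelian_subgroup)

abbreviation cl :: "'a => 'a set" where "cl x == N +>\<^bsub>M\<^esub> x"

lemma cl_eq_iff: "x \<in> carrier M ==> y \<in> carrier M ==> cl x = cl y \<longleftrightarrow> x \<ominus>\<^bsub>M\<^esub> y \<in> N"
 using N.a_rcos_module[of y x] N.a_repr_independence'[of x y] N.a_rcos_self[of x]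
 by (auto simp: a_minus_def)

lemma cl_add: "x \<in> carrier M ==> y \<in> carrier M ==> set_add M (cl x) (cl y) = cl (x \<oplus>\<^bsub>M\<^esub> y)"
 by (rule N.a_rcos_sum)

lemma cl_smult:
 assumes r: "r \<in> carrier R" and x: "x \<in> carrier M"
 shows "(\<Union>a\<in>cl x. cl (r \<odot>\<^bsub>M\<^esub> a)) = cl (r \<odot>\<^bsub>M\<^esub> x)"
proof -
 have "cl (r \<odot>\<^bsub>M\<^esub> a) = cl (r \<odot>\<^bsub>M\<^esub> x)" if a: "a \<in> cl x" for a
 proof -
  have ac: "a \<in> carrier M" using N.a_elemrcos_carrier[OF x a] .
  have "cl a = cl x" using N.a_repr_independence'[OF a x] by simp
  then have "a \<ominus>\<^bsub>M\<^esub> x \<in> N" using cl_eq_iff[OF ac x] by simp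
  then have "r \<odot>\<^bsub>M\<^esub> (a \<ominus>\<^bsub>M\<^esub> x) \<in> N" using sub r by (auto simp: is_submodule_def)
  moreover have "r \<odot>\<^bsub>M\<^esub> (a \<ominus>\<^bsub>M\<^esub> x) = r \<odot>\<^bsub>M\<^esub> a \<ominus>\<^bsub>M\<^esub> r \<odot>\<^bsub>M\<^esub> x"
   using r ac x by (simp add: a_minus_def M.smult_r_distr M.smult_r_minus)
  ultimately show ?thesis using cl_eq_iff r ac x by simp
 qed
 moreover have "x \<in> cl x" using N.a_rcos_self[OF x] .
 ultimately show ?thesis by blast
qed

lemma quotient_carrier: "carrier (quotient_module M N) = cl ` carrier M"
 by (auto simp: quotient_module_def A_RCOSETS_def')

lemma quotient_ops:
 "x \<in> carrier M ==> y \<in> carrier M ==> cl x \<oplus>\<^bsub>quotient_module M N\<^esub> cl y = cl (x \<oplus>\<^bsub>M\<^esub> y)"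
 "r \<in> carrier R ==> x \<in> carrier M ==> r \<odot>\<^bsub>quotient_module M N\<^esub> cl x = cl (r \<odot>\<^bsub>M\<^esub> x)"
 "\<zero>\<^bsub>quotient_module M N\<^esub> = cl \<zero>\<^bsub>M\<^esub>"
 using cl_add cl_smult N.a_rcos_const[of "\<zero>\<^bsub>M\<^esub>"] sub
 by (auto simp: quotient_module_def is_submodule_def N.a_subset)

lemma cl_zero_iff: "x \<in> carrier M ==> cl x = \<zero>\<^bsub>quotient_module M N\<^esub> \<longleftrightarrow> x \<in> N"
proof -
 have "\<ominus>\<^bsub>M\<^esub> \<zero>\<^bsub>M\<^esub> = \<zero>\<^bsub>M\<^esub>" using M.r_neg[of "\<zero>\<^bsub>M\<^esub>"] M.l_zero[of "\<ominus>\<^bsub>M\<^esub> \<zero>\<^bsub>M\<^esub>"] by simp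
 then have "x \<ominus>\<^bsub>M\<^esub> \<zero>\<^bsub>M\<^esub> = x" if "x \<in> carrier M" using that M.r_zero[OF that] unfolding a_minus_def by metis
 then show "x \<in> carrier M ==> cl x = \<zero>\<^bsub>quotient_module M N\<^esub> \<longleftrightarrow> x \<in> N"
  unfolding quotient_ops(3) using cl_eq_iff[of x "\<zero>\<^bsub>M\<^esub>"] by (metis M.zero_closed)
qed

lemma module_quotient: "Module.module R (quotient_module M N)"
proof (rule moduleI)
 show "cring R" by (rule M.is_cring)
 show "abelian_group (quotient_module M N)"
 proof (rule abelian_groupI)
  fix X assume "X \<in> carrier (quotient_module M N)"
  then obtain x where x: "x \<in> carrier M" "X = cl x" by (auto simp: quotient_carrier)
  then show "\<exists>Y\<in>carrier (quotient_module M N). Y \<oplus>\<^bsub>quotient_module M N\<^esub> X = \<zero>\<^bsub>quotient_module M N\<^esub>"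
   by (intro bexI[of _ "cl (\<ominus>\<^bsub>M\<^esub> x)"]) (auto simp: quotient_carrier quotient_ops M.l_neg)
 qed (auto simp: quotient_carrier quotient_ops M.a_ac)
qed (auto simp: quotient_carrier quotient_ops M.smult_l_distr M.smult_r_distr M.smult_assoc1)

text \<open>
 The first isomorphism theorem, for a map that is linear over a ring \<open>S\<close> which acts on \<open>M\<close>
 through \<open>h\<close>.
\<close>

lemma first_isomorphism:
 assumes S: "cring S" and h: "h \<in> ring_hom S R" and Q: "Module.module S Q"
  and q: "\<And>x. x \<in> carrier M ==> q x \<in> carrier Q"
   "\<And>x y. x \<in> carrier M ==> y \<in> carrier M ==> q (x \<oplus>\<^bsub>M\<^esub> y) = q x \<oplus>\<^bsub>Q\<^esub> q y"
   "\<And>r x. r \<in> carrier S ==> x \<in> carrier M ==> q (h r \<odot>\<^bsub>M\<^esub> x) = r \<odot>\<^bsub>Q\<^esub> q x"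
  and surj: "\<And>y. y \<in> carrier Q ==> \<exists>x\<in>carrier M. q x = y"
  and ker: "\<And>x. x \<in> carrier M ==> q x = \<zero>\<^bsub>Q\<^esub> \<longleftrightarrow> x \<in> N"
 shows "module_isomorphic S (restrict_scalars h (quotient_module M N)) Q"
proof -
 interpret Q: Module.module S Q by (rule Q)
 have hc: "r \<in> carrier S ==> h r \<in> carrier R" for r using h by (auto simp: ring_hom_def)
 have eq: "q x = q y \<longleftrightarrow> cl x = cl y" if x: "x \<in> carrier M" and y: "y \<in> carrier M" for x y
 proof -
  have "q x = q ((x \<ominus>\<^bsub>M\<^esub> y) \<oplus>\<^bsub>M\<^esub> y)" using x y by (simp add: a_minus_def M.a_assoc M.l_neg)
  then have "q x = q (x \<ominus>\<^bsub>M\<^esub> y) \<oplus>\<^bsub>Q\<^esub> q y" using x y q(2) by simp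
  then have "q x = q y \<longleftrightarrow> q (x \<ominus>\<^bsub>M\<^esub> y) = \<zero>\<^bsub>Q\<^esub>"
   using x y q(1) by (metis M.minus_closed Q.add.l_cancel_one Q.l_zero Q.add.right_cancel Q.zero_closed)
  then show ?thesis using ker x y cl_eq_iff by simp
 qed
 define f where "f X = q (SOME x. x \<in> carrier M \<and> cl x = X)" for X
 have f: "f (cl x) = q x" if x: "x \<in> carrier M" for x
 proof -
  have "(SOME y. y \<in> carrier M \<and> cl y = cl x) \<in> carrier M \<and> cl (SOME y. y \<in> carrier M \<and> cl y = cl x) = cl x"
   by (rule someI[of _ x]) (use x in auto)
  then show ?thesis unfolding f_def using eq x by blast
 qed
 show ?thesis unfolding module_isomorphic_def
 proof (intro conjI exI[of _ f] ballI)
  show "Module.module S (restrict_scalars h (quotient_module M N))"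
   by (rule module_restrict_scalars[OF module_quotient S h])
  show "Module.module S Q" by (rule Q)
  have "inj_on f (cl ` carrier M)" by (rule inj_onI) (auto simp: f eq)
  moreover have "f ` cl ` carrier M = carrier Q"
  proof
   show "f ` cl ` carrier M \<subseteq> carrier Q" using q(1) by (auto simp: f)
   show "carrier Q \<subseteq> f ` cl ` carrier M"
   proof
    fix y assume "y \<in> carrier Q"
    then obtain x where "x \<in> carrier M" "q x = y" using surj by blast
    then show "y \<in> f ` cl ` carrier M" using f[of x] by (metis image_eqI)
   qed
  qed
  ultimately show "bij_betw f (carrier (restrict_scalars h (quotient_module M N))) (carrier Q)"
   by (simp add: bij_betw_def restrict_scalars_def quotient_carrier)
 next
  fix X Y assume "X \<in> carrier (restrict_scalars h (quotient_module M N))"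
   "Y \<in> carrier (restrict_scalars h (quotient_module M N))"
  then show "f (X \<oplus>\<^bsub>restrict_scalars h (quotient_module M N)\<^esub> Y) = f X \<oplus>\<^bsub>Q\<^esub> f Y"
   by (auto simp: restrict_scalars_def quotient_carrier quotient_ops f q)
 next
  fix r X assume "r \<in> carrier S" "X \<in> carrier (restrict_scalars h (quotient_module M N))"
  then show "f (r \<odot>\<^bsub>restrict_scalars h (quotient_module M N)\<^esub> X) = r \<odot>\<^bsub>Q\<^esub> f X"
   by (auto simp: restrict_scalars_def quotient_carrier quotient_ops f q hc)
 qed
qed

end

subsection \<open>Cochain complexes\<close>

locale cochain_complex =
 fixes R :: "'r ring" and C :: "nat => ('r, 'a) module" and d :: "nat => 'a => 'a"
 assumes module_C: "\<And>k. Module.module R (C k)"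
  and d_closed: "\<And>k x. x \<in> carrier (C k) ==> d k x \<in> carrier (C (Suc k))"
  and d_add: "\<And>k x y. x \<in> carrier (C k) ==> y \<in> carrier (C k) ==>
   d k (x \<oplus>\<^bsub>C k\<^esub> y) = d k x \<oplus>\<^bsub>C (Suc k)\<^esub> d k y"
  and d_smult: "\<And>k r x. r \<in> carrier R ==> x \<in> carrier (C k) ==>
   d k (r \<odot>\<^bsub>C k\<^esub> x) = r \<odot>\<^bsub>C (Suc k)\<^esub> d k x"
  and d_d: "\<And>k x. x \<in> carrier (C k) ==> d (Suc k) (d k x) = \<zero>\<^bsub>C (Suc (Suc k))\<^esub>"
begin

sublocale C: Module.module R "C k" for k by (rule module_C)

lemma d_zero: "d k \<zero>\<^bsub>C k\<^esub> = \<zero>\<^bsub>C (Suc k)\<^esub>"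
 using d_smult[of "\<zero>\<^bsub>R\<^esub>" "\<zero>\<^bsub>C k\<^esub>" k] d_closed[of "\<zero>\<^bsub>C k\<^esub>" k]
 by (simp add: C.smult_l_null)

lemma cocycles_submodule: "is_submodule R (C k) (cocycles C d k)"
 by (auto simp: is_submodule_def cocycles_def d_zero d_add d_smult C.smult_r_null)

lemma coboundaries_submodule: "is_submodule R ((C k)\<lparr>carrier := cocycles C d k\<rparr>) (coboundaries C d k)"
proof (cases k)
 case 0
 then show ?thesis
  by (auto simp: is_submodule_def coboundaries_def cocycles_def d_zero C.smult_r_null)
next
 case (Suc j)
 have "x \<oplus>\<^bsub>C (Suc j)\<^esub> y \<in> d j ` carrier (C j)" if "x \<in> d j ` carrier (C j)" "y \<in> d j ` carrier (C j)" for x y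
  using that by (auto simp flip: d_add)
 moreover have "r \<odot>\<^bsub>C (Suc j)\<^esub> x \<in> d j ` carrier (C j)" if "r \<in> carrier R" "x \<in> d j ` carrier (C j)" for r x
  using that by (auto simp flip: d_smult)
 moreover have "\<zero>\<^bsub>C (Suc j)\<^esub> \<in> d j ` carrier (C j)" using d_zero[of j] by (metis C.zero_closed image_eqI)
 ultimately show ?thesis
  using Suc by (auto simp: is_submodule_def coboundaries_def cocycles_def d_closed d_d)
qed

sublocale H: submodule_quotient R "(C k)\<lparr>carrier := cocycles C d k\<rparr>" "coboundaries C d k" for k
 by (rule submodule_quotient.intro[OF module_restrict_carrier[OF module_C cocycles_submodule]
    coboundaries_submodule])

definition cls :: "nat => 'a => 'a set" where
 "cls k x = coboundaries C d k +>\<^bsub>(C k)\<lparr>carrier := cocycles C d k\<rparr>\<^esub> x"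

lemma module_cohomology: "Module.module R (cohomology C d k)"
 unfolding cohomology_def by (rule H.module_quotient)

lemma cohomology_carrier: "carrier (cohomology C d k) = cls k ` cocycles C d k"
 unfolding cohomology_def H.quotient_carrier cls_def by simp

lemma cls_ops:
 "x \<in> cocycles C d k ==> y \<in> cocycles C d k ==>
  cls k (x \<oplus>\<^bsub>C k\<^esub> y) = cls k x \<oplus>\<^bsub>cohomology C d k\<^esub> cls k y"
 "r \<in> carrier R ==> x \<in> cocycles C d k ==> cls k (r \<odot>\<^bsub>C k\<^esub> x) = r \<odot>\<^bsub>cohomology C d k\<^esub> cls k x"
 unfolding cohomology_def cls_def using H.quotient_ops(1)[of x k y] H.quotient_ops(2)[of r x k] by auto

lemma cls_zero_iff:
 "x \<in> cocycles C d k ==> cls k x = \<zero>\<^bsub>cohomology C d k\<^esub> \<longleftrightarrow> x \<in> coboundaries C d k"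
 unfolding cohomology_def cls_def using H.cl_zero_iff[of x k] by simp

end

lemma cochain_complex_eps_part:
 assumes "cochain_complex real_ring G d" and zero: "\<And>k. \<zero>\<^bsub>G (Suc k)\<^esub> = \<zero>\<^bsub>G k\<^esub>"
 shows "cochain_complex real_ring (%j. eps_part (G j)) (%k. apsnd (d k))"
proof -
 interpret G: cochain_complex real_ring G d by (rule assms(1))
 have b: "Module.module real_ring (restrict_scalars (%r. (r, 0)) (base_change (G k)))" for k
  by (rule module_restrict_scalars[OF module_base_change[OF G.module_C] cring_real_ring real_to_dual_hom])
 have [simp]: "carrier real_ring = UNIV" by (simp add: real_ring_def)
 have z: "0 \<odot>\<^bsub>G k\<^esub> x = \<zero>\<^bsub>G k\<^esub>" if "x \<in> carrier (G k)" for k x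
  using G.C.smult_l_null[OF that] by (simp add: real_ring_def)
 have zz: "r \<odot>\<^bsub>G k\<^esub> \<zero>\<^bsub>G k\<^esub> = \<zero>\<^bsub>G k\<^esub>" for r k using G.C.smult_r_null[of r] by simp
 have c: "r \<odot>\<^bsub>G k\<^esub> x \<in> carrier (G k)" if "x \<in> carrier (G k)" for r k x using G.C.smult_closed[of r x] that by simp
 have "is_submodule real_ring (restrict_scalars (%r. (r, 0)) (base_change (G k))) ({\<zero>\<^bsub>G k\<^esub>} \<times> carrier (G k))" for k
  by (auto simp: is_submodule_def restrict_scalars_def base_change_def z zz c)
 then have m: "Module.module real_ring (eps_part (G k))" for k
  unfolding eps_part_def by (rule module_restrict_carrier[OF b])
 have e: "carrier (eps_part (G k)) = {\<zero>\<^bsub>G k\<^esub>} \<times> carrier (G k)"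
  "\<zero>\<^bsub>eps_part (G k)\<^esub> = (\<zero>\<^bsub>G k\<^esub>, \<zero>\<^bsub>G k\<^esub>)"
  "(m, x) \<oplus>\<^bsub>eps_part (G k)\<^esub> (m', x') = (m \<oplus>\<^bsub>G k\<^esub> m', x \<oplus>\<^bsub>G k\<^esub> x')"
  "r \<odot>\<^bsub>eps_part (G k)\<^esub> (m, x) = (r \<odot>\<^bsub>G k\<^esub> m, (r \<odot>\<^bsub>G k\<^esub> x) \<oplus>\<^bsub>G k\<^esub> (0 \<odot>\<^bsub>G k\<^esub> m))"
  for k m x m' x' r
  by (simp_all add: eps_part_def restrict_scalars_def base_change_def)
 have ds: "d k (r \<odot>\<^bsub>G k\<^esub> x) = r \<odot>\<^bsub>G (Suc k)\<^esub> d k x" if "x \<in> carrier (G k)" for k r x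
  using G.d_smult[of r x k] that by simp
 have za: "\<zero>\<^bsub>G k\<^esub> \<oplus>\<^bsub>G (Suc k)\<^esub> \<zero>\<^bsub>G k\<^esub> = \<zero>\<^bsub>G k\<^esub>" for k
  using G.C.l_zero[OF G.C.zero_closed[of "Suc k"]] unfolding zero .
 have zs: "r \<odot>\<^bsub>G (Suc k)\<^esub> \<zero>\<^bsub>G k\<^esub> = \<zero>\<^bsub>G k\<^esub>" for r k
  using zz[of "Suc k" r] unfolding zero .
 have zr: "x \<oplus>\<^bsub>G (Suc k)\<^esub> \<zero>\<^bsub>G k\<^esub> = x" if "x \<in> carrier (G (Suc k))" for x k
  using G.C.r_zero[OF that] unfolding zero .
 show ?thesis
 proof (rule cochain_complex.intro)
  fix k show "Module.module real_ring (eps_part (G k))" by (rule m)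
 next
  fix k x assume "x \<in> carrier (eps_part (G k))"
  then show "apsnd (d k) x \<in> carrier (eps_part (G (Suc k)))"
   by (cases x) (simp add: e zero G.d_closed)
 next
  fix k x y assume "x \<in> carrier (eps_part (G k))" "y \<in> carrier (eps_part (G k))"
  then show "apsnd (d k) (x \<oplus>\<^bsub>eps_part (G k)\<^esub> y) =
    apsnd (d k) x \<oplus>\<^bsub>eps_part (G (Suc k))\<^esub> apsnd (d k) y"
   by (cases x; cases y) (simp add: e zero za G.d_add)
 next
  fix k r x assume "x \<in> carrier (eps_part (G k))"
  then show "apsnd (d k) (r \<odot>\<^bsub>eps_part (G k)\<^esub> x) = r \<odot>\<^bsub>eps_part (G (Suc k))\<^esub> apsnd (d k) x"
   by (cases x) (auto simp: e zero zz zs zr c ds G.d_closed)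
 next
  fix k x assume "x \<in> carrier (eps_part (G k))"
  then show "apsnd (d (Suc k)) (apsnd (d k) x) = \<zero>\<^bsub>eps_part (G (Suc (Suc k)))\<^esub>"
   by (cases x) (auto simp add: e G.d_d zero)
 qed
qed

text \<open>
 If an automorphism of the coefficient module carries the differential \<open>D\<close> to the diagonal one, the
 classes of the three components identify the cohomology of \<open>D\<close>.
\<close>

theorem split_cohomology:
 fixes G :: "nat => (real, 'a) module" and E :: "nat => (real, 'b) module"
 defines "B == %k. dsum_module (base_change (G k)) (restrict_scalars fst (E k))"
 assumes G: "cochain_complex real_ring G d" and E: "cochain_complex real_ring E e"
  and zero: "\<And>k. \<zero>\<^bsub>G (Suc k)\<^esub> = \<zero>\<^bsub>G k\<^esub>"
  and D: "\<And>k z. z \<in> carrier (B k) ==> D k z \<in> carrier (B (Suc k))"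
  and Q: "\<And>k. bij_betw (Q k) (carrier (B k)) (carrier (B k))"
  and Q_add: "\<And>k z w. z \<in> carrier (B k) ==> w \<in> carrier (B k) ==>
   Q k (z \<oplus>\<^bsub>B k\<^esub> w) = Q k z \<oplus>\<^bsub>B k\<^esub> Q k w"
  and Q_smult: "\<And>k r z. z \<in> carrier (B k) ==> Q k (r \<odot>\<^bsub>B k\<^esub> z) = r \<odot>\<^bsub>B k\<^esub> Q k z"
  and Q_D: "\<And>k z. z \<in> carrier (B k) ==>
   Q (Suc k) (D k z) = (case Q k z of ((m, x), a) => ((d k m, d k x), e k a))"
 shows "module_isomorphic real_ring
   (restrict_scalars (%r. (r, 0)) (cohomology B D k))
   (dsum_module (cohomology (%j. eps_part (G j)) (%k. apsnd (d k)) k)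
    (dsum_module (cohomology E e k) (cohomology G d k)))"
  and "module_isomorphic dual_ring (cohomology B D k)
   (dsum_module (base_change (cohomology G d k)) (restrict_scalars fst (cohomology E e k)))"
proof -
 interpret G: cochain_complex real_ring G d by (rule G)
 interpret E: cochain_complex real_ring E e by (rule E)
 interpret G1: cochain_complex real_ring "%j. eps_part (G j)" "%k. apsnd (d k)"
  by (rule cochain_complex_eps_part[OF G zero])
 define \<Delta> where "\<Delta> k z = (case z of ((m, x), a) => ((d k m, d k x), e k a))" for k and z :: "('a \<times> 'a) \<times> 'b"
 have [simp]: "carrier real_ring = UNIV" "carrier dual_ring = UNIV" by (simp_all add: real_ring_def dual_ring_def)
 have B: "Module.module dual_ring (B k)" for k unfolding B_def
  by (intro module_dsum module_base_change module_restrict_scalars[OF _ cring_dual_ring dual_to_real_hom]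
    G.module_C E.module_C)
 have inB: "((m, x), a) \<in> carrier (B k) \<longleftrightarrow> m \<in> carrier (G k) \<and> x \<in> carrier (G k) \<and> a \<in> carrier (E k)" for m x a k
  by (auto simp: B_def dsum_module_def base_change_def restrict_scalars_def)
 have zB: "\<zero>\<^bsub>B k\<^esub> = ((\<zero>\<^bsub>G k\<^esub>, \<zero>\<^bsub>G k\<^esub>), \<zero>\<^bsub>E k\<^esub>)" for k
  by (simp add: B_def dsum_module_def base_change_def restrict_scalars_def)
 have addB: "((m, x), a) \<oplus>\<^bsub>B k\<^esub> ((m', x'), a') = ((m \<oplus>\<^bsub>G k\<^esub> m', x \<oplus>\<^bsub>G k\<^esub> x'), a \<oplus>\<^bsub>E k\<^esub> a')" for m x a m' x' a' k
  by (simp add: B_def dsum_module_def base_change_def restrict_scalars_def)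
 have smB: "(s, t) \<odot>\<^bsub>B k\<^esub> ((m, x), a) = ((s \<odot>\<^bsub>G k\<^esub> m, (s \<odot>\<^bsub>G k\<^esub> x) \<oplus>\<^bsub>G k\<^esub> (t \<odot>\<^bsub>G k\<^esub> m)), s \<odot>\<^bsub>E k\<^esub> a)" for m x a s t k
  by (simp add: B_def dsum_module_def base_change_def restrict_scalars_def)
 have cG: "r \<odot>\<^bsub>G k\<^esub> x \<in> carrier (G k)" if "x \<in> carrier (G k)" for r k x using G.C.smult_closed[of r x] that by simp
 have cE: "r \<odot>\<^bsub>E k\<^esub> x \<in> carrier (E k)" if "x \<in> carrier (E k)" for r k x using E.C.smult_closed[of r x] that by simp
 have Q_in: "Q k z \<in> carrier (B k)" if "z \<in> carrier (B k)" for k z using Q[of k] that by (auto simp: bij_betw_def)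
 have Q_inj: "z = w" if "Q k z = Q k w" "z \<in> carrier (B k)" "w \<in> carrier (B k)" for k z w
  using Q[of k] that by (auto simp: bij_betw_def inj_on_def)
 have Q_surj: "\<exists>z\<in>carrier (B k). Q k z = w" if "w \<in> carrier (B k)" for k w
  using Q[of k] that unfolding bij_betw_def by (metis imageE)
 interpret Bk: Module.module dual_ring "B k" for k by (rule B)
 have Q0: "Q k \<zero>\<^bsub>B k\<^esub> = \<zero>\<^bsub>B k\<^esub>" for k
  using Q_add[of "\<zero>\<^bsub>B k\<^esub>" k "\<zero>\<^bsub>B k\<^esub>"] Q_in[of "\<zero>\<^bsub>B k\<^esub>" k] by (simp add: Bk.add.l_cancel_one)
 have \<Delta>_in: "\<Delta> k z \<in> carrier (B (Suc k))" if "z \<in> carrier (B k)" for k z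
  using that by (cases z) (auto simp: \<Delta>_def inB G.d_closed E.d_closed)
 have \<Delta>_add: "\<Delta> k (z \<oplus>\<^bsub>B k\<^esub> w) = \<Delta> k z \<oplus>\<^bsub>B (Suc k)\<^esub> \<Delta> k w" if "z \<in> carrier (B k)" "w \<in> carrier (B k)" for k z w
  using that by (cases z; cases w) (auto simp: \<Delta>_def inB addB G.d_add E.d_add)
 have \<Delta>_smult: "\<Delta> k (r \<odot>\<^bsub>B k\<^esub> z) = r \<odot>\<^bsub>B (Suc k)\<^esub> \<Delta> k z" if "z \<in> carrier (B k)" for k r z
  using that by (cases z; cases r) (auto simp: \<Delta>_def inB smB cG cE G.d_add G.d_smult[simplified] E.d_smult[simplified])
 have QD: "Q (Suc k) (D k z) = \<Delta> k (Q k z)" if "z \<in> carrier (B k)" for k z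
  using Q_D[OF that] by (simp add: \<Delta>_def)
 interpret BD: cochain_complex dual_ring B D
 proof (rule cochain_complex.intro)
  fix k show "Module.module dual_ring (B k)" by (rule B)
 next
  fix k z assume "z \<in> carrier (B k)" then show "D k z \<in> carrier (B (Suc k))" by (rule D)
 next
  fix k z w assume z: "z \<in> carrier (B k)" and w: "w \<in> carrier (B k)"
  show "D k (z \<oplus>\<^bsub>B k\<^esub> w) = D k z \<oplus>\<^bsub>B (Suc k)\<^esub> D k w"
  proof (rule Q_inj[of "Suc k"])
   show "Q (Suc k) (D k (z \<oplus>\<^bsub>B k\<^esub> w)) = Q (Suc k) (D k z \<oplus>\<^bsub>B (Suc k)\<^esub> D k w)"
    using z w by (simp add: QD Q_add D \<Delta>_add Q_in)
  qed (use z w D in auto)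
 next
  fix k z r assume z: "z \<in> carrier (B k)"
  show "D k (r \<odot>\<^bsub>B k\<^esub> z) = r \<odot>\<^bsub>B (Suc k)\<^esub> D k z"
  proof (rule Q_inj[of "Suc k"])
   show "Q (Suc k) (D k (r \<odot>\<^bsub>B k\<^esub> z)) = Q (Suc k) (r \<odot>\<^bsub>B (Suc k)\<^esub> D k z)"
    using z by (simp add: QD Q_smult D \<Delta>_smult Q_in)
  qed (use z D in auto)
 next
  fix k z assume z: "z \<in> carrier (B k)"
  have "\<Delta> (Suc k) (\<Delta> k w) = \<zero>\<^bsub>B (Suc (Suc k))\<^esub>" if "w \<in> carrier (B k)" for w
   using that by (cases w) (auto simp: \<Delta>_def inB zB G.d_d E.d_d)
  then have "Q (Suc (Suc k)) (D (Suc k) (D k z)) = Q (Suc (Suc k)) \<zero>\<^bsub>B (Suc (Suc k))\<^esub>"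
   using z by (simp add: QD D Q_in Q0)
  then show "D (Suc k) (D k z) = \<zero>\<^bsub>B (Suc (Suc k))\<^esub>"
   by (rule Q_inj[of "Suc (Suc k)"]) (use z D in auto)
 qed
 define Z where "Z = cocycles B D k"
 have Z: "Z \<subseteq> carrier (B k)" by (auto simp: Z_def cocycles_def)
 have Z_iff: "z \<in> Z \<longleftrightarrow> (case Q k z of ((m, x), a) =>
   m \<in> cocycles G d k \<and> x \<in> cocycles G d k \<and> a \<in> cocycles E e k)" if z: "z \<in> carrier (B k)" for z
 proof -
  have "D k z = \<zero>\<^bsub>B (Suc k)\<^esub> \<longleftrightarrow> \<Delta> k (Q k z) = \<zero>\<^bsub>B (Suc k)\<^esub>"
   using QD[OF z] Q0[of "Suc k"] Q_inj[of "Suc k" "D k z" "\<zero>\<^bsub>B (Suc k)\<^esub>"] D[OF z] by auto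
  then show ?thesis using z Q_in[OF z]
   by (cases "Q k z") (auto simp: Z_def cocycles_def \<Delta>_def zB inB)
 qed
 have bd_iff: "z \<in> coboundaries B D k \<longleftrightarrow> (case Q k z of ((m, x), a) =>
   m \<in> coboundaries G d k \<and> x \<in> coboundaries G d k \<and> a \<in> coboundaries E e k)" if z: "z \<in> carrier (B k)" for z
 proof (cases k)
  case 0
  have "z = \<zero>\<^bsub>B k\<^esub> \<longleftrightarrow> Q k z = \<zero>\<^bsub>B k\<^esub>" using Q0[of k] Q_inj[of k z "\<zero>\<^bsub>B k\<^esub>"] z by auto
  then show ?thesis using 0 by (cases "Q k z") (auto simp: coboundaries_def zB)
 next
  case (Suc j)
  have "z \<in> D j ` carrier (B j) \<longleftrightarrow> (\<exists>w\<in>carrier (B j). Q k z = \<Delta> j w)"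
  proof
   assume "z \<in> D j ` carrier (B j)"
   then show "\<exists>w\<in>carrier (B j). Q k z = \<Delta> j w" using QD Q_in Suc by blast
  next
   assume "\<exists>w\<in>carrier (B j). Q k z = \<Delta> j w"
   then obtain w v where "w \<in> carrier (B j)" "Q k z = \<Delta> j w" "v \<in> carrier (B j)" "Q j v = w"
    using Q_surj by blast
   then have "z = D j v" using Q_inj[of k z "D j v"] QD[of v j] D[of v j] z Suc by simp
   then show "z \<in> D j ` carrier (B j)" using \<open>v \<in> carrier (B j)\<close> by blast
  qed
  also have "... \<longleftrightarrow> (case Q k z of ((m, x), a) =>
    m \<in> d j ` carrier (G j) \<and> x \<in> d j ` carrier (G j) \<and> a \<in> e j ` carrier (E j))"
  proof (cases "Q k z")
   case (Pair mx a)
   obtain m x where mx: "mx = (m, x)" by (cases mx)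
   have "(\<exists>w\<in>carrier (B j). ((m, x), a) = \<Delta> j w) \<longleftrightarrow>
     (\<exists>m0\<in>carrier (G j). \<exists>x0\<in>carrier (G j). \<exists>a0\<in>carrier (E j). m = d j m0 \<and> x = d j x0 \<and> a = e j a0)"
   proof
    assume "\<exists>w\<in>carrier (B j). ((m, x), a) = \<Delta> j w"
    then obtain m0 x0 a0 where "((m0, x0), a0) \<in> carrier (B j)" "((m, x), a) = \<Delta> j ((m0, x0), a0)"
     by (metis prod.exhaust)
    then show "\<exists>m0\<in>carrier (G j). \<exists>x0\<in>carrier (G j). \<exists>a0\<in>carrier (E j).
      m = d j m0 \<and> x = d j x0 \<and> a = e j a0"
     by (auto simp: \<Delta>_def inB)
   next
    assume "\<exists>m0\<in>carrier (G j). \<exists>x0\<in>carrier (G j). \<exists>a0\<in>carrier (E j).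
      m = d j m0 \<and> x = d j x0 \<and> a = e j a0"
    then obtain m0 x0 a0 where "((m0, x0), a0) \<in> carrier (B j)" "((m, x), a) = \<Delta> j ((m0, x0), a0)"
     by (auto simp: \<Delta>_def inB)
    then show "\<exists>w\<in>carrier (B j). ((m, x), a) = \<Delta> j w" by blast
   qed
   then show ?thesis using Pair mx by auto
  qed
  finally show ?thesis using Suc by (simp add: coboundaries_def)
 qed
 let ?M = "(B k)\<lparr>carrier := cocycles B D k\<rparr>"
 have cohB: "cohomology B D k = quotient_module ?M (coboundaries B D k)" by (simp add: cohomology_def)
 note addZ = BD.H.M.a_closed[of _ k, simplified]
 have Q_case: "\<exists>m x a. Q k z = ((m, x), a) \<and> m \<in> cocycles G d k \<and> x \<in> cocycles G d k \<and> a \<in> cocycles E e k \<and>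
   z \<in> carrier (B k)" if "z \<in> cocycles B D k" for z
  using that Z_iff[of z] Z by (cases "Q k z") (auto simp: Z_def)
 have lift: "\<exists>z\<in>cocycles B D k. Q k z = ((m, x), a)"
  if "m \<in> cocycles G d k" "x \<in> cocycles G d k" "a \<in> cocycles E e k" for m x a
 proof -
  have "((m, x), a) \<in> carrier (B k)" using that by (auto simp: inB cocycles_def)
  then obtain z where "z \<in> carrier (B k)" "Q k z = ((m, x), a)" using Q_surj by blast
  then show ?thesis using Z_iff[of z] that by (auto simp: Z_def)
 qed
 have tG: "r \<odot>\<^bsub>G k\<^esub> m \<in> cocycles G d k" if "m \<in> cocycles G d k" for r m
  using G.cocycles_submodule[of k] that by (auto simp: is_submodule_def)
 have eps_coc: "(\<zero>\<^bsub>G k\<^esub>, x) \<in> cocycles (%j. eps_part (G j)) (%k. apsnd (d k)) k" if "x \<in> cocycles G d k" for x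
  using that by (auto simp: cocycles_def eps_part_def restrict_scalars_def base_change_def zero)
 have eps_cob: "(\<zero>\<^bsub>G k\<^esub>, x) \<in> coboundaries (%j. eps_part (G j)) (%k. apsnd (d k)) k \<longleftrightarrow> x \<in> coboundaries G d k" for x
  by (cases k) (auto simp: coboundaries_def eps_part_def restrict_scalars_def base_change_def zero image_iff)
 show "module_isomorphic dual_ring (cohomology B D k)
   (dsum_module (base_change (cohomology G d k)) (restrict_scalars fst (cohomology E e k)))"
 proof -
  let ?P = "dsum_module (base_change (cohomology G d k)) (restrict_scalars fst (cohomology E e k))"
  have P: "Module.module dual_ring ?P"
   by (intro module_dsum module_base_change module_restrict_scalars[OF _ cring_dual_ring dual_to_real_hom]
     G.module_cohomology E.module_cohomology)
  define q where "q z = (case Q k z of ((m, x), a) => ((G.cls k m, G.cls k x), E.cls k a))" for z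
  have "module_isomorphic dual_ring (restrict_scalars id (quotient_module ?M (coboundaries B D k))) ?P"
  proof (rule BD.H.first_isomorphism[where h = id and q = q, OF cring_dual_ring _ P])
   show "id \<in> ring_hom dual_ring dual_ring" by (simp add: ring_hom_def)
  next
   fix z assume "z \<in> carrier ?M"
   then show "q z \<in> carrier ?P"
    using Q_case[of z] by (auto simp: q_def dsum_module_def base_change_def restrict_scalars_def
      G.cohomology_carrier E.cohomology_carrier)
  next
   fix z w assume "z \<in> carrier ?M" "w \<in> carrier ?M"
   then show "q (z \<oplus>\<^bsub>?M\<^esub> w) = q z \<oplus>\<^bsub>?P\<^esub> q w"
    using Q_case[of z] Q_case[of w]
    by (auto simp: q_def dsum_module_def base_change_def restrict_scalars_def Q_add addB
      G.cls_ops E.cls_ops)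
  next
   fix r z assume "z \<in> carrier ?M"
   then show "q (id r \<odot>\<^bsub>?M\<^esub> z) = r \<odot>\<^bsub>?P\<^esub> q z"
    using Q_case[of z]
    by (cases r) (auto simp: q_def dsum_module_def base_change_def restrict_scalars_def Q_smult smB tG
      G.cls_ops E.cls_ops)
  next
   fix y assume "y \<in> carrier ?P"
   then obtain m x a where "y = ((G.cls k m, G.cls k x), E.cls k a)" "m \<in> cocycles G d k"
    "x \<in> cocycles G d k" "a \<in> cocycles E e k"
    by (auto simp: dsum_module_def base_change_def restrict_scalars_def
      G.cohomology_carrier E.cohomology_carrier)
   then show "\<exists>z\<in>carrier ?M. q z = y"
    using lift[of m x a] by (auto simp: q_def intro!: bexI split: prod.splits)
  next
   fix z assume "z \<in> carrier ?M"
   then show "q z = \<zero>\<^bsub>?P\<^esub> \<longleftrightarrow> z \<in> coboundaries B D k"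
    using Q_case[of z] bd_iff[of z]
    by (auto simp: q_def dsum_module_def base_change_def restrict_scalars_def
      G.cls_zero_iff E.cls_zero_iff)
  qed
  moreover have "restrict_scalars id (quotient_module ?M (coboundaries B D k)) = cohomology B D k"
   by (simp add: cohB restrict_scalars_def quotient_module_def)
  ultimately show ?thesis by simp
 qed
 show "module_isomorphic real_ring
   (restrict_scalars (%r. (r, 0)) (cohomology B D k))
   (dsum_module (cohomology (%j. eps_part (G j)) (%k. apsnd (d k)) k)
    (dsum_module (cohomology E e k) (cohomology G d k)))"
 proof -
  let ?P = "dsum_module (cohomology (%j. eps_part (G j)) (%k. apsnd (d k)) k)
    (dsum_module (cohomology E e k) (cohomology G d k))"
  have P: "Module.module real_ring ?P"
   by (intro module_dsum G.module_cohomology E.module_cohomology G1.module_cohomology)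
  have eps_add: "(\<zero>\<^bsub>G k\<^esub>, x \<oplus>\<^bsub>G k\<^esub> y) = (\<zero>\<^bsub>G k\<^esub>, x) \<oplus>\<^bsub>eps_part (G k)\<^esub> (\<zero>\<^bsub>G k\<^esub>, y)" for x y
   by (simp add: eps_part_def restrict_scalars_def base_change_def)
  have eps_smult: "(\<zero>\<^bsub>G k\<^esub>, r \<odot>\<^bsub>G k\<^esub> x) = r \<odot>\<^bsub>eps_part (G k)\<^esub> (\<zero>\<^bsub>G k\<^esub>, x)" if "x \<in> carrier (G k)" for r x
   using G.C.smult_r_null[of r k] G.C.smult_l_null[of "\<zero>\<^bsub>G k\<^esub>" k] cG[OF that]
   by (simp add: eps_part_def restrict_scalars_def base_change_def real_ring_def)
  have eps_zero: "\<zero>\<^bsub>eps_part (G k)\<^esub> = (\<zero>\<^bsub>G k\<^esub>, \<zero>\<^bsub>G k\<^esub>)"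
   by (simp add: eps_part_def restrict_scalars_def base_change_def)
  define q where "q z = (case Q k z of ((m, x), a) => (G1.cls k (\<zero>\<^bsub>G k\<^esub>, x), (E.cls k a, G.cls k m)))" for z
  have coc_car: "x \<in> cocycles G d k ==> x \<in> carrier (G k)" for x by (simp add: cocycles_def)
  show ?thesis unfolding cohB
  proof (rule BD.H.first_isomorphism[where q = q, OF cring_real_ring real_to_dual_hom P])
   fix z assume "z \<in> carrier ?M"
   then show "q z \<in> carrier ?P"
    using Q_case[of z] by (auto simp: q_def dsum_module_def eps_coc
      G.cohomology_carrier E.cohomology_carrier G1.cohomology_carrier)
  next
   fix z w assume "z \<in> carrier ?M" "w \<in> carrier ?M"
   then show "q (z \<oplus>\<^bsub>?M\<^esub> w) = q z \<oplus>\<^bsub>?P\<^esub> q w"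
    using Q_case[of z] Q_case[of w]
    by (auto simp: q_def dsum_module_def Q_add addB G.cls_ops E.cls_ops G1.cls_ops eps_add eps_coc)
  next
   fix r z assume "z \<in> carrier ?M"
   then obtain m x a where z: "Q k z = ((m, x), a)" "m \<in> cocycles G d k" "x \<in> cocycles G d k"
    "a \<in> cocycles E e k" "z \<in> carrier (B k)" using Q_case[of z] by auto
   have "0 \<odot>\<^bsub>G k\<^esub> m = \<zero>\<^bsub>G k\<^esub>"
    using G.C.smult_l_null[OF coc_car[OF z(2)]] by (simp add: real_ring_def)
   then have "Q k ((r, 0) \<odot>\<^bsub>B k\<^esub> z) = ((r \<odot>\<^bsub>G k\<^esub> m, r \<odot>\<^bsub>G k\<^esub> x), r \<odot>\<^bsub>E k\<^esub> a)"
    using z cG[OF coc_car[OF z(3)]] by (simp add: Q_smult smB)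
   then show "q ((r, 0) \<odot>\<^bsub>?M\<^esub> z) = r \<odot>\<^bsub>?P\<^esub> q z"
    using z by (simp add: q_def dsum_module_def G.cls_ops E.cls_ops G1.cls_ops eps_smult coc_car eps_coc)
  next
   fix y assume "y \<in> carrier ?P"
   then obtain u a m where y: "y = (G1.cls k u, (E.cls k a, G.cls k m))" "a \<in> cocycles E e k"
    "m \<in> cocycles G d k" "u \<in> cocycles (%j. eps_part (G j)) (%k. apsnd (d k)) k"
    by (auto simp: dsum_module_def G.cohomology_carrier E.cohomology_carrier G1.cohomology_carrier)
   from y(4) obtain x where "u = (\<zero>\<^bsub>G k\<^esub>, x)" "x \<in> cocycles G d k"
    by (auto simp: cocycles_def eps_part_def restrict_scalars_def base_change_def)
   then show "\<exists>z\<in>carrier ?M. q z = y"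
    using lift[of m x a] y by (auto simp: q_def intro!: bexI split: prod.splits)
  next
   fix z assume "z \<in> carrier ?M"
   then show "q z = \<zero>\<^bsub>?P\<^esub> \<longleftrightarrow> z \<in> coboundaries B D k"
    using Q_case[of z] bd_iff[of z]
    by (auto simp: q_def dsum_module_def G.cls_zero_iff E.cls_zero_iff
      G1.cls_zero_iff[OF eps_coc] eps_cob)
  qed
 qed
qed

section \<open>Index tensors\<close>

text \<open>The infinitesimal action of a matrix on the components of a covariant tensor.\<close>

primrec act :: "(7 => 7 => real) => 7 list => (7 list => real) => real" where
 "act A [] t = 0"
| "act A (a # is) t = (\<Sigma> q. A a q * t (q # is)) + act A is (%js. t (a # js))"

lemma act_cong:
 "(\<And>js. length js = length is ==> t js = u js) ==> act A is t = act A is u"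
proof (induction "is" arbitrary: t u)
 case (Cons a "is")
 have "t (q # is) = u (q # is)" for q by (rule Cons.prems) simp
 moreover have "act A is (%js. t (a # js)) = act A is (%js. u (a # js))"
  by (rule Cons.IH) (simp add: Cons.prems)
 ultimately show ?case by simp
qed simp

lemma act_add: "act A is (%js. t js + u js) = act A is t + act A is u"
 by (induction "is" arbitrary: t u) (simp_all add: sum.distrib algebra_simps)

lemma act_cmult: "act A is (%js. r * t js) = r * act A is t"
 by (induction "is" arbitrary: t) (simp_all add: sum_distrib_left algebra_simps)

lemma act_zero: "act A is (%js. 0) = 0"
 using act_cmult[of A "is" 0] by simp

lemma act_diff: "act A is (%js. t js - u js) = act A is t - act A is u"
 using act_add[of A "is" t "%js. (- 1) * u js"] act_cmult[of A "is" "- 1" u] by simp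

lemma act_sum: "finite I ==> act A is (%js. \<Sum>x\<in>I. t x js) = (\<Sum>x\<in>I. act A is (t x))"
 by (induction I rule: finite_induct) (simp_all add: act_zero act_add)

lemma act_add_left: "act (%a q. A a q + B a q) is t = act A is t + act B is t"
 by (induction "is" arbitrary: t) (simp_all add: sum.distrib algebra_simps)

lemma act_cmult_left: "act (%a q. r * A a q) is t = r * act A is t"
 by (induction "is" arbitrary: t) (simp_all add: sum_distrib_left algebra_simps)

lemma act_zero_left: "act (%a q. 0) is t = 0"
 using act_cmult_left[of 0] by simp

lemma act_diff_left: "act (%a q. A a q - B a q) is t = act A is t - act B is t"
 using act_add_left[of A "%a q. (- 1) * B a q"] act_cmult_left[of "- 1" B] by simp

lemma act_sum_left: "finite I ==> act (%a q. \<Sum>x\<in>I. A x a q) is t = (\<Sum>x\<in>I. act (A x) is t)"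
 by (induction I rule: finite_induct) (simp_all add: act_zero_left act_add_left)

lemma act_append:
 "act A (xs @ ys) t = act A xs (%us. t (us @ ys)) + act A ys (%vs. t (xs @ vs))"
 by (induction xs arbitrary: t) simp_all

lemma act_update:
 "act A is t = (\<Sum>r<length is. \<Sigma> q. A (is ! r) q * t (is[r := q]))"
 by (induction "is" arbitrary: t) (simp_all add: sum.lessThan_Suc_shift del: sum.lessThan_Suc)

lemma act_commutator:
 "act A is (%js. act B js t) - act B is (%js. act A js t) =
  act (%a q. \<Sigma> p. A a p * B p q - B a p * A p q) is t"
proof (induction "is" arbitrary: t)
 case (Cons a "is")
 have e: "act A (a # is) (%js. act B js t) =
   (\<Sigma> p. (\<Sigma> q. A a q * B q p) * t (p # is)) + (\<Sigma> q. A a q * act B is (%js. t (q # js)))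
   + (\<Sigma> q. B a q * act A is (%js. t (q # js))) + act A is (%js. act B js (%ks. t (a # ks)))"
  for A B
 proof -
  have "(\<Sigma> q. A a q * (\<Sigma> p. B q p * t (p # is))) =
   (\<Sigma> p. (\<Sigma> q. A a q * B q p) * t (p # is))"
   unfolding sum_distrib_left sum_distrib_right by (subst sum.swap) (simp add: mult.assoc)
  then show ?thesis
   by (simp add: act_add act_sum act_cmult distrib_left sum.distrib)
 qed
 show ?case unfolding e using Cons.IH[of "%ks. t (a # ks)"]
  by (simp add: sum_subtractf left_diff_distrib)
qed simp

subsection \<open>Alternating functions of indices\<close>

lemma swap_alt_transpose:
 assumes "swap_alt n F" "length as + length bs + length cs + 2 = n"
 shows "F (as @ u # bs @ v # cs) = - F (as @ v # bs @ u # cs)"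
proof -
 have "F (as @ u # bs @ v # cs) = (- 1) ^ length bs * F (as @ bs @ u # v # cs)" for u v
  using swap_alt_move[OF assms(1), of as bs "v # cs"] assms(2) by simp
 moreover have "F ((as @ bs) @ u # v # cs) = - F ((as @ bs) @ v # u # cs)"
  by (rule swap_altD[OF assms(1)]) (use assms(2) in simp)
 ultimately show ?thesis by simp
qed

lemma swap_alt_repeat:
 assumes "swap_alt n F" "length as + length bs + length cs + 2 = n"
 shows "F (as @ u # bs @ u # cs) = 0"
 using swap_alt_transpose[OF assms, of u u] by simp

lemma swap_alt_not_distinct:
 assumes "swap_alt n F" "length L = n" "\<not> distinct L" shows "F L = 0"
proof -
 obtain xs ys zs y where "L = xs @ [y] @ ys @ [y] @ zs" using not_distinct_decomp[OF assms(3)] by blast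
 then show ?thesis using swap_alt_repeat[OF assms(1), of xs ys zs y] assms(2) by simp
qed

lemma swap_alt_perm:
 assumes F: "swap_alt n F"
 shows "length pre + length xs = n ==> mset xs = mset ys ==> \<bar>F (pre @ xs)\<bar> = \<bar>F (pre @ ys)\<bar>"
proof (induction xs arbitrary: ys pre)
 case (Cons a xs)
 then have "a \<in> set ys" by (metis list.set_intros(1) set_mset_mset)
 then obtain us vs where ys: "ys = us @ a # vs" using split_list by metis
 have m: "mset xs = mset (us @ vs)" using Cons.prems(2) ys by simp
 have l: "length xs = length us + length vs" using mset_eq_length[OF m] by simp
 have "\<bar>F ((pre @ [a]) @ xs)\<bar> = \<bar>F ((pre @ [a]) @ us @ vs)\<bar>"
  by (rule Cons.IH) (use Cons.prems m in auto)
 moreover have "F (pre @ a # us @ vs) = (- 1) ^ length us * F (pre @ us @ a # vs)"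
  by (rule swap_alt_move[OF F]) (use Cons.prems l in auto)
 ultimately show ?case by (simp add: ys abs_mult power_abs)
qed simp

text \<open>A skew matrix acts trivially on top degree forms, as its trace vanishes.\<close>

lemma act_top:
 assumes A: "skew A" and F: "swap_alt 7 F" and L: "length L = 7"
 shows "act A L F = 0"
proof (cases "distinct L")
 case True
 have "card (set L) = CARD(7)" using distinct_card[OF True] L by simp
 then have U: "set L = UNIV" by (intro card_subset_eq) auto
 have "A (L ! r) q * F (L[r := q]) = 0" if r: "r < 7" for r q
 proof (cases "q = L ! r")
  case False
  obtain s where s: "s < 7" "L ! s = q" using U L by (metis UNIV_I in_set_conv_nth)
  have "s \<noteq> r" using s False by auto
  then have "L[r := q] ! s = L[r := q] ! r" using r s L by simp
  then have "\<not> distinct (L[r := q])" using \<open>s \<noteq> r\<close> r s L by (metis length_list_update nth_eq_iff_index_eq)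
  then show ?thesis using swap_alt_not_distinct[OF F] L by simp
 qed (simp add: skew_diag[OF A])
 then show ?thesis unfolding act_update L by (intro sum.neutral ballI) simp
next
 case False
 obtain xs ys zs u where Lu: "L = xs @ u # ys @ u # zs" using not_distinct_decomp[OF False] by auto
 have len: "length xs + length ys + length zs + 2 = 7" using L Lu by simp
 have z: "F (us @ u # vs @ u # ws) = 0" if "length us + length vs + length ws + 2 = 7" for us vs ws
  using swap_alt_repeat[OF F that] .
 have t: "F (xs @ q # ys @ u # zs) = - F (xs @ u # ys @ q # zs)" for q
  by (rule swap_alt_transpose[OF F len])
 have 1: "act A xs (%us. F (us @ u # ys @ u # zs)) = 0"
  using act_cong[of xs "%us. F (us @ u # ys @ u # zs)" "%us. 0" A] z len by (simp add: act_zero)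
 have 2: "act A ys (%us. F (xs @ u # us @ u # zs)) = 0"
  using act_cong[of ys "%us. F (xs @ u # us @ u # zs)" "%us. 0" A] z len by (simp add: act_zero)
 have 3: "act A zs (%us. F (xs @ u # ys @ u # us)) = 0"
  using act_cong[of zs "%us. F (xs @ u # ys @ u # us)" "%us. 0" A] z len by (simp add: act_zero)
 have "A u q * F (xs @ q # ys @ u # zs) = - (A u q * F (xs @ u # ys @ q # zs))" for q
  unfolding t[of q] by simp
 then have "(\<Sigma> q. A u q * F (xs @ q # ys @ u # zs)) = - (\<Sigma> q. A u q * F (xs @ u # ys @ q # zs))"
  by (simp only: sum_negf)
 then show ?thesis by (simp add: Lu act_append 1 2 3)
qed

subsection \<open>Sums over lists of indices\<close>

lemma finite_lists: "finite {I :: 7 list. length I = n}"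
 using finite_lists_length_eq[of "UNIV :: 7 set" n] by simp

lemma sum_lists_0: "(\<Sum>I | length I = 0. h I) = h []"
 by simp

lemma sum_lists_Suc:
 fixes h :: "7 list => 'a::comm_monoid_add"
 shows "(\<Sum>I | length I = Suc n. h I) = (\<Sigma> i. \<Sum>I | length I = n. h (i # I))"
proof -
 have "(\<Sigma> i. \<Sum>I | length I = n. h (i # I)) =
   (\<Sum>(i, I)\<in>UNIV \<times> {I. length I = n}. h (i # I))"
  by (rule sum.cartesian_product)
 also have "... = (\<Sum>I | length I = Suc n. h I)"
  by (rule sum.reindex_bij_witness[where i = "%L. (hd L, tl L)" and j = "%(i, I). i # I"])
    (auto simp: length_Suc_conv)
 finally show ?thesis by simp
qed

lemma sum_lists_2:
 "(\<Sum>I | length I = 2. h I) = (\<Sigma> i j. h [i, j])" for h :: "7 list => real"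
 by (simp add: numeral_2_eq_2 sum_lists_Suc)

lemma sum_lists_3:
 "(\<Sum>I | length I = 3. h I) = (\<Sigma> i j k. h [i, j, k])" for h :: "7 list => real"
 by (simp add: numeral_3_eq_3 sum_lists_Suc)

text \<open>Skew matrices are skew-adjoint on tensors.\<close>

lemma act_adjoint:
 assumes B: "skew B"
 shows "(\<Sum>I | length I = n. act B I S * F I) = - (\<Sum>I | length I = n. S I * act B I F)"
proof (induction n arbitrary: S F)
 case (Suc n)
 have "(\<Sigma> i q. B i q * S (q # I) * F (i # I)) =
   - (\<Sigma> i q. S (i # I) * (B i q * F (q # I)))" for I
 proof -
  have "(\<Sigma> i q. B i q * S (q # I) * F (i # I)) =
    (\<Sigma> q i. - (S (q # I) * (B q i * F (i # I))))"
  proof (subst sum.swap, intro sum.cong refl)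
   fix i q show "B i q * S (q # I) * F (i # I) = - (S (q # I) * (B q i * F (i # I)))"
    using skewD[OF B, of i q] by simp
  qed
  then show ?thesis by (simp add: sum_negf)
 qed
 then have "(\<Sum>I | length I = n. \<Sigma> i q. B i q * S (q # I) * F (i # I)) =
   - (\<Sum>I | length I = n. \<Sigma> i q. S (i # I) * (B i q * F (q # I)))"
  by (simp add: sum_negf)
 then have 1: "(\<Sigma> i. \<Sum>I | length I = n. \<Sigma> q. B i q * S (q # I) * F (i # I)) =
   - (\<Sigma> i. \<Sum>I | length I = n. \<Sigma> q. S (i # I) * (B i q * F (q # I)))"
  by (subst (1 3) sum.swap)
 have 2: "(\<Sigma> i. \<Sum>I | length I = n. act B I (%J. S (i # J)) * F (i # I)) =
   - (\<Sigma> i. \<Sum>I | length I = n. S (i # I) * act B I (%J. F (i # J)))"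
  unfolding Suc.IH[of "%J. S (_ # J)"] by (simp add: sum_negf)
 show ?case using 1 2
  by (simp add: sum_lists_Suc sum.distrib distrib_left distrib_right sum_distrib_left sum_distrib_right)
qed simp

definition PL :: "7 list => real" where
 "PL L = P (L ! 0) (L ! 1) (L ! 2)"

lemma PL_simp [simp]: "PL [a, b, c] = P a b c"
 by (simp add: PL_def)

lemma stab_cyclic: "stab A b c a = stab A a b c"
 by (simp add: stab_def)

lemma stab_swap: "stab A b a c = - stab A a b c"
proof -
 have "P a c q = - P c a q" "P c b q = - P b c q" "P b a q = - P a b q" for q by (rule P_swap12)+
 then show ?thesis by (simp add: stab_def sum_negf)
qed

lemma act_PL: "act A [a, b, c] PL = stab A a b c"
proof -
 have "P q b c = P b c q" "P a q c = P c a q" for q using P_cyclic by metis+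
 then show ?thesis by (simp add: stab_def)
qed

lemma sum3_support:
 fixes f :: "7 => 7 => 7 => real"
 assumes d: "distinct [p, q, r]"
  and z: "\<And>i j k. \<not> (distinct [i, j, k] \<and> {i, j, k} \<subseteq> {p, q, r}) ==> f i j k = 0"
 shows "(\<Sigma> i j k. f i j k) =
  f p q r + f p r q + f q p r + f q r p + f r p q + f r q p"
proof -
 have s: "(\<Sigma> i. h i) = h p + h q + h r" if "\<And>i. i \<notin> {p, q, r} ==> h i = 0" for h :: "7 => real"
 proof -
  have "(\<Sigma> i. h i) = (\<Sum>i\<in>{p, q, r}. h i)"
   by (rule sum.mono_neutral_right) (use that in auto)
  then show ?thesis using d by simp
 qed
 have k: "(\<Sigma> k. f i j k) = f i j p + f i j q + f i j r" for i j by (rule s) (auto intro: z)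
 have j: "(\<Sigma> j. f i j x) = f i p x + f i q x + f i r x" for i x by (rule s) (auto intro: z)
 have i: "(\<Sigma> i. f i y x) = f p y x + f q y x + f r y x" for y x by (rule s) (auto intro: z)
 have z2: "f x x y = 0" "f x y x = 0" "f y x x = 0" for x y by (auto intro: z)
 show ?thesis by (simp add: k j i sum.distrib z2)
qed

text \<open>
 On the index level \<open>\<psi>\<close> is the three-form contracted into the volume form \<open>V\<close>. Differentiating it
 and antisymmetrising over the complement of \<open>p, q\<close> leaves the divergence of the three-form in the
 slots \<open>p, q\<close>: this is the identity \<open>d*\<phi> = \<plusminus> *\<delta>\<phi>\<close>.
\<close>

lemma coclosed_index:
 assumes A: "\<And>k. skew (A k)" and V: "swap_alt 7 V" and V0: "V [1, 2, 3, 4, 5, 6, 0] \<noteq> 0"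
  and cc: "\<And>as. length as = 5 ==> (\<Sum>r<5. (- 1) ^ r * act (A (as ! r)) (omit r as)
   (%js. \<Sum>I | length I = 3. PL I * V (I @ js))) = 0"
  and pq: "p \<noteq> q"
 shows "(\<Sigma> k. stab (A k) k p q) = 0"
proof -
 obtain as where as: "set as = UNIV - {p, q}" "distinct as"
  using finite_distinct_list[of "UNIV - {p, q}"] by auto
 have l: "length as = 5" using distinct_card[OF as(2)] as(1) pq by simp
 have V1: "V (p # q # as) \<noteq> 0"
 proof -
  have "distinct (p # q # as)" using as pq by auto
  moreover have "set (p # q # as) = set [1, 2, 3, 4, 5, 6, 0 :: 7]"
   using as(1) unfolding UNIV_7[symmetric] by (auto simp: UNIV_7[symmetric])
  ultimately have "mset (p # q # as) = mset [1, 2, 3, 4, 5, 6, 0]"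
   by (subst set_eq_iff_mset_eq_distinct[symmetric]) simp_all
  then have "\<bar>V ([] @ p # q # as)\<bar> = \<bar>V ([] @ [1, 2, 3, 4, 5, 6, 0])\<bar>"
   by (intro swap_alt_perm[OF V]) (use l in auto)
  then show ?thesis using V0 by auto
 qed
 have step1: "act B is (%js. \<Sum>I | length I = 3. PL I * V (I @ js)) =
   (\<Sum>I | length I = 3. act B I PL * V (I @ is))"
  if B: "skew B" and "length is = 4" for B "is"
 proof -
  have "act B is (%js. V (I @ js)) = - act B I (%J. V (J @ is))" if "length I = 3" for I
   using act_top[OF B V, of "I @ is"] that \<open>length is = 4\<close> by (simp add: act_append)
  then show ?thesis
   by (simp add: act_sum[OF finite_lists] act_cmult act_adjoint[OF B] sum_negf)
 qed
 have step2: "(\<Sum>I | length I = 3. act B I PL * V (I @ is)) = 6 * (stab B p q r * V (p # q # r # is))"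
  if r: "r \<notin> {p, q}" and "is": "length is = 4" "set is = UNIV - {p, q, r}" for B "is" r
 proof -
  have z: "V (i # j # k # is) = 0" if "\<not> (distinct [i, j, k] \<and> {i, j, k} \<subseteq> {p, q, r})" for i j k
   by (rule swap_alt_not_distinct[OF V]) (use that "is" in auto)
  have V12: "V (j # i # k # is) = - V (i # j # k # is)" for i j k
   using swap_altD[OF V, of "[]" "k # is" j i] "is" by simp
  have V23: "V (i # k # j # is) = - V (i # j # k # is)" for i j k
   using swap_altD[OF V, of "[i]" "is" k j] "is" by simp
  have S12: "stab B j i k = - stab B i j k" for i j k by (rule stab_swap)
  have S23: "stab B i k j = - stab B i j k" for i j k
   using stab_swap[of B k j i] stab_cyclic[of B i j k] stab_cyclic[of B i k j] stab_cyclic[of B k j i] stab_cyclic[of B j k i] by linarith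
  have "(\<Sum>I | length I = 3. act B I PL * V (I @ is)) =
    (\<Sigma> i j k. stab B i j k * V (i # j # k # is))"
   by (simp add: sum_lists_3 act_PL del: act.simps)
  also have "... = stab B p q r * V (p # q # r # is) + stab B p r q * V (p # r # q # is)
    + stab B q p r * V (q # p # r # is) + stab B q r p * V (q # r # p # is)
    + stab B r p q * V (r # p # q # is) + stab B r q p * V (r # q # p # is)"
   by (rule sum3_support) (use r pq z in auto)
  also have "... = 6 * (stab B p q r * V (p # q # r # is))"
   using V12[of q p r] V23[of p r q] V12[of r p q] V23[of q r p] V12[of r q p]
    S12[of q p r] S23[of p r q] S12[of r p q] S23[of q r p] S12[of r q p] by simp
  finally show ?thesis .
 qed
 have "6 * V (p # q # as) * (\<Sum>r<5. stab (A (as ! r)) p q (as ! r)) =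
   (\<Sum>r<5. (- 1) ^ r * act (A (as ! r)) (omit r as) (%js. \<Sum>I | length I = 3. PL I * V (I @ js)))"
  unfolding sum_distrib_left
 proof (rule sum.cong[OF refl])
  fix r :: nat assume "r \<in> {..<5}"
  then have r: "r < length as" using l by simp
  have dec: "as = take r as @ as ! r # drop (Suc r) as" using r by (rule id_take_nth_drop)
  have lo: "length (omit r as) = 4" using r l by (auto simp: omit_def)
  have so: "set (omit r as) = UNIV - {p, q, as ! r}"
  proof -
   have "set as = insert (as ! r) (set (omit r as))" by (subst dec) (simp add: omit_def)
   moreover have "as ! r \<notin> set (omit r as)"
    using as(2) by (subst (asm) dec) (auto simp: omit_def)
   ultimately show ?thesis using as(1) by auto
  qed
  have rn: "as ! r \<notin> {p, q}" using r as(1) nth_mem by blast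
  have "V ([p, q] @ as ! r # take r as @ drop (Suc r) as) =
    (- 1) ^ length (take r as) * V ([p, q] @ take r as @ as ! r # drop (Suc r) as)"
   by (rule swap_alt_move[OF V]) (use r l in auto)
  then have v: "V (p # q # as ! r # omit r as) = (- 1) ^ r * V (p # q # as)"
   using r dec[symmetric] by (simp add: omit_def)
  have e: "x * (6 * (y * (x * z))) = 6 * z * y" if "x * x = 1" for x y z :: real
  proof -
   have "x * (6 * (y * (x * z))) = (x * x) * (6 * z * y)" by (simp only: mult_ac)
   then show ?thesis by (simp add: that)
  qed
  have "(- 1) ^ r * (- 1) ^ r = (1 :: real)" by (simp flip: power_mult_distrib)
  note e = e[OF this]
  show "6 * V (p # q # as) * stab (A (as ! r)) p q (as ! r) = (- 1) ^ r * act (A (as ! r)) (omit r as)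
    (%js. \<Sum>I | length I = 3. PL I * V (I @ js))"
   unfolding step1[OF A lo] step2[OF rn lo so] v by (rule e[symmetric])
 qed
 then have "(\<Sum>r<5. stab (A (as ! r)) p q (as ! r)) = 0" using cc[OF l] V1 by simp
 moreover have "(\<Sum>r<5. stab (A (as ! r)) p q (as ! r)) = (\<Sum>k\<in>set as. stab (A k) p q k)"
  using sum.reindex_bij_betw[OF bij_betw_nth[OF as(2) refl refl], of "%k. stab (A k) p q k"] l by simp
 moreover have "(\<Sigma> k. stab (A k) p q k) = (\<Sum>k\<in>set as. stab (A k) p q k)"
 proof (rule sum.mono_neutral_right)
  have z: "stab B a a b = 0" for B a b using stab_swap[of B a a b] by simp
  have "stab B p q p = stab B p p q" "stab B p q q = stab B q q p" for B
   using stab_cyclic[of B p p q] stab_cyclic[of B q q p] stab_cyclic[of B p q q] stab_cyclic[of B q p p]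
   by linarith+
  then have "stab B p q p = 0" "stab B p q q = 0" for B by (simp_all add: z)
  then show "\<forall>k\<in>UNIV - set as. stab (A k) p q k = 0" using as(1) by auto
 qed auto
 ultimately have "(\<Sigma> k. stab (A k) p q k) = 0" by simp
 then show ?thesis by (simp add: stab_cyclic)
qed

section \<open>Orthonormal bases and adapted frames\<close>

lemma covector_wedge_3:
 "covector_wedge [t0, t1, t2] [v0, v1, v2] =
  (t0 \<bullet> v0) * ((t1 \<bullet> v1) * (t2 \<bullet> v2) - (t1 \<bullet> v2) * (t2 \<bullet> v1))
  - (t0 \<bullet> v1) * ((t1 \<bullet> v0) * (t2 \<bullet> v2) - (t1 \<bullet> v2) * (t2 \<bullet> v0))
  + (t0 \<bullet> v2) * ((t1 \<bullet> v0) * (t2 \<bullet> v1) - (t1 \<bullet> v1) * (t2 \<bullet> v0))"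
proof -
 have f: "{..<length [t0, t1, t2]} = {0, 1, 2 :: nat}" by auto
 have f123: "finite {1 :: nat, 2}" "0 \<notin> {1 :: nat, 2}" by auto
 have f23: "finite {2 :: nat}" "1 \<notin> {2 :: nat}" by auto
 show ?thesis
  unfolding covector_wedge_def f
  unfolding sum_over_permutations_insert[OF f123]
  unfolding sum_over_permutations_insert[OF f23]
  unfolding permutes_sing
  by (simp add: sign_swap_id permutation_swap_id sign_compose sign_id swap_id_eq numeral_2_eq_2
    lessThan_Suc algebra_simps transpose_def)
qed

lemma covector_wedge_cong:
 assumes "length ts = length ts'" "\<And>r s. r < length ts ==> s < length ts ==> ts ! r \<bullet> vs ! s = ts' ! r \<bullet> vs' ! s"
 shows "covector_wedge ts vs = covector_wedge ts' vs'"
 unfolding covector_wedge_def assms(1)[symmetric]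
proof (intro sum.cong refl arg_cong2[of _ _ _ _ "(*)"] prod.cong)
 fix \<pi> r assume "\<pi> \<in> {\<pi>. \<pi> permutes {..<length ts}}" "r \<in> {..<length ts}"
 then have "r < length ts" "\<pi> r < length ts" using permutes_in_image by fastforce+
 then show "ts ! r \<bullet> vs ! \<pi> r = ts' ! r \<bullet> vs' ! \<pi> r" by (rule assms(2))
qed

definition eps7 :: "7 list => real" where
 "eps7 L = covector_wedge (map (%i. axis i 1) [1, 2, 3, 4, 5, 6, 7]) (map (%i. axis i 1) L)"

lemma covector_wedge_dual:
 fixes L :: "7 list"
 assumes d: "distinct L"
 shows "covector_wedge (map (%i. axis i 1) L) (map (%i. axis i 1) L) = 1"
proof -
 let ?n = "length L"
 let ?t = "%\<pi>. of_int (sign \<pi>) * (\<Prod>r<?n. (axis (L ! r) 1 :: vec7) \<bullet> axis (L ! \<pi> r) 1)"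
 have in_n: "\<pi> r < ?n" if "\<pi> permutes {..<?n}" "r < ?n" for \<pi> r
  using that permutes_in_image by fastforce
 have z: "?t \<pi> = 0" if \<pi>: "\<pi> permutes {..<?n}" "\<pi> \<noteq> id" for \<pi>
 proof -
  obtain r where r: "\<pi> r \<noteq> r" using \<pi>(2) by (auto simp: fun_eq_iff)
  then have r7: "r < ?n" using \<pi>(1) by (metis lessThan_iff permutes_not_in)
  then have "L ! r \<noteq> L ! \<pi> r" using d r in_n[OF \<pi>(1)] by (simp add: nth_eq_iff_index_eq)
  then have "(axis (L ! r) 1 :: vec7) \<bullet> axis (L ! \<pi> r) 1 = 0" by (simp add: inner_axis_axis)
  then have "(\<Prod>r<?n. (axis (L ! r) 1 :: vec7) \<bullet> axis (L ! \<pi> r) 1) = 0" using r7 by (intro prod_zero) auto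
  then show ?thesis by simp
 qed
 have "covector_wedge (map (%i. axis i 1) L) (map (%i. axis i 1) L) = (\<Sum>\<pi> | \<pi> permutes {..<?n}. ?t \<pi>)"
  unfolding covector_wedge_def
  by (intro sum.cong arg_cong2[of _ _ _ _ "(*)"] refl prod.cong) (auto simp: in_n)
 also have "... = ?t id"
  by (rule trans[OF sum.mono_neutral_right[of _ "{id}"]])
    (auto simp: z permutes_id finite_permutations)
 also have "... = 1" by (simp add: sign_id inner_axis_axis)
 finally show ?thesis .
qed

lemma seven: "(7 :: 7) = 0" by simp

lemma eps7_1: "eps7 [1, 2, 3, 4, 5, 6, 0] = 1"
 using covector_wedge_dual[of "[1, 2, 3, 4, 5, 6, 0]"] by (simp add: eps7_def seven)

section \<open>Curvature tensors with values in \<open>\<Lambda>\<^sup>2\<^sub>1\<^sub>4\<close>\<close>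

text \<open>
 An algebraic curvature tensor whose two-form part lies in the stabiliser of the three-form; the
 component \<open>R i j a q\<close> is \<open>g(e\<^sub>q, R(e\<^sub>i, e\<^sub>j) e\<^sub>a)\<close>.
\<close>

locale g2_curvature =
 fixes R :: "7 => 7 => 7 => 7 => real"
 assumes R_skew: "\<And>i j. skew (R i j)"
  and R_swap: "\<And>i j a q. R j i a q = - R i j a q"
  and R_bianchi: "\<And>i j a q. R i j a q + R j a i q + R a i j q = 0"
  and R_stab: "\<And>i j a b c. stab (R i j) a b c = 0"
begin

lemma R_skew': "R i j q a = - R i j a q"
 using skewD[OF R_skew] .

lemma R_pair: "R i j a q = R a q i j"
 using R_bianchi[of i j a q] R_bianchi[of j a q i] R_bianchi[of a q i j] R_bianchi[of q i j a]
  R_skew'[of i j a q] R_skew'[of j a i q] R_skew'[of a i j q] R_skew'[of a q i j] R_skew'[of j q a i]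
  R_skew'[of i q a j] R_swap[of i j] R_swap[of j a] R_swap[of a i] R_swap[of a q] R_swap[of q i] R_swap[of q j]
 by (smt (verit))

lemma R_tau: "(\<Sigma> a b. P c a b * R i j a b) = 0"
 using stab_iff_tau[OF R_skew, of i j] R_stab by (simp add: tau_def)

lemma R_tau': "(\<Sigma> a b. P c a b * R a b i j) = 0"
 using R_tau[of c i j] by (simp add: R_pair[of i j])

text \<open>By the Bianchi identity only the skew part in the contracted pair counts, which is \<open>R_tau'\<close>.\<close>

lemma R_contract: "(\<Sigma> a b. P c a b * R k a b q) = 0"
proof -
 have "(\<Sigma> a b. P c a b * R k a b q) = (\<Sigma> a b. - (P c a b * R k b a q))"
 proof (subst sum.swap, intro sum.cong refl)
  fix a b show "P c b a * R k b a q = - (P c a b * R k b a q)" using P_swap23[of c a b] by simp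
 qed
 then have "2 * (\<Sigma> a b. P c a b * R k a b q) =
   (\<Sigma> a b. P c a b * R k a b q) + (\<Sigma> a b. - (P c a b * R k b a q))"
  by simp
 also have "... = (\<Sigma> a b. - (P c a b * R a b k q))"
  unfolding sum.distrib[symmetric]
 proof (intro sum.cong refl)
  fix a b
  have "R k a b q - R k b a q = - R a b k q" using R_bianchi[of k a b q] R_swap[of k b] by simp
  then have "P c a b * (R k a b q - R k b a q) = P c a b * (- R a b k q)" by simp
  then show "P c a b * R k a b q + - (P c a b * R k b a q) = - (P c a b * R a b k q)"
   by (simp add: right_diff_distrib)
 qed
 also have "... = 0" using R_tau'[of c k q] by (simp add: sum_negf)
 finally show ?thesis by simp
qed

text \<open>Contracting the stabiliser condition with the three-form yields the Ricci curvature.\<close>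

lemma R_ricci: "(\<Sigma> j. R i j a j) = 0"
proof -
 define T where "T j = (\<Sigma> b c q. R i j b q * P c a q * P j b c)" for j
 have 1: "6 * R i j a j + 2 * T j = 0" for j
 proof -
  have "(\<Sigma> b c. (\<Sigma> q. R i j a q * P b c q) * P j b c) = (\<Sigma> q. R i j a q * (6 * kd q j))"
  proof -
   have "(\<Sigma> b c. (\<Sigma> q. R i j a q * P b c q) * P j b c) =
    (\<Sigma> b c q. R i j a q * (P q b c * P j b c))"
    unfolding sum_distrib_right
   proof (intro sum.cong refl)
    fix b c q show "R i j a q * P b c q * P j b c = R i j a q * (P q b c * P j b c)"
     using P_cyclic[of b c q] by simp
   qed
   also have "... = (\<Sigma> b q c. R i j a q * (P q b c * P j b c))"
    by (rule sum.cong[OF refl], rule sum.swap)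
   also have "... = (\<Sigma> q b c. R i j a q * (P q b c * P j b c))"
    by (rule sum.swap)
   finally show ?thesis by (simp add: P_P flip: sum_distrib_left)
  qed
  then have t1: "(\<Sigma> b c. (\<Sigma> q. R i j a q * P b c q) * P j b c) = 6 * R i j a j"
   by (simp add: mult.left_commute[of _ 6] flip: sum_distrib_left)
  have t2: "(\<Sigma> b c. (\<Sigma> q. R i j b q * P c a q) * P j b c) = T j"
   by (simp add: T_def sum_distrib_right)
  have t3: "(\<Sigma> b c. (\<Sigma> q. R i j c q * P a b q) * P j b c) = T j"
  proof -
   have "(\<Sigma> b c. (\<Sigma> q. R i j c q * P a b q) * P j b c) =
     (\<Sigma> b c. (\<Sigma> q. R i j b q * P a c q) * P j c b)"
    by (rule sum.swap)
   also have "... = T j" unfolding T_def sum_distrib_right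
   proof (intro sum.cong refl)
    fix b c q show "R i j b q * P a c q * P j c b = R i j b q * P c a q * P j b c"
     using P_swap12[of c a q] P_swap23[of j b c] by simp
   qed
   finally show ?thesis .
  qed
  have "(\<Sigma> b c. stab (R i j) a b c * P j b c) = 0" by (simp add: R_stab)
  then show ?thesis unfolding stab_def distrib_right sum.distrib t1 t2 t3 by simp
 qed
 have "(\<Sigma> j. T j) = 0"
 proof -
  have "(\<Sigma> j. T j) = (\<Sigma> j b c q. P c a q * (P c j b * R i j b q))"
   unfolding T_def
  proof (intro sum.cong refl)
   fix j b c q show "R i j b q * P c a q * P j b c = P c a q * (P c j b * R i j b q)"
    using P_cyclic[of j b c] by simp
  qed
  also have "... = (\<Sigma> j b. \<Sum>z\<in>UNIV. P (fst z) a (snd z) * (P (fst z) j b * R i j b (snd z)))"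
   unfolding UNIV_Times_UNIV[symmetric] by (simp add: sum.cartesian_product split_def)
  also have "... = (\<Sigma> j. \<Sum>z\<in>UNIV. \<Sigma> b. P (fst z) a (snd z) * (P (fst z) j b * R i j b (snd z)))"
   by (rule sum.cong[OF refl], rule sum.swap)
  also have "... = (\<Sum>z\<in>UNIV. \<Sigma> j b. P (fst z) a (snd z) * (P (fst z) j b * R i j b (snd z)))"
   by (rule sum.swap)
  also have "... = 0" by (simp add: R_contract flip: sum_distrib_left)
  finally show ?thesis .
 qed
 moreover have "(\<Sigma> j. 6 * R i j a j + 2 * T j) = 0" using 1 by simp
 ultimately show ?thesis by (simp add: sum.distrib flip: sum_distrib_left)
qed

lemma R_ricci': "(\<Sigma> j. R j i j q) = 0" "(\<Sigma> j. R i j j q) = 0"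
proof -
 have "R i j j q = - R i j q j" "R j i j q = R i j q j" for j
  using R_skew'[of i j j q] R_skew'[of j i j q] R_swap[of j i] by simp_all
 then show "(\<Sigma> j. R j i j q) = 0" "(\<Sigma> j. R i j j q) = 0"
  by (simp_all add: R_ricci sum_negf)
qed

end

section \<open>Orthonormal bases\<close>

context lc_atlas
begin

definition orthonormal :: "'y => (7 => vec7) => bool" where
 "orthonormal y e \<longleftrightarrow> (\<forall>i j. g y (e i) (e j) = kd i j)"

lemma g_sum_right: "g y u (\<Sum>i\<in>I. r i *\<^sub>R v i) = (\<Sum>i\<in>I. r i * g y u (v i))"
 using linear_sum[OF g_linear(1), of y u "%i. r i *\<^sub>R v i" I] linear_scale[OF g_linear(1), of y u] by simp

lemma orthonormal_expand:
 assumes "orthonormal y e" shows "v = (\<Sigma> i. g y (e i) v *\<^sub>R e i)"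
proof -
 define L :: "vec7 => vec7" where "L v = (\<chi> i. g y (e i) v)" for v
 have L: "linear L"
  by (rule linearI) (simp_all add: L_def vec_eq_iff linear_add[OF g_linear(1)] linear_scale[OF g_linear(1)])
 have Le: "L (\<Sigma> i. w i *\<^sub>R e i) = (\<chi> i. w i)" for w
  using assms by (simp add: L_def g_sum_right orthonormal_def vec_eq_iff)
 have "surj L"
 proof (rule surjI)
  fix w show "L (\<Sigma> i. (w $ i) *\<^sub>R e i) = w" by (simp add: Le vec_eq_iff)
 qed
 then have "inj L" using linear_surjective_imp_injective[OF L] by simp
 moreover have "L v = L (\<Sigma> i. g y (e i) v *\<^sub>R e i)" unfolding Le by (simp add: L_def)
 ultimately show ?thesis by (rule injD)
qed

lemma orthonormal_contract:
 fixes h :: "vec7 => vec7 => real"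
 assumes e: "orthonormal y e" and f: "orthonormal y f"
  and h: "\<And>v. linear (%u. h u v)" "\<And>u. linear (h u)"
 shows "(\<Sigma> i. h (e i) (e i)) = (\<Sigma> i. h (f i) (f i))"
proof -
 have hs: "h (\<Sigma> j. r j *\<^sub>R v j) w = (\<Sigma> j. r j * h (v j) w)"
  "h w (\<Sigma> j. r j *\<^sub>R v j) = (\<Sigma> j. r j * h w (v j))" for r :: "7 => real" and v w
  by (simp_all add: linear_sum[OF h(1)] linear_scale[OF h(1)] linear_sum[OF h(2)] linear_scale[OF h(2)])
 have "h (e i) (e i) = (\<Sigma> j k. g y (f j) (e i) * g y (f k) (e i) * h (f j) (f k))" for i
 proof -
  have "h (e i) (e i) = h (\<Sigma> j. g y (f j) (e i) *\<^sub>R f j) (\<Sigma> j. g y (f j) (e i) *\<^sub>R f j)"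
   using orthonormal_expand[OF f, of "e i"] by simp
  then show ?thesis by (simp only: hs) (subst sum.swap, simp add: sum_distrib_left mult_ac)
 qed
 then have "(\<Sigma> i. h (e i) (e i)) =
   (\<Sigma> i j k. g y (f j) (e i) * g y (f k) (e i) * h (f j) (f k))" by simp
 also have "... = (\<Sigma> j i k. g y (f j) (e i) * g y (f k) (e i) * h (f j) (f k))"
  by (rule sum.swap)
 also have "... = (\<Sigma> j k i. g y (f j) (e i) * g y (f k) (e i) * h (f j) (f k))"
  by (rule sum.cong[OF refl], rule sum.swap)
 also have "... = (\<Sigma> j k. kd j k * h (f j) (f k))"
 proof (intro sum.cong refl)
  fix j k
  have "kd j k = g y (f j) (\<Sigma> i. g y (e i) (f k) *\<^sub>R e i)"
   using f orthonormal_expand[OF e, of "f k"] by (simp add: orthonormal_def)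
  also have "... = (\<Sigma> i. g y (f j) (e i) * g y (f k) (e i))"
   unfolding g_sum_right by (intro sum.cong refl) (metis g_sym mult.commute)
  finally show "(\<Sigma> i. g y (f j) (e i) * g y (f k) (e i) * h (f j) (f k)) = kd j k * h (f j) (f k)"
   by (simp add: sum_distrib_right)
 qed
 finally show ?thesis by simp
qed

lemma mlin_Cons: "mlin (Suc n) \<omega> ==> mlin n (%us. \<omega> (v # us))"
 unfolding mlin_def
proof (intro allI impI)
 fix vs :: "vec7 list" and i assume m: "\<forall>vs i. length vs = Suc n \<and> i < Suc n \<longrightarrow> linear (%v. \<omega> (vs[i := v]))"
  and l: "length vs = n \<and> i < n"
 have "linear (%u. \<omega> ((v # vs)[Suc i := u]))" using m l by (metis Suc_less_eq length_Cons)
 then show "linear (%u. \<omega> (v # vs[i := u]))" by simp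
qed

lemma mlin_head: "mlin (Suc n) \<omega> ==> length us = n ==> linear (%u. \<omega> (u # us))"
 using mlin_append[of "Suc n" \<omega> "[]" us] by simp

lemma orthonormal_lists:
 assumes e: "orthonormal y e" and f: "orthonormal y f"
 shows "mlin p \<omega> ==> mlin p \<eta> ==> (\<Sum>I | length I = p. \<omega> (map e I) * \<eta> (map e I)) =
  (\<Sum>I | length I = p. \<omega> (map f I) * \<eta> (map f I))"
proof (induction p arbitrary: \<omega> \<eta>)
 case (Suc p)
 have "(\<Sum>I | length I = Suc p. \<omega> (map e I) * \<eta> (map e I)) =
   (\<Sigma> i. \<Sum>I | length I = p. \<omega> (e i # map e I) * \<eta> (e i # map e I))"
  by (simp add: sum_lists_Suc)
 also have "... = (\<Sigma> i. \<Sum>I | length I = p. \<omega> (e i # map f I) * \<eta> (e i # map f I))"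
  using Suc.IH[OF mlin_Cons[OF Suc.prems(1)] mlin_Cons[OF Suc.prems(2)]] by simp
 also have "... = (\<Sum>I | length I = p. \<Sigma> i. \<omega> (e i # map f I) * \<eta> (e i # map f I))"
  by (rule sum.swap)
 also have "... = (\<Sum>I | length I = p. \<Sigma> i. \<omega> (f i # map f I) * \<eta> (f i # map f I))"
 proof (rule sum.cong[OF refl])
  fix I :: "7 list" assume "I \<in> {I. length I = p}"
  then have l: "length (map f I) = p" by simp
  note 1 = mlin_head[OF Suc.prems(1) l] and 2 = mlin_head[OF Suc.prems(2) l]
  show "(\<Sigma> i. \<omega> (e i # map f I) * \<eta> (e i # map f I)) = (\<Sigma> i. \<omega> (f i # map f I) * \<eta> (f i # map f I))"
   by (rule orthonormal_contract[OF e f, where h = "%u v. \<omega> (u # map f I) * \<eta> (v # map f I)"])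
     (auto intro!: linearI simp: linear_add[OF 1] linear_scale[OF 1] linear_add[OF 2] linear_scale[OF 2] algebra_simps)
 qed
 also have "... = (\<Sigma> i. \<Sum>I | length I = p. \<omega> (f i # map f I) * \<eta> (f i # map f I))"
  by (rule sum.swap)
 finally show ?case by (simp add: sum_lists_Suc)
qed simp

lemma mlin_eq_on_basis:
 assumes e: "orthonormal y e"
 shows "mlin p \<omega> ==> mlin p \<eta> ==> (\<And>I. length I = p ==> \<omega> (map e I) = \<eta> (map e I)) ==> length vs = p ==> \<omega> vs = \<eta> vs"
proof (induction p arbitrary: \<omega> \<eta> vs)
 case 0 then show ?case by (metis length_0_conv list.simps(8))
next
 case (Suc p)
 then obtain v us where vs: "vs = v # us" "length us = p" by (auto simp: length_Suc_conv)
 note 1 = mlin_head[OF Suc.prems(1) vs(2)] and 2 = mlin_head[OF Suc.prems(2) vs(2)]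
 have i: "\<omega> (e i # us) = \<eta> (e i # us)" for i
 proof (rule Suc.IH[OF mlin_Cons[OF Suc.prems(1)] mlin_Cons[OF Suc.prems(2)] _ vs(2)])
  fix I :: "7 list" assume "length I = p"
  then show "\<omega> (e i # map e I) = \<eta> (e i # map e I)" using Suc.prems(3)[of "i # I"] by simp
 qed
 have "\<omega> (v # us) = \<omega> ((\<Sigma> i. g y (e i) v *\<^sub>R e i) # us)" using orthonormal_expand[OF e, of v] by simp
 also have "... = \<eta> ((\<Sigma> i. g y (e i) v *\<^sub>R e i) # us)"
  by (simp add: linear_sum[OF 1] linear_scale[OF 1] linear_sum[OF 2] linear_scale[OF 2] i)
 also have "... = \<eta> (v # us)" using orthonormal_expand[OF e, of v] by simp
 finally show ?case by (simp add: vs)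
qed

lemma smooth_form_germ:
 assumes "smooth_form A (smooth_fun A) p \<alpha>" "length Ys = p" "\<And>Y. Y \<in> set Ys ==> smv x Y"
 shows "smf x (%y. \<alpha> y (map (%Y. Y y) Ys))"
proof -
 have "\<forall>\<^sub>F y in nhds x. \<forall>Y\<in>set Ys. smv y Y"
  using assms(3) smv_eventually by (intro eventually_ball_finite) auto
 then obtain U where U: "open U" "x \<in> U" "\<And>y Y. y \<in> U ==> Y \<in> set Ys ==> smv y Y"
  by (auto simp: eventually_nhds)
 then have "smooth_fun A U (%y. \<alpha> y (map (%Y. Y y) Ys))"
  using assms(1,2) unfolding smooth_form_def by (auto simp: smooth_vf_iff)
 then show ?thesis using U by (auto simp: smf_def)
qed

end

section \<open>Adapted frames\<close>

locale g2mfd = lc_atlas A g nab for A :: "'y::t2_space chart set" and g nab +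
 fixes \<phi> vol :: "'y => vec7 list => real"
 assumes g2: "g2_structure A \<phi> g vol" and tf: "torsion_free A \<phi> g vol"
begin

definition frame :: "'y set => (7 => 'y => vec7) => bool" where
 "frame U E \<longleftrightarrow> open U \<and> (\<forall>y\<in>U. (\<forall>i. smv y (E i)) \<and> orthonormal y (%i. E i y) \<and>
   (\<forall>i j k. \<phi> y [E i y, E j y, E k y] = P i j k) \<and>
   (\<forall>L. length L = 7 \<longrightarrow> vol y (map (%i. E i y) L) = eps7 L))"

lemma phi_alt: "alt_form 3 (\<phi> y)" and vol_alt: "alt_form 7 (vol y)"
 and phi_smooth: "smooth_form A (smooth_fun A) 3 \<phi>" and vol_smooth: "smooth_form A (smooth_fun A) 7 vol"
 using g2 by (auto simp: g2_structure_def)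

text \<open>The dual frame of the adapted coframe; it is smooth by Cramer's rule.\<close>

lemma frame_exists: "\<exists>U E. frame U E \<and> x \<in> U"
proof -
 note ex = g2[unfolded g2_structure_def Let_def, THEN conjunct2, THEN conjunct2, THEN conjunct2,
   THEN conjunct2, THEN conjunct2, rule_format, of x]
 obtain U0 and \<theta> :: "7 => 'y => vec7" where U0: "open U0" "x \<in> U0" "\<forall>i. smooth_cov A U0 (\<theta> i)"
  and all: "\<forall>y\<in>U0. (\<forall>u v. g y u v = (\<Sigma> i. (\<theta> i y \<bullet> u) * (\<theta> i y \<bullet> v))) \<and>
   (\<forall>vs. length vs = 7 \<longrightarrow> vol y vs = covector_wedge (map (%i. \<theta> i y) [1,2,3,4,5,6,7]) vs) \<and>
   (\<forall>vs. length vs = 3 \<longrightarrow> \<phi> y vs =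
   covector_wedge (map (%i. \<theta> i y) [1,2,3]) vs + covector_wedge (map (%i. \<theta> i y) [1,4,5]) vs +
   covector_wedge (map (%i. \<theta> i y) [1,6,7]) vs + covector_wedge (map (%i. \<theta> i y) [2,4,6]) vs -
   covector_wedge (map (%i. \<theta> i y) [2,5,7]) vs - covector_wedge (map (%i. \<theta> i y) [3,4,7]) vs -
   covector_wedge (map (%i. \<theta> i y) [3,5,6]) vs)"
  using ex by (elim exE conjE) (rule that)
 have g\<theta>: "g y u v = (\<Sigma> i. (\<theta> i y \<bullet> u) * (\<theta> i y \<bullet> v))" if "y \<in> U0" for y u v
  using all that by blast
 have vol\<theta>: "vol y vs = covector_wedge (map (%i. \<theta> i y) [1,2,3,4,5,6,7]) vs"
  if "y \<in> U0" "length vs = 7" for y vs using all that by blast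
 have phi\<theta>: "\<phi> y vs =
   covector_wedge (map (%i. \<theta> i y) [1,2,3]) vs + covector_wedge (map (%i. \<theta> i y) [1,4,5]) vs +
   covector_wedge (map (%i. \<theta> i y) [1,6,7]) vs + covector_wedge (map (%i. \<theta> i y) [2,4,6]) vs -
   covector_wedge (map (%i. \<theta> i y) [2,5,7]) vs - covector_wedge (map (%i. \<theta> i y) [3,4,7]) vs -
   covector_wedge (map (%i. \<theta> i y) [3,5,6]) vs" if "y \<in> U0" "length vs = 3" for y vs
  using all that by blast
 define U where "U = U0 \<inter> fst (pref A x)"
 define d where "d a = ext A x (axis a 1)" for a
 have U: "open U" "x \<in> U" "\<And>y. y \<in> U ==> y \<in> U0" "\<And>y. y \<in> U ==> y \<in> fst (pref A x)"
  using U0 chart_open(1)[OF pref_in] in_pref by (auto simp: U_def)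
 have d: "smv y (d a)" if "y \<in> U" for y a unfolding d_def using smv_ext U(4)[OF that] by blast
 define M :: "'y => real^7^7" where "M y = (\<chi> i a. \<theta> i y \<bullet> d a y)" for y
 have M: "smf y (%y. M y $ i $ a)" if "y \<in> U" for y i a
  using smooth_covD[OF U0(3)[rule_format] U0(1)] d[OF that] U(3)[OF that] by (simp add: M_def smc_def)
 have Mv: "(M y *v w) $ i = \<theta> i y \<bullet> (\<Sigma> a. (w $ a) *\<^sub>R d a y)" for y w i
  by (simp add: M_def matrix_vector_mult_def inner_sum_right mult.commute)
 have det: "det (M y) \<noteq> 0" if y: "y \<in> U" for y
 proof -
  have "w = 0" if "M y *v w = 0" for w
  proof -
   let ?v = "\<Sigma> a. (w $ a) *\<^sub>R d a y"
   have "\<theta> i y \<bullet> ?v = 0" for i using Mv[of y w i] that by simp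
   then have "g y ?v ?v = 0" using g\<theta>[OF U(3)[OF y]] by simp
   then have v: "?v = 0" using g_pos[of ?v y] by auto
   have "linear (%w. ext A x w y)" using linear_ext U(4)[OF y] by blast
   then have "ext A x (\<Sigma> a. (w $ a) *\<^sub>R axis a 1) y = ?v"
    by (simp add: d_def linear_sum[of "%w. ext A x w y"] linear_scale[of "%w. ext A x w y"])
   then have e: "ext A x w y = 0" using v vec7_expand[of w] by simp
   have "w = to_chart A (pref A x) y (ext A x w y)" using to_chart_ext[OF U(4)[OF y]] by simp
   also have "... = 0" unfolding e using linear_0[OF linear_to_chart[OF pref_in U(4)[OF y]]] by simp
   finally show ?thesis .
  qed
  then have "invertible (M y)" by (simp add: invertible_left_inverse matrix_left_invertible_ker)
  then show ?thesis by (simp add: invertible_det_nz)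
 qed
 have det_smf: "smf y (%y. det (N y))" if "\<And>i a. smf y (%y. N y $ i $ a)" for y and N :: "'y => real^7^7"
  unfolding det_def using that by (intro smf_sum smf_mult smf_prod smf_const)
 define N where "N j y = (\<chi> k. det (\<chi> i a. if a = k then (axis j 1 :: vec7) $ i else M y $ i $ a) / det (M y))" for j y
 have N: "M y *v N j y = axis j 1" if "y \<in> U" for j y
  using cramer[OF det[OF that], of "N j y" "axis j 1"] by (simp add: N_def)
 have Ns: "smf y (%y. N j y $ a)" if y: "y \<in> U" for j a y
 proof -
  have "smf y (%y. (\<chi> i k. if k = a then (axis j 1 :: vec7) $ i else M y $ i $ k) $ i $ k)" for i k
   by (cases "k = a") (simp_all add: smf_const M[OF y])
  then show ?thesis
   unfolding N_def vec_lambda_beta divide_inverse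
   by (intro smf_mult smf_inverse det_smf det y M) auto
 qed
 define E where "E j y = (\<Sigma> a. (N j y $ a) *\<^sub>R d a y)" for j y
 have E: "smv y (E j)" if "y \<in> U" for j y
  unfolding E_def[abs_def] using d Ns that by (intro smv_sum smv_scale) auto
 have \<theta>E: "\<theta> i y \<bullet> E j y = kd i j" if "y \<in> U" for i j y
  using Mv[of y "N j y" i] N[OF that, of j] by (simp add: E_def axis_def kd_def)
 have "frame U E" unfolding frame_def
 proof (intro conjI ballI allI impI)
  fix y assume y: "y \<in> U"
  show "orthonormal y (%i. E i y)" unfolding orthonormal_def
   using y by (simp add: g\<theta>[OF U(3)[OF y]] \<theta>E)
  fix i j k show "\<phi> y [E i y, E j y, E k y] = P i j k"
   by (simp add: phi\<theta>[OF U(3)[OF y]] covector_wedge_3 \<theta>E[OF y] P_def vol3_def seven)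
 next
  fix y and L :: "7 list" assume y: "y \<in> U" and L: "length L = 7"
  have "covector_wedge (map (%i. \<theta> i y) [1,2,3,4,5,6,7]) (map (%i. E i y) L) = eps7 L"
   unfolding eps7_def
  proof (rule covector_wedge_cong)
   fix r s assume rs: "r < length (map (%i. \<theta> i y) [1,2,3,4,5,6,7::7])" "s < length (map (%i. \<theta> i y) [1,2,3,4,5,6,7::7])"
   have *: "map (%i. \<theta> i y) K ! r \<bullet> map (%i. E i y) L ! s = map (%i. axis i 1) K ! r \<bullet> map (%i. axis i (1::real)) L ! s"
    if "length K = 7" for K :: "7 list"
    using rs L that by (simp add: \<theta>E[OF y] inner_axis_axis kd_def)
   show "map (%i. \<theta> i y) [1,2,3,4,5,6,7] ! r \<bullet> map (%i. E i y) L ! s =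
     map (%i. axis i 1) [1,2,3,4,5,6,7] ! r \<bullet> map (%i. axis i (1::real)) L ! s" by (rule *) simp
  qed simp
  then show "vol y (map (%i. E i y) L) = eps7 L" using vol\<theta>[OF U(3)[OF y]] L by simp
 qed (use U E in auto)
 then show ?thesis using U by blast
qed

lemma onb_orthonormal: "orthonormal y (onb g y)"
proof -
 obtain U E where "frame U E" "y \<in> U" using frame_exists by blast
 then have "\<forall>i j. g y (E i y) (E j y) = (if i = j then 1 else 0)"
  by (simp add: frame_def orthonormal_def kd_def)
 then have "\<exists>e :: 7 => vec7. \<forall>i j. g y (e i) (e j) = (if i = j then 1 else 0)" by (rule exI[of _ "%i. E i y"])
 then show ?thesis unfolding orthonormal_def kd_def onb_def by (rule someI_ex)
qed

end

section \<open>Tensor calculus in an adapted frame\<close>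

lemma sum_swap13:
 "(\<Sum>a\<in>X. \<Sum>b\<in>Y. \<Sum>c\<in>Z. f a b c) = (\<Sum>c\<in>Z. \<Sum>b\<in>Y. \<Sum>a\<in>X. f a b c)"
proof -
 have "(\<Sum>a\<in>X. \<Sum>b\<in>Y. \<Sum>c\<in>Z. f a b c) = (\<Sum>b\<in>Y. \<Sum>a\<in>X. \<Sum>c\<in>Z. f a b c)" by (rule sum.swap)
 also have "... = (\<Sum>b\<in>Y. \<Sum>c\<in>Z. \<Sum>a\<in>X. f a b c)" by (rule sum.cong[OF refl], rule sum.swap)
 also have "... = (\<Sum>c\<in>Z. \<Sum>b\<in>Y. \<Sum>a\<in>X. f a b c)" by (rule sum.swap)
 finally show ?thesis .
qed

text \<open>Contractions with the three-form and the metric commute with their stabiliser.\<close>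

lemma act_KP:
 assumes A: "skew A" and st: "\<And>a b c. stab A a b c = 0"
 shows "act A (c # is) (%L. \<Sigma> a b. P (hd L) a b * t (a # b # tl L)) =
  (\<Sigma> a b. P c a b * act A (a # b # is) t)"
proof -
 let ?T = "%a b. t (a # b # is)"
 have r1: "(\<Sigma> a b. P c a b * (\<Sigma> q. A a q * ?T q b)) =
   (\<Sigma> a b. (\<Sigma> q. P c q b * A q a) * ?T a b)"
  unfolding sum_distrib_left sum_distrib_right mult.assoc[symmetric] by (rule sum_swap13)
 have r2: "(\<Sigma> a b. P c a b * (\<Sigma> q. A b q * ?T a q)) =
   (\<Sigma> a b. (\<Sigma> q. P c a q * A q b) * ?T a b)"
  unfolding sum_distrib_left sum_distrib_right mult.assoc[symmetric]
  by (rule sum.cong[OF refl], rule sum.swap)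
 have r0: "(\<Sigma> q. A c q * (\<Sigma> a b. P q a b * ?T a b)) =
   (\<Sigma> a b. (\<Sigma> q. A c q * P q a b) * ?T a b)"
 proof -
  have "(\<Sigma> q. A c q * (\<Sigma> a b. P q a b * ?T a b)) =
    (\<Sigma> q a b. A c q * P q a b * ?T a b)"
   by (simp add: sum_distrib_left mult.assoc)
  also have "... = (\<Sigma> a q b. A c q * P q a b * ?T a b)" by (rule sum.swap)
  also have "... = (\<Sigma> a b q. A c q * P q a b * ?T a b)"
   by (rule sum.cong[OF refl], rule sum.swap)
  finally show ?thesis by (simp add: sum_distrib_right)
 qed
 have co: "(\<Sigma> q. A c q * P q a b) = (\<Sigma> q. P c q b * A q a) + (\<Sigma> q. P c a q * A q b)" for a b
 proof -
  have "A c q * P q a b = A c q * P a b q" for q using P_cyclic[of a b q] by simp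
  then have "(\<Sigma> q. A c q * P q a b) = (\<Sigma> q. A c q * P a b q)" by (simp only:)
  moreover have "P c q b * A q a = - (A a q * P b c q)" for q
   using P_cyclic[of c q b] skewD[OF A, of q a] by simp
  then have "(\<Sigma> q. P c q b * A q a) = - (\<Sigma> q. A a q * P b c q)" by (simp only: sum_negf)
  moreover have "P c a q * A q b = - (A b q * P c a q)" for q using skewD[OF A, of q b] by simp
  then have "(\<Sigma> q. P c a q * A q b) = - (\<Sigma> q. A b q * P c a q)" by (simp only: sum_negf)
  ultimately show ?thesis using st[of c a b] unfolding stab_def by linarith
 qed
 show ?thesis
  by (simp add: r0 co act_sum act_cmult distrib_left distrib_right sum.distrib r1 r2)
qed

lemma act_KT:
 assumes A: "skew A"
 shows "act A is (%L. \<Sigma> a. t (a # a # L)) = (\<Sigma> a. act A (a # a # is) t)"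
proof -
 have "(\<Sigma> a q. A a q * t (q # a # is)) = (\<Sigma> a q. - (A a q * t (a # q # is)))"
 proof (subst sum.swap, intro sum.cong refl)
  fix a q show "A q a * t (a # q # is) = - (A a q * t (a # q # is))" using skewD[OF A, of q a] by simp
 qed
 then show ?thesis by (simp add: act_sum sum.distrib sum_negf)
qed

context g2mfd
begin

text \<open>The four-form \<open>\<psi>\<close>.\<close>

definition psi4 :: "'y => vec7 list => real" where
 "psi4 y = hodge_star (onb g y) (vol y) 3 (\<phi> y)"

text \<open>
 The Hodge star may be computed in any orthonormal basis, in particular in the adapted frames.
\<close>

lemma psi4_basis:
 assumes "orthonormal y e" "length vs = 4"
 shows "psi4 y vs = (\<Sum>I | length I = 3. \<phi> y (map e I) * vol y (map e I @ vs)) / 6"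
proof -
 have m: "mlin 3 (%us. vol y (us @ vs))" unfolding mlin_def
 proof (intro allI impI)
  fix us :: "vec7 list" and i :: nat assume "length us = 3 \<and> i < 3"
  then have "linear (%v. vol y ((us @ vs)[i := v]))"
   using assms(2) by (intro mlin_linear[OF alt_form_mlin[OF vol_alt]]) auto
  then show "linear (%v. vol y (us[i := v] @ vs))"
   using \<open>length us = 3 \<and> i < 3\<close> by (simp add: list_update_append)
 qed
 show ?thesis unfolding psi4_def hodge_star_def
  using orthonormal_lists[OF onb_orthonormal assms(1) alt_form_mlin[OF phi_alt] m]
  by (simp add: fact_numeral)
qed

lemma mlin_psi4: "mlin 4 (psi4 y)"
 unfolding mlin_def
proof (intro allI impI)
 fix vs :: "vec7 list" and i :: nat assume l: "length vs = 4 \<and> i < 4"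
 have "linear (%v. vol y (map (onb g y) I @ vs[i := v]))" if "length I = 3" for I :: "7 list"
 proof -
  have "linear (%v. vol y ((map (onb g y) I @ vs)[3 + i := v]))"
   using l that by (intro mlin_linear[OF alt_form_mlin[OF vol_alt]]) auto
  then show ?thesis using that by (simp add: list_update_append)
 qed
 then show "linear (%v. psi4 y (vs[i := v]))"
 proof -
  have "(%v. psi4 y (vs[i := v])) =
    (%v. \<Sum>I | length I = 3. (\<phi> y (map (onb g y) I) / fact 3) *\<^sub>R vol y (map (onb g y) I @ vs[i := v]))"
   by (simp add: psi4_def hodge_star_def sum_divide_distrib)
  moreover have "linear ..."
   by (intro linear_compose_sum ballI linear_compose_scale_right)
     (use \<open>\<And>I. length I = 3 ==> linear (%v. vol y (map (onb g y) I @ vs[i := v]))\<close> in simp)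
  ultimately show ?thesis by simp
 qed
qed

lemma swap_alt_psi4: "swap_alt 4 (psi4 y)"
 unfolding swap_alt_def
proof (intro allI impI)
 fix as cs :: "vec7 list" and u w assume l: "length as + length cs + 2 = 4"
 have "vol y (map (onb g y) I @ as @ u # w # cs) = - vol y (map (onb g y) I @ as @ w # u # cs)"
  if "length I = 3" for I
  using swap_altD[OF alt_form_swap[OF vol_alt], of "map (onb g y) I @ as" cs y u w] that l by simp
 then show "psi4 y (as @ u # w # cs) = - psi4 y (as @ w # u # cs)"
  by (simp add: psi4_def hodge_star_def sum_negf)
qed

lemma tensor_psi4: "tensor 4 psi4"
 unfolding tensor_def
proof (intro conjI allI impI)
 show "mlin 4 (psi4 y)" for y by (rule mlin_psi4)
 fix x Ys assume Ys: "length Ys = 4 \<and> (\<forall>Y\<in>set Ys. smv x Y)"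
 obtain U E where f: "frame U E" "x \<in> U" using frame_exists by blast
 have sE: "smv x (E i)" for i using f by (simp add: frame_def)
 have U: "\<forall>\<^sub>F y in nhds x. y \<in> U" using f by (auto simp: frame_def eventually_nhds)
 have "smf x (%y. \<Sum>I | length I = 3. \<phi> y (map (%i. E i y) I) * vol y (map (%i. E i y) I @ map (%Y. Y y) Ys) * inverse 6)"
 proof (intro smf_sum smf_mult smf_const)
  fix I assume "I \<in> {I :: 7 list. length I = 3}"
  then have I: "length I = 3" by simp
  have "smf x (%y. \<phi> y (map (%Y. Y y) (map E I)))"
   by (rule smooth_form_germ[OF phi_smooth]) (use I sE in auto)
  then show "smf x (%y. \<phi> y (map (%i. E i y) I))" by (simp add: comp_def)
  have "smf x (%y. vol y (map (%Y. Y y) (map E I @ Ys)))"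
   by (rule smooth_form_germ[OF vol_smooth]) (use I sE Ys in auto)
  then show "smf x (%y. vol y (map (%i. E i y) I @ map (%Y. Y y) Ys))" by (simp add: comp_def)
 qed
 then show "smf x (%y. psi4 y (map (%Y. Y y) Ys))"
 proof (rule smf_cong, intro eventually_mono[OF U])
  fix y assume "y \<in> U"
  then have "orthonormal y (%i. E i y)" using f by (simp add: frame_def)
  note b = psi4_basis[OF this, of "map (%Y. Y y) Ys"]
  have l: "length (map (%Y. Y y) Ys) = 4" using Ys by simp
  show "(\<Sum>I | length I = 3. \<phi> y (map (%i. E i y) I) * vol y (map (%i. E i y) I @ map (%Y. Y y) Ys) * inverse 6) =
    psi4 y (map (%Y. Y y) Ys)"
   unfolding b[OF l] divide_inverse sum_distrib_right ..
 qed
qed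

end

locale g2frame = g2mfd A g nab \<phi> vol for A :: "'y::t2_space chart set" and g nab \<phi> vol +
 fixes U :: "'y set" and E :: "7 => 'y => vec7"
 assumes frame: "frame U E"
begin

lemma U_open: "open U" and E_smv: "y \<in> U ==> smv y (E i)" and E_on: "y \<in> U ==> orthonormal y (%i. E i y)"
 and E_phi: "y \<in> U ==> \<phi> y [E i y, E j y, E k y] = P i j k"
 and E_vol: "y \<in> U ==> length L = 7 ==> vol y (map (%i. E i y) L) = eps7 L"
 using frame by (auto simp: frame_def)

lemma g_E: "y \<in> U ==> g y (E i y) (E j y) = kd i j"
 using E_on by (simp add: orthonormal_def)

lemma eventually_U: "y \<in> U ==> \<forall>\<^sub>F z in nhds y. z \<in> U"
 using U_open by (auto simp: eventually_nhds)

lemma E_expand: "y \<in> U ==> v = (\<Sigma> i. g y (E i y) v *\<^sub>R E i y)"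
 using orthonormal_expand[OF E_on] by blast

definition smU :: "('y => real) => bool" where
 "smU f \<longleftrightarrow> (\<forall>y\<in>U. smf y f)"

definition dE :: "7 => ('y => real) => 'y => real" where
 "dE k f y = dirD A y (E k y) f"

definition Om :: "7 => 7 => 7 => 'y => real" where
 "Om k a q y = g y (E q y) (nab (E k) (E a) y)"

definition smt :: "nat => (7 list => 'y => real) => bool" where
 "smt n t \<longleftrightarrow> (\<forall>is. length is = n \<longrightarrow> smU (t is))"

lemma smUD: "smU f ==> y \<in> U ==> smf y f" by (simp add: smU_def)

lemma smU_rules:
 "smU (%y. r)" "smU f ==> smU h ==> smU (%y. f y + h y)" "smU f ==> smU h ==> smU (%y. f y - h y)"
 "smU f ==> smU h ==> smU (%y. f y * h y)" "(\<And>i. i \<in> I ==> smU (F i)) ==> smU (%y. \<Sum>i\<in>I. F i y)"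
 by (auto simp: smU_def intro: smf_const smf_add smf_diff smf_mult smf_sum)

lemma smU_dE: "smU f ==> smU (dE k f)"
 unfolding smU_def dE_def[abs_def] using smf_dirD E_smv by blast

lemma smU_cong: "(\<And>y. y \<in> U ==> f y = h y) ==> smU f ==> smU h"
 unfolding smU_def using smf_cong eventually_mono[OF eventually_U] by (metis (mono_tags, lifting))

lemma dE_cong: "y \<in> U ==> (\<And>z. z \<in> U ==> f z = h z) ==> dE k f y = dE k h y"
 unfolding dE_def by (rule dirD_cong) (rule eventually_mono[OF eventually_U], auto)

lemma dE_const: "dE k (%y. r) y = 0"
 by (simp add: dE_def dirD_const)

lemma dE_rules:
 assumes "y \<in> U" "smU f" "smU h"
 shows "dE k (%y. f y + h y) y = dE k f y + dE k h y" "dE k (%y. f y - h y) y = dE k f y - dE k h y"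
  "dE k (%y. f y * h y) y = f y * dE k h y + dE k f y * h y"
 unfolding dE_def
 by (rule dirD_add dirD_diff dirD_mult; rule smUD; rule assms)+

lemma dE_cmult: "y \<in> U ==> smU f ==> dE k (%y. r * f y) y = r * dE k f y"
 by (simp add: dE_def dirD_cmult smUD)

lemma dE_sum: "y \<in> U ==> (\<And>i. i \<in> I ==> smU (F i)) ==> dE k (%y. \<Sum>i\<in>I. F i y) y = (\<Sum>i\<in>I. dE k (F i) y)"
 by (simp add: dE_def dirD_sum smUD)

lemma nab_E: "y \<in> U ==> nab (E k) (E a) y = (\<Sigma> q. Om k a q y *\<^sub>R E q y)"
 unfolding Om_def by (rule E_expand)

lemma smU_Om: "smU (Om k a q)"
 unfolding smU_def Om_def[abs_def] using smf_g E_smv smv_nab by blast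

lemma Om_skew: assumes y: "y \<in> U" shows "skew (%a q. Om k a q y)"
 unfolding skew_def
proof (intro allI)
 fix a q
 have "dirD A y (E k y) (%z. g z (E a z) (E q z)) = dirD A y (E k y) (%z. kd a q)"
  by (rule dirD_cong, rule eventually_mono[OF eventually_U[OF y]]) (simp add: g_E)
 then have "0 = g y (nab (E k) (E a) y) (E q y) + g y (E a y) (nab (E k) (E q) y)"
  using nab_metric[OF E_smv[OF y] E_smv[OF y] E_smv[OF y], of k a q] by (simp add: dirD_const)
 then show "Om k a q y = - Om k q a y" using g_sym[of y "E q y"] by (simp add: Om_def)
qed

lemma dE_commutator:
 assumes y: "y \<in> U" and f: "smU f"
 shows "dE i (dE j f) y - dE j (dE i f) y = (\<Sigma> q. (Om i j q y - Om j i q y) * dE q f y)"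
proof -
 have "dE i (dE j f) y - dE j (dE i f) y = dirD A y (lie_bracket A (E i) (E j) y) f"
  unfolding dE_def[abs_def] by (rule dirD_lie_bracket[OF smUD[OF f y] E_smv[OF y] E_smv[OF y]])
 also have "lie_bracket A (E i) (E j) y = (\<Sigma> q. (Om i j q y - Om j i q y) *\<^sub>R E q y)"
  using lie_bracket_value[OF E_smv[OF y] E_smv[OF y], of i j]
  by (simp add: nab_E[OF y] scaleR_left_diff_distrib sum_subtractf)
 finally show ?thesis by (simp add: dirD_sum_left[OF smUD[OF f y]] dE_def[abs_def])
qed

subsection \<open>Covariant derivatives of index tensors\<close>

lemma smU_act:
 assumes "\<And>a q. smU (M a q)"
 shows "smt n t ==> length is = n ==> smU (%y. act (%a q. M a q y) is (%js. t js y))"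
proof (induction "is" arbitrary: n t)
 case (Cons a "is")
 obtain m where n: "n = Suc m" "length is = m" using Cons.prems(2) by auto
 have t: "smt m (%js. t (a # js))" using Cons.prems(1) n by (simp add: smt_def)
 show ?case unfolding act.simps
  by (intro smU_rules assms Cons.IH[OF t n(2)]) (use Cons.prems in "auto simp: smt_def")
qed (simp add: smU_rules)

lemma dE_act:
 assumes M: "\<And>a q. smU (M a q)" and y: "y \<in> U"
 shows "smt n t ==> length is = n ==> dE k (%y. act (%a q. M a q y) is (%js. t js y)) y =
  act (%a q. dE k (M a q) y) is (%js. t js y) + act (%a q. M a q y) is (%js. dE k (t js) y)"
proof (induction "is" arbitrary: n t)
 case (Cons a "is")
 obtain m where n: "n = Suc m" "length is = m" using Cons.prems(2) by auto
 have t: "smt m (%js. t (a # js))" using Cons.prems(1) n by (simp add: smt_def)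
 have tq: "smU (t (q # is))" for q using Cons.prems by (simp add: smt_def)
 show ?case
  unfolding act.simps
  using Cons.IH[OF t n(2)]
  by (simp add: dE_rules(1)[OF y smU_rules(5)[OF smU_rules(4)[OF M tq]] smU_act[OF M t n(2)]]
    dE_sum[OF y smU_rules(4)[OF M tq]] dE_rules(3)[OF y M tq] sum.distrib algebra_simps)
qed (simp add: dE_const)

definition cov :: "(7 list => 'y => real) => 7 list => 'y => real" where
 "cov t L y = dE (hd L) (t (tl L)) y - act (%a q. Om (hd L) a q y) (tl L) (%js. t js y)"

lemma cov_Cons: "cov t (k # is) y = dE k (t is) y - act (%a q. Om k a q y) is (%js. t js y)"
 by (simp add: cov_def)

lemma smt_cov: assumes "smt n t" shows "smt (Suc n) (cov t)"
 unfolding smt_def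
proof (intro allI impI)
 fix L :: "7 list" assume "length L = Suc n"
 then obtain k "is" where L: "L = k # is" "length is = n" by (auto simp: length_Suc_conv)
 show "smU (cov t L)" unfolding L cov_Cons[abs_def]
  by (intro smU_rules smU_dE smU_act[OF smU_Om assms L(2)]) (use assms L in "simp add: smt_def")
qed

lemma cov_cong:
 assumes "y \<in> U" "length is = n" "\<And>js z. length js = n ==> z \<in> U ==> t js z = u js z"
 shows "cov t (k # is) y = cov u (k # is) y"
 unfolding cov_Cons using dE_cong[OF assms(1) assms(3)[OF assms(2)]]
  act_cong[of "is" "%js. t js y" "%js. u js y"] assms by simp

lemma cov_linear:
 assumes "y \<in> U" "smt n t" "smt n u" "length is = n"
 shows "cov (%L y. t L y + u L y) (k # is) y = cov t (k # is) y + cov u (k # is) y"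
  "cov (%L y. t L y - u L y) (k # is) y = cov t (k # is) y - cov u (k # is) y"
  "cov (%L y. r * t L y) (k # is) y = r * cov t (k # is) y"
 using assms by (simp_all add: cov_Cons dE_rules dE_cmult smt_def act_add act_diff act_cmult algebra_simps)

definition fc :: "('y => vec7 list => real) => 7 list => 'y => real" where
 "fc T L y = T y (map (%i. E i y) L)"

lemma smt_fc: assumes "tensor n T" shows "smt n (fc T)"
 unfolding smt_def smU_def
proof (intro allI impI ballI)
 fix L :: "7 list" and y assume "length L = n" "y \<in> U"
 then have "smf y (%z. T z (map (%Y. Y z) (map E L)))"
  using E_smv by (intro tensor_smf[OF assms]) auto
 then show "smf y (fc T L)" by (simp add: fc_def[abs_def] comp_def)
qed

lemma nablaT_frame:
 assumes T: "tensor n T" and y: "y \<in> U" and l: "length is = n"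
 shows "nablaT T y (E k y) (map (%i. E i y) is) = cov (fc T) (k # is) y"
proof -
 have "nablaT T y (E k y) (map (%Y. Y y) (map E is)) = nabF T y (E k) (map E is)"
  by (rule nablaT_fields[OF T E_smv[OF y]]) (use l E_smv[OF y] in auto)
 moreover have "map (%Y. Y y) (map E is) = map (%i. E i y) is" for y by simp
 moreover have "T y ((map (%i. E i y) is)[r := nab (E k) (E (is ! r)) y]) =
   (\<Sigma> q. Om k (is ! r) q y * fc T (is[r := q]) y)" if "r < length is" for r
 proof -
  note lin = mlin_linear[OF tensor_mlin[OF T, of y], of "map (%i. E i y) is" r]
  have lin: "linear (%v. T y ((map (%i. E i y) is)[r := v]))" using lin that l by simp
  show ?thesis
   by (simp add: nab_E[OF y] linear_sum[OF lin] linear_scale[OF lin] fc_def map_update)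
 qed
 ultimately show ?thesis
  by (simp add: nabF_def cov_Cons act_update dE_def fc_def[abs_def] comp_def)
qed

subsection \<open>The three-form is parallel\<close>

lemma tensor_phi: "tensor 3 \<phi>"
 unfolding tensor_def using alt_form_mlin[OF phi_alt] smooth_form_germ[OF phi_smooth] by auto

lemma fc_phi: "length L = 3 ==> y \<in> U ==> fc \<phi> L y = PL L"
 by (auto simp: fc_def E_phi numeral_3_eq_3 length_Suc_conv)

lemma fc_psi4: "length L = 4 ==> y \<in> U ==> fc psi4 L y = (\<Sum>I | length I = 3. PL I * eps7 (I @ L)) / 6"
proof -
 assume L: "length L = 4" and y: "y \<in> U"
 have "\<phi> y (map (%i. E i y) I) * vol y (map (%i. E i y) I @ map (%i. E i y) L) = PL I * eps7 (I @ L)"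
  if "length I = 3" for I
  using fc_phi[OF that y] E_vol[OF y, of "I @ L"] L that by (simp add: fc_def)
 then show ?thesis unfolding fc_def using psi4_basis[OF E_on[OF y], of "map (%i. E i y) L"] L by simp
qed

lemma eps7_swap_alt: assumes y: "y \<in> U" shows "swap_alt 7 eps7"
 unfolding swap_alt_def
proof (intro allI impI)
 fix as cs :: "7 list" and u w assume l: "length as + length cs + 2 = 7"
 have "eps7 (as @ u # w # cs) = vol y (map (%i. E i y) (as @ u # w # cs))" for u w
  by (subst E_vol[OF y]) (use l in auto)
 then show "eps7 (as @ u # w # cs) = - eps7 (as @ w # u # cs)"
  using swap_altD[OF alt_form_swap[OF vol_alt], of "map (%i. E i y) as" "map (%i. E i y) cs" y "E u y" "E w y"] l
  by simp
qed

lemma cov_phi: assumes "y \<in> U" shows "cov (fc \<phi>) [k, a, b, c] y = - stab (%a q. Om k a q y) a b c"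
proof -
 have "cov (fc \<phi>) [k, a, b, c] y = cov (%L y. PL L) [k, a, b, c] y"
  by (rule cov_cong[where n = 3]) (use assms fc_phi in auto)
 then show ?thesis by (simp only: cov_Cons[of "%L y. PL L"] dE_const act_PL diff_0)
qed

text \<open>
 The theorem of Fernandez and Gray: a closed and coclosed \<open>G\<^sub>2\<close> structure is parallel.
\<close>

lemma Om_stab:
 assumes y: "y \<in> U" shows "stab (%a q. Om k a q y) a b c = 0"
proof (rule fernandez_gray_algebra[where \<omega> = "%k a q. Om k a q y"])
 show "skew (%a q. Om k a q y)" for k by (rule Om_skew[OF y])
 have nz: "length I = 3 ==> nablaT \<phi> y (E k y) (map (%i. E i y) I) = cov (fc \<phi>) (k # I) y" for k I
  by (rule nablaT_frame[OF tensor_phi y])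
 show "stab (%a' q. Om a a' q y) b c d - stab (%a q. Om b a q y) a c d
   + stab (%a q. Om c a q y) a b d - stab (%a q. Om d a q y) a b c = 0" for a b c d
 proof -
  let ?vs = "map (%i. E i y) [a, b, c, d]"
  have "ext_cov_deriv A (dirD A) \<phi> y ?vs = 0" using tf by (simp add: torsion_free_def Let_def)
  moreover have "swap_alt 3 (%us. \<phi> y (us @ []))" using alt_form_swap[OF phi_alt] by simp
  from nablaT_alternate[where T = \<phi> and x = y and ts = "[]" and p = 3 and vs = ?vs, OF this]
  have "(\<Sum>i<Suc 3. (- 1) ^ i * dirD A y (?vs ! i) (%z. \<phi> z (map (%u. ext A y u z) (omit i ?vs)))) =
    (\<Sum>i<Suc 3. (- 1) ^ i * nablaT \<phi> y (?vs ! i) (omit i ?vs @ []))"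
   by (simp del: sum.lessThan_Suc)
  moreover have "length ?vs = Suc 3" by simp
  ultimately have "(\<Sum>i<Suc 3. (- 1) ^ i * nablaT \<phi> y (?vs ! i) (omit i ?vs @ [])) = 0"
   by (simp only: ext_cov_deriv_def) (simp del: sum.lessThan_Suc list.map)
  then show ?thesis
   using nz[of "[b, c, d]" a] nz[of "[a, c, d]" b] nz[of "[a, b, d]" c] nz[of "[a, b, c]" d]
   by (simp add: omit_def numeral_3_eq_3 cov_phi[OF y] numeral_2_eq_2)
 qed
 show "(\<Sigma> k. stab (%a q. Om k a q y) k p q) = 0" if "p \<noteq> q" for p q
 proof (rule coclosed_index[OF Om_skew[OF y] eps7_swap_alt[OF y] _ _ that])
  show "eps7 [1, 2, 3, 4, 5, 6, 0] \<noteq> 0" by (simp add: eps7_1)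
  fix as :: "7 list" assume as: "length as = 5"
  let ?vs = "map (%i. E i y) as"
  let ?c = "%L. \<Sum>I | length I = 3. PL I * eps7 (I @ L)"
  have "ext_cov_deriv A (dirD A) psi4 y ?vs = 0"
   using tf by (simp add: torsion_free_def Let_def psi4_def[abs_def])
  moreover have "swap_alt 4 (%us. psi4 y (us @ []))" using swap_alt_psi4 by simp
  note nablaT_alternate[where T = psi4 and x = y and ts = "[]" and p = 4 and vs = ?vs, OF this]
  ultimately have "(\<Sum>i<Suc 4. (- 1) ^ i * nablaT psi4 y (?vs ! i) (omit i ?vs @ [])) = 0"
   using as by (simp add: ext_cov_deriv_def del: sum.lessThan_Suc)
  moreover have "nablaT psi4 y (?vs ! i) (omit i ?vs @ []) =
    - (1 / 6) * act (%a q. Om (as ! i) a q y) (omit i as) ?c" if i: "i < 5" for i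
  proof -
   have l: "length (omit i as) = 4" using i as by (simp add: omit_def)
   have "omit i ?vs = map (%i. E i y) (omit i as)" by (simp add: omit_def take_map drop_map)
   then have "nablaT psi4 y (?vs ! i) (omit i ?vs @ []) = cov (fc psi4) (as ! i # omit i as) y"
    using nablaT_frame[OF tensor_psi4 y l, of "as ! i"] i as by simp
   also have "... = cov (%L y. (1 / 6) * ?c L) (as ! i # omit i as) y"
    by (rule cov_cong[OF y l]) (simp add: fc_psi4)
   also have "... = - (1 / 6) * act (%a q. Om (as ! i) a q y) (omit i as) ?c"
    unfolding cov_Cons dE_const act_cmult by simp
   finally show ?thesis .
  qed
  ultimately have "(\<Sum>i<5. (- 1) ^ i * (- (1 / 6) * act (%a q. Om (as ! i) a q y) (omit i as) ?c)) = 0"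
   by (simp add: eval_nat_numeral del: sum.lessThan_Suc)
  then have "- (1 / 6) * (\<Sum>i<5. (- 1) ^ i * act (%a q. Om (as ! i) a q y) (omit i as) ?c) = 0"
   unfolding sum_distrib_left by (simp only: mult.left_commute)
  then show "(\<Sum>i<5. (- 1) ^ i * act (%a q. Om (as ! i) a q y) (omit i as) ?c) = 0" by simp
 qed
qed

end

definition cr :: "nat => nat" where
 "cr k = (if k = 1 \<or> k = 2 then 1 else 0)"

context g2_curvature
begin

lemma contract1: "(\<Sigma> a b. P c a b * (\<Sigma> q. R k a b q * f q)) = 0"
proof -
 have "(\<Sigma> a b. P c a b * (\<Sigma> q. R k a b q * f q)) =
   (\<Sigma> a b q. f q * (P c a b * R k a b q))"
  by (simp add: sum_distrib_left mult_ac)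
 also have "... = (\<Sigma> a q b. f q * (P c a b * R k a b q))"
  by (rule sum.cong[OF refl], rule sum.swap)
 also have "... = (\<Sigma> q a b. f q * (P c a b * R k a b q))" by (rule sum.swap)
 finally show ?thesis by (simp only: sum_distrib_left[symmetric] R_contract mult_zero_right sum.neutral_const)
qed

lemma contract2: "(\<Sigma> a q. R k a a q * f q) = 0"
 by (subst sum.swap) (simp only: sum_distrib_right[symmetric] R_ricci' mult_zero_left sum.neutral_const)

text \<open>The coupling \<open>f\<close> is the antisymmetrised curvature action on a covector, by the Bianchi identity.\<close>

lemma sigma_curv:
 "(\<Sigma> j. R u k v j * f j) - (\<Sigma> j. R v k u j * f j) = (\<Sigma> j. R j k v u * f j)"
 unfolding sum_subtractf[symmetric]
proof (rule sum.cong[OF refl])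
 fix j
 have "R u k v j - R v k u j = R j k v u"
  using R_pair[of u k v j] R_pair[of v k u j] R_bianchi[of j v k u] R_pair[of j u k v]
   R_swap[of v j u k] R_swap[of u j v k] R_swap[of v k j u] R_swap[of j k v u] R_skew'[of j v u k] R_skew'[of j u v k]
  by linarith
 then show "R u k v j * f j - R v k u j * f j = R j k v u * f j" by (simp flip: left_diff_distrib)
qed

text \<open>
 Two of the sums are Ricci contractions. The others combine by the Bianchi identity.
\<close>

lemma beta_curv:
 "(\<Sigma> j. (\<Sigma> q. R j a z q * F q j) + (\<Sigma> q. R j a j q * F z q)
   - (\<Sigma> q. R j a j q * F q z) - (\<Sigma> q. R j a z q * F j q)) =
  - (\<Sigma> u v. R z a v u * F v u)"
proof -
 have c: "(\<Sigma> j q. R j a j q * h q) = 0" for h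
  by (subst sum.swap) (simp only: sum_distrib_right[symmetric] R_ricci' mult_zero_left sum.neutral_const)
 have "(\<Sigma> u v. R z a v u * F v u) =
   (\<Sigma> u v. R v a z u * F v u) - (\<Sigma> u v. R u a z v * F v u)"
  unfolding sum_subtractf[symmetric]
 proof (intro sum.cong refl)
  fix u v
  have "R z a v u = R v a z u - R u a z v"
   using R_bianchi[of z a v u] R_pair[of u a z v] R_skew'[of z v u a] R_swap[of z v a u] R_swap[of v a z u]
    by linarith
  then show "R z a v u * F v u = R v a z u * F v u - R u a z v * F v u" by (simp flip: left_diff_distrib)
 qed
 moreover have "(\<Sigma> u v. R v a z u * F v u) = (\<Sigma> v u. R v a z u * F v u)"
  by (rule sum.swap)
 ultimately show ?thesis by (simp add: sum.distrib sum_subtractf c)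
qed

end

section \<open>The Ricci identity\<close>

context g2frame
begin

definition Rm :: "7 => 7 => 7 => 7 => 'y => real" where
 "Rm i j a q y = g y (E q y) (curvF (E i) (E j) (E a) y)"

lemma nab_sum_left:
 assumes y: "y \<in> U" and Z: "smv y Z"
 shows "finite I ==> nab (%z. \<Sum>q\<in>I. r q *\<^sub>R E q z) Z y = (\<Sum>q\<in>I. r q *\<^sub>R nab (E q) Z y)"
proof (induction I rule: finite_induct)
 case empty
 have "nab (%z. 0 *\<^sub>R E 0 z) Z y = 0 *\<^sub>R nab (E 0) Z y"
  by (rule nab_scale_left[OF smf_const E_smv[OF y] Z])
 then show ?case by simp
next
 case (insert q I)
 have "smv y (%z. r q *\<^sub>R E q z)" "smv y (%z. \<Sum>q\<in>I. r q *\<^sub>R E q z)"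
  by (intro smv_sum smv_scale smf_const E_smv y)+
 then show ?case using insert nab_scale_left[OF smf_const E_smv[OF y] Z] nab_add_left[OF _ _ Z] by simp
qed

lemma nab_nab_E:
 assumes y: "y \<in> U"
 shows "g y (E p y) (nab (E i) (nab (E j) (E a)) y) =
  dE i (Om j a p) y + (\<Sigma> q. Om j a q y * Om i q p y)"
proof -
 have s: "smv y (%z. Om j a q z *\<^sub>R E q z)" for q
  by (intro smv_scale E_smv y smUD[OF smU_Om y])
 have "nab (E i) (nab (E j) (E a)) y = nab (E i) (%z. \<Sigma> q. Om j a q z *\<^sub>R E q z) y"
  by (rule nab_cong[OF E_smv[OF y] smv_nab[OF E_smv[OF y] E_smv[OF y]]])
    (rule eventually_mono[OF eventually_U[OF y]], rule nab_E)
 also have "... = (\<Sigma> q. dE i (Om j a q) y *\<^sub>R E q y + Om j a q y *\<^sub>R nab (E i) (E q) y)"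
  using nab_sum_right[where I = UNIV and x = y and X = "E i", OF finite E_smv[OF y] s]
  by (simp add: nab_scale_right[OF smUD[OF smU_Om y] E_smv[OF y] E_smv[OF y]] dE_def)
 finally show ?thesis
  by (simp add: sum.distrib linear_add[OF g_linear(1)] g_sum_right g_E[OF y] Om_def[of i _ p])
qed

lemma Rm_formula:
 assumes y: "y \<in> U"
 shows "Rm i j a p y = dE i (Om j a p) y - dE j (Om i a p) y
  + (\<Sigma> q. Om j a q y * Om i q p y - Om i a q y * Om j q p y)
  - (\<Sigma> r. (Om i j r y - Om j i r y) * Om r a p y)"
proof -
 have "nab (lie_bracket A (E i) (E j)) (E a) y = nab (%z. \<Sigma> q. (Om i j q y - Om j i q y) *\<^sub>R E q z) (E a) y"
 proof (rule nab_value[OF smv_lie_bracket[OF E_smv[OF y] E_smv[OF y]] _ _ E_smv[OF y]])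
  show "smv y (%z. \<Sigma> q. (Om i j q y - Om j i q y) *\<^sub>R E q z)"
   by (intro smv_sum smv_scale smf_const E_smv y)
  show "lie_bracket A (E i) (E j) y = (\<Sigma> q. (Om i j q y - Om j i q y) *\<^sub>R E q y)"
   using lie_bracket_value[OF E_smv[OF y] E_smv[OF y], of i j]
   by (simp add: nab_E[OF y] scaleR_left_diff_distrib sum_subtractf)
 qed
 also have "... = (\<Sigma> q. (Om i j q y - Om j i q y) *\<^sub>R nab (E q) (E a) y)"
  by (rule nab_sum_left[OF y E_smv[OF y] finite])
 finally have b: "g y (E p y) (nab (lie_bracket A (E i) (E j)) (E a) y) =
   (\<Sigma> r. (Om i j r y - Om j i r y) * Om r a p y)"
  by (simp add: g_sum_right Om_def[of _ a p])
 show ?thesis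
  by (simp add: Rm_def curvF_def linear_diff[OF g_linear(1)] nab_nab_E[OF y] b sum_subtractf)
qed

lemma cov_cov:
 assumes t: "smt n t" and l: "length is = n" and y: "y \<in> U"
 shows "cov (cov t) (i # j # is) y = dE i (dE j (t is)) y - act (%a q. dE i (Om j a q) y) is (%js. t js y)
  - act (%a q. Om j a q y) is (%js. dE i (t js) y) - (\<Sigma> q. Om i j q y * cov t (q # is) y)
  - act (%a q. Om i a q y) is (%js. dE j (t js) y)
  + act (%a q. Om i a q y) is (%js. act (%a q. Om j a q y) js (%ks. t ks y))"
proof -
 have ti: "smU (t is)" using t l by (simp add: smt_def)
 have "dE i (cov t (j # is)) y = dE i (dE j (t is)) y -
   (act (%a q. dE i (Om j a q) y) is (%js. t js y) + act (%a q. Om j a q y) is (%js. dE i (t js) y))"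
  unfolding cov_Cons[abs_def]
  using dE_rules(2)[OF y smU_dE[OF ti] smU_act[OF smU_Om t l]] dE_act[OF smU_Om y t l] by simp
 then show ?thesis
  by (subst cov_Cons) (simp add: cov_Cons[of t j] act_diff)
qed

text \<open>
 The second derivatives of the components cancel except for the bracket of the frame fields, which
 the torsion-free connection expresses by \<open>Om\<close>. The remaining terms are those of \<open>Rm_formula\<close>.
\<close>

lemma ricci_identity:
 assumes t: "smt n t" and l: "length is = n" and y: "y \<in> U"
 shows "cov (cov t) (i # j # is) y - cov (cov t) (j # i # is) y =
  - act (%a q. Rm i j a q y) is (%js. t js y)"
proof -
 let ?t = "%js. t js y"
 let ?T = "%q. Om i j q y - Om j i q y"
 have ti: "smU (t is)" using t l by (simp add: smt_def)
 have R: "act (%a q. Rm i j a q y) is ?t =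
   act (%a q. dE i (Om j a q) y) is ?t - act (%a q. dE j (Om i a q) y) is ?t
   - act (%a q. \<Sigma> p. Om i a p y * Om j p q y - Om j a p y * Om i p q y) is ?t
   - (\<Sigma> r. ?T r * act (%a q. Om r a q y) is ?t)"
 proof -
  have "Rm i j a q y = ((dE i (Om j a q) y - dE j (Om i a q) y)
    - (\<Sigma> p. Om i a p y * Om j p q y - Om j a p y * Om i p q y)) - (\<Sigma> r. ?T r * Om r a q y)" for a q
   unfolding Rm_formula[OF y] by (simp add: sum_subtractf)
  then show ?thesis
   by (simp only: act_diff_left act_sum_left[OF finite] act_cmult_left)
 qed
 have C: "act (%a q. Om i a q y) is (%js. act (%a q. Om j a q y) js ?t) -
   act (%a q. Om j a q y) is (%js. act (%a q. Om i a q y) js ?t) =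
   act (%a q. \<Sigma> p. Om i a p y * Om j p q y - Om j a p y * Om i p q y) is ?t"
  by (rule act_commutator)
 have D: "(\<Sigma> q. Om i j q y * cov t (q # is) y) - (\<Sigma> q. Om j i q y * cov t (q # is) y) =
   (\<Sigma> q. ?T q * dE q (t is) y) - (\<Sigma> q. ?T q * act (%a p. Om q a p y) is ?t)"
  by (simp add: cov_Cons sum_subtractf[symmetric] algebra_simps)
 show ?thesis
  unfolding cov_cov[OF t l y] R using C D dE_commutator[OF y ti, of i j] by linarith
qed

text \<open>
 Curvature annihilates parallel tensors; here the components are constant in the frame.
\<close>

lemma parallel_act_Rm:
 assumes "\<And>L z. length L = Suc n ==> z \<in> U ==> cov (%L y. t L) L z = 0" "length is = n" "y \<in> U"
 shows "act (%a q. Rm i j a q y) is t = 0"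
proof -
 have s: "smt n (%L y. t L)" by (simp add: smt_def smU_rules)
 have "cov (cov (%L y. t L)) (i # j # is) y = 0" for i j
 proof -
  have "cov (cov (%L y. t L)) (i # j # is) y = cov (%L y. 0) (i # j # is) y"
   by (rule cov_cong[where n = "Suc n"]) (use assms in auto)
  then show ?thesis by (simp add: cov_Cons[of "%L y. 0"] dE_const act_zero del: act.simps)
 qed
 then show ?thesis using ricci_identity[OF s assms(2,3), of i j] by simp
qed

text \<open>
 The metric and the three-form are parallel with constant components.
\<close>

lemma curvature_g2: assumes y: "y \<in> U" shows "g2_curvature (%i j a q. Rm i j a q y)"
proof
 fix i j
 show "skew (%a q. Rm i j a q y)" unfolding skew_def
 proof (intro allI)
  fix a q
  have "cov (%L y. kd (L ! 0) (L ! 1)) L z = 0" if l: "length L = Suc 2" and z: "z \<in> U" for L z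
  proof -
   obtain k a b where L: "L = [k, a, b]" using l unfolding numeral_2_eq_2 by (auto simp: length_Suc_conv)
   show ?thesis using skewD[OF Om_skew[OF z], of k a b] by (simp add: L cov_Cons dE_const)
  qed
  then have "act (%a q. Rm i j a q y) [a, q] (%L. kd (L ! 0) (L ! 1)) = 0"
   by (rule parallel_act_Rm) (use y in auto)
  then show "Rm i j a q y = - Rm i j q a y" by simp
 qed
 fix a q
 show "Rm j i a q y = - Rm i j a q y"
  using curvF_swap[OF E_smv[OF y] E_smv[OF y] E_smv[OF y], of j i a]
  by (simp add: Rm_def linear_neg[OF g_linear(1)])
 show "Rm i j a q y + Rm j a i q y + Rm a i j q y = 0"
 proof -
  have "g y (E q y) (curvF (E i) (E j) (E a) y + curvF (E j) (E a) (E i) y + curvF (E a) (E i) (E j) y) = 0"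
   using bianchi[OF E_smv[OF y] E_smv[OF y] E_smv[OF y], of i j a] linear_0[OF g_linear(1)] by simp
  then show ?thesis by (simp add: Rm_def linear_add[OF g_linear(1)])
 qed
 fix b c
 have "cov (%L y. PL L) L z = 0" if l: "length L = Suc 3" and z: "z \<in> U" for L z
 proof -
  obtain k a b c where L: "L = [k, a, b, c]" using l unfolding numeral_3_eq_3 by (auto simp: length_Suc_conv)
  show ?thesis unfolding L using Om_stab[OF z] by (simp only: cov_Cons dE_const act_PL diff_0 minus_zero)
 qed
 then have "act (%a q. Rm i j a q y) [a, b, c] PL = 0"
  by (rule parallel_act_Rm) (use y in auto)
 then show "stab (%a q. Rm i j a q y) a b c = 0" by (simp only: act_PL)
qed

section \<open>The canonical complex in an adapted frame\<close>

text \<open>Contraction of the first two indices with the three-form and with the metric.\<close>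

definition KP :: "(7 list => 'y => real) => 7 list => 'y => real" where
 "KP t L y = (\<Sigma> a b. P (hd L) a b * t (a # b # tl L) y)"

definition KT :: "(7 list => 'y => real) => 7 list => 'y => real" where
 "KT t L y = (\<Sigma> a. t (a # a # L) y)"

lemma smt_KP: "smt (Suc (Suc n)) t ==> smt (Suc n) (KP t)"
 unfolding smt_def KP_def[abs_def] by (auto intro!: smU_rules)

lemma smt_KT: "smt (Suc (Suc n)) t ==> smt n (KT t)"
 unfolding smt_def KT_def[abs_def] by (auto intro!: smU_rules)

lemma cov_KP:
 assumes t: "smt (Suc (Suc n)) t" and l: "length is = n" and y: "y \<in> U"
 shows "cov (KP t) (k # c # is) y = (\<Sigma> a b. P c a b * cov t (k # a # b # is) y)"
proof -
 have s: "smU (t (a # b # is))" for a b using t l by (simp add: smt_def)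
 have "dE k (KP t (c # is)) y = (\<Sigma> a b. P c a b * dE k (t (a # b # is)) y)"
  unfolding KP_def[abs_def] using s by (simp add: dE_sum[OF y] dE_cmult[OF y] smU_rules)
 moreover have "act (%a q. Om k a q y) (c # is) (%js. KP t js y) =
   (\<Sigma> a b. P c a b * act (%a q. Om k a q y) (a # b # is) (%js. t js y))"
  unfolding KP_def[abs_def] by (rule act_KP[OF Om_skew[OF y] Om_stab[OF y]])
 ultimately show ?thesis by (simp add: cov_Cons sum_subtractf right_diff_distrib del: act.simps)
qed

lemma cov_KT:
 assumes t: "smt (Suc (Suc n)) t" and l: "length is = n" and y: "y \<in> U"
 shows "cov (KT t) (k # is) y = (\<Sigma> a. cov t (k # a # a # is) y)"
proof -
 have s: "smU (t (a # a # is))" for a using t l by (simp add: smt_def)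
 have "dE k (KT t is) y = (\<Sigma> a. dE k (t (a # a # is)) y)"
  unfolding KT_def[abs_def] using s by (simp add: dE_sum[OF y])
 moreover have "act (%a q. Om k a q y) is (%js. KT t js y) =
   (\<Sigma> a. act (%a q. Om k a q y) (a # a # is) (%js. t js y))"
  unfolding KT_def[abs_def] by (rule act_KT[OF Om_skew[OF y]])
 ultimately show ?thesis by (simp add: cov_Cons sum_subtractf del: act.simps)
qed

text \<open>
 The projected exterior product with a one-form, in the canonical coordinates: a canonical \<open>p\<close>-form
 is given by a scalar for \<open>p = 0, 3\<close> and by a vector for \<open>p = 1, 2\<close>. The first index of the argument
 is that of the one-form. For a covariant derivative these are gradient, curl and divergence.
\<close>

definition Sy :: "nat => (7 list => 'y => real) => 7 list => 'y => real" where
 "Sy p t L y = (if p = 0 then t L y else if p = 1 then (1/3) * KP t L y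
   else if p = 2 then (3/7) * KT t L y else 0)"

lemma cov_Sy1:
 assumes "smt (Suc (Suc n)) t" "length is = n" "y \<in> U"
 shows "cov (Sy 1 t) (k # c # is) y = (1/3) * (\<Sigma> a b. P c a b * cov t (k # a # b # is) y)"
proof -
 have "Sy 1 t = (%L y. (1/3) * KP t L y)" by (simp add: Sy_def fun_eq_iff)
 then show ?thesis
  using cov_linear(3)[OF assms(3) smt_KP[OF assms(1)] smt_KP[OF assms(1)], of "c # is" "1/3" k]
   cov_KP[OF assms] assms by simp
qed

lemma cov_Sy2:
 assumes "smt (Suc (Suc n)) t" "length is = n" "y \<in> U"
 shows "cov (Sy 2 t) (k # is) y = (3/7) * (\<Sigma> a. cov t (k # a # a # is) y)"
proof -
 have "Sy 2 t = (%L y. (3/7) * KT t L y)" by (simp add: Sy_def fun_eq_iff)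
 then show ?thesis
  using cov_linear(3)[OF assms(3) smt_KT[OF assms(1)] smt_KT[OF assms(1)], of "is" "3/7" k]
   cov_KT[OF assms] assms by simp
qed

lemma smt_Sy:
 "smt (Suc n) t ==> smt (Suc n) (Sy 0 t)" "smt (Suc (Suc n)) t ==> smt (Suc n) (Sy 1 t)"
 "smt (Suc (Suc n)) t ==> smt n (Sy 2 t)"
proof -
 show "smt (Suc n) t ==> smt (Suc n) (Sy 0 t)" by (simp add: Sy_def[abs_def] smt_def)
 assume t: "smt (Suc (Suc n)) t"
 show "smt (Suc n) (Sy 1 t)" "smt n (Sy 2 t)"
  using smt_KP[OF t] smt_KT[OF t] smU_rules(4)[OF smU_rules(1), of _ "1/3"] smU_rules(4)[OF smU_rules(1), of _ "3/7"]
  by (auto simp: Sy_def[abs_def] smt_def)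
qed

text \<open>\<open>curl grad = 0\<close> and \<open>div curl = 0\<close>, as the curvature is in \<open>\<Lambda>\<^sup>2\<^sub>1\<^sub>4\<close> in both pairs of indices.\<close>

lemma P_antisym_sum:
 "(\<Sigma> a b. P c a b * f a b) = (1/2) * (\<Sigma> a b. P c a b * (f a b - f b a))"
proof -
 have "(\<Sigma> a b. P c a b * f b a) = (\<Sigma> a b. - (P c a b * f a b))"
 proof (subst sum.swap, intro sum.cong refl)
  fix a b show "P c b a * f a b = - (P c a b * f a b)" using P_swap23[of c a b] by simp
 qed
 then show ?thesis by (simp add: right_diff_distrib sum_subtractf sum_negf)
qed

lemma curl_grad:
 assumes t: "smt n t" and l: "length is = n" and y: "y \<in> U"
 shows "Sy 1 (cov (Sy 0 (cov t))) (c # is) y = 0"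
proof -
 interpret R: g2_curvature "%i j a q. Rm i j a q y" by (rule curvature_g2[OF y])
 have "Sy 0 (cov t) = cov t" by (simp add: Sy_def fun_eq_iff)
 then have "Sy 1 (cov (Sy 0 (cov t))) (c # is) y =
   (1/3) * (\<Sigma> a b. P c a b * cov (cov t) (a # b # is) y)"
  by (simp add: Sy_def KP_def)
 also have "... = (1/6) * (\<Sigma> a b. P c a b * - act (%i q. Rm a b i q y) is (%js. t js y))"
  by (subst P_antisym_sum) (simp add: ricci_identity[OF t l y])
 also have "(\<Sigma> a b. P c a b * - act (%i q. Rm a b i q y) is (%js. t js y)) =
   - act (%i q. \<Sigma> a b. P c a b * Rm a b i q y) is (%js. t js y)"
  by (simp add: act_sum_left act_cmult_left sum_negf)
 finally show ?thesis by (simp add: R.R_tau' act_zero_left)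
qed

lemma div_curl:
 assumes t: "smt (Suc n) t" and l: "length is = n" and y: "y \<in> U"
 shows "Sy 2 (cov (Sy 1 (cov t))) is y = 0"
proof -
 interpret R: g2_curvature "%i j a q. Rm i j a q y" by (rule curvature_g2[OF y])
 have "Sy 2 (cov (Sy 1 (cov t))) is y =
   (1/7) * (\<Sigma> c a b. P c a b * cov (cov t) (c # a # b # is) y)"
  by (simp add: Sy_def[of 2] KT_def cov_Sy1[OF smt_cov[OF t] l y] del: One_nat_def flip: sum_distrib_left sum_divide_distrib)
 also have "(\<Sigma> c a b. P c a b * cov (cov t) (c # a # b # is) y) =
   (\<Sigma> b c a. P b c a * cov (cov t) (c # a # b # is) y)"
 proof -
  have "P b c a = P c a b" for a b c using P_cyclic[of c a b] by simp
  then have "(\<Sigma> c a b. P c a b * cov (cov t) (c # a # b # is) y) =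
    (\<Sigma> c a b. P b c a * cov (cov t) (c # a # b # is) y)" by simp
  also have "... = (\<Sigma> c b a. P b c a * cov (cov t) (c # a # b # is) y)"
   by (rule sum.cong[OF refl], rule sum.swap)
  also have "... = (\<Sigma> b c a. P b c a * cov (cov t) (c # a # b # is) y)"
   by (rule sum.swap)
  finally show ?thesis .
 qed
 also have "... = (\<Sigma> b. (1/2) * (\<Sigma> c a. P b c a * - act (%i q. Rm c a i q y) (b # is) (%js. t js y)))"
  by (subst P_antisym_sum) (use l in "simp add: ricci_identity[OF t _ y] del: act.simps")
 also have "... = (\<Sigma> b. (1/2) * - act (%i q. \<Sigma> c a. P b c a * Rm c a i q y) (b # is) (%js. t js y))"
  by (simp add: act_sum_left act_cmult_left sum_negf del: act.simps)
 finally show ?thesis by (simp add: R.R_tau' act_zero_left del: act.simps)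
qed

subsection \<open>Homotopies\<close>

text \<open>
 The homotopies and couplings on index tensors. The value indices come last; \<open>f_ix\<close>, \<open>b_ix\<close> and
 \<open>c_ix\<close> are the couplings before the projected exterior product, with the index of the one-form in
 front. The homotopies are applied to the covariant derivative.
\<close>

definition sigma_ix :: "(7 list => 'y => real) => 7 list => 'y => real" where
 "sigma_ix N L y = N (last L # butlast L) y - N (last (butlast L) # butlast (butlast L) @ [last L]) y"

definition beta_ix :: "(7 list => 'y => real) => 7 list => 'y => real" where
 "beta_ix N L y = (1/4) * (\<Sigma> j. N (j # butlast L @ [j, last L]) y - N (j # L @ [j]) y)"

definition f_ix :: "(7 list => 'y => real) => 7 list => 'y => real" where
 "f_ix M L y = (\<Sigma> j. Rm j (hd L) (last L) (last (butlast L)) y * M (butlast (butlast (tl L)) @ [j]) y)"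

definition b_ix :: "(7 list => 'y => real) => 7 list => 'y => real" where
 "b_ix N L y = - (1/4) * (\<Sigma> u v. Rm (last L) (hd L) v u y * N (butlast (tl L) @ [v, u]) y)"

definition c_ix :: "(7 list => 'y => real) => 7 list => 'y => real" where
 "c_ix N L y = - (1/2) * (\<Sigma> u v. Rm (last L) (hd L) v u y * N (v # butlast (tl L) @ [u]) y)"

lemma b_sigma_ix:
 assumes y: "y \<in> U"
 shows "b_ix (sigma_ix N) (k # I @ [z]) y = - c_ix N (k # I @ [z]) y"
proof -
 interpret R: g2_curvature "%i j a q. Rm i j a q y" by (rule curvature_g2[OF y])
 have "(\<Sigma> u v. Rm z k v u y * N (u # I @ [v]) y) =
   (\<Sigma> u v. - (Rm z k v u y * N (v # I @ [u]) y))"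
 proof (subst sum.swap, intro sum.cong refl)
  fix u v show "Rm z k u v y * N (v # I @ [u]) y = - (Rm z k v u y * N (v # I @ [u]) y)"
   using R.R_skew'[of z k u v] by simp
 qed
 then show ?thesis
  by (simp add: b_ix_def c_ix_def sigma_ix_def butlast_append right_diff_distrib sum_subtractf sum_negf)
qed

lemma cov_sigma_ix:
 assumes N: "smt (length I + 2) N" and I: "length I \<le> 1" and y: "y \<in> U"
 shows "cov (sigma_ix N) (a # I @ [u, v]) y = cov N (a # v # I @ [u]) y - cov N (a # u # I @ [v]) y"
proof -
 have s: "smU (N (v # I @ [u]))" for u v using N by (simp add: smt_def)
 consider "I = []" | c where "I = [c]" using I by (cases I) auto
 then show ?thesis
  using dE_rules(2)[OF y s s, of a v u u v]
  by cases (simp_all add: cov_Cons sigma_ix_def[abs_def] right_diff_distrib sum_subtractf algebra_simps)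
qed

lemma cov_beta_ix:
 assumes N: "smt (length I + 3) N" and I: "length I \<le> 1" and y: "y \<in> U"
 shows "cov (beta_ix N) (a # I @ [z]) y =
  (1/4) * (\<Sigma> j. cov N (a # j # I @ [j, z]) y - cov N (a # j # I @ [z, j]) y)"
proof -
 have s: "smU (N (j # I @ [j, z]))" "smU (N (j # I @ [z, j]))" for j z using N by (simp_all add: smt_def)
 have d: "dE a (%y. (1/4) * (\<Sigma> j. N (j # I @ [j, z]) y - N (j # I @ [z, j]) y)) y =
   (1/4) * (\<Sigma> j. dE a (N (j # I @ [j, z])) y - dE a (N (j # I @ [z, j])) y)" for z
  by (subst dE_cmult[OF y smU_rules(5)[OF smU_rules(3)[OF s]]])
    (simp add: dE_sum[OF y smU_rules(3)[OF s]] dE_rules(2)[OF y s])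
 have sk: "(\<Sigma> j q. Om a j q y * F q j) = - (\<Sigma> j q. Om a j q y * F j q)" for F
 proof -
  have "(\<Sigma> j q. Om a j q y * F q j) = (\<Sigma> j q. - (Om a j q y * F j q))"
  proof (subst sum.swap, intro sum.cong refl)
   fix j q show "Om a q j y * F j q = - (Om a j q y * F j q)"
    using skewD[OF Om_skew[OF y], of a q j] by simp
  qed
  then show ?thesis by (simp add: sum_negf)
 qed
 have sw: "(\<Sigma> q. Om a x q y * (\<Sigma> j. F q j)) = (\<Sigma> j q. Om a x q y * F q j)"
  for x and F :: "7 => 7 => real"
  unfolding sum_distrib_left by (rule sum.swap)
 consider "I = []" | c where "I = [c]" using I by (cases I) auto
 then show ?thesis
 proof cases
  case 1
  show ?thesis
   using d sk[of "%q j. N [q, j, z] y"] sk[of "%q j. N [q, z, j] y"]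
   by (simp add: 1 cov_Cons beta_ix_def[abs_def] sum_subtractf sum.distrib right_diff_distrib sw
     sum_distrib_left[symmetric] mult.left_commute[of _ "1/4"] sum_divide_distrib[symmetric])
 next
  case 2
  show ?thesis
   using d sk[of "%q j. N [q, c, j, z] y"] sk[of "%q j. N [q, c, z, j] y"]
   by (simp add: 2 cov_Cons beta_ix_def[abs_def] sum_subtractf sum.distrib right_diff_distrib sw
     sum_distrib_left[symmetric] mult.left_commute[of _ "1/4"] sum_divide_distrib[symmetric] add_divide_distrib)
 qed
qed

text \<open>
 The symbol of the differential: a canonical form of degree \<open>p \<le> 2\<close> has \<open>cr p\<close> coordinate
 indices \<open>b\<close>, and \<open>a\<close> is the index of the one-form.
\<close>

definition Sw :: "nat => 7 list => 7 => 7 list => real" where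
 "Sw p I a b = (if p = 0 then kd (hd I) a else if p = 1 then (1/3) * P (hd I) a (hd b) else (3/7) * kd a (hd b))"

lemma Sy_expand:
 assumes p: "p \<le> 2" and I: "length I = cr (Suc p)"
 shows "Sy p t (I @ J) y = (\<Sigma> a. \<Sum>b | length b = cr p. Sw p I a b * t (a # b @ J) y)"
proof -
 consider "p = 0" | "p = 1" | "p = 2" using p by linarith
 then show ?thesis
 proof cases
  case 3
  have "(\<Sigma> a b. (3/7) * kd a b * t (a # b # J) y) = (\<Sigma> a. (3/7) * t (a # a # J) y)"
   unfolding mult.assoc sum_distrib_left[symmetric] by simp
  then show ?thesis using 3 I
   by (simp add: cr_def Sy_def KT_def Sw_def sum_lists_Suc sum_lists_0 sum_distrib_left)
 next
  case 1
  then obtain c where "I = [c]" using I by (auto simp: cr_def length_Suc_conv)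
  then show ?thesis using 1 by (simp add: cr_def Sy_def Sw_def sum_lists_0)
 next
  case 2
  then obtain c where "I = [c]" using I by (auto simp: cr_def length_Suc_conv)
  then show ?thesis using 2
   by (simp add: cr_def Sy_def KP_def Sw_def sum_lists_Suc sum_lists_0 sum_distrib_left)
 qed
qed

lemma cov_Sy:
 assumes t: "smt (Suc (cr p + n)) t" and p: "p \<le> 2" and I: "length I = cr (Suc p)" and J: "length J = n" and y: "y \<in> U"
 shows "cov (Sy p t) (k # I @ J) y = Sy p (%L. cov t (k # L)) (I @ J) y"
proof -
 consider "p = 0" | "p = 1" | "p = 2" using p by linarith
 then show ?thesis
 proof cases
  case 1
  have "Sy 0 u = u" for u by (simp add: Sy_def fun_eq_iff)
  then show ?thesis using 1 by simp
 next
  case 2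
  then obtain c where "I = [c]" using I by (auto simp: cr_def length_Suc_conv)
  moreover have "smt (Suc (Suc n)) t" using t 2 by (simp add: cr_def)
  ultimately show ?thesis using cov_Sy1[of n t J y k c] J y 2 by (simp add: Sy_def[of 1 "%L. cov t (k # L)"] KP_def del: One_nat_def)
 next
  case 3
  then have "I = []" "smt (Suc (Suc n)) t" using t I by (auto simp: cr_def)
  then show ?thesis using cov_Sy2[of n t J y k] J y 3 by (simp add: Sy_def[of 2 "%L. cov t (k # L)"] KT_def)
 qed
qed

lemma Sw_contract:
 assumes p: "p \<le> 2" and I: "length I = cr (Suc p)" and y: "y \<in> U"
 shows "(\<Sigma> a. \<Sum>b | length b = cr p. Sw p I a b * act (%i q. Rm k a i q y) b F) = 0"
proof -
 interpret R: g2_curvature "%i j a q. Rm i j a q y" by (rule curvature_g2[OF y])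
 consider "p = 0" | "p = 1" | "p = 2" using p by linarith
 then show ?thesis
 proof cases
  case 2
  then obtain c where "I = [c]" using I by (auto simp: cr_def length_Suc_conv)
  then show ?thesis using 2 R.contract1[of c k "%q. F [q]"]
   by (simp add: cr_def Sw_def sum_lists_Suc sum_lists_0 mult.assoc flip: sum_distrib_left sum_divide_distrib)
 next
  case 3
  have "(\<Sigma> a b. (3/7) * kd a b * (\<Sigma> q. Rm k a b q y * F [q])) =
    (3/7) * (\<Sigma> a q. Rm k a a q y * F [q])"
   unfolding mult.assoc sum_distrib_left[symmetric] by simp
  then show ?thesis using 3 R.contract2[of k "%q. F [q]"]
   by (simp add: cr_def Sw_def sum_lists_Suc sum_lists_0)
 qed (simp add: cr_def sum_lists_0)
qed

text \<open>
 Both terms on the right contract second covariant derivatives of \<open>M\<close>, in opposite orders. The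
 curvature on the form index vanishes by \<open>Sw_contract\<close>, that on the value index is \<open>sigma_curv\<close>.
\<close>

lemma f_homotopy:
 assumes M: "smt (cr p + 1) M" and p: "p \<le> 2" and I: "length I = cr (Suc p)" and y: "y \<in> U"
 shows "Sy p (f_ix M) (I @ [u, v]) y =
  sigma_ix (cov (Sy p (cov M))) (I @ [u, v]) y - Sy p (cov (sigma_ix (cov M))) (I @ [u, v]) y"
proof -
 interpret R: g2_curvature "%i j a q. Rm i j a q y" by (rule curvature_g2[OF y])
 note sM = smt_cov[OF M, simplified]
 let ?C = "cov (cov M)" and ?A = "%k a. act (%i q. Rm k a i q y)"
 have w: "Sw p I a b * f_ix M (a # b @ [u, v]) y = Sw p I a b * ?C (v # a # b @ [u]) y - Sw p I a b * ?C (u # a # b @ [v]) y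
   - Sw p I a b * cov (sigma_ix (cov M)) (a # b @ [u, v]) y
   + Sw p I a b * ?A v a b (%b. M (b @ [u]) y) - Sw p I a b * ?A u a b (%b. M (b @ [v]) y)"
  if b: "length b = cr p" for a b
 proof -
  have l: "length b \<le> 1" using b by (simp add: cr_def)
  have "smt (length b + 2) (cov M)" using sM b by simp
  note s = cov_sigma_ix[OF this l y, of a u v]
  have "f_ix M (a # b @ [u, v]) y = ?C (v # a # b @ [u]) y - ?C (u # a # b @ [v]) y
   - cov (sigma_ix (cov M)) (a # b @ [u, v]) y + ?A v a b (%b. M (b @ [u]) y) - ?A u a b (%b. M (b @ [v]) y)"
   using ricci_identity[OF M, of "b @ [u]" y v a] ricci_identity[OF M, of "b @ [v]" y u a] y b
    R.sigma_curv[of u a v "%j. M (b @ [j]) y"]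
   unfolding s by (simp add: f_ix_def butlast_append act_append)
  then show ?thesis by (simp only: distrib_left right_diff_distrib)
 qed
 have e: "cov (Sy p (cov M)) (k # I @ [l]) y = (\<Sigma> a. \<Sum>b | length b = cr p. Sw p I a b * ?C (k # a # b @ [l]) y)" for k l
  using cov_Sy[where n = 1 and t = "cov M", OF _ p I _ y, of "[l]" k] sM Sy_expand[OF p I] by simp
 have "Sy p (f_ix M) (I @ [u, v]) y = cov (Sy p (cov M)) (v # I @ [u]) y - cov (Sy p (cov M)) (u # I @ [v]) y
   - Sy p (cov (sigma_ix (cov M))) (I @ [u, v]) y"
  unfolding e Sy_expand[OF p I] using w Sw_contract[OF p I y]
  by (simp add: sum.distrib sum_subtractf)
 then show ?thesis by (simp add: sigma_ix_def butlast_append)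
qed

text \<open>
 As for \<open>f_homotopy\<close>, with \<open>beta_curv\<close> for the curvature on the two value indices.
\<close>

lemma b_homotopy:
 assumes N: "smt (cr p + 2) N" and p: "p \<le> 2" and I: "length I = cr (Suc p)" and y: "y \<in> U"
 shows "Sy p (b_ix N) (I @ [z]) y =
  beta_ix (cov (Sy p (cov N))) (I @ [z]) y - Sy p (cov (beta_ix (cov N))) (I @ [z]) y"
proof -
 interpret R: g2_curvature "%i j a q. Rm i j a q y" by (rule curvature_g2[OF y])
 note sN = smt_cov[OF N]
 let ?C = "cov (cov N)" and ?A = "%k a. act (%i q. Rm k a i q y)"
 let ?H = "%j b. N (b @ [j, z]) y - N (b @ [z, j]) y"
 have w: "Sw p I a b * b_ix N (a # b @ [z]) y =
   (1/4) * (\<Sigma> j. Sw p I a b * ?C (j # a # b @ [j, z]) y - Sw p I a b * ?C (j # a # b @ [z, j]) y)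
   - Sw p I a b * cov (beta_ix (cov N)) (a # b @ [z]) y + (1/4) * (\<Sigma> j. Sw p I a b * ?A j a b (?H j))"
  if b: "length b = cr p" for a b
 proof -
  have l: "length b \<le> 1" using b by (simp add: cr_def)
  have "smt (length b + 3) (cov N)" using sN b by (simp add: numeral_3_eq_3)
  note s = cov_beta_ix[OF this l y, of a z]
  have j: "?C (j # a # b @ [j, z]) y - ?C (j # a # b @ [z, j]) y
    - (?C (a # j # b @ [j, z]) y - ?C (a # j # b @ [z, j]) y) + ?A j a b (?H j) =
    (\<Sigma> q. Rm j a z q y * N (b @ [q, j]) y) + (\<Sigma> q. Rm j a j q y * N (b @ [z, q]) y)
    - (\<Sigma> q. Rm j a j q y * N (b @ [q, z]) y) - (\<Sigma> q. Rm j a z q y * N (b @ [j, q]) y)" for j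
   using ricci_identity[OF N, of "b @ [j, z]" y j a] ricci_identity[OF N, of "b @ [z, j]" y j a] y b
   by (simp add: act_append act_diff)
  have "b_ix N (a # b @ [z]) y = (1/4) * (\<Sigma> j. ?C (j # a # b @ [j, z]) y - ?C (j # a # b @ [z, j]) y
    - (?C (a # j # b @ [j, z]) y - ?C (a # j # b @ [z, j]) y) + ?A j a b (?H j))"
   unfolding j R.beta_curv[of a z "%u v. N (b @ [u, v]) y"] by (simp add: b_ix_def butlast_append)
  then have "b_ix N (a # b @ [z]) y = (1/4) * (\<Sigma> j. ?C (j # a # b @ [j, z]) y - ?C (j # a # b @ [z, j]) y)
    - cov (beta_ix (cov N)) (a # b @ [z]) y + (1/4) * (\<Sigma> j. ?A j a b (?H j))"
   unfolding s by (simp only: sum.distrib sum_subtractf distrib_left right_diff_distrib)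
  then show ?thesis
   by (simp only: distrib_left right_diff_distrib mult.left_commute[of "Sw p I a b" "1/4"] sum_distrib_left)
 qed
 have e: "cov (Sy p (cov N)) (k # I @ [l, m]) y = (\<Sigma> a. \<Sum>b | length b = cr p. Sw p I a b * ?C (k # a # b @ [l, m]) y)" for k l m
  using cov_Sy[where n = 2 and t = "cov N", OF _ p I _ y, of "[l, m]" k] sN Sy_expand[OF p I] by simp
 have sw: "(\<Sigma> a. \<Sum>b | length b = cr p. \<Sigma> j. F a b j) = (\<Sigma> j a. \<Sum>b | length b = cr p. F a b j)"
  for F :: "7 => 7 list => 7 => real"
  by (rule trans[OF sum.cong[OF refl sum.swap] sum.swap])
 have gen: "(\<Sigma> a. \<Sum>b | length b = cr p. (1/4) * (\<Sigma> j. X a b j) - Y a b + (1/4) * (\<Sigma> j. Z a b j)) =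
   (1/4) * (\<Sigma> j a. \<Sum>b | length b = cr p. X a b j) - (\<Sigma> a. \<Sum>b | length b = cr p. Y a b)
   + (1/4) * (\<Sigma> j a. \<Sum>b | length b = cr p. Z a b j)" for X Y and Z :: "7 => 7 list => 7 => real"
  by (simp only: sum.distrib sum_subtractf sum_distrib_left[symmetric] sw)
 have "Sy p (b_ix N) (I @ [z]) y =
   (1/4) * (\<Sigma> j a. \<Sum>b | length b = cr p. Sw p I a b * ?C (j # a # b @ [j, z]) y - Sw p I a b * ?C (j # a # b @ [z, j]) y)
   - Sy p (cov (beta_ix (cov N))) (I @ [z]) y
   + (1/4) * (\<Sigma> j a. \<Sum>b | length b = cr p. Sw p I a b * ?A j a b (?H j))"
  unfolding Sy_expand[OF p I] by (rule trans[OF _ gen], intro sum.cong refl w) simp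
 then show ?thesis by (simp add: beta_ix_def butlast_append e Sw_contract[OF p I y] sum_subtractf)
qed

end

section \<open>The canonical projections at a point\<close>

text \<open>
 Canonical coordinates of a form with components \<open>w\<close> in an adapted basis: a canonical form of
 degree two or three is recovered from its contraction with the three-form. Further indices, which
 belong to the values, are carried along at the end of the list.
\<close>

definition ccl :: "nat => (7 list => real) => 7 list => real" where
 "ccl k w L = (if k \<le> 1 then w L
   else if k = 2 then (1/6) * (\<Sigma> a b. P (hd L) a b * w (a # b # tl L))
   else if k = 3 then (1/42) * (\<Sigma> a b c. P a b c * w (a # b # c # L))
   else 0)"

lemma ccl_simps:
 "ccl 0 w L = w L" "ccl 1 w L = w L"
 "ccl 2 w L = (1/6) * (\<Sigma> a b. P (hd L) a b * w (a # b # tl L))"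
 "ccl 3 w L = (1/42) * (\<Sigma> a b c. P a b c * w (a # b # c # L))"
 "4 \<le> k ==> ccl k w L = 0"
 by (simp_all add: ccl_def)

lemma degree_cases:
 obtains "k \<le> 1" | "k = (2::nat)" | "k = 3" | "4 \<le> k" by linarith

lemma ccl_cong:
 assumes "\<And>L. length L = k ==> w (L @ J) = w' (L @ J)" "length I = cr k"
 shows "ccl k w (I @ J) = ccl k w' (I @ J)"
proof (cases k rule: degree_cases)
 case 1 then show ?thesis using assms by (auto simp: ccl_def cr_def le_Suc_eq)
next
 case 2
 then obtain c where "I = [c]" using assms(2) by (auto simp: cr_def length_Suc_conv)
 then show ?thesis using 2 assms(1)[of "[_, _]"] by (simp add: ccl_simps)
next
 case 3
 then have "I = []" using assms(2) by (auto simp: cr_def)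
 then show ?thesis using 3 assms(1)[of "[_, _, _]"] by (simp add: ccl_simps)
qed (simp add: ccl_simps)

lemma ccl_tail:
 assumes "length I = cr k" shows "ccl k w (I @ J) = ccl k (%L. w (L @ J)) I"
proof (cases k rule: degree_cases)
 case 2
 then obtain c where "I = [c]" using assms by (auto simp: cr_def length_Suc_conv)
 then show ?thesis using 2 by (simp add: ccl_simps)
qed (auto simp: ccl_def)

lemma ccl_linear:
 "ccl k (%L. w L + w' L) I = ccl k w I + ccl k w' I" "ccl k (%L. r * w L) I = r * ccl k w I"
 "ccl k (%L. w L - w' L) I = ccl k w I - ccl k w' I" "ccl k (%L. 0) I = 0"
 by (auto simp: ccl_def distrib_left right_diff_distrib sum.distrib sum_subtractf mult.left_commute[of _ r]
   simp flip: sum_distrib_left)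

lemma ccl_sum: "finite X ==> ccl k (%L. \<Sum>b\<in>X. w b L) I = (\<Sum>b\<in>X. ccl k (w b) I)"
 by (induction X rule: finite_induct) (simp_all add: ccl_linear)

lemma P_P_P: "(\<Sigma> a b c. P a b c * P a b c) = 42"
 by (simp add: P_P kd_def)

subsection \<open>Forms\<close>

definition pform :: "nat => (vec7 list => real) => bool" where
 "pform p \<omega> \<longleftrightarrow> mlin p \<omega> \<and> (\<forall>vs. length vs \<noteq> p \<longrightarrow> \<omega> vs = 0)"

lemma pform_alt: "p \<le> 1 ==> pform p \<omega> ==> alt_form p \<omega>"
 unfolding pform_def alt_form_def mlin_def by auto

lemma alt_form_pform: "alt_form p \<omega> ==> pform p \<omega>"
 by (auto simp: pform_def alt_form_mlin) (simp add: alt_form_def)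

lemma mlin_comb: "mlin p \<omega> ==> mlin p \<eta> ==> mlin p (%vs. \<omega> vs + r * \<eta> vs)"
 unfolding mlin_def real_scaleR_def[symmetric]
 by (intro allI impI linear_compose_add linear_compose_scale_right) auto

lemma alt_form_zero: "alt_form p (%_. 0)"
 by (simp add: alt_form_def linear_zero)

lemma alt_form_comb:
 assumes "alt_form p \<omega>" "alt_form p \<eta>" shows "alt_form p (%vs. \<omega> vs + r * \<eta> vs)"
proof -
 have "mlin p (%vs. \<omega> vs + r * \<eta> vs)" using assms alt_form_mlin mlin_comb by blast
 then show ?thesis using assms unfolding alt_form_def mlin_def by simp
qed

context g2mfd
begin

definition adapted :: "'y => (7 => vec7) => bool" where
 "adapted x e \<longleftrightarrow> orthonormal x e \<and> (\<forall>i j k. \<phi> x [e i, e j, e k] = P i j k)"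

lemma interior_alt: "alt_form 2 (interior_mult v (\<phi> x))"
 unfolding alt_form_def interior_mult_def
proof (intro conjI allI impI)
 note p = phi_alt[of x, unfolded alt_form_def]
 fix vs :: "vec7 list" and i j :: nat
 show "length vs \<noteq> 2 ==> \<phi> x (v # vs) = 0" using p by simp
 show "linear (%u. \<phi> x (v # vs[i := u]))" if "length vs = 2 \<and> i < 2"
 proof -
  have "linear (%u. \<phi> x ((v # vs)[Suc i := u]))" using p that by (metis One_nat_def Suc_1 Suc_less_eq length_Cons numeral_3_eq_3)
  then show ?thesis by simp
 qed
 show "\<phi> x (v # vs) = 0" if "length vs = 2 \<and> i < j \<and> j < 2 \<and> vs ! i = vs ! j"
 proof -
  have "length (v # vs) = 3 \<and> Suc i < Suc j \<and> Suc j < 3 \<and> (v # vs) ! Suc i = (v # vs) ! Suc j"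
   using that by simp
  then show ?thesis using p by blast
 qed
qed

lemma can_forms_alt: "\<beta> \<in> can_forms \<phi> k x ==> alt_form k \<beta>"
 using interior_alt alt_form_comb[OF alt_form_zero phi_alt[of x]]
 by (cases k rule: degree_cases) (auto simp: can_forms_def alt_form_zero)

lemma can_forms_comb:
 assumes "\<beta> \<in> can_forms \<phi> k x" "\<gamma> \<in> can_forms \<phi> k x"
 shows "(%vs. \<beta> vs + r * \<gamma> vs) \<in> can_forms \<phi> k x"
proof (cases k rule: degree_cases)
 case 1 then show ?thesis using assms alt_form_comb by (simp add: can_forms_def)
next
 case 2
 then obtain v w where v: "\<beta> = interior_mult v (\<phi> x)" "\<gamma> = interior_mult w (\<phi> x)"
  using assms by (auto simp: can_forms_def)
 have "\<beta> vs + r * \<gamma> vs = interior_mult (v + r *\<^sub>R w) (\<phi> x) vs" for vs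
 proof (cases "length vs = 2")
  case True
  have "linear (%u. \<phi> x (u # vs))" using mlin_head[of 2 "\<phi> x" vs] alt_form_mlin[OF phi_alt] True by simp
  from linear_add[OF this] linear_scale[OF this] show ?thesis by (simp add: v interior_mult_def)
 next
  case False then show ?thesis using phi_alt[of x] by (simp add: v interior_mult_def alt_form_def)
 qed
 then show ?thesis using 2 by (auto simp: can_forms_def)
next
 case 3
 then obtain s t where v: "\<beta> = (%vs. s * \<phi> x vs)" "\<gamma> = (%vs. t * \<phi> x vs)"
  using assms by (auto simp: can_forms_def)
 have "(%vs. \<beta> vs + r * \<gamma> vs) = (%vs. (s + r * t) * \<phi> x vs)" by (auto simp: v algebra_simps)
 then show ?thesis using 3 by (auto simp: can_forms_def)
next
 case 4 then show ?thesis using assms by (simp add: can_forms_def)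
qed

lemma can_forms_zero: "(%_. 0) \<in> can_forms \<phi> k x"
proof (cases k rule: degree_cases)
 case 2
 have "(%_. 0) = interior_mult 0 (\<phi> x)"
 proof
  fix vs show "0 = interior_mult 0 (\<phi> x) vs"
  proof (cases "length vs = 2")
   case True
   have "linear (%u. \<phi> x (u # vs))" using mlin_head[of 2 "\<phi> x" vs] alt_form_mlin[OF phi_alt] True by simp
   from linear_0[OF this] show ?thesis by (simp add: interior_mult_def)
  next
   case False then show ?thesis using phi_alt[of x] by (simp add: interior_mult_def alt_form_def)
  qed
 qed
 then show ?thesis using 2 by (auto simp: can_forms_def)
next
 case 3 then show ?thesis by (auto simp: can_forms_def intro: exI[of _ 0])
qed (auto simp: can_forms_def alt_form_zero)

lemma can_forms_sum:
 assumes "finite X" "\<And>b. b \<in> X ==> \<beta> b \<in> can_forms \<phi> k x"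
 shows "(%vs. \<Sum>b\<in>X. r b * \<beta> b vs) \<in> can_forms \<phi> k x"
 using assms
proof (induction X rule: finite_induct)
 case (insert b X)
 then show ?case using can_forms_comb[of "%vs. \<Sum>b\<in>X. r b * \<beta> b vs" k x "\<beta> b" "r b"] by (simp add: add.commute)
qed (simp add: can_forms_zero)

lemma form_inner_basis:
 "orthonormal x e ==> orthonormal x f ==> mlin k \<omega> ==> mlin k \<gamma> ==> form_inner e k \<omega> \<gamma> = form_inner f k \<omega> \<gamma>"
 unfolding form_inner_def by (simp only: orthonormal_lists[of x e f k \<omega> \<gamma>])

lemma form_inner_definite:
 assumes e: "orthonormal x e" and a: "alt_form k \<gamma>" and z: "form_inner e k \<gamma> \<gamma> = 0"
 shows "\<gamma> = (%_. 0)"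
proof
 fix vs
 have "(\<Sum>I | length I = k. \<gamma> (map e I) * \<gamma> (map e I)) = 0" using z by (simp add: form_inner_def)
 then have i: "\<gamma> (map e I) = 0" if "length I = k" for I
  using that sum_nonneg_eq_0_iff[OF finite_lists, of k "%I. \<gamma> (map e I) * \<gamma> (map e I)"] by auto
 show "\<gamma> vs = 0"
 proof (cases "length vs = k")
  case True
  show ?thesis
   by (rule mlin_eq_on_basis[OF e alt_form_mlin[OF a] alt_form_mlin[OF alt_form_zero] _ True]) (rule i)
 next
  case False then show ?thesis using a by (simp add: alt_form_def)
 qed
qed

text \<open>
 The orthogonal projection is characterised in any orthonormal basis; it is unique as the inner
 product is definite on alternating forms.
\<close>

lemma can_proj0_eq:
 assumes e: "orthonormal x e" and w: "mlin k \<omega>" and b: "\<beta> \<in> can_forms \<phi> k x"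
  and o: "\<And>\<gamma>. \<gamma> \<in> can_forms \<phi> k x ==> form_inner e k (%vs. \<omega> vs - \<beta> vs) \<gamma> = 0"
 shows "can_proj0 \<phi> g k x \<omega> = \<beta>"
 unfolding can_proj0_def
proof (rule the_equality)
 have ml: "mlin k (%vs. \<omega> vs - \<beta>' vs)" if "\<beta>' \<in> can_forms \<phi> k x" for \<beta>'
  using mlin_comb[OF w alt_form_mlin[OF can_forms_alt[OF that]], of "-1"] by simp
 have tr: "form_inner (onb g x) k (%vs. \<omega> vs - \<beta>' vs) \<gamma> = form_inner e k (%vs. \<omega> vs - \<beta>' vs) \<gamma>"
  if "\<beta>' \<in> can_forms \<phi> k x" "\<gamma> \<in> can_forms \<phi> k x" for \<beta>' \<gamma>
  by (rule form_inner_basis[OF onb_orthonormal e ml alt_form_mlin[OF can_forms_alt]]) (use that in auto)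
 show "\<beta> \<in> can_forms \<phi> k x \<and>
   (\<forall>\<gamma>\<in>can_forms \<phi> k x. form_inner (onb g x) k (%vs. \<omega> vs - \<beta> vs) \<gamma> = 0)"
  using b o tr[OF b] by simp
 fix \<beta>' assume b': "\<beta>' \<in> can_forms \<phi> k x \<and>
   (\<forall>\<gamma>\<in>can_forms \<phi> k x. form_inner (onb g x) k (%vs. \<omega> vs - \<beta>' vs) \<gamma> = 0)"
 define \<delta> where "\<delta> = (%vs. \<beta>' vs + (-1) * \<beta> vs)"
 have d: "\<delta> \<in> can_forms \<phi> k x" unfolding \<delta>_def using can_forms_comb b b' by blast
 have "form_inner e k \<delta> \<delta> = form_inner e k (%vs. \<omega> vs - \<beta> vs) \<delta> - form_inner e k (%vs. \<omega> vs - \<beta>' vs) \<delta>"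
  unfolding form_inner_def diff_divide_distrib[symmetric] sum_subtractf[symmetric]
  by (simp add: \<delta>_def algebra_simps)
 also have "... = 0" using o[OF d] tr[OF _ d, of \<beta>'] b' d by simp
 finally have "\<delta> = (%_. 0)" by (rule form_inner_definite[OF e can_forms_alt[OF d]])
 then show "\<beta>' = \<beta>" by (auto simp: \<delta>_def fun_eq_iff)
qed

text \<open>The canonical coordinates are the inner products with the canonical forms.\<close>

lemma interior_basis:
 assumes "adapted x e"
 shows "interior_mult v (\<phi> x) [e a, e b] = (\<Sigma> c. g x (e c) v * P c a b)"
proof -
 have l: "linear (%u. \<phi> x (u # [e a, e b]))"
  using mlin_head[of 2 "\<phi> x" "[e a, e b]"] alt_form_mlin[OF phi_alt] by simp
 have "\<phi> x (v # [e a, e b]) = \<phi> x ((\<Sigma> c. g x (e c) v *\<^sub>R e c) # [e a, e b])"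
  using orthonormal_expand[of x e v] assms by (simp add: adapted_def)
 then show ?thesis
  using assms by (simp add: interior_mult_def adapted_def linear_sum[OF l] linear_scale[OF l])
qed

lemma ccl_interior:
 assumes "adapted x e"
 shows "ccl 2 (%L. interior_mult v (\<phi> x) (map e L)) [c] = g x (e c) v"
proof -
 have "(\<Sigma> a b. P c a b * (\<Sigma> d. g x (e d) v * P d a b)) =
   (\<Sigma> a b d. g x (e d) v * (P c a b * P d a b))"
  by (simp add: sum_distrib_left mult_ac)
 also have "... = (\<Sigma> d b a. g x (e d) v * (P c a b * P d a b))" by (rule sum_swap13)
 also have "... = (\<Sigma> d a b. g x (e d) v * (P c a b * P d a b))"
  by (rule sum.cong[OF refl], rule sum.swap)
 also have "... = (\<Sigma> d. g x (e d) v * (6 * kd c d))" by (simp only: sum_distrib_left[symmetric] P_P)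
 also have "... = 6 * g x (e c) v" by (simp add: kd_def if_distrib cong: if_cong)
 finally show ?thesis by (simp add: ccl_simps interior_basis[OF assms])
qed

lemma ccl_phi:
 assumes "adapted x e" shows "ccl 3 (%L. r * \<phi> x (map e L)) [] = r"
 using assms P_P_P by (simp add: ccl_simps adapted_def mult.left_commute[of _ r] flip: sum_distrib_left)

lemma form_inner_canonical:
 assumes e: "adapted x e" and c: "\<gamma> \<in> can_forms \<phi> k x"
  and z: "\<And>I. length I = cr k ==> ccl k (%L. \<omega> (map e L)) I = 0"
 shows "form_inner e k \<omega> \<gamma> = 0"
proof (cases k rule: degree_cases)
 case 1
 then have "\<omega> (map e I) = 0" if "length I = k" for I
  using z[of I] that by (auto simp: ccl_def cr_def le_Suc_eq)
 then show ?thesis by (simp add: form_inner_def)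
next
 case 2
 then obtain v where v: "\<gamma> = interior_mult v (\<phi> x)" using c by (auto simp: can_forms_def)
 have "(\<Sigma> a b. \<omega> [e a, e b] * (\<Sigma> c. g x (e c) v * P c a b)) =
   (\<Sigma> a b c. g x (e c) v * (P c a b * \<omega> [e a, e b]))"
  by (simp add: sum_distrib_left mult_ac)
 also have "... = (\<Sigma> c b a. g x (e c) v * (P c a b * \<omega> [e a, e b]))" by (rule sum_swap13)
 also have "... = (\<Sigma> c a b. g x (e c) v * (P c a b * \<omega> [e a, e b]))"
  by (rule sum.cong[OF refl], rule sum.swap)
 also have "... = 0"
  using z[of "[_]"] 2 by (simp add: sum_distrib_left[symmetric] ccl_simps cr_def)
 finally show ?thesis by (simp add: 2 form_inner_def sum_lists_2 v interior_basis[OF e])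
next
 case 3
 then obtain r where v: "\<gamma> = (%vs. r * \<phi> x vs)" using c by (auto simp: can_forms_def)
 have s: "\<omega> [e a, e b, e c] * (r * \<phi> x [e a, e b, e c]) = r * (P a b c * \<omega> [e a, e b, e c])" for a b c
  using e unfolding adapted_def by (simp only: mult_ac)
 have "(\<Sigma> a b c. P a b c * \<omega> [e a, e b, e c]) = 0"
  using z[of "[]"] 3 by (simp add: ccl_simps cr_def)
 then show ?thesis
  unfolding 3 form_inner_def sum_lists_3 v list.map s sum_distrib_left[symmetric] by simp
next
 case 4 then show ?thesis using c by (simp add: can_forms_def form_inner_def)
qed

lemma can_proj0_ccl:
 assumes e: "adapted x e" and w: "pform k \<omega>"
 shows "can_proj0 \<phi> g k x \<omega> \<in> can_forms \<phi> k x"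
  and "length I = cr k ==> ccl k (%L. can_proj0 \<phi> g k x \<omega> (map e L)) I = ccl k (%L. \<omega> (map e L)) I"
proof -
 have "\<exists>\<beta>\<in>can_forms \<phi> k x. \<forall>I. length I = cr k \<longrightarrow> ccl k (%L. \<beta> (map e L)) I = ccl k (%L. \<omega> (map e L)) I"
 proof (cases k rule: degree_cases)
  case 1 then show ?thesis using pform_alt w by (auto simp: can_forms_def)
 next
  case 2
  let ?v = "\<Sigma> c. ccl 2 (%L. \<omega> (map e L)) [c] *\<^sub>R e c"
  have "ccl 2 (%L. interior_mult ?v (\<phi> x) (map e L)) [c] = ccl 2 (%L. \<omega> (map e L)) [c]" for c
   using e by (simp add: ccl_interior[OF e] g_sum_right adapted_def orthonormal_def)
  then show ?thesis using 2
   by (intro bexI[of _ "interior_mult ?v (\<phi> x)"]) (auto simp: can_forms_def cr_def length_Suc_conv)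
 next
  case 3
  let ?r = "ccl 3 (%L. \<omega> (map e L)) []"
  show ?thesis using 3 ccl_phi[OF e, of ?r]
   by (intro bexI[of _ "%vs. ?r * \<phi> x vs"]) (auto simp: can_forms_def cr_def)
 next
  case 4 then show ?thesis by (intro bexI[OF _ can_forms_zero]) (simp add: ccl_simps)
 qed
 then obtain \<beta> where b: "\<beta> \<in> can_forms \<phi> k x"
  "\<And>I. length I = cr k ==> ccl k (%L. \<beta> (map e L)) I = ccl k (%L. \<omega> (map e L)) I" by blast
 have "can_proj0 \<phi> g k x \<omega> = \<beta>"
 proof (rule can_proj0_eq[OF _ _ b(1)])
  show "orthonormal x e" "mlin k \<omega>" using e w by (auto simp: adapted_def pform_def)
  fix \<gamma> assume "\<gamma> \<in> can_forms \<phi> k x"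
  then show "form_inner e k (%vs. \<omega> vs - \<beta> vs) \<gamma> = 0"
   by (rule form_inner_canonical[OF e]) (simp add: ccl_linear b(2))
 qed
 then show "can_proj0 \<phi> g k x \<omega> \<in> can_forms \<phi> k x"
  "length I = cr k ==> ccl k (%L. can_proj0 \<phi> g k x \<omega> (map e L)) I = ccl k (%L. \<omega> (map e L)) I"
  using b by simp_all
qed

lemma can_forms_eq_zero:
 assumes e: "adapted x e" and b: "\<beta> \<in> can_forms \<phi> k x"
  and z: "\<And>I. length I = cr k ==> ccl k (%L. \<beta> (map e L)) I = 0"
 shows "\<beta> = (%_. 0)"
 using form_inner_definite[OF _ can_forms_alt[OF b] form_inner_canonical[OF e b z], of x] e by (simp add: adapted_def)

lemma can_forms_components:
 assumes e: "adapted x e" and b: "\<beta> \<in> can_forms \<phi> k x"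
 shows "k = 2 ==> \<beta> [e a, e b] = (\<Sigma> c. P c a b * ccl 2 (%L. \<beta> (map e L)) [c])"
  and "k = 3 ==> \<beta> [e a, e b, e c] = P a b c * ccl 3 (%L. \<beta> (map e L)) []"
  and "4 \<le> k ==> \<beta> vs = 0"
proof -
 show "\<beta> [e a, e b] = (\<Sigma> c. P c a b * ccl 2 (%L. \<beta> (map e L)) [c])" if "k = 2"
 proof -
  obtain v where v: "\<beta> = interior_mult v (\<phi> x)" using \<open>k = 2\<close> b by (auto simp: can_forms_def)
  show ?thesis unfolding v by (simp only: ccl_interior[OF e] interior_basis[OF e] mult.commute)
 qed
 show "\<beta> [e a, e b, e c] = P a b c * ccl 3 (%L. \<beta> (map e L)) []" if "k = 3"
 proof -
  obtain r where v: "\<beta> = (%vs. r * \<phi> x vs)" using \<open>k = 3\<close> b by (auto simp: can_forms_def)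
  show ?thesis unfolding v ccl_phi[OF e] using e by (simp add: adapted_def)
 qed
 show "\<beta> vs = 0" if "4 \<le> k" using that b by (simp add: can_forms_def)
qed

lemma can_proj_high: "4 \<le> k ==> can_proj \<phi> g k \<alpha> = (%x vs. 0)"
proof -
 assume k: "4 \<le> k"
 have "can_proj0 \<phi> g k x \<omega> = (%_. 0)" for x \<omega>
  unfolding can_proj0_def by (rule the_equality) (use k in "auto simp: can_forms_def form_inner_def")
 then show ?thesis by (simp add: can_proj_def[abs_def])
qed

end

section \<open>Bundle-valued forms in an adapted frame\<close>

text \<open>Antisymmetrisation in the first index, as for products with one-forms and exterior derivatives.\<close>

definition alt_sum :: "nat => ('v list => real) => 'v list => real" where
 "alt_sum p F L = (\<Sum>i<Suc p. (- 1) ^ i * F (L ! i # omit i L))"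

lemma length_omit: "i < length L ==> length (omit i L) = length L - 1"
 by (simp add: omit_def)

lemma omit_append: "i < length I ==> omit i (I @ J) = omit i I @ J"
 by (simp add: omit_def)

lemma omit_map: "omit i (map f L) = map f (omit i L)"
 by (simp add: omit_def take_map drop_map)

lemma omit_update:
 assumes "i < length vs" "i \<noteq> j"
 shows "omit i (vs[j := v]) = (omit i vs)[(if j < i then j else j - 1) := v]"
proof (cases "j < i")
 case True
 then show ?thesis using assms by (simp add: omit_def take_update_swap drop_update_cancel list_update_append)
next
 case False
 then have "Suc i \<le> j" "\<not> j - 1 < i" using assms by auto
 then show ?thesis using assms False
  by (simp add: omit_def take_update_swap drop_update_swap list_update_append list_update_beyond)
qed

lemma alt_sum_cong:
 assumes "length L = Suc p + n" "\<And>K. length K = Suc p + n ==> F K = F' K"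
 shows "alt_sum p F L = alt_sum p F' L"
 unfolding alt_sum_def using assms by (intro sum.cong refl) (simp add: length_omit)

lemma alt_sum_map: "Suc p \<le> length L ==> alt_sum p F (map f L) = alt_sum p (%K. F (map f K)) L"
 unfolding alt_sum_def by (intro sum.cong refl) (simp add: omit_map)

lemma alt_sum_append: "length I = Suc p ==> alt_sum p F (I @ J) = alt_sum p (%K. F (K @ J)) I"
 unfolding alt_sum_def by (intro sum.cong refl) (simp add: omit_append nth_append)

lemma mlin_alt_sum:
 assumes F: "mlin (Suc p) F" shows "mlin (Suc p) (alt_sum p F)"
 unfolding mlin_def
proof (intro allI impI)
 fix vs :: "vec7 list" and j assume l: "length vs = Suc p \<and> j < Suc p"
 have "linear (%v. F (vs[j := v] ! i # omit i (vs[j := v])))" if i: "i < Suc p" for i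
 proof (cases "i = j")
  case True
  have "omit j (vs[j := v]) = omit j vs" for v by (simp add: omit_def)
  moreover have "linear (%v. F (v # omit j vs))"
   using mlin_append[OF F, of "[]" "omit j vs"] l by (simp add: length_omit)
  ultimately show ?thesis using True l by simp
 next
  case False
  let ?k = "if j < i then j else j - 1"
  have "linear (%v. F ((vs ! i # omit i vs)[Suc ?k := v]))"
   by (rule mlin_linear[OF F]) (use l i False in "auto simp: length_omit")
  then show ?thesis using False l i by (simp add: omit_update)
 qed
 then show "linear (%v. alt_sum p F (vs[j := v]))"
  unfolding alt_sum_def real_scaleR_def[symmetric]
  by (intro linear_compose_sum ballI linear_compose_scale_right) simp
qed

lemma linear_ccl: "(\<And>L. linear (%v. f v L)) ==> linear (%v. ccl k (%L. f v L) I)"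
proof (rule linearI)
 assume f: "\<And>L. linear (%v. f v L)"
 fix v w :: 'a and r
 have "f (v + w) = (%L. f v L + f w L)" "f (r *\<^sub>R v) = (%L. r * f v L)"
  using linear_add[OF f] linear_scale[OF f] by (auto simp: fun_eq_iff)
 then show "ccl k (%L. f (v + w) L) I = ccl k (%L. f v L) I + ccl k (%L. f w L) I"
  "ccl k (%L. f (r *\<^sub>R v) L) I = r *\<^sub>R ccl k (%L. f v L) I"
  by (simp_all add: ccl_linear)
qed

context g2frame
begin

lemma adapted_E: "y \<in> U ==> adapted y (%i. E i y)"
 by (simp add: adapted_def E_on E_phi)

lemma mlin_smooth:
 assumes x: "x \<in> U"
 shows "(\<And>y. y \<in> U ==> mlin n (T y)) ==> (\<And>L. length L = n ==> smf x (%y. T y (map (%i. E i y) L))) ==>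
  length Ys = n ==> (\<And>Y. Y \<in> set Ys ==> smv x Y) ==> smf x (%y. T y (map (%Y. Y y) Ys))"
proof (induction n arbitrary: T Ys)
 case 0
 then show ?case using "0.prems"(2)[of "[]"] by simp
next
 case (Suc n)
 obtain Y Zs where Ys: "Ys = Y # Zs" "length Zs = n" using Suc.prems(3) by (auto simp: length_Suc_conv)
 have "smf x (%y. \<Sigma> i. g y (E i y) (Y y) * T y (E i y # map (%Y. Y y) Zs))"
 proof (intro smf_sum smf_mult)
  fix i
  show "smf x (%y. g y (E i y) (Y y))" using Suc.prems(4) Ys by (intro smf_g E_smv x) simp
  show "smf x (%y. T y (E i y # map (%Y. Y y) Zs))"
  proof (rule Suc.IH[where T = "%y us. T y (E i y # us)"])
   show "mlin n (%us. T y (E i y # us))" if "y \<in> U" for y by (rule mlin_Cons[OF Suc.prems(1)[OF that]])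
   show "smf x (%y. T y (E i y # map (%i. E i y) L))" if "length L = n" for L
    using Suc.prems(2)[of "i # L"] that by simp
  qed (use Suc.prems(4) Ys in auto)
 qed
 then show ?case
 proof (rule smf_cong, intro eventually_mono[OF eventually_U[OF x]])
  fix y assume y: "y \<in> U"
  have l: "linear (%u. T y (u # map (%Y. Y y) Zs))"
   by (rule mlin_head[OF Suc.prems(1)[OF y]]) (simp add: Ys)
  have "T y (Y y # map (%Y. Y y) Zs) = T y ((\<Sigma> i. g y (E i y) (Y y) *\<^sub>R E i y) # map (%Y. Y y) Zs)"
   using E_expand[OF y, of "Y y"] by simp
  then show "(\<Sigma> i. g y (E i y) (Y y) * T y (E i y # map (%Y. Y y) Zs)) = T y (map (%Y. Y y) Ys)"
   by (simp add: Ys linear_sum[OF l] linear_scale[OF l])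
 qed
qed

text \<open>Canonical coordinates commute with the covariant derivative, as the three-form is parallel.\<close>

definition cc :: "nat => (7 list => 'y => real) => 7 list => 'y => real" where
 "cc p t L y = ccl p (%K. t K y) L"

lemma KT_KP: "KT (KP t) L y = (\<Sigma> a b c. P a b c * t (a # b # c # L) y)"
proof -
 have "(\<Sigma> a b c. P a b c * t (a # b # c # L) y) =
   (\<Sigma> a c b. P a b c * t (a # b # c # L) y)"
  by (rule sum.cong[OF refl], rule sum.swap)
 also have "... = (\<Sigma> c a b. P a b c * t (a # b # c # L) y)" by (rule sum.swap)
 also have "... = (\<Sigma> c a b. P c a b * t (a # b # c # L) y)"
 proof -
  have "P a b c = P c a b" for a b c using P_cyclic[of a b c] by simp
  then show ?thesis by simp
 qed
 finally show ?thesis by (simp add: KT_def KP_def)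
qed

lemma cc_formulas:
 "p \<le> 1 ==> cc p t = t" "cc 2 t = (%L y. (1/6) * KP t L y)" "cc 3 t = (%L y. (1/42) * KT (KP t) L y)"
 "4 \<le> p ==> cc p t = (%L y. 0)"
 unfolding KT_KP by (simp_all add: cc_def[abs_def] ccl_def[abs_def] KP_def)

lemma smt_cmult: "smt n t ==> smt n (%L y. r * t L y)"
 by (simp add: smt_def smU_rules)

lemma smt_cc: assumes t: "smt (p + n) t" shows "smt (cr p + n) (cc p t)"
proof (cases p rule: degree_cases)
 case 1 then show ?thesis using t by (auto simp: cc_formulas cr_def le_Suc_eq)
next
 case 2
 have "smt (Suc n) (KP t)" by (rule smt_KP) (use t 2 in simp)
 from smt_cmult[OF this, of "1/6"] show ?thesis unfolding 2 cc_formulas by (simp add: cr_def)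
next
 case 3
 have "smt n (KT (KP t))" by (intro smt_KT smt_KP) (use t 3 in "simp add: numeral_3_eq_3")
 from smt_cmult[OF this, of "1/42"] show ?thesis unfolding 3 cc_formulas by (simp add: cr_def)
next
 case 4 then show ?thesis by (simp add: cc_formulas smt_def smU_rules)
qed

lemma cov_cc:
 assumes t: "smt (p + n) t" and I: "length I = cr p" and J: "length J = n" and y: "y \<in> U"
 shows "cov (cc p t) (k # I @ J) y = ccl p (%K. cov t (k # K) y) (I @ J)"
proof (cases p rule: degree_cases)
 case 1 then show ?thesis by (simp add: cc_formulas ccl_def)
next
 case 2
 then obtain c where I: "I = [c]" using I by (auto simp: cr_def length_Suc_conv)
 have t: "smt (Suc (Suc n)) t" using t 2 by simp
 have "cov (cc p t) (k # I @ J) y = (1/6) * cov (KP t) (k # c # J) y"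
  unfolding 2 cc_formulas I using cov_linear(3)[OF y smt_KP[OF t] smt_KP[OF t], of "c # J" "1/6" k] J by simp
 then show ?thesis by (simp add: cov_KP[OF t J y] 2 I ccl_simps)
next
 case 3
 then have I: "I = []" using I by (simp add: cr_def)
 have t: "smt (Suc (Suc (Suc n))) t" using t 3 by (simp add: numeral_3_eq_3)
 have K: "smt n (KT (KP t))" by (intro smt_KT smt_KP t)
 have "cov (cc p t) (k # I @ J) y = (1/42) * cov (KT (KP t)) (k # J) y"
  unfolding 3 cc_formulas I using cov_linear(3)[OF y K K, of J "1/42" k] J by simp
 also have "cov (KT (KP t)) (k # J) y = (\<Sigma> a. cov (KP t) (k # a # a # J) y)"
  by (rule cov_KT[OF smt_KP[OF t] J y])
 also have "... = KT (KP (%K y. cov t (k # K) y)) J y"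
  using J by (simp add: KT_def KP_def cov_KP[OF t _ y])
 finally show ?thesis by (simp add: KT_KP 3 I ccl_simps)
next
 case 4 then show ?thesis by (simp add: cc_formulas ccl_simps cov_Cons dE_const act_zero del: act.simps)
qed

text \<open>
 The constants of \<open>Sy\<close> come from here: in degree \<open>2\<close> the two terms of the antisymmetrisation
 agree after contraction, whence \<open>2/6\<close>; in degree \<open>3\<close> the three terms do, and the contraction of
 the three-form with itself gives \<open>3 * 6 / 42\<close>.
\<close>

lemma ccl_alt_sum:
 assumes p: "p \<le> 2" and I: "length I = cr (Suc p)"
 shows "ccl (Suc p) (alt_sum p F) (I @ J) = Sy p (%K y. ccl p (%M. F (hd K # M)) (tl K)) (I @ J) y"
proof -
 consider "p = 0" | "p = 1" | "p = 2" using p by linarith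
 then show ?thesis
 proof cases
  case 1
  then obtain c where "I = [c]" using I by (auto simp: cr_def length_Suc_conv)
  then show ?thesis using 1 by (simp add: ccl_def alt_sum_def Sy_def omit_def)
 next
  case 2
  then obtain c where c: "I = [c]" using I by (auto simp: cr_def length_Suc_conv)
  have "(\<Sigma> a b. P c a b * alt_sum 1 F (a # b # J)) =
    (\<Sigma> a b. P c a b * (F (a # b # J) - F (b # a # J)))"
   by (simp add: alt_sum_def omit_def)
  then show ?thesis
   using P_antisym_sum[of c "%a b. F (a # b # J)"]
   by (simp add: 2 c ccl_def Sy_def KP_def)
 next
  case 3
  then have I: "I = []" using I by (simp add: cr_def)
  let ?f = "%a b c. F (a # b # c # J)"
  have s1: "(\<Sigma> a b c. P a b c * ?f b a c) =
    - (\<Sigma> a b c. P a b c * ?f a b c)"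
  proof -
   have e: "P a b c * ?f b a c = - (P b a c * ?f b a c)" for a b c using P_swap12[of a b c] by simp
   have "(\<Sigma> a b c. P a b c * ?f b a c) =
     (\<Sigma> b a c. P a b c * ?f b a c)" by (rule sum.swap)
   then show ?thesis unfolding e sum_negf .
  qed
  have s2: "(\<Sigma> a b c. P a b c * ?f c a b) =
    (\<Sigma> a b c. P a b c * ?f a b c)"
  proof -
   have "(\<Sigma> a b c. P a b c * ?f c a b) =
     (\<Sigma> a c b. P a b c * ?f c a b)"
    by (rule sum.cong[OF refl], rule sum.swap)
   also have "... = (\<Sigma> c a b. P a b c * ?f c a b)" by (rule sum.swap)
   also have "... = (\<Sigma> c a b. P c a b * ?f c a b)"
   proof -
    have "P a b c = P c a b" for a b c using P_cyclic[of a b c] by simp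
    then show ?thesis by simp
   qed
   finally show ?thesis .
  qed
  have "alt_sum 2 F (a # b # c # J) = ?f a b c - ?f b a c + ?f c a b" for a b c
   by (simp add: alt_sum_def omit_def numeral_2_eq_2)
  then have "(\<Sigma> a b c. P a b c * alt_sum 2 F (a # b # c # J)) =
    3 * (\<Sigma> a b c. P a b c * ?f a b c)"
   by (simp add: distrib_left right_diff_distrib sum.distrib sum_subtractf s1 s2)
  then show ?thesis
   by (simp add: 3 I ccl_def Sy_def KT_def flip: sum_divide_distrib)
 qed
qed

lemma Sy_cong:
 assumes "p \<le> 2" "length L = cr (Suc p) + n" "\<And>K. length K = Suc (cr p + n) ==> t K y = u K y"
 shows "Sy p t L y = Sy p u L y"
proof -
 consider "p = 0" | "p = 1" | "p = 2" using assms(1) by linarith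
 then show ?thesis
 proof cases
  case 1 then show ?thesis using assms(2,3) by (simp add: Sy_def cr_def)
 next
  case 2
  then obtain c J where "L = c # J" "length J = n" using assms(2) by (auto simp: cr_def length_Suc_conv)
  then show ?thesis using 2 assms(3) by (simp add: Sy_def cr_def KP_def)
 next
  case 3 then show ?thesis using assms(2,3) by (simp add: Sy_def cr_def KT_def)
 qed
qed

end

subsection \<open>Germs of sections\<close>

text \<open>
 Sections of a bundle are tested by multilinear functionals \<open>ell y J\<close>, depending on \<open>q\<close> tangent
 vectors \<open>J\<close>: for a covector these are its values, for an endomorphism its matrix elements.
\<close>

definition (in atlas) germ :: "nat => ('y => vec7 list => 'w => real) => 'y => ('y => 'w) => bool" where
 "germ q ell x s \<longleftrightarrow> (\<forall>Js. length Js = q \<and> (\<forall>J\<in>set Js. smv x J) \<longrightarrow>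
   smf x (%y. ell y (map (%J. J y) Js) (s y)))"

locale vbundle = g2mfd A g nab \<phi> vol for A :: "'y::t2_space chart set" and g nab \<phi> vol +
 fixes q :: nat and ell :: "'y => vec7 list => 'w::euclidean_space => real"
  and sec :: "'y set => ('y => 'w) => bool" and conn :: "'y => vec7 => ('y => 'w) => 'w"
 assumes ell_linear: "linear (ell y J)"
  and ell_mlin: "mlin q (%J. ell y J w)"
  and ell_basis: "b \<in> Basis ==> \<exists>J. length J = q \<and> (\<forall>w. w \<bullet> b = ell y J w)"
  and sec_iff: "open V ==> sec V s \<longleftrightarrow> (\<forall>x\<in>V. germ q ell x s)"
  and conn_apply: "germ q ell x s ==> smv x X ==> length Js = q ==> (\<And>J. J \<in> set Js ==> smv x J) ==>
    ell x (map (%J. J x) Js) (conn x (X x) s) = dirD A x (X x) (%y. ell y (map (%J. J y) Js) (s y))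
     - (\<Sum>r<q. ell x ((map (%J. J x) Js)[r := nab X (Js ! r) x]) (s x))"
begin

definition T :: "('y => vec7 list => 'w) => 'y => vec7 list => real" where
 "T \<alpha> y us = ell y (drop (length us - q) us) (\<alpha> y (take (length us - q) us))"

definition pforms :: "nat => ('y => vec7 list => 'w) => bool" where
 "pforms p \<alpha> \<longleftrightarrow> (\<forall>y. \<forall>b\<in>Basis. pform p (%vs. \<alpha> y vs \<bullet> b))"

definition can :: "nat => ('y => vec7 list => 'w) => bool" where
 "can p \<alpha> \<longleftrightarrow> (\<forall>y. \<forall>b\<in>Basis. (%vs. \<alpha> y vs \<bullet> b) \<in> can_forms \<phi> p y)"

lemma can_cochains_iff: "\<alpha> \<in> can_cochains A \<phi> sec p \<longleftrightarrow> can p \<alpha> \<and> smooth_form A sec p \<alpha>"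
 by (auto simp: can_cochains_def can_def)

lemma T_append: "length J = q ==> T \<alpha> y (us @ J) = ell y J (\<alpha> y us)"
 by (simp add: T_def)

lemma functional_expand: "linear h ==> h w = (\<Sum>b\<in>Basis. h b * (w \<bullet> b))" for h :: "'w => real"
proof -
 assume h: "linear h"
 have "h w = h (\<Sum>b\<in>Basis. (w \<bullet> b) *\<^sub>R b)" by (simp add: euclidean_representation)
 then show ?thesis by (simp add: linear_sum[OF h] linear_scale[OF h] mult.commute)
qed

lemma mlin_sum: "(\<And>b. b \<in> X ==> mlin p (\<omega> b)) ==> mlin p (%vs. \<Sum>b\<in>X. r b * \<omega> b vs)"
 unfolding mlin_def real_scaleR_def[symmetric]
 by (intro allI impI linear_compose_sum ballI linear_compose_scale_right) auto

lemma pforms_functional: "pforms p \<alpha> ==> linear h ==> pform p (%vs. h (\<alpha> y vs))" for h :: "'w => real"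
proof -
 assume a: "pforms p \<alpha>" and h: "linear h"
 have "pform p (%vs. \<Sum>b\<in>Basis. h b * (\<alpha> y vs \<bullet> b))"
  using a mlin_sum[of Basis p "%b vs. \<alpha> y vs \<bullet> b" h] by (simp add: pforms_def pform_def)
 then show ?thesis by (simp only: functional_expand[OF h, symmetric])
qed

lemma can_functional: "can p \<alpha> ==> linear h ==> (%vs. h (\<alpha> y vs)) \<in> can_forms \<phi> p y" for h :: "'w => real"
proof -
 assume a: "can p \<alpha>" and h: "linear h"
 have "(%vs. \<Sum>b\<in>Basis. h b * (\<alpha> y vs \<bullet> b)) \<in> can_forms \<phi> p y"
  by (rule can_forms_sum) (use a in "auto simp: can_def")
 then show ?thesis by (simp only: functional_expand[OF h, symmetric])
qed

lemma pforms_ell: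
 assumes "\<And>y J. length J = q ==> pform p (%vs. ell y J (\<alpha> y vs))" shows "pforms p \<alpha>"
 unfolding pforms_def
proof (intro allI ballI)
 fix y and b :: 'w assume "b \<in> Basis"
 then obtain J where "length J = q" "\<And>w. w \<bullet> b = ell y J w" using ell_basis by blast
 then show "pform p (%vs. \<alpha> y vs \<bullet> b)" using assms by simp
qed

lemma can_pforms: "can p \<alpha> ==> pforms p \<alpha>"
 unfolding can_def pforms_def by (blast intro: alt_form_pform can_forms_alt)

lemma ell_eqI: "(\<And>J. length J = q ==> ell y J w = ell y J w') ==> w = w'"
 by (rule euclidean_eqI) (metis ell_basis)

lemma pforms_length: "pforms p \<alpha> ==> length vs \<noteq> p ==> \<alpha> y vs = 0"
 by (rule euclidean_eqI) (simp add: pforms_def pform_def)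

lemma T_mlin: assumes a: "pforms p \<alpha>" shows "mlin (p + q) (T \<alpha> y)"
 unfolding mlin_def
proof (intro allI impI)
 fix vs :: "vec7 list" and i assume l: "length vs = p + q \<and> i < p + q"
 obtain us J where vs: "vs = us @ J" "length us = p" "length J = q"
  using l that[of "take p vs" "drop p vs"] by simp
 show "linear (%v. T \<alpha> y (vs[i := v]))"
 proof (cases "i < p")
  case True
  then show ?thesis using mlin_linear[of p "%us. ell y J (\<alpha> y us)" us i]
    pforms_functional[OF a ell_linear, of y J y] vs
   by (simp add: list_update_append T_append pform_def)
 next
  case False
  then show ?thesis using mlin_linear[OF ell_mlin, of J "i - p" y "\<alpha> y us"] vs l
   by (simp add: list_update_append T_append)
 qed
qed

lemma T_tensor:
 assumes s: "smooth_form A sec p \<alpha>" and a: "pforms p \<alpha>" shows "tensor (p + q) (T \<alpha>)"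
 unfolding tensor_def
proof (intro conjI allI impI)
 show "mlin (p + q) (T \<alpha> y)" for y by (rule T_mlin[OF a])
 fix x Ys assume Ys: "length Ys = p + q \<and> (\<forall>Y\<in>set Ys. smv x Y)"
 have "\<forall>\<^sub>F y in nhds x. \<forall>Y\<in>set Ys. smv y Y"
  using Ys smv_eventually by (intro eventually_ball_finite) auto
 then obtain V where V: "open V" "x \<in> V" "\<And>y Y. y \<in> V ==> Y \<in> set Ys ==> smv y Y"
  by (auto simp: eventually_nhds)
 let ?Xs = "take p Ys" and ?Js = "drop p Ys"
 have "open V \<and> length ?Xs = p \<and> (\<forall>X\<in>set ?Xs. smooth_vf A V X)"
  using V(1,3) Ys by (auto simp: smooth_vf_iff dest: in_set_takeD)
 then have "sec V (%y. \<alpha> y (map (%X. X y) ?Xs))" using s unfolding smooth_form_def by blast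
 then have "germ q ell x (%y. \<alpha> y (map (%X. X y) ?Xs))" using sec_iff V by blast
 then have "smf x (%y. ell y (map (%J. J y) ?Js) (\<alpha> y (map (%X. X y) ?Xs)))"
  unfolding germ_def by (elim allE[of _ ?Js] impE) (use Ys in "auto dest: in_set_dropD")
 then show "smf x (%y. T \<alpha> y (map (%Y. Y y) Ys))" using Ys by (simp add: T_def take_map drop_map)
qed

lemma smooth_formI:
 assumes a: "pforms p \<alpha>"
  and s: "\<And>x Ys. length Ys = p + q ==> (\<And>Y. Y \<in> set Ys ==> smv x Y) ==> smf x (%y. T \<alpha> y (map (%Y. Y y) Ys))"
 shows "smooth_form A sec p \<alpha>"
 unfolding smooth_form_def
proof (intro allI impI)
 fix V Xs assume V: "open V \<and> length Xs = p \<and> (\<forall>X\<in>set Xs. smooth_vf A V X)"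
 have "germ q ell x (%y. \<alpha> y (map (%X. X y) Xs))" if "x \<in> V" for x
  unfolding germ_def
 proof (intro allI impI)
  fix Js assume Js: "length Js = q \<and> (\<forall>J\<in>set Js. smv x J)"
  have "smf x (%y. T \<alpha> y (map (%Y. Y y) (Xs @ Js)))"
   by (rule s) (use V Js that in "auto simp: smooth_vf_iff")
  then show "smf x (%y. ell y (map (%J. J y) Js) (\<alpha> y (map (%X. X y) Xs)))"
   using Js by (simp add: T_append)
 qed
 then show "sec V (%y. \<alpha> y (map (%X. X y) Xs))" using sec_iff V by blast
qed

subsection \<open>The exterior covariant derivative\<close>

lemma conn_zero: "conn x v (%y. 0) = 0"
proof (rule ell_eqI)
 fix J :: "vec7 list" assume J: "length J = q"
 let ?Js = "map (ext A x) J"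
 have z: "ell y K 0 = 0" for y K using linear_0[OF ell_linear] .
 have "germ q ell x (%y. 0)" by (simp add: germ_def z smf_const)
 from conn_apply[OF this smv_ext[OF in_pref], of ?Js v]
 have "ell x (map (%J. J x) ?Js) (conn x v (%y. 0)) = 0"
  using J smv_ext[OF in_pref] by (auto simp: ext_self z dirD_const)
 then show "ell x J (conn x v (%y. 0)) = ell x J 0" by (simp add: comp_def ext_self z)
qed

abbreviation extd :: "('y => vec7 list => 'w) => 'y => vec7 list => 'w" where
 "extd == ext_cov_deriv A conn"

text \<open>
 The extensions of tangent vectors have vanishing brackets and a symmetric covariant derivative, so
 that the exterior derivative is the antisymmetrisation of \<open>nablaT\<close>.
\<close>

lemma ell_extd:
 assumes a: "\<And>x. alt_form p (%vs. ell x J (\<alpha> x vs))" and t: "tensor (p + q) (T \<alpha>)"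
  and J: "length J = q" and l: "length vs = Suc p"
 shows "ell x J (extd \<alpha> x vs) = alt_sum p (%K. nablaT (T \<alpha>) x (hd K) (tl K @ J)) vs"
proof -
 have g: "germ q ell x (%y. \<alpha> y (map (%v. ext A x v y) (omit i vs)))" if "i < Suc p" for i
  unfolding germ_def
 proof (intro allI impI)
  fix Js assume Js: "length Js = q \<and> (\<forall>J\<in>set Js. smv x J)"
  have "smf x (%y. T \<alpha> y (map (%Y. Y y) (map (ext A x) (omit i vs) @ Js)))"
   by (rule tensor_smf[OF t]) (use l that Js smv_ext[OF in_pref] in "auto simp: length_omit")
  then show "smf x (%y. ell y (map (%J. J y) Js) (\<alpha> y (map (%v. ext A x v y) (omit i vs))))"
   using Js by (simp add: T_append comp_def)
 qed
 have c: "ell x J (conn x (vs ! i) (%y. \<alpha> y (map (%v. ext A x v y) (omit i vs)))) =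
   dirD A x (vs ! i) (%y. T \<alpha> y (map (%u. ext A x u y) (omit i vs @ J))) -
   (\<Sum>r<length J. T \<alpha> x (omit i vs @ J[r := nab (ext A x (vs ! i)) (ext A x (J ! r)) x]))"
  if i: "i < Suc p" for i
  using conn_apply[OF g[OF i] smv_ext[OF in_pref], of "map (ext A x) J" "vs ! i"] J smv_ext[OF in_pref]
  by (auto simp: comp_def ext_self T_append)
 have "swap_alt p (%us. T \<alpha> x (us @ J))" using alt_form_swap[OF a] J by (simp add: T_append)
 from nablaT_alternate[where T = "T \<alpha>" and ts = J and x = x and p = p and vs = vs, OF this l] show ?thesis
  unfolding alt_sum_def ext_cov_deriv_def l linear_sum[OF ell_linear] linear_scale[OF ell_linear]
  by (simp add: c del: sum.lessThan_Suc)
qed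

lemma pforms_extd:
 assumes c: "can p \<alpha>" and s: "smooth_form A sec p \<alpha>" shows "pforms (Suc p) (extd \<alpha>)"
proof (rule pforms_ell)
 fix y and J :: "vec7 list" assume J: "length J = q"
 note t = T_tensor[OF s can_pforms[OF c]]
 note f = ell_extd[OF can_forms_alt[OF can_functional[OF c ell_linear]] t J]
 show "pform (Suc p) (%vs. ell y J (extd \<alpha> y vs))"
  unfolding pform_def
 proof (intro conjI allI impI)
  have m: "mlin (Suc p) (%K. nablaT (T \<alpha>) y (hd K) (tl K @ J))"
   unfolding mlin_def
  proof (intro allI impI)
   fix vs :: "vec7 list" and i assume l: "length vs = Suc p \<and> i < Suc p"
   then obtain v us where vs: "vs = v # us" "length us = p" by (auto simp: length_Suc_conv)
   show "linear (%w. nablaT (T \<alpha>) y (hd (vs[i := w])) (tl (vs[i := w]) @ J))"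
   proof (cases i)
    case 0 then show ?thesis using nablaT_linear[OF t, of "us @ J"] vs J by simp
   next
    case (Suc j)
    then have "linear (%w. nablaT (T \<alpha>) y v ((us @ J)[j := w]))"
     using l vs J by (intro nablaT_slot_linear[OF t]) auto
    then show ?thesis using Suc l vs by (simp add: list_update_append)
   qed
  qed
  show "mlin (Suc p) (%vs. ell y J (extd \<alpha> y vs))"
   using mlin_alt_sum[OF m] unfolding mlin_def by (auto simp: f)
  fix vs :: "vec7 list" assume l: "length vs \<noteq> Suc p"
  have "extd \<alpha> y vs = 0" unfolding ext_cov_deriv_def
  proof (intro sum.neutral ballI)
   fix i assume "i \<in> {..<length vs}"
   then have "\<alpha> z (map (%v. ext A y v z) (omit i vs)) = 0" for z
    by (intro pforms_length[OF can_pforms[OF c]]) (use l in "simp add: length_omit; linarith")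
   then show "(- 1) ^ i *\<^sub>R conn y (vs ! i) (%z. \<alpha> z (map (%v. ext A y v z) (omit i vs))) = 0"
    by (simp add: conn_zero)
  qed
  then show "ell y J (extd \<alpha> y vs) = 0" using linear_0[OF ell_linear] by simp
 qed
qed

lemma can_can_proj: "pforms k \<beta> ==> can k (can_proj \<phi> g k \<beta>)"
 unfolding can_def
proof (intro allI ballI)
 fix y and b :: 'w assume p: "pforms k \<beta>" and b: "b \<in> Basis"
 obtain U E where "frame U E" "y \<in> U" using frame_exists by blast
 then have "adapted y (%i. E i y)" by (simp add: frame_def adapted_def)
 from can_proj0_ccl(1)[OF this] show "(%vs. can_proj \<phi> g k \<beta> y vs \<bullet> b) \<in> can_forms \<phi> k y"
  using p b by (simp add: can_proj_def pforms_def)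
qed

end

subsection \<open>Components in a frame\<close>

locale vbundle_frame = vbundle A g nab \<phi> vol q ell sec conn + g2frame A g nab \<phi> vol U E
 for A :: "'y::t2_space chart set" and g nab \<phi> vol q and ell :: "'y => vec7 list => 'w::euclidean_space => real"
  and sec conn U E
begin

definition ccf :: "nat => ('y => vec7 list => 'w) => 7 list => 'y => real" where
 "ccf p \<alpha> = cc p (fc (T \<alpha>))"

lemma fc_T: "length J = q ==> fc (T \<alpha>) (I @ J) y = ell y (map (%i. E i y) J) (\<alpha> y (map (%i. E i y) I))"
 by (simp add: fc_def T_append)

lemma ccf_append:
 "length I = cr p ==> length J = q ==> ccf p \<alpha> (I @ J) y =
  ccl p (%L. ell y (map (%i. E i y) J) (\<alpha> y (map (%i. E i y) L))) I"
 unfolding ccf_def cc_def by (subst ccl_tail) (simp_all add: fc_T)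

lemma split_list: "length L = m + q ==> (\<And>I J. L = I @ J ==> length I = m ==> length J = q ==> R) ==> R" for L :: "7 list"
proof -
 assume a: "length L = m + q" "\<And>I J. L = I @ J ==> length I = m ==> length J = q ==> R"
 show R using a(1) a(2)[of "take m L" "drop m L"] by simp
qed

lemma smt_ccf: "smooth_form A sec p \<alpha> ==> can p \<alpha> ==> smt (cr p + q) (ccf p \<alpha>)"
 unfolding ccf_def by (intro smt_cc smt_fc T_tensor can_pforms)

lemma can_components:
 assumes c: "can p \<alpha>" and y: "y \<in> U" and J: "length J = q"
 shows "p = 2 ==> fc (T \<alpha>) (a # b # J) y = (\<Sigma> c. P c a b * ccf p \<alpha> (c # J) y)"
  and "p = 3 ==> fc (T \<alpha>) (a # b # c # J) y = P a b c * ccf p \<alpha> J y"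
  and "4 \<le> p ==> \<alpha> y vs = 0"
proof -
 note ce = can_forms_components[OF adapted_E[OF y] can_functional[OF c ell_linear[of y "map (%i. E i y) J"], of y]]
 show "p = 2 ==> fc (T \<alpha>) (a # b # J) y = (\<Sigma> c. P c a b * ccf p \<alpha> (c # J) y)"
  using ce(1)[of a b] fc_T[OF J, of \<alpha> "[a, b]" y] ccf_append[of "[_]" 2 J \<alpha> y] J
  by (simp add: cr_def)
 show "p = 3 ==> fc (T \<alpha>) (a # b # c # J) y = P a b c * ccf p \<alpha> J y"
  using ce(2)[of a b c] fc_T[OF J, of \<alpha> "[a, b, c]" y] ccf_append[of "[]" 3 J \<alpha> y] J
  by (simp add: cr_def)
 show "\<alpha> y vs = 0" if "4 \<le> p"
 proof (rule euclidean_eqI)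
  fix b :: 'w assume "b \<in> Basis"
  then have "(%vs. \<alpha> y vs \<bullet> b) = (%_. 0)" using c that unfolding can_def by (simp add: can_forms_def)
  from fun_cong[OF this] show "\<alpha> y vs \<bullet> b = 0 \<bullet> b" by simp
 qed
qed

lemma smooth_components:
 assumes c: "can p \<alpha>" and s: "smt (cr p + q) (ccf p \<alpha>)" and L: "length L = p + q"
 shows "smU (fc (T \<alpha>) L)"
 using L
proof (rule split_list)
 fix I J assume L: "L = I @ J" "length I = p" "length J = q"
 show ?thesis
 proof (cases p rule: degree_cases)
  case 1
  then have "ccf p \<alpha> = fc (T \<alpha>)" "cr p = p" by (auto simp: ccf_def cc_formulas cr_def le_Suc_eq)
  then show ?thesis using s L by (simp add: smt_def)
 next
  case 2
  then obtain a b where I: "I = [a, b]" using L(2) unfolding 2 by (auto simp: numeral_2_eq_2 length_Suc_conv)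
  have "smU (%y. \<Sigma> c. P c a b * ccf p \<alpha> (c # J) y)"
   using s L 2 by (intro smU_rules) (simp add: smt_def cr_def)
  then show ?thesis
   by (rule smU_cong[rotated]) (use can_components(1)[OF c _ L(3) 2] in "simp add: L I")
 next
  case 3
  then obtain a b d where I: "I = [a, b, d]" using L(2) unfolding 3 by (auto simp: numeral_3_eq_3 length_Suc_conv)
  have "smU (%y. P a b d * ccf p \<alpha> J y)"
   using s L 3 by (intro smU_rules) (simp add: smt_def cr_def)
  then show ?thesis
   by (rule smU_cong[rotated]) (use can_components(2)[OF c _ L(3) 3] in "simp add: L I")
 next
  case 4
  have "smU (%y. 0)" by (rule smU_rules)
  then show ?thesis
   by (rule smU_cong[rotated]) (use can_components(3)[OF c _ L(3) 4] linear_0[OF ell_linear] in "simp add: L fc_T")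
 qed
qed

lemma smooth_at:
 assumes c: "can p \<alpha>" and s: "smt (cr p + q) (ccf p \<alpha>)" and x: "x \<in> U"
  and Ys: "length Ys = p + q" "\<And>Y. Y \<in> set Ys ==> smv x Y"
 shows "smf x (%y. T \<alpha> y (map (%Y. Y y) Ys))"
proof (rule mlin_smooth[OF x _ _ Ys])
 show "mlin (p + q) (T \<alpha> y)" for y by (rule T_mlin[OF can_pforms[OF c]])
 fix L :: "7 list" assume "length L = p + q"
 from smUD[OF smooth_components[OF c s this] x] show "smf x (%y. T \<alpha> y (map (%i. E i y) L))"
  by (simp add: fc_def[abs_def])
qed

lemma can_functional_zero:
 fixes h :: "'w => real"
 assumes c: "can p \<alpha>" and h: "linear h" and y: "y \<in> U"
  and z: "\<And>I. length I = cr p ==> ccl p (%L. h (\<alpha> y (map (%i. E i y) L))) I = 0"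
 shows "h (\<alpha> y vs) = 0"
 using can_forms_eq_zero[OF adapted_E[OF y] can_functional[OF c h] z] by (metis (no_types, lifting))

text \<open>
 The coordinates determine the values on the frame, hence on all tangent vectors, by multilinearity.
\<close>

lemma can_eqI:
 assumes c: "can p \<alpha>" "can p \<beta>" and y: "y \<in> U"
  and e: "\<And>L. length L = cr p + q ==> ccf p \<alpha> L y = ccf p \<beta> L y"
 shows "\<alpha> y vs = \<beta> y vs"
proof -
 define \<delta> where "\<delta> = (%y vs. \<alpha> y vs - \<beta> y vs)"
 have d: "can p \<delta>"
  unfolding can_def
 proof (intro allI ballI)
  fix y and b :: 'w assume "b \<in> Basis"
  then have "(%vs. \<alpha> y vs \<bullet> b + (- 1) * (\<beta> y vs \<bullet> b)) \<in> can_forms \<phi> p y"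
   using c by (intro can_forms_comb) (auto simp: can_def)
  then show "(%vs. \<delta> y vs \<bullet> b) \<in> can_forms \<phi> p y" by (simp add: \<delta>_def inner_diff_left)
 qed
 have "\<delta> y vs = 0"
 proof (rule euclidean_eqI)
  fix b :: 'w assume b: "b \<in> Basis"
  obtain J where J: "length J = q" "\<And>w. w \<bullet> b = ell y J w" using ell_basis[OF b] by blast
  have "ell y J (\<delta> y vs) = 0"
  proof (rule can_functional_zero[OF d ell_linear y])
   fix I :: "7 list" assume I: "length I = cr p"
   show "ccl p (%L. ell y J (\<delta> y (map (%i. E i y) L))) I = 0"
   proof (rule mlin_eq_on_basis[OF E_on[OF y], where \<eta> = "%_. 0" and p = q])
    show "mlin q (%J. ccl p (%L. ell y J (\<delta> y (map (%i. E i y) L))) I)"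
     unfolding mlin_def by (intro allI impI linear_ccl) (rule mlin_linear[OF ell_mlin]; simp)
    show "mlin q (%_. 0)" by (rule alt_form_mlin[OF alt_form_zero])
    fix K :: "7 list" assume K: "length K = q"
    have "ccl p (%L. ell y (map (%i. E i y) K) (\<delta> y (map (%i. E i y) L))) I =
      ccf p \<alpha> (I @ K) y - ccf p \<beta> (I @ K) y"
     by (simp add: ccf_append[OF I K] \<delta>_def linear_diff[OF ell_linear] ccl_linear)
    then show "ccl p (%L. ell y (map (%i. E i y) K) (\<delta> y (map (%i. E i y) L))) I = 0"
     using e[of "I @ K"] I K by simp
   qed (rule J(1))
  qed
  then show "\<delta> y vs \<bullet> b = 0 \<bullet> b" using J(2)[of "\<delta> y vs"] by simp
 qed
 then show ?thesis by (simp add: \<delta>_def)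
qed

lemma ccf_can_proj:
 assumes p: "pforms k \<beta>" and y: "y \<in> U" and L: "length L = cr k + q"
 shows "ccf k (can_proj \<phi> g k \<beta>) L y = ccf k \<beta> L y"
 using L
proof (rule split_list)
 fix I J assume L: "L = I @ J" "length I = cr k" "length J = q"
 let ?h = "ell y (map (%i. E i y) J)"
 have h: "?h w = (\<Sum>b\<in>Basis. ?h b * (w \<bullet> b))" for w by (rule functional_expand[OF ell_linear])
 have "ccl k (%L. ?h (can_proj \<phi> g k \<beta> y (map (%i. E i y) L))) I =
   (\<Sum>b\<in>Basis. ?h b * ccl k (%L. can_proj0 \<phi> g k y (%us. \<beta> y us \<bullet> b) (map (%i. E i y) L)) I)"
  by (subst h) (simp add: ccl_sum ccl_linear can_proj_def)
 also have "... = (\<Sum>b\<in>Basis. ?h b * ccl k (%L. \<beta> y (map (%i. E i y) L) \<bullet> b) I)"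
  using p by (intro sum.cong refl) (simp add: can_proj0_ccl(2)[OF adapted_E[OF y] _ L(2)] pforms_def)
 also have "... = ccl k (%L. \<Sum>b\<in>Basis. ?h b * (\<beta> y (map (%i. E i y) L) \<bullet> b)) I"
  by (simp add: ccl_sum ccl_linear)
 also have "... = ccl k (%L. ?h (\<beta> y (map (%i. E i y) L))) I"
  by (rule arg_cong[where f = "%f. ccl k f I"], rule ext, rule h[symmetric])
 finally show ?thesis using L by (simp add: ccf_append)
qed

lemma ccf_alt:
 assumes k: "p \<le> 2" and b: "pforms (Suc p) \<beta>" and y: "y \<in> U" and L: "length L = cr (Suc p) + q"
  and f: "\<And>L. length L = Suc p + q ==> fc (T \<beta>) L y = alt_sum p F L"
  and t: "\<And>k I J. length I = cr p ==> length J = q ==> ccl p (%M. F (k # M)) (I @ J) = t (k # I @ J) y"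
 shows "ccf (Suc p) (can_proj \<phi> g (Suc p) \<beta>) L y = Sy p t L y"
proof -
 have "ccf (Suc p) \<beta> L y = Sy p (%K y. ccl p (%M. F (hd K # M)) (tl K)) L y"
  using L
 proof (rule split_list)
  fix I J assume IJ: "L = I @ J" "length I = cr (Suc p)" "length J = q"
  have "ccf (Suc p) \<beta> L y = ccl (Suc p) (alt_sum p F) (I @ J)"
   unfolding ccf_def cc_def IJ(1) by (rule ccl_cong) (use f IJ in auto)
  then show ?thesis using ccl_alt_sum[OF k IJ(2), of F J y] by (simp add: IJ(1))
 qed
 also have "... = Sy p t L y"
 proof (rule Sy_cong[OF k L])
  fix K :: "7 list" assume "length K = Suc (cr p + q)"
  then obtain k M where K: "K = k # M" "length M = cr p + q" by (auto simp: length_Suc_conv)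
  from K(2) show "ccl p (%M. F (hd K # M)) (tl K) = t K y"
   by (rule split_list) (use t K in simp)
 qed
 finally show ?thesis using ccf_can_proj[OF b y L] by simp
qed

text \<open>In canonical coordinates the differential is gradient, curl and divergence.\<close>

lemma ccf_d:
 assumes k: "p \<le> 2" and c: "can p \<alpha>" and s: "smooth_form A sec p \<alpha>" and y: "y \<in> U"
  and L: "length L = cr (Suc p) + q"
 shows "ccf (Suc p) (can_proj \<phi> g (Suc p) (extd \<alpha>)) L y = Sy p (cov (ccf p \<alpha>)) L y"
proof (rule ccf_alt[OF k pforms_extd[OF c s] y L])
 note t = T_tensor[OF s can_pforms[OF c]]
 fix L :: "7 list" assume L: "length L = Suc p + q"
 then show "fc (T (extd \<alpha>)) L y = alt_sum p (%K. cov (fc (T \<alpha>)) K y) L"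
 proof (rule split_list)
  fix I J assume IJ: "L = I @ J" "length I = Suc p" "length J = q"
  let ?m = "map (%i. E i y)"
  have "fc (T (extd \<alpha>)) L y = alt_sum p (%K. nablaT (T \<alpha>) y (hd K) (tl K @ ?m J)) (?m I)"
   unfolding IJ(1) fc_T[OF IJ(3)]
   by (rule ell_extd[OF can_forms_alt[OF can_functional[OF c ell_linear]] t]) (use IJ in auto)
  also have "... = alt_sum p (%K. nablaT (T \<alpha>) y (hd (?m K)) (tl (?m K) @ ?m J)) I"
   by (rule alt_sum_map) (use IJ in simp)
  also have "... = alt_sum p (%K. cov (fc (T \<alpha>)) (K @ J) y) I"
  proof (rule alt_sum_cong[where n = 0])
   fix K :: "7 list" assume "length K = Suc p + 0"
   then obtain k M where K: "K = k # M" "length M = p" by (auto simp: length_Suc_conv)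
   show "nablaT (T \<alpha>) y (hd (?m K)) (tl (?m K) @ ?m J) = cov (fc (T \<alpha>)) (K @ J) y"
    using nablaT_frame[OF t y, of "M @ J" k] K IJ by simp
  qed (use IJ in simp)
  also have "... = alt_sum p (%K. cov (fc (T \<alpha>)) K y) L" unfolding IJ(1) by (rule alt_sum_append[symmetric]) (rule IJ)
  finally show ?thesis .
 qed
next
 fix k and I J :: "7 list" assume "length I = cr p" "length J = q"
 then show "ccl p (%M. cov (fc (T \<alpha>)) (k # M) y) (I @ J) = cov (ccf p \<alpha>) (k # I @ J) y"
  unfolding ccf_def using cov_cc[OF smt_fc[OF T_tensor[OF s can_pforms[OF c]]] _ _ y, of I J k] by simp
qed

end

section \<open>The two coefficient bundles\<close>

lemma covec_eval: "linear f ==> (\<chi> i. f (axis i 1)) \<bullet> w = f w" for f :: "vec7 => real"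
proof -
 assume f: "linear f"
 have "w = (\<Sigma> i. (w $ i) *\<^sub>R axis i 1)" using basis_expansion[of w] by (simp add: scalar_mult_eq_scaleR)
 then have "f w = f (\<Sigma> i. (w $ i) *\<^sub>R axis i 1)" by simp
 then show ?thesis by (simp add: inner_vec_def linear_sum[OF f] linear_scale[OF f] mult.commute)
qed

lemma matrix_eval: "linear f ==> matrix f *v w = f w" for f :: "vec7 => vec7"
proof -
 assume f: "linear f"
 have "w = (\<Sigma> i. (w $ i) *\<^sub>R axis i 1)" using basis_expansion[of w] by (simp add: scalar_mult_eq_scaleR)
 then have "f w = f (\<Sigma> i. (w $ i) *\<^sub>R axis i 1)" by simp
 then show ?thesis
  by (simp add: matrix_mult_sum column_def matrix_def vec_lambda_eta scalar_mult_eq_scaleR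
    linear_sum[OF f] linear_scale[OF f])
qed

lemma mlin_head_tail:
 assumes "\<And>us. length us = p ==> linear (%v. F v us)" "\<And>v. mlin p (F v)"
 shows "mlin (Suc p) (%K. F (hd K) (tl K))"
 unfolding mlin_def
proof (intro allI impI)
 fix vs :: "vec7 list" and i assume l: "length vs = Suc p \<and> i < Suc p"
 then obtain v us where vs: "vs = v # us" "length us = p" by (auto simp: length_Suc_conv)
 show "linear (%w. F (hd (vs[i := w])) (tl (vs[i := w])))"
  using assms(1)[OF vs(2)] mlin_linear[OF assms(2) vs(2)] l vs by (cases i) auto
qed

lemma mlin_cmult: "mlin p \<omega> ==> mlin p (%vs. r * \<omega> vs)"
 unfolding mlin_def real_scaleR_def[symmetric] by (intro allI impI linear_compose_scale_right) auto

lemma mlin_diff: "mlin p \<omega> ==> mlin p \<eta> ==> mlin p (%vs. \<omega> vs - \<eta> vs)"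
 unfolding mlin_def by (intro allI impI linear_compose_sub) auto

lemma mlin_sum': "(\<And>b. b \<in> X ==> mlin p (\<omega> b)) ==> mlin p (%vs. \<Sum>b\<in>X. \<omega> b vs)"
 unfolding mlin_def by (intro allI impI linear_compose_sum ballI) auto

lemma lin_scaleR: "linear f ==> linear (%x. f x *\<^sub>R c)" for f :: "'a::real_vector => real"
 by (rule linearI) (simp_all add: linear_add linear_scale scaleR_add_left)

lemma lin_mult: "linear f ==> linear (%x. f x * c)" "linear f ==> linear (%x. c * f x)"
 for f :: "'a::real_vector => real"
 by (auto intro!: linearI simp: linear_add linear_scale algebra_simps)

context lc_atlas
begin

definition ellG :: "'y => vec7 list => vec7 => real" where
 "ellG y J w = w \<bullet> hd J"

definition ellE :: "'y => vec7 list => real^7^7 => real" where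
 "ellE y J N = g y (hd J) (N *v hd (tl J))"

lemma smooth_endD:
 assumes "smooth_end A U s" "open U" "x \<in> U" shows "sme x s"
 unfolding sme_def
proof (intro allI impI)
 fix Z assume "smv x Z"
 then obtain \<rho> Z' where Z': "\<And>y. smv y Z'" "smf x \<rho>" "\<rho> x \<noteq> 0" "\<forall>\<^sub>F y in nhds x. Z' y = \<rho> y *\<^sub>R Z y"
  by (rule smv_globalize) blast
 have "smv x (%y. s y *v Z' y)"
  using assms Z'(1) smooth_vf_iff[OF assms(2)] by (auto simp: smooth_end_def)
 then have "smv x (%y. inverse (\<rho> y) *\<^sub>R (s y *v Z' y))"
  using smv_scale smf_inverse Z' by blast
 moreover have "\<forall>\<^sub>F y in nhds x. inverse (\<rho> y) *\<^sub>R (s y *v Z' y) = s y *v Z y"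
 proof -
  have "(\<rho> \<longlongrightarrow> \<rho> x) (nhds x)" using smf_isCont[OF Z'(2)] by (simp add: isCont_def tendsto_at_iff_tendsto_nhds)
  then have "\<forall>\<^sub>F y in nhds x. \<rho> y \<noteq> 0" using Z'(3) by (rule tendsto_imp_eventually_ne)
  then show ?thesis using Z'(4)
   by eventually_elim (simp add: matrix_vector_mult_scaleR)
 qed
 ultimately show "smv x (%y. s y *v Z y)" by (rule smv_cong)
qed

text \<open>The curvature operator is linear in its two directions.\<close>

lemma linear_curvature1: "linear (%a. curvature A nab x a b *v w)"
proof -
 note e = smv_ext[OF in_pref, of x]
 have "curvature A nab x a b *v w = (\<Sigma> i. (a $ i) *\<^sub>R curvF (ext A x (axis i 1)) (ext A x b) (ext A x w) x)" for a
 proof -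
  have "curvF (ext A x a) (ext A x b) (ext A x w) x =
    (\<Sigma> i. (ext A x a x $ i) *\<^sub>R curvF (ext A x (axis i 1)) (ext A x b) (ext A x w) x)"
   by (rule tensorial[where L = "%X. curvF X (ext A x b) (ext A x w) x"])
     (use curvF_tensorial1[OF e e] e in auto)
  then show ?thesis using curvature_apply[OF e e e, of a b w] by (simp add: ext_self)
 qed
 then show ?thesis by (auto intro!: linearI simp: sum.distrib scaleR_add_left scaleR_sum_right)
qed

lemma linear_curvature2: "linear (%b. curvature A nab x a b *v w)"
proof -
 note e = smv_ext[OF in_pref, of x]
 have "curvature A nab x a b *v w = - (curvature A nab x b a *v w)" for b
  using curvature_apply[OF e e e, of a b w] curvature_apply[OF e e e, of b a w] curvF_swap[OF e e e, of b a w]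
  by (simp add: ext_self)
 then show ?thesis using linear_compose_neg[OF linear_curvature1[of x a w]] by simp
qed

lemma linear_g_curvature:
 "linear (%a. g x u (curvature A nab x a b *v w))" "linear (%b. g x u (curvature A nab x a b *v w))"
 using linear_compose[OF linear_curvature1 g_linear(1)] linear_compose[OF linear_curvature2 g_linear(1)]
 by (simp_all add: comp_def)

lemma trace_orthonormal:
 assumes e: "orthonormal x e" shows "trace N = (\<Sigma> u. g x (e u) (N *v e u))"
proof -
 have c: "N $ i $ i = (\<Sigma> u. g x (e u) (N *v axis i 1) * (e u $ i))" for i
 proof -
  have "N $ i $ i = (N *v axis i 1) $ i" by (simp add: matrix_vector_mul_component axis_def inner_vec_def if_distrib cong: if_cong)
  also have "... = (\<Sigma> u. g x (e u) (N *v axis i 1) *\<^sub>R e u) $ i"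
   using orthonormal_expand[OF e, of "N *v axis i 1"] by simp
  finally show ?thesis by simp
 qed
 have "g x (e u) (N *v e u) = (\<Sigma> i. g x (e u) (N *v axis i 1) * (e u $ i))" for u
 proof -
  have l: "linear (%v. g x (e u) (N *v v))"
   using linear_compose[OF matrix_vector_mul_linear g_linear(1)] by (simp add: comp_def)
  have "g x (e u) (N *v e u) = g x (e u) (N *v (\<Sigma> i. (e u $ i) *\<^sub>R axis i 1))"
   using vec7_expand[of "e u"] by simp
  then show ?thesis by (simp only: linear_sum[OF l] linear_scale[OF l] real_scaleR_def mult.commute)
 qed
 then show ?thesis unfolding trace_def c by (subst sum.swap) simp
qed

lemma trace_mult_orthonormal:
 assumes e: "orthonormal x e"
 shows "trace (M ** N) = (\<Sigma> u v. g x (e u) (M *v e v) * g x (e v) (N *v e u))"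
proof -
 have "g x (e u) ((M ** N) *v e u) = (\<Sigma> v. g x (e u) (M *v e v) * g x (e v) (N *v e u))" for u
 proof -
  have l: "linear (%v. g x (e u) (M *v v))"
   using linear_compose[OF matrix_vector_mul_linear g_linear(1)] by (simp add: comp_def)
  have "g x (e u) ((M ** N) *v e u) = g x (e u) (M *v (\<Sigma> v. g x (e v) (N *v e u) *\<^sub>R e v))"
   using orthonormal_expand[OF e, of "N *v e u"] by (simp add: matrix_vector_mul_assoc)
  then show ?thesis by (simp only: linear_sum[OF l] linear_scale[OF l] real_scaleR_def mult.commute)
 qed
 then show ?thesis using trace_orthonormal[OF e, of "M ** N"] by simp
qed

end

sublocale g2mfd \<subseteq> cv: vbundle A g nab \<phi> vol "Suc 0" ellG "smooth_cov A" "conn_cov A nab"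
proof
 fix y J and w w' b :: vec7 and r :: real
 show "ellG y J (w + w') = ellG y J w + ellG y J w'" "ellG y J (r *\<^sub>R w) = r *\<^sub>R ellG y J w"
  unfolding ellG_def by (simp_all add: inner_add_left)
 show "mlin (Suc 0) (%J. ellG y J w)"
  unfolding mlin_def ellG_def by (auto simp: length_Suc_conv intro!: linearI simp: inner_add_right)
 show "\<exists>J. length J = Suc 0 \<and> (\<forall>w. w \<bullet> b = ellG y J w)" by (rule exI[of _ "[b]"]) (simp add: ellG_def)
next
 fix V :: "'y set" and s :: "'y => vec7" assume V: "open V"
 have "germ (Suc 0) ellG x s \<longleftrightarrow> smc x s" for x
  unfolding germ_def smc_def ellG_def
 proof safe
  fix Z assume a: "\<forall>Js. length Js = Suc 0 \<and> (\<forall>J\<in>set Js. smv x J) \<longrightarrow> smf x (%y. s y \<bullet> hd (map (%J. J y) Js))" "smv x Z"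
  then show "smf x (%y. s y \<bullet> Z y)" using spec[OF a(1), of "[Z]"] by simp
 qed (auto simp: length_Suc_conv)
 then show "smooth_cov A V s \<longleftrightarrow> (\<forall>x\<in>V. germ (Suc 0) ellG x s)"
  using smooth_covI[OF V] smooth_covD[OF _ V] by metis
next
 fix x and s :: "'y => vec7" and X Js
 assume s: "germ (Suc 0) ellG x s" and X: "smv x X" and Js: "length Js = Suc 0" "\<And>J. J \<in> set Js ==> smv x J"
 obtain Z where Z: "Js = [Z]" using Js(1) by (auto simp: length_Suc_conv)
 have c: "smc x s" unfolding smc_def
 proof (intro allI impI)
  fix Z assume "smv x Z"
  then show "smf x (%y. s y \<bullet> Z y)" using s[unfolded germ_def, rule_format, of "[Z]"] by (simp add: ellG_def)
 qed
 show "ellG x (map (%J. J x) Js) (conn_cov A nab x (X x) s) =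
   dirD A x (X x) (%y. ellG y (map (%J. J y) Js) (s y)) -
   (\<Sum>r<Suc 0. ellG x ((map (%J. J x) Js)[r := nab X (Js ! r) x]) (s x))"
  using conn_cov_apply[OF c X, of Z] Js by (simp add: Z ellG_def)
qed

sublocale g2mfd \<subseteq> en: vbundle A g nab \<phi> vol 2 ellE "smooth_end A" "conn_end A nab"
proof
 fix y J and N N' b :: "real^7^7" and r :: real
 show "ellE y J (N + N') = ellE y J N + ellE y J N'" "ellE y J (r *\<^sub>R N) = r *\<^sub>R ellE y J N"
  unfolding ellE_def
  by (simp_all add: matrix_vector_mult_add_rdistrib linear_add[OF g_linear(1)]
    scaleR_matrix_vector_assoc[symmetric] linear_scale[OF g_linear(1)])
 show "mlin 2 (%J. ellE y J N)"
  unfolding mlin_def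
 proof (intro allI impI)
  fix vs :: "vec7 list" and i :: nat assume l: "length vs = 2 \<and> i < 2"
  then obtain a b where vs: "vs = [a, b]" by (auto simp: numeral_2_eq_2 length_Suc_conv)
  have "linear (%v. g y a (N *v v))"
   using linear_compose[OF matrix_vector_mul_linear g_linear(1)] by (simp add: comp_def)
  moreover have "i = 0 \<or> i = 1" using l by auto
  ultimately show "linear (%v. ellE y (vs[i := v]) N)"
   using g_linear(2) by (auto simp: vs ellE_def)
 qed
 assume "b \<in> Basis"
 then obtain i j where b: "b = axis i (axis j 1)" by (auto simp: Basis_vec_def)
 obtain U E where f: "frame U E" "y \<in> U" using frame_exists by blast
 then have o: "orthonormal y (%i. E i y)" by (simp add: frame_def)
 let ?u = "\<Sigma> k. (E k y $ i) *\<^sub>R E k y"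
 have "g y ?u v = v $ i" for v
 proof -
  have "g y ?u v = (\<Sigma> k. (E k y $ i) * g y (E k y) v)"
   by (simp add: linear_sum[OF g_linear(2)] linear_scale[OF g_linear(2)])
  also have "... = (\<Sigma> k. g y (E k y) v *\<^sub>R E k y) $ i" by (simp add: mult.commute)
  finally show ?thesis using orthonormal_expand[OF o, of v] by simp
 qed
 then have "w \<bullet> b = ellE y [?u, axis j 1] w" for w
  by (simp add: ellE_def b inner_axis matrix_vector_mul_component)
 then show "\<exists>J. length J = 2 \<and> (\<forall>w. w \<bullet> b = ellE y J w)" by (intro exI[of _ "[?u, axis j 1]"]) simp
next
 have ge: "germ 2 ellE x s \<longleftrightarrow> sme x s" for x :: 'y and s :: "'y => real^7^7"
 proof
  assume s: "germ 2 ellE x s"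
  obtain U E where f: "frame U E" "x \<in> U" using frame_exists by blast
  interpret F: g2frame A g nab \<phi> vol U E by unfold_locales (rule f)
  show "sme x s" unfolding sme_def
  proof (intro allI impI)
   fix Z assume Z: "smv x Z"
   have "smf x (%y. g y (E i y) (s y *v Z y))" for i
    using s[unfolded germ_def, rule_format, of "[E i, Z]"] Z F.E_smv[OF f(2)] by (simp add: ellE_def)
   then have "smv x (%y. \<Sigma> i. g y (E i y) (s y *v Z y) *\<^sub>R E i y)"
    by (intro smv_sum smv_scale F.E_smv f(2))
   then show "smv x (%y. s y *v Z y)"
    by (rule smv_cong) (rule eventually_mono[OF F.eventually_U[OF f(2)]], rule F.E_expand[symmetric])
  qed
 next
  assume s: "sme x s"
  show "germ 2 ellE x s" unfolding germ_def
  proof (intro allI impI)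
   fix Js assume "length Js = 2 \<and> (\<forall>J\<in>set Js. smv x J)"
   then obtain Y Z where "Js = [Y, Z]" "smv x Y" "smv x Z" by (auto simp: numeral_2_eq_2 length_Suc_conv)
   then show "smf x (%y. ellE y (map (%J. J y) Js) (s y))"
    using s by (auto simp: ellE_def sme_def intro: smf_g)
  qed
 qed
 {
  fix V :: "'y set" and s :: "'y => real^7^7" assume V: "open V"
  show "smooth_end A V s \<longleftrightarrow> (\<forall>x\<in>V. germ 2 ellE x s)"
   using smooth_endI[OF V] smooth_endD[OF _ V] ge by metis
 next
  fix x s X Js
  assume "germ 2 ellE x s" and X: "smv x X" and Js: "length Js = 2" "\<And>J. J \<in> set Js ==> smv x J"
  then have s: "sme x s" by (simp add: ge)
  obtain Y Z where J: "Js = [Y, Z]" using Js(1) by (auto simp: numeral_2_eq_2 length_Suc_conv)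
  then have YZ: "smv x Y" "smv x Z" using Js by auto
  have sZ: "smv x (%y. s y *v Z y)" using s YZ by (simp add: sme_def)
  show "ellE x (map (%J. J x) Js) (conn_end A nab x (X x) s) =
    dirD A x (X x) (%y. ellE y (map (%J. J y) Js) (s y)) -
    (\<Sum>r<2. ellE x ((map (%J. J x) Js)[r := nab X (Js ! r) x]) (s x))"
   using conn_end_apply[OF s X YZ(2)] nab_metric[OF X YZ(1) sZ]
   by (simp add: J ellE_def linear_diff[OF g_linear(1)] numeral_2_eq_2)
 }
qed

sublocale g2frame \<subseteq> cv: vbundle_frame A g nab \<phi> vol "Suc 0" ellG "smooth_cov A" "conn_cov A nab" U E
 by unfold_locales

sublocale g2frame \<subseteq> en: vbundle_frame A g nab \<phi> vol 2 ellE "smooth_end A" "conn_end A nab" U E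
 by unfold_locales

section \<open>Homotopies and couplings in a frame\<close>

context vbundle_frame
begin

text \<open>The three-form is parallel, so that covariant derivatives may be taken in canonical coordinates.\<close>

lemma ccl_nabla:
 assumes c: "can p \<alpha>" and s: "smooth_form A sec p \<alpha>" and y: "y \<in> U"
  and I: "length I = cr p" and J: "length J = q"
 shows "ccl p (%L. nablaT (T \<alpha>) y (E k y) (map (%i. E i y) L @ map (%i. E i y) J)) I =
  cov (ccf p \<alpha>) (k # I @ J) y"
proof -
 note t = T_tensor[OF s can_pforms[OF c]]
 have "ccl p (%L. nablaT (T \<alpha>) y (E k y) (map (%i. E i y) L @ map (%i. E i y) J)) (I @ []) =
   ccl p (%L. cov (fc (T \<alpha>)) (k # L @ J) y) (I @ [])"
 proof (rule ccl_cong[OF _ I])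
  fix L :: "7 list" assume "length L = p"
  then show "nablaT (T \<alpha>) y (E k y) (map (%i. E i y) (L @ []) @ map (%i. E i y) J) =
    cov (fc (T \<alpha>)) (k # (L @ []) @ J) y"
   using nablaT_frame[OF t y, of "L @ J" k] J by simp
 qed
 also have "... = ccl p (%K. cov (fc (T \<alpha>)) (k # K) y) (I @ J)" by (simp add: ccl_tail[OF I])
 finally show ?thesis unfolding ccf_def using cov_cc[OF smt_fc[OF t] I J y] by simp
qed

end

context g2mfd
begin

definition sig :: "nat => ('y => vec7 list => vec7) => 'y => vec7 list => real^7^7" where
 "sig p m y vs = (if length vs = p then matrix (%v. \<Sigma> i. (nablaT (cv.T m) y v (vs @ [onb g y i]) - nablaT (cv.T m) y (onb g y i) (vs @ [v])) *\<^sub>R onb g y i) else 0)"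

definition bet :: "nat => ('y => vec7 list => real^7^7) => 'y => vec7 list => vec7" where
 "bet p a y vs = (if length vs = p then (\<chi> z. (1/4) * (\<Sigma> j. nablaT (en.T a) y (onb g y j) (vs @ [onb g y j, axis z 1]) -
   nablaT (en.T a) y (onb g y j) (vs @ [axis z 1, onb g y j]))) else 0)"

text \<open>
 The homotopies: twice the skew part of the covariant derivative in the cotangent factor and the
 direction, and half the divergence of the skew part of an endomorphism. They are written with the
 covariant derivative of forms, so that their values are forms again; the canonical projection
 keeps them in the canonical complexes.
\<close>

definition sigma :: "nat => ('y => vec7 list => vec7) => 'y => vec7 list => real^7^7" where
 "sigma p m = can_proj \<phi> g p (sig p m)"

definition beta :: "nat => ('y => vec7 list => real^7^7) => 'y => vec7 list => vec7" where
 "beta p a = can_proj \<phi> g p (bet p a)"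

lemma nabla_slots:
 assumes t: "tensor (p + n) S"
 shows "length J = n ==> mlin p (%vs. nablaT S y v (vs @ J))"
  and "length as + length bs + 1 = p + n ==> linear (%w. nablaT S y v (as @ w # bs))"
  and "length us = p + n ==> linear (%v. nablaT S y v us)"
proof -
 have m: "mlin (p + n) (nablaT S y v)"
  unfolding mlin_def using nablaT_slot_linear[OF t] by blast
 show "mlin p (%vs. nablaT S y v (vs @ J))" if "length J = n"
  unfolding mlin_def
 proof (intro allI impI)
  fix vs :: "vec7 list" and i assume l: "length vs = p \<and> i < p"
  have "linear (%w. nablaT S y v ((vs @ J)[i := w]))"
   by (rule mlin_linear[OF m]) (use l that in auto)
  then show "linear (%w. nablaT S y v (vs[i := w] @ J))" using l by (simp add: list_update_append)
 qed
 show "linear (%w. nablaT S y v (as @ w # bs))" if "length as + length bs + 1 = p + n"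
  using mlin_append[OF m that] .
 show "linear (%v. nablaT S y v us)" if "length us = p + n" using nablaT_linear[OF t that] .
qed

lemma sig_apply:
 assumes t: "tensor (p + Suc 0) (cv.T m)" and l: "length vs = p"
 shows "ellE y [u, v] (sig p m y vs) = nablaT (cv.T m) y v (vs @ [u]) - nablaT (cv.T m) y u (vs @ [v])"
proof -
 let ?e = "onb g y"
 let ?F = "%u v. nablaT (cv.T m) y v (vs @ [u]) - nablaT (cv.T m) y u (vs @ [v])"
 have l1: "linear (?F u)" for u
  using nabla_slots(3)[OF t, of "vs @ [u]" y] nabla_slots(2)[OF t, of vs "[]" y u] l
  by (intro linear_compose_sub) auto
 have l2: "linear (%u. ?F u v)"
  using nabla_slots(3)[OF t, of "vs @ [v]" y] nabla_slots(2)[OF t, of vs "[]" y v] l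
  by (intro linear_compose_sub) auto
 have "sig p m y vs *v v = (\<Sigma> i. ?F (?e i) v *\<^sub>R ?e i)"
  unfolding sig_def using l
  by (subst if_P, simp) (intro matrix_eval linear_compose_sum ballI lin_scaleR l1)
 then have "g y u (sig p m y vs *v v) = (\<Sigma> i. ?F (?e i) v * g y u (?e i))" by (simp add: g_sum_right)
 also have "... = ?F (\<Sigma> i. g y (?e i) u *\<^sub>R ?e i) v"
  unfolding linear_sum[OF l2] linear_scale[OF l2]
  using g_sym by (intro sum.cong refl) (simp add: mult.commute)
 finally show ?thesis using orthonormal_expand[OF onb_orthonormal, of u y] by (simp add: ellE_def)
qed

lemma pforms_sig:
 assumes t: "tensor (p + Suc 0) (cv.T m)" shows "en.pforms p (sig p m)"
proof (rule en.pforms_ell)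
 fix y and J :: "vec7 list" assume "length J = 2"
 then obtain u v where J: "J = [u, v]" by (auto simp: numeral_2_eq_2 length_Suc_conv)
 have m: "mlin p (%vs. nablaT (cv.T m) y v (vs @ [u]) - nablaT (cv.T m) y u (vs @ [v]))"
  by (intro mlin_diff nabla_slots(1)[OF t]) simp_all
 show "pform p (%vs. ellE y J (sig p m y vs))"
  unfolding pform_def J
 proof (intro conjI allI impI)
  show "mlin p (%vs. ellE y [u, v] (sig p m y vs))"
   using m unfolding mlin_def by (simp add: sig_apply[OF t])
  fix vs :: "vec7 list" assume "length vs \<noteq> p"
  then show "ellE y [u, v] (sig p m y vs) = 0" using linear_0[OF en.ell_linear] by (simp add: sig_def)
 qed
qed

lemma bet_apply:
 assumes t: "tensor (p + 2) (en.T a)" and l: "length vs = p"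
  and e: "orthonormal y e"
 shows "ellG y [w] (bet p a y vs) = (1/4) * (\<Sigma> j. nablaT (en.T a) y (e j) (vs @ [e j, w]) - nablaT (en.T a) y (e j) (vs @ [w, e j]))"
proof -
 let ?F = "%u v w. nablaT (en.T a) y u (vs @ [v, w]) - nablaT (en.T a) y u (vs @ [w, v])"
 have l1: "linear (%u. ?F u v w)" for v w
  using nabla_slots(3)[OF t, of "vs @ [v, w]" y] nabla_slots(3)[OF t, of "vs @ [w, v]" y] l
  by (intro linear_compose_sub) auto
 have l2: "linear (%v. ?F u v w)" for u w
  using nabla_slots(2)[OF t, of vs "[w]" y u] nabla_slots(2)[OF t, of "vs @ [w]" "[]" y u] l
  by (intro linear_compose_sub) auto
 have l3: "linear (%w. ?F u v w)" for u v
  using nabla_slots(2)[OF t, of vs "[v]" y u] nabla_slots(2)[OF t, of "vs @ [v]" "[]" y u] l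
  by (intro linear_compose_sub) auto
 let ?o = "onb g y"
 have "linear (%w. \<Sigma> j. ?F (?o j) (?o j) w)" by (intro linear_compose_sum ballI l3)
 from linear_compose_scale_right[OF this, of "1/4"]
 have "linear (%w. (1/4) * (\<Sigma> j. ?F (?o j) (?o j) w))" by simp
 from covec_eval[OF this, of w]
 have "ellG y [w] (bet p a y vs) = (1/4) * (\<Sigma> j. ?F (?o j) (?o j) w)"
  using l by (simp add: ellG_def bet_def)
 also have "(\<Sigma> j. ?F (?o j) (?o j) w) = (\<Sigma> j. ?F (e j) (e j) w)"
  by (rule orthonormal_contract[OF onb_orthonormal e, where h = "%u v. ?F u v w"]) (rule l1 l2)+
 finally show ?thesis .
qed

lemma pforms_bet:
 assumes t: "tensor (p + 2) (en.T a)" shows "cv.pforms p (bet p a)"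
proof (rule cv.pforms_ell)
 fix y and J :: "vec7 list" assume "length J = Suc 0"
 then obtain w where J: "J = [w]" by (auto simp: length_Suc_conv)
 have m: "mlin p (%vs. (1/4) * (\<Sigma> j. nablaT (en.T a) y (onb g y j) (vs @ [onb g y j, w]) -
   nablaT (en.T a) y (onb g y j) (vs @ [w, onb g y j])))"
  by (intro mlin_cmult mlin_sum' mlin_diff nabla_slots(1)[OF t]) simp_all
 show "pform p (%vs. ellG y J (bet p a y vs))"
  unfolding pform_def J
 proof (intro conjI allI impI)
  show "mlin p (%vs. ellG y [w] (bet p a y vs))"
   using m unfolding mlin_def by (simp add: bet_apply[OF t _ onb_orthonormal])
  fix vs :: "vec7 list" assume "length vs \<noteq> p"
  then show "ellG y [w] (bet p a y vs) = 0" by (simp add: bet_def ellG_def)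
 qed
qed

lemma conn_cov_form_apply:
 assumes t: "tensor (p + Suc 0) (cv.T m)" and pf: "cv.pforms p m"
 shows "conn_cov_form A nab m x X vs \<bullet> w = (if length vs = p then nablaT (cv.T m) x X (vs @ [w]) else 0)"
proof (cases "length vs = p")
 case True
 let ?s = "%y. m y (map (%v. ext A x v y) vs)"
 have "smc x ?s" unfolding smc_def
 proof (intro allI impI)
  fix Z assume Z: "smv x Z"
  have "smf x (%y. cv.T m y (map (%Y. Y y) (map (ext A x) vs @ [Z])))"
   by (rule tensor_smf[OF t]) (use Z True smv_ext[OF in_pref] in auto)
  then show "smf x (%y. ?s y \<bullet> Z y)" by (simp add: cv.T_append comp_def ellG_def)
 qed
 from conn_cov_apply[OF this smv_ext[OF in_pref] smv_ext[OF in_pref], of X w] True show ?thesis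
  by (simp add: conn_cov_form_def nablaT_def inner_diff_left inner_sum_left ext_self comp_def
    cv.T_append ellG_def list_update_append nth_append)
next
 case False
 have z: "m y us = 0" if "length us \<noteq> p" for y us using cv.pforms_length[OF pf that] .
 have "(%y. m y (map (%v. ext A x v y) vs)) = (%y. 0)" using False by (intro ext z) simp
 then show ?thesis using False by (simp add: conn_cov_form_def cv.conn_zero z)
qed

text \<open>
 The endomorphism \<open>\<B>(m)\<close> is determined by its matrix elements, since the metric is nondegenerate.
\<close>

lemma B_op_apply:
 assumes t: "tensor (p + Suc 0) (cv.T m)" and pf: "cv.pforms p m"
 shows "ellE x [u, v] (B_op A g nab m x vs) = (if length vs = p then nablaT (cv.T m) x u (vs @ [v]) else 0)"
proof -
 let ?e = "onb g x"
 let ?M = "matrix (%v. \<Sigma> i. (if length vs = p then nablaT (cv.T m) x (?e i) (vs @ [v]) else 0) *\<^sub>R ?e i)"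
 let ?c = "%u v. if length vs = p then nablaT (cv.T m) x u (vs @ [v]) else 0"
 have l1: "linear (?c u)" for u
  using nabla_slots(2)[OF t, of vs "[]" x u] by (cases "length vs = p") (auto simp: linear_zero)
 have l2: "linear (%u. ?c u v)" for v
  using nabla_slots(3)[OF t, of "vs @ [v]" x] by (cases "length vs = p") (auto simp: linear_zero)
 have M: "g x X (?M *v Y) = ?c X Y" for X Y
 proof -
  have "?M *v Y = (\<Sigma> i. ?c (?e i) Y *\<^sub>R ?e i)"
   by (intro matrix_eval linear_compose_sum ballI lin_scaleR l1)
  then have "g x X (?M *v Y) = (\<Sigma> i. ?c (?e i) Y * g x X (?e i))" by (simp add: g_sum_right)
  also have "... = ?c (\<Sigma> i. g x (?e i) X *\<^sub>R ?e i) Y"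
   unfolding linear_sum[OF l2] linear_scale[OF l2]
   using g_sym by (intro sum.cong refl) (simp add: mult.commute)
  finally show ?thesis using orthonormal_expand[OF onb_orthonormal, of X x] by simp
 qed
 have "B_op A g nab m x vs = ?M" unfolding B_op_def conn_cov_form_apply[OF t pf]
 proof (rule the_equality)
  show "\<forall>X Y. g x X (?M *v Y) = ?c X Y" using M by blast
  fix N assume N: "\<forall>X Y. g x X (N *v Y) = ?c X Y"
  show "N = ?M"
  proof (rule en.ell_eqI)
   fix J :: "vec7 list" assume "length J = 2"
   then obtain a b where "J = [a, b]" by (auto simp: numeral_2_eq_2 length_Suc_conv)
   then show "ellE x J N = ellE x J ?M" using N M by (simp add: ellE_def)
  qed
 qed
 then show ?thesis using M by (simp add: ellE_def)
qed

lemma pforms_B: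
 assumes t: "tensor (p + Suc 0) (cv.T m)" and pf: "cv.pforms p m" shows "en.pforms p (B_op A g nab m)"
proof (rule en.pforms_ell)
 fix y and J :: "vec7 list" assume "length J = 2"
 then obtain u v where J: "J = [u, v]" by (auto simp: numeral_2_eq_2 length_Suc_conv)
 show "pform p (%vs. ellE y J (B_op A g nab m y vs))"
  unfolding pform_def J
  using nabla_slots(1)[OF t, of "[v]" y u] by (simp add: B_op_apply[OF t pf] mlin_def)
qed

subsection \<open>Couplings as exterior products\<close>

text \<open>
 The sum over the fixed orthonormal basis may be taken over any other one.
\<close>

lemma f_op_apply:
 assumes l: "length vs = Suc p" and e: "orthonormal x e"
 shows "ellE x [u, v] (f_op A g nab m x vs) =
  alt_sum p (%K. \<Sigma> j. ellG x [e j] (m x (tl K)) * g x u (curvature A nab x (e j) (hd K) *v v)) vs"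
proof -
 let ?h = "%K a b. ellG x [b] (m x (tl K)) * g x u (curvature A nab x a (hd K) *v v)"
 have c: "(\<Sigma> j. ?h K (onb g x j) (onb g x j)) = (\<Sigma> j. ?h K (e j) (e j))" for K
  by (rule orthonormal_contract[OF onb_orthonormal e, where h = "?h K"])
    (auto intro!: linearI simp: ellG_def inner_add_right linear_add[OF linear_curvature1]
     linear_scale[OF linear_curvature1] linear_add[OF g_linear(1)] linear_scale[OF g_linear(1)] algebra_simps)
 have "ellE x [u, v] (f_op A g nab m x vs) =
   (\<Sigma> j. \<Sum>i<Suc p. (- 1) ^ i * ?h (vs ! i # omit i vs) (onb g x j) (onb g x j))"
  unfolding f_op_def wedge1_def l linear_sum[OF en.ell_linear] linear_scale[OF en.ell_linear]
  by (simp add: ellE_def ellG_def linear_scale[OF g_linear(1)] scaleR_matrix_vector_assoc[symmetric]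
    mult.assoc del: sum.lessThan_Suc)
 also have "... = (\<Sum>i<Suc p. \<Sigma> j. (- 1) ^ i * ?h (vs ! i # omit i vs) (onb g x j) (onb g x j))"
  by (rule sum.swap)
 finally show ?thesis unfolding alt_sum_def sum_distrib_left[symmetric] c .
qed

lemma pforms_f:
 assumes pf: "cv.pforms p m" shows "en.pforms (Suc p) (f_op A g nab m)"
proof (rule en.pforms_ell)
 fix y and J :: "vec7 list" assume "length J = 2"
 then obtain u v where J: "J = [u, v]" by (auto simp: numeral_2_eq_2 length_Suc_conv)
 let ?e = "onb g y"
 have m: "mlin (Suc p) (%K. (%k us. \<Sigma> j. ellG y [?e j] (m y us) * g y u (curvature A nab y (?e j) k *v v)) (hd K) (tl K))"
 proof (rule mlin_head_tail)
  show "linear (%k. \<Sigma> j. ellG y [?e j] (m y us) * g y u (curvature A nab y (?e j) k *v v))" for us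
   by (intro linear_compose_sum ballI lin_mult linear_g_curvature)
  show "mlin p (%us. \<Sigma> j. ellG y [?e j] (m y us) * g y u (curvature A nab y (?e j) k *v v))" for k
   using cv.pforms_functional[OF pf cv.ell_linear] unfolding pform_def
   by (subst mult.commute) (intro mlin_sum' mlin_cmult, blast)
 qed
 show "pform (Suc p) (%vs. ellE y J (f_op A g nab m y vs))"
  unfolding pform_def J
 proof (intro conjI allI impI)
  show "mlin (Suc p) (%vs. ellE y [u, v] (f_op A g nab m y vs))"
   using mlin_alt_sum[OF m] unfolding mlin_def by (simp add: f_op_apply[OF _ onb_orthonormal])
  fix vs :: "vec7 list" assume l: "length vs \<noteq> Suc p"
  have "f_op A g nab m y vs = 0" unfolding f_op_def wedge1_def
  proof (intro sum.neutral ballI)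
   fix j i assume "i \<in> {..<length vs}"
   then have "length (omit i vs) \<noteq> p" using l by (simp add: length_omit; linarith)
   from cv.pforms_length[OF pf this]
   show "(- 1) ^ i *\<^sub>R (m y (omit i vs) \<bullet> onb g y j) *\<^sub>R curvature A nab y (onb g y j) (vs ! i) = 0" by simp
  qed
  then show "ellE y [u, v] (f_op A g nab m y vs) = 0" using linear_0[OF en.ell_linear] by simp
 qed
qed

text \<open>Both \<open>b\<close> and \<open>c\<close> contract the curvature with an endomorphism-valued form.\<close>

definition tw :: "real => ('y => vec7 list => real^7^7) => 'y => vec7 list => vec7" where
 "tw r K x vs = (\<chi> i. - r * wedge1 (%M N. trace (M ** N)) (curvature A nab x (axis i 1)) (K x) vs)"

lemma b_op_tw: "b_op A nab a = tw (1/4) a"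
 and c_op_tw: "c_op A g nab m = tw (1/2) (B_op A g nab m)"
 by (simp_all add: tw_def b_op_def c_op_def fun_eq_iff)

lemma tw_apply:
 assumes l: "length vs = Suc p" and e: "orthonormal x e"
 shows "ellG x [w] (tw r K x vs) =
  alt_sum p (%L. - r * (\<Sigma> a b. g x (e a) (curvature A nab x w (hd L) *v e b) *
   ellE x [e b, e a] (K x (tl L)))) vs"
proof -
 let ?f = "%w. alt_sum p (%L. - r * (\<Sigma> a b. g x (e a) (curvature A nab x w (hd L) *v e b) *
   ellE x [e b, e a] (K x (tl L)))) vs"
 have eq: "- r * wedge1 (%M N. trace (M ** N)) (curvature A nab x w) (K x) vs = ?f w" for w
  unfolding wedge1_def alt_sum_def l sum_distrib_left
  by (intro sum.cong refl) (simp add: trace_mult_orthonormal[OF e] ellE_def sum_distrib_left mult_ac)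
 have "linear ?f"
  unfolding alt_sum_def by (intro linear_compose_sum ballI lin_mult linear_g_curvature)
 from covec_eval[OF this, of w] show ?thesis unfolding ellG_def tw_def eq by simp
qed

lemma pforms_tw:
 assumes pf: "en.pforms p K" shows "cv.pforms (Suc p) (tw r K)"
proof (rule cv.pforms_ell)
 fix y and J :: "vec7 list" assume "length J = Suc 0"
 then obtain w where J: "J = [w]" by (auto simp: length_Suc_conv)
 let ?e = "onb g y"
 let ?F = "%k us. - r * (\<Sigma> a b. g y (?e a) (curvature A nab y w k *v ?e b) * ellE y [?e b, ?e a] (K y us))"
 have m: "mlin (Suc p) (%L. ?F (hd L) (tl L))"
 proof (rule mlin_head_tail)
  show "linear (%k. ?F k us)" for us by (intro linear_compose_sum ballI lin_mult linear_g_curvature)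
  show "mlin p (?F k)" for k
   using en.pforms_functional[OF pf en.ell_linear] unfolding pform_def
   by (intro mlin_cmult mlin_sum') blast
 qed
 show "pform (Suc p) (%vs. ellG y J (tw r K y vs))"
  unfolding pform_def J
 proof (intro conjI allI impI)
  show "mlin (Suc p) (%vs. ellG y [w] (tw r K y vs))"
   using mlin_alt_sum[OF m] unfolding mlin_def by (simp add: tw_apply[OF _ onb_orthonormal])
  fix vs :: "vec7 list" assume l: "length vs \<noteq> Suc p"
  have "wedge1 (%M N. trace (M ** N)) (curvature A nab y (axis i 1)) (K y) vs = 0" for i
   unfolding wedge1_def
  proof (intro sum.neutral ballI)
   fix j assume "j \<in> {..<length vs}"
   then have "length (omit j vs) \<noteq> p" using l by (simp add: length_omit; linarith)
   from en.pforms_length[OF pf this]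
   show "(- 1) ^ j *\<^sub>R trace (curvature A nab y (axis i 1) (vs ! j) ** K y (omit j vs)) = 0"
    by (simp add: trace_def)
  qed
  then show "ellG y [w] (tw r K y vs) = 0" by (simp add: ellG_def tw_def inner_vec_def)
 qed
qed

end

subsection \<open>Components\<close>

context g2frame
begin

lemma length_1: "length J = Suc 0 \<longleftrightarrow> (\<exists>a. J = [a])" and length_2: "length J = 2 \<longleftrightarrow> (\<exists>a b. J = [a, b])"
 by (auto simp: length_Suc_conv numeral_2_eq_2)

lemma curvature_E: "y \<in> U ==> g y (E u y) (curvature A nab y (E i y) (E k y) *v E v y) = Rm i k v u y"
 unfolding Rm_def using curvature_apply[OF E_smv E_smv E_smv] by simp

lemma ccf_sigma:
 assumes c: "cv.can p m" and s: "smooth_form A (smooth_cov A) p m" and y: "y \<in> U" and L: "length L = cr p + 2"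
 shows "en.ccf p (sigma p m) L y = sigma_ix (cov (cv.ccf p m)) L y"
 using L
proof (rule en.split_list)
 fix I J assume IJ: "L = I @ J" "length I = cr p" "length J = 2"
 then obtain u v where J: "J = [u, v]" by (auto simp: length_2)
 note t = cv.T_tensor[OF s cv.can_pforms[OF c]]
 let ?m = "map (%i. E i y)"
 have "en.ccf p (sigma p m) L y = en.ccf p (sig p m) L y"
  unfolding sigma_def by (rule en.ccf_can_proj[OF pforms_sig[OF t] y L])
 also have "... = ccl p (%L. ellE y [E u y, E v y] (sig p m y (?m L))) (I @ [])"
  using IJ J by (simp add: en.ccf_append)
 also have "... = ccl p (%L. nablaT (cv.T m) y (E v y) (?m L @ ?m [u]) - nablaT (cv.T m) y (E u y) (?m L @ ?m [v])) (I @ [])"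
  by (rule ccl_cong[OF _ IJ(2)]) (simp add: sig_apply[OF t])
 also have "... = cov (cv.ccf p m) (v # I @ [u]) y - cov (cv.ccf p m) (u # I @ [v]) y"
  using cv.ccl_nabla[OF c s y IJ(2), of "[u]" v] cv.ccl_nabla[OF c s y IJ(2), of "[v]" u]
  by (simp add: ccl_linear)
 finally show ?thesis by (simp add: IJ J sigma_ix_def butlast_append)
qed

lemma ccf_beta:
 assumes c: "en.can p a" and s: "smooth_form A (smooth_end A) p a" and y: "y \<in> U" and L: "length L = cr p + Suc 0"
 shows "cv.ccf p (beta p a) L y = beta_ix (cov (en.ccf p a)) L y"
 using L
proof (rule cv.split_list)
 fix I J assume IJ: "L = I @ J" "length I = cr p" "length J = Suc 0"
 then obtain w where J: "J = [w]" by (auto simp: length_1)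
 note t = en.T_tensor[OF s en.can_pforms[OF c]]
 let ?m = "map (%i. E i y)"
 have "cv.ccf p (beta p a) L y = cv.ccf p (bet p a) L y"
  unfolding beta_def by (rule cv.ccf_can_proj[OF pforms_bet[OF t] y L])
 also have "... = ccl p (%L. ellG y [E w y] (bet p a y (?m L))) (I @ [])"
  using IJ J by (simp add: cv.ccf_append)
 also have "... = ccl p (%L. (1/4) * (\<Sigma> j. nablaT (en.T a) y (E j y) (?m L @ ?m [j, w]) -
   nablaT (en.T a) y (E j y) (?m L @ ?m [w, j]))) (I @ [])"
  by (rule ccl_cong[OF _ IJ(2)]) (simp add: bet_apply[OF t _ E_on[OF y]])
 also have "... = (1/4) * (\<Sigma> j. cov (en.ccf p a) (j # I @ [j, w]) y - cov (en.ccf p a) (j # I @ [w, j]) y)"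
  unfolding append_Nil2 ccl_linear(2) ccl_sum[OF finite] ccl_linear(3)
  using en.ccl_nabla[OF c s y IJ(2), of "[_, _]"] by simp
 finally show ?thesis by (simp add: IJ J beta_ix_def butlast_append)
qed

lemma ccf_f:
 assumes k: "p \<le> 2" and c: "cv.can p m" and y: "y \<in> U" and L: "length L = cr (Suc p) + 2"
 shows "en.ccf (Suc p) (can_proj \<phi> g (Suc p) (f_op A g nab m)) L y = Sy p (f_ix (cv.ccf p m)) L y"
proof (rule en.ccf_alt[OF k pforms_f[OF cv.can_pforms[OF c]] y L])
 let ?m = "map (%i. E i y)"
 fix L :: "7 list" assume L: "length L = Suc p + 2"
 then show "fc (en.T (f_op A g nab m)) L y = alt_sum p (%K. f_ix (fc (cv.T m)) K y) L"
 proof (rule en.split_list)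
  fix I J assume IJ: "L = I @ J" "length I = Suc p" "length J = 2"
  then obtain u v where J: "J = [u, v]" by (auto simp: length_2)
  have "fc (en.T (f_op A g nab m)) L y = ellE y [E u y, E v y] (f_op A g nab m y (?m I))"
   using en.fc_T[OF IJ(3)] by (simp add: IJ J)
  also have "... = alt_sum p (%K. \<Sigma> j. ellG y [E j y] (m y (tl (?m K))) *
    g y (E u y) (curvature A nab y (E j y) (hd (?m K)) *v E v y)) I"
   by (subst f_op_apply[OF _ E_on[OF y]], use IJ in simp) (rule alt_sum_map, use IJ in simp)
  also have "... = alt_sum p (%K. f_ix (fc (cv.T m)) (K @ J) y) I"
  proof (rule alt_sum_cong[where n = 0])
   fix K :: "7 list" assume "length K = Suc p + 0"
   then obtain k M where K: "K = k # M" by (auto simp: length_Suc_conv)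
   show "(\<Sigma> j. ellG y [E j y] (m y (tl (?m K))) *
     g y (E u y) (curvature A nab y (E j y) (hd (?m K)) *v E v y)) = f_ix (fc (cv.T m)) (K @ J) y"
    using cv.fc_T[of "[_]" m M y] by (simp add: K J f_ix_def butlast_append curvature_E[OF y] mult.commute)
  qed (use IJ in simp)
  finally show ?thesis by (simp add: IJ alt_sum_append)
 qed
next
 fix k and I J :: "7 list" assume I: "length I = cr p" and "length J = 2"
 then obtain u v where J: "J = [u, v]" by (auto simp: length_2)
 have "ccl p (%M. f_ix (fc (cv.T m)) (k # M) y) (I @ J) =
   ccl p (%M. \<Sigma> j. Rm j k v u y * fc (cv.T m) (M @ [j]) y) I"
  unfolding ccl_tail[OF I] by (simp add: J f_ix_def butlast_append)
 also have "... = (\<Sigma> j. Rm j k v u y * cv.ccf p m (I @ [j]) y)"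
  by (simp add: ccl_sum ccl_linear cv.ccf_def cc_def ccl_tail[OF I])
 finally show "ccl p (%M. f_ix (fc (cv.T m)) (k # M) y) (I @ J) = f_ix (cv.ccf p m) (k # I @ J) y"
  by (simp add: J f_ix_def butlast_append)
qed

lemma ccf_tw:
 assumes k: "p \<le> 2" and c: "en.pforms p K" and y: "y \<in> U" and L: "length L = cr (Suc p) + Suc 0"
 shows "cv.ccf (Suc p) (can_proj \<phi> g (Suc p) (tw r K)) L y = Sy p (%L y. 4 * r * b_ix (en.ccf p K) L y) L y"
proof (rule cv.ccf_alt[OF k pforms_tw[OF c] y L])
 let ?m = "map (%i. E i y)"
 let ?F = "%t L. - r * (\<Sigma> a b. Rm (last L) (hd L) b a y * t (butlast (tl L) @ [b, a]) y)"
 fix L :: "7 list" assume L: "length L = Suc p + Suc 0"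
 then show "fc (cv.T (tw r K)) L y = alt_sum p (?F (fc (en.T K))) L"
 proof (rule cv.split_list)
  fix I J assume IJ: "L = I @ J" "length I = Suc p" "length J = Suc 0"
  then obtain w where J: "J = [w]" by (auto simp: length_1)
  have "fc (cv.T (tw r K)) L y = ellG y [E w y] (tw r K y (?m I))"
   using cv.fc_T[OF IJ(3)] by (simp add: IJ J)
  also have "... = alt_sum p (%L. - r * (\<Sigma> a b. g y (E a y) (curvature A nab y (E w y) (hd (?m L)) *v E b y) *
    ellE y [E b y, E a y] (K y (tl (?m L))))) I"
   by (subst tw_apply[OF _ E_on[OF y]], use IJ in simp) (rule alt_sum_map, use IJ in simp)
  also have "... = alt_sum p (%K'. ?F (fc (en.T K)) (K' @ J)) I"
  proof (rule alt_sum_cong[where n = 0])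
   fix L :: "7 list" assume "length L = Suc p + 0"
   then obtain k M where M: "L = k # M" by (auto simp: length_Suc_conv)
   show "- r * (\<Sigma> a b. g y (E a y) (curvature A nab y (E w y) (hd (?m L)) *v E b y) *
    ellE y [E b y, E a y] (K y (tl (?m L)))) = ?F (fc (en.T K)) (L @ J)"
    using en.fc_T[of "[_, _]" K M y] by (simp add: M J butlast_append curvature_E[OF y])
  qed (use IJ in simp)
  finally show ?thesis by (simp add: IJ alt_sum_append)
 qed
next
 let ?F = "%t L. - r * (\<Sigma> a b. Rm (last L) (hd L) b a y * t (butlast (tl L) @ [b, a]) y)"
 fix k and I J :: "7 list" assume I: "length I = cr p" and "length J = Suc 0"
 then obtain w where J: "J = [w]" by (auto simp: length_1)
 have "ccl p (%M. ?F (fc (en.T K)) (k # M)) (I @ J) =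
   ccl p (%M. - r * (\<Sigma> a b. Rm w k b a y * fc (en.T K) (M @ [b, a]) y)) I"
  unfolding ccl_tail[OF I] by (simp add: J)
 also have "... = - r * (\<Sigma> a b. Rm w k b a y * en.ccf p K (I @ [b, a]) y)"
  unfolding ccl_linear(2) ccl_sum[OF finite] by (simp add: en.ccf_def cc_def ccl_tail[OF I])
 finally show "ccl p (%M. ?F (fc (en.T K)) (k # M)) (I @ J) = 4 * r * b_ix (en.ccf p K) (k # I @ J) y"
  by (simp add: J b_ix_def butlast_append)
qed

lemma ccf_B:
 assumes c: "cv.can p m" and s: "smooth_form A (smooth_cov A) p m" and y: "y \<in> U" and I: "length I = cr p"
 shows "en.ccf p (B_op A g nab m) (I @ [u, v]) y = cov (cv.ccf p m) (u # I @ [v]) y"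
proof -
 note t = cv.T_tensor[OF s cv.can_pforms[OF c]]
 let ?m = "map (%i. E i y)"
 have "en.ccf p (B_op A g nab m) (I @ [u, v]) y = ccl p (%L. ellE y [E u y, E v y] (B_op A g nab m y (?m L))) (I @ [])"
  using I by (simp add: en.ccf_append)
 also have "... = ccl p (%L. nablaT (cv.T m) y (E u y) (?m L @ ?m [v])) (I @ [])"
  by (rule ccl_cong[OF _ I]) (simp add: B_op_apply[OF t cv.can_pforms[OF c]])
 finally show ?thesis using cv.ccl_nabla[OF c s y I, of "[v]" u] by simp
qed

end

section \<open>The splitting\<close>

definition fcomb :: "real => ('y => vec7 list => 'w::real_vector) => ('y => vec7 list => 'w) => 'y => vec7 list => 'w" where
 "fcomb r \<alpha> \<beta> = (%y vs. \<alpha> y vs + r *\<^sub>R \<beta> y vs)"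

lemma fcomb_cancel: "fcomb (-1) (fcomb 1 \<alpha> \<beta>) \<beta> = \<alpha>"
 by (simp add: fcomb_def)

subsection \<open>Index operators\<close>

context g2frame
begin

lemma smt_cong:
 assumes "smt n t" "\<And>L y. length L = n ==> y \<in> U ==> t L y = u L y" shows "smt n u"
 using assms smU_cong unfolding smt_def by blast

lemma cov_cong':
 assumes "length M = Suc n" "y \<in> U" "\<And>K z. length K = n ==> z \<in> U ==> t K z = u K z"
 shows "cov t M y = cov u M y"
proof -
 obtain k L where M: "M = k # L" "length L = n" using assms(1) by (auto simp: length_Suc_conv)
 show ?thesis unfolding M(1) by (rule cov_cong[OF assms(2) M(2) assms(3)])
qed

lemma cov_comb:
 assumes "length M = Suc n" "y \<in> U" "smt n t" "smt n u"
 shows "cov (%L y. t L y + r * u L y) M y = cov t M y + r * cov u M y"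
proof -
 obtain k L where M: "M = k # L" "length L = n" using assms(1) by (auto simp: length_Suc_conv)
 have "cov (%L y. t L y + r * u L y) M y = cov t M y + cov (%L y. r * u L y) M y"
  unfolding M(1) by (rule cov_linear(1)[OF assms(2,3) smt_cmult[OF assms(4)] M(2)])
 then show ?thesis unfolding M(1) cov_linear(3)[OF assms(2,4,4) M(2)] .
qed

lemma Sy_cov_cong:
 assumes "p \<le> 2" "length L = cr (Suc p) + n" "y \<in> U" "\<And>K z. length K = cr p + n ==> z \<in> U ==> t K z = u K z"
 shows "Sy p (cov t) L y = Sy p (cov u) L y"
 by (rule Sy_cong[OF assms(1,2)]) (rule cov_cong'[OF _ assms(3,4)])

lemma Sy_comb: "Sy p (%L y. t L y + r * u L y) L y = Sy p t L y + r * Sy p u L y"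
 by (simp add: Sy_def KP_def KT_def distrib_left sum.distrib sum_distrib_left mult_ac)

lemma Sy_cov_comb:
 assumes "p \<le> 2" "length L = cr (Suc p) + n" "y \<in> U" "smt (cr p + n) t" "smt (cr p + n) u"
 shows "Sy p (cov (%L y. t L y + r * u L y)) L y = Sy p (cov t) L y + r * Sy p (cov u) L y"
 unfolding Sy_comb[symmetric]
 by (rule Sy_cong[OF assms(1,2)]) (rule cov_comb[OF _ assms(3-5)])

lemma smt_Sy_cov:
 assumes p: "p \<le> 2" and t: "smt (cr p + n) t" shows "smt (cr (Suc p) + n) (Sy p (cov t))"
proof -
 have s: "smt (Suc (cr p + n)) (cov t)" by (rule smt_cov[OF t])
 consider "p = 0" | "p = 1" | "p = 2" using p by linarith
 then show ?thesis
 proof cases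
  case 1 then show ?thesis using smt_Sy(1)[of n "cov t"] s by (simp add: cr_def)
 next
  case 2 then show ?thesis using smt_Sy(2)[of n "cov t"] s by (simp add: cr_def)
 next
  case 3 then show ?thesis using smt_Sy(3)[of n "cov t"] s by (simp add: cr_def)
 qed
qed

lemma sigma_ix_cong:
 assumes "length L = n + 2" "\<And>M. length M = n + 2 ==> N M y = N' M y"
 shows "sigma_ix N L y = sigma_ix N' L y"
 unfolding sigma_ix_def using assms by simp

lemma beta_ix_cong:
 assumes "length L = Suc n" "\<And>M. length M = n + 3 ==> N M y = N' M y"
 shows "beta_ix N L y = beta_ix N' L y"
 unfolding beta_ix_def using assms by simp

lemma sigma_ix_comb: "sigma_ix (%L y. t L y + r * u L y) L y = sigma_ix t L y + r * sigma_ix u L y"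
 by (simp add: sigma_ix_def algebra_simps)

lemma beta_ix_comb: "beta_ix (%L y. t L y + r * u L y) L y = beta_ix t L y + r * beta_ix u L y"
proof -
 have "(\<Sigma> j. (t (j # butlast L @ [j, last L]) y + r * u (j # butlast L @ [j, last L]) y) -
   (t (j # L @ [j]) y + r * u (j # L @ [j]) y)) =
   (\<Sigma> j. (t (j # butlast L @ [j, last L]) y - t (j # L @ [j]) y) +
   r * (u (j # butlast L @ [j, last L]) y - u (j # L @ [j]) y))"
  by (intro sum.cong refl) (simp add: algebra_simps)
 then show ?thesis unfolding beta_ix_def by (simp add: sum.distrib flip: sum_distrib_left)
qed

lemma smt_sigma_ix: "smt (n + 2) N ==> smt (n + 2) (sigma_ix N)"
 unfolding smt_def sigma_ix_def[abs_def] by (auto intro!: smU_rules)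

lemma smt_beta_ix: "smt (n + 3) N ==> smt (Suc n) (beta_ix N)"
 unfolding smt_def beta_ix_def[abs_def]
 by (intro allI impI smU_rules(4)[OF smU_rules(1)] smU_rules(5) smU_rules(3)) auto

text \<open>
 The trace over the two value indices is parallel, as the connection matrices are skew.
\<close>

lemma Sy_trace:
 assumes p: "p \<le> 2" and t: "smt (cr p + 2) t" and y: "y \<in> U" and I: "length I = cr (Suc p)"
  and z: "\<And>K z. length K = cr p ==> z \<in> U ==> (\<Sigma> u. t (K @ [u, u]) z) = 0"
 shows "(\<Sigma> u. Sy p (cov t) (I @ [u, u]) y) = 0"
proof -
 have c: "(\<Sigma> u. cov t (k # K @ [u, u]) y) = 0" if K: "length K = cr p" for k K
 proof -
  let ?A = "%a q. Om k a q y"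
  have s: "smU (t (K @ [u, u]))" for u using t K by (simp add: smt_def)
  have "(\<Sigma> u. dE k (t (K @ [u, u])) y) = dE k (%y. \<Sigma> u. t (K @ [u, u]) y) y"
   by (rule dE_sum[OF y s, symmetric])
  also have "... = dE k (%y. 0) y" by (rule dE_cong[OF y z[OF K]])
  finally have d: "(\<Sigma> u. dE k (t (K @ [u, u])) y) = 0" by (simp add: dE_const)
  have "(\<Sigma> u. act ?A K (%K. t (K @ [u, u]) y)) = act ?A K (%K. \<Sigma> u. t (K @ [u, u]) y)"
   by (simp add: act_sum)
  also have "... = act ?A K (%K. 0)" by (rule act_cong) (use z y K in auto)
  finally have a: "(\<Sigma> u. act ?A K (%K. t (K @ [u, u]) y)) = 0" by (simp add: act_zero)
  have b: "(\<Sigma> u. act ?A [u, u] (%J. t (K @ J) y)) = 0"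
   using act_KT[OF Om_skew[OF y], of k "[]" "%J. t (K @ J) y"] by simp
  show ?thesis using d a b by (simp add: cov_Cons act_append sum_subtractf sum.distrib del: act.simps)
 qed
 consider "p = 0" | "p = 1" | "p = 2" using p by linarith
 then show ?thesis
 proof cases
  case 1
  then obtain k where "I = [k]" using I by (auto simp: cr_def length_Suc_conv)
  then show ?thesis using c[of "[]" k] 1 by (simp add: Sy_def cr_def)
 next
  case 2
  then obtain k where k: "I = [k]" using I by (auto simp: cr_def length_Suc_conv)
  have "(\<Sigma> u a b. P k a b * cov t [a, b, u, u] y) =
    (\<Sigma> b a u. P k a b * cov t [a, b, u, u] y)" by (rule sum_swap13)
  then show ?thesis using c[of "[_]"] 2 k
   by (simp add: Sy_def cr_def KP_def flip: sum_distrib_left sum_divide_distrib)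
 next
  case 3
  then have "I = []" using I by (simp add: cr_def)
  moreover have "(\<Sigma> u a. cov t [a, a, u, u] y) = (\<Sigma> a u. cov t [a, a, u, u] y)"
   by (rule sum.swap)
  ultimately show ?thesis using c[of "[_]"] 3
   by (simp add: Sy_def cr_def KT_def flip: sum_distrib_left sum_divide_distrib)
 qed
qed

end

subsection \<open>The canonical complex of a bundle\<close>

context vbundle
begin

definition coch :: "nat => ('y => vec7 list => 'w) => bool" where
 "coch p \<alpha> \<longleftrightarrow> can p \<alpha> \<and> smooth_form A sec p \<alpha>"

definition dd :: "nat => ('y => vec7 list => 'w) => 'y => vec7 list => 'w" where
 "dd p \<alpha> = can_proj \<phi> g (Suc p) (extd \<alpha>)"

lemma cochD: "coch p \<alpha> ==> can p \<alpha>" "coch p \<alpha> ==> smooth_form A sec p \<alpha>"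
 "coch p \<alpha> ==> pforms p \<alpha>" "coch p \<alpha> ==> tensor (p + q) (T \<alpha>)"
 using can_pforms T_tensor by (auto simp: coch_def)

lemma can_comb: "can p \<alpha> ==> can p \<beta> ==> can p (fcomb r \<alpha> \<beta>)"
 unfolding can_def fcomb_def by (simp add: inner_add_left can_forms_comb)

lemma T_comb: "T (fcomb r \<alpha> \<beta>) y us = T \<alpha> y us + r * T \<beta> y us"
 by (simp add: T_def fcomb_def linear_add[OF ell_linear] linear_scale[OF ell_linear])

lemma coch_comb: assumes "coch p \<alpha>" "coch p \<beta>" shows "coch p (fcomb r \<alpha> \<beta>)"
proof -
 have c: "can p (fcomb r \<alpha> \<beta>)" using assms can_comb by (simp add: coch_def)
 have "smooth_form A sec p (fcomb r \<alpha> \<beta>)"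
 proof (rule smooth_formI[OF can_pforms[OF c]])
  fix x Ys assume "length Ys = p + q" "\<And>Y. Y \<in> set Ys ==> smv x Y"
  then show "smf x (%y. T (fcomb r \<alpha> \<beta>) y (map (%Y. Y y) Ys))"
   unfolding T_comb using cochD(4)[OF assms(1)] cochD(4)[OF assms(2)]
   by (intro smf_add smf_mult smf_const tensor_smf) auto
 qed
 then show ?thesis using c by (simp add: coch_def)
qed

lemma can_zero: "can p (%y vs. 0)"
 by (simp add: can_def can_forms_zero)

lemma coch_zero: "coch p (%y vs. 0)"
proof -
 have "smooth_form A sec p (%y vs. 0)"
  by (rule smooth_formI[OF can_pforms[OF can_zero]]) (simp add: T_def linear_0[OF ell_linear] smf_const)
 then show ?thesis by (simp add: coch_def can_zero)
qed

lemma dd_high: "3 \<le> p ==> dd p \<alpha> = (%y vs. 0)"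
 by (simp add: dd_def can_proj_high)

lemma can_dd: "coch p \<alpha> ==> can (Suc p) (dd p \<alpha>)"
 unfolding dd_def by (intro can_can_proj pforms_extd cochD)

text \<open>To be a cochain, and equality of cochains, are tested on canonical coordinates in frames.\<close>

lemma frame_obtain: obtains U E where "vbundle_frame A g nab \<phi> vol q ell sec conn U E" "x \<in> U"
proof -
 obtain U E where f: "frame U E" "x \<in> U" using frame_exists by blast
 have "vbundle_frame A g nab \<phi> vol q ell sec conn U E" by unfold_locales (rule f)
 then show ?thesis using that f by blast
qed

end

context vbundle_frame
begin

lemma ccf_comb: "ccf p (fcomb r \<alpha> \<beta>) = (%L y. ccf p \<alpha> L y + r * ccf p \<beta> L y)"
 by (simp add: ccf_def cc_def fc_def T_comb ccl_linear fun_eq_iff)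

lemma ccf_zero: "ccf p (%y vs. 0) L y = 0"
 by (simp add: ccf_def cc_def fc_def T_def linear_0[OF ell_linear] ccl_linear)

lemma coch_smt: "coch p \<alpha> ==> smt (cr p + q) (ccf p \<alpha>)"
 using smt_ccf by (simp add: coch_def)

lemma ccf_dd: "p \<le> 2 ==> coch p \<alpha> ==> y \<in> U ==> length L = cr (Suc p) + q ==>
  ccf (Suc p) (dd p \<alpha>) L y = Sy p (cov (ccf p \<alpha>)) L y"
 unfolding dd_def by (rule ccf_d) (simp_all add: coch_def)

lemma smt_dd: assumes p: "p \<le> 2" and a: "coch p \<alpha>" shows "smt (cr (Suc p) + q) (ccf (Suc p) (dd p \<alpha>))"
 by (rule smt_cong[OF smt_Sy_cov[OF p coch_smt[OF a]]]) (simp add: ccf_dd[OF p a])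

end

context vbundle
begin

lemma coch_dd: assumes a: "coch p \<alpha>" shows "coch (Suc p) (dd p \<alpha>)"
proof (cases "p \<le> 2")
 case True
 have "smooth_form A sec (Suc p) (dd p \<alpha>)"
 proof (rule smooth_formI[OF can_pforms[OF can_dd[OF a]]])
  fix x Ys assume Ys: "length Ys = Suc p + q" "\<And>Y. Y \<in> set Ys ==> smv x Y"
  obtain U E where F: "vbundle_frame A g nab \<phi> vol q ell sec conn U E" "x \<in> U" by (rule frame_obtain)
  interpret F: vbundle_frame A g nab \<phi> vol q ell sec conn U E by (rule F)
  show "smf x (%y. T (dd p \<alpha>) y (map (%Y. Y y) Ys))"
   by (rule F.smooth_at[OF can_dd[OF a] F.smt_dd[OF True a] F(2) Ys])
 qed
 then show ?thesis using can_dd[OF a] by (simp add: coch_def)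
next
 case False then show ?thesis using coch_zero by (simp add: dd_high)
qed

lemma dd_comb:
 assumes a: "coch p \<alpha>" "coch p \<beta>" shows "dd p (fcomb r \<alpha> \<beta>) = fcomb r (dd p \<alpha>) (dd p \<beta>)"
proof (cases "p \<le> 2")
 case True
 show ?thesis
 proof (intro ext)
  fix y vs
  obtain U E where F: "vbundle_frame A g nab \<phi> vol q ell sec conn U E" "y \<in> U" by (rule frame_obtain)
  interpret F: vbundle_frame A g nab \<phi> vol q ell sec conn U E by (rule F)
  show "dd p (fcomb r \<alpha> \<beta>) y vs = fcomb r (dd p \<alpha>) (dd p \<beta>) y vs"
  proof (rule F.can_eqI[OF can_dd[OF coch_comb[OF a]] can_comb[OF can_dd[OF a(1)] can_dd[OF a(2)]] F(2)])
   fix L :: "7 list" assume L: "length L = cr (Suc p) + q"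
   show "F.ccf (Suc p) (dd p (fcomb r \<alpha> \<beta>)) L y = F.ccf (Suc p) (fcomb r (dd p \<alpha>) (dd p \<beta>)) L y"
    unfolding F.ccf_comb
    using F.Sy_cov_comb[OF True L F(2) F.coch_smt[OF a(1)] F.coch_smt[OF a(2)], of r]
    by (simp add: F.ccf_dd[OF True _ F(2) L] a coch_comb F.ccf_comb)
  qed
 qed
next
 case False then show ?thesis by (simp add: dd_high fcomb_def)
qed

lemma dd_zero: "dd p (%y vs. 0) = (%y vs. 0)"
 using dd_comb[OF coch_zero coch_zero, of p 1] by (simp add: fcomb_def fun_eq_iff)

lemma dd_dd: assumes a: "coch p \<alpha>" shows "dd (Suc p) (dd p \<alpha>) = (%y vs. 0)"
proof (cases "p \<le> 1")
 case True
 show ?thesis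
 proof (intro ext)
  fix y vs
  obtain U E where F: "vbundle_frame A g nab \<phi> vol q ell sec conn U E" "y \<in> U" by (rule frame_obtain)
  interpret F: vbundle_frame A g nab \<phi> vol q ell sec conn U E by (rule F)
  show "dd (Suc p) (dd p \<alpha>) y vs = 0"
  proof (rule F.can_eqI[OF can_dd[OF coch_dd[OF a]] can_zero F(2)])
   fix L :: "7 list" assume L: "length L = cr (Suc (Suc p)) + q"
   have p: "p \<le> 2" "Suc p \<le> 2" using True by auto
   have "F.ccf (Suc (Suc p)) (dd (Suc p) (dd p \<alpha>)) L y = F.Sy (Suc p) (F.cov (F.ccf (Suc p) (dd p \<alpha>))) L y"
    by (rule F.ccf_dd[OF p(2) coch_dd[OF a] F(2) L])
   also have "... = F.Sy (Suc p) (F.cov (F.Sy p (F.cov (F.ccf p \<alpha>)))) L y"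
    by (rule F.Sy_cov_cong[OF p(2) L F(2)]) (rule F.ccf_dd[OF p(1) a])
   also have "... = 0"
   proof -
    consider "p = 0" | "p = 1" using True by linarith
    then show ?thesis
    proof cases
     case 1
     then obtain c J where L': "L = c # J" "length J = q" using L by (auto simp: cr_def length_Suc_conv)
     show ?thesis using F.curl_grad[of q "F.ccf 0 \<alpha>" J y c] F.coch_smt[OF a] L' 1 F(2) by (simp add: cr_def)
    next
     case 2
     then show ?thesis
      using F.div_curl[of q "F.ccf 1 \<alpha>" L y] F.coch_smt[OF a] L F(2)
      by (simp add: cr_def numeral_2_eq_2)
    qed
   qed
   finally show "F.ccf (Suc (Suc p)) (dd (Suc p) (dd p \<alpha>)) L y = F.ccf (Suc (Suc p)) (%y vs. 0) L y"
    by (simp add: F.ccf_zero)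
  qed
 qed
next
 case False then show ?thesis by (simp add: dd_high)
qed

end

subsection \<open>The homotopies\<close>

context g2mfd
begin

lemma can_sigma: "cv.coch p m ==> en.can p (sigma p m)"
 unfolding sigma_def by (intro en.can_can_proj pforms_sig cv.cochD)

lemma can_beta: "en.coch p a ==> cv.can p (beta p a)"
 unfolding beta_def by (intro cv.can_can_proj pforms_bet en.cochD)

end

context g2frame
begin

lemma ccf_sigma': "cv.coch p m ==> y \<in> U ==> length L = cr p + 2 ==>
  en.ccf p (sigma p m) L y = sigma_ix (cov (cv.ccf p m)) L y"
 by (rule ccf_sigma) (simp_all add: cv.coch_def)

lemma ccf_beta': "en.coch p a ==> y \<in> U ==> length L = Suc (cr p) ==>
  cv.ccf p (beta p a) L y = beta_ix (cov (en.ccf p a)) L y"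
 by (rule ccf_beta) (simp_all add: en.coch_def)

lemma smt_cov_ccf: "cv.coch p m ==> smt (cr p + 2) (cov (cv.ccf p m))"
  "en.coch p a ==> smt (cr p + 3) (cov (en.ccf p a))"
 using smt_cov[OF cv.coch_smt, of p m] smt_cov[OF en.coch_smt, of p a] by (simp_all add: eval_nat_numeral)

lemma smt_sigma: "cv.coch p m ==> smt (cr p + 2) (en.ccf p (sigma p m))"
 by (rule smt_cong[OF smt_sigma_ix[OF smt_cov_ccf(1)]]) (simp_all add: ccf_sigma')

lemma smt_beta: "en.coch p a ==> smt (Suc (cr p)) (cv.ccf p (beta p a))"
 by (rule smt_cong[OF smt_beta_ix[OF smt_cov_ccf(2)]]) (simp_all add: ccf_beta')

end

context g2mfd
begin

lemma frame_at: obtains U E where "g2frame A g nab \<phi> vol U E" "x \<in> U"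
proof -
 obtain U E where f: "frame U E" "x \<in> U" using frame_exists by blast
 have "g2frame A g nab \<phi> vol U E" by unfold_locales (rule f)
 then show ?thesis using that f by blast
qed

lemma coch_sigma: assumes m: "cv.coch p m" shows "en.coch p (sigma p m)"
proof -
 have "smooth_form A (smooth_end A) p (sigma p m)"
 proof (rule en.smooth_formI[OF en.can_pforms[OF can_sigma[OF m]]])
  fix x Ys assume Ys: "length Ys = p + 2" "\<And>Y. Y \<in> set Ys ==> smv x Y"
  obtain U E where F: "g2frame A g nab \<phi> vol U E" "x \<in> U" by (rule frame_at)
  interpret F: g2frame A g nab \<phi> vol U E by (rule F)
  show "smf x (%y. en.T (sigma p m) y (map (%Y. Y y) Ys))"
   by (rule F.en.smooth_at[OF can_sigma[OF m] F.smt_sigma[OF m] F(2) Ys])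
 qed
 then show ?thesis using can_sigma[OF m] by (simp add: en.coch_def)
qed

lemma coch_beta: assumes a: "en.coch p a" shows "cv.coch p (beta p a)"
proof -
 have "smooth_form A (smooth_cov A) p (beta p a)"
 proof (rule cv.smooth_formI[OF cv.can_pforms[OF can_beta[OF a]]])
  fix x Ys assume Ys: "length Ys = p + Suc 0" "\<And>Y. Y \<in> set Ys ==> smv x Y"
  obtain U E where F: "g2frame A g nab \<phi> vol U E" "x \<in> U" by (rule frame_at)
  interpret F: g2frame A g nab \<phi> vol U E by (rule F)
  have "F.smt (cr p + Suc 0) (F.cv.ccf p (beta p a))" using F.smt_beta[OF a] by simp
  from F.cv.smooth_at[OF can_beta[OF a] this F(2) Ys]
  show "smf x (%y. cv.T (beta p a) y (map (%Y. Y y) Ys))" .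
 qed
 then show ?thesis using can_beta[OF a] by (simp add: cv.coch_def)
qed

lemma sigma_comb:
 assumes m: "cv.coch p m" "cv.coch p n" shows "sigma p (fcomb r m n) = fcomb r (sigma p m) (sigma p n)"
proof (intro ext)
 fix y vs
 obtain U E where F: "g2frame A g nab \<phi> vol U E" "y \<in> U" by (rule frame_at)
 interpret F: g2frame A g nab \<phi> vol U E by (rule F)
 show "sigma p (fcomb r m n) y vs = fcomb r (sigma p m) (sigma p n) y vs"
 proof (rule F.en.can_eqI[OF can_sigma[OF cv.coch_comb[OF m]] en.can_comb[OF can_sigma[OF m(1)] can_sigma[OF m(2)]] F(2)])
  fix L :: "7 list" assume L: "length L = cr p + 2"
  have "F.sigma_ix (F.cov (%L y. F.cv.ccf p m L y + r * F.cv.ccf p n L y)) L y =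
    F.sigma_ix (%L y. F.cov (F.cv.ccf p m) L y + r * F.cov (F.cv.ccf p n) L y) L y"
   by (rule F.sigma_ix_cong[OF L], rule F.cov_comb[OF _ F(2) F.cv.coch_smt[OF m(1)] F.cv.coch_smt[OF m(2)]]) simp
  then show "F.en.ccf p (sigma p (fcomb r m n)) L y = F.en.ccf p (fcomb r (sigma p m) (sigma p n)) L y"
   by (simp add: F.en.ccf_comb F.ccf_sigma'[OF _ F(2) L] m cv.coch_comb F.cv.ccf_comb F.sigma_ix_comb)
 qed
qed

lemma beta_comb:
 assumes a: "en.coch p a" "en.coch p b" shows "beta p (fcomb r a b) = fcomb r (beta p a) (beta p b)"
proof (intro ext)
 fix y vs
 obtain U E where F: "g2frame A g nab \<phi> vol U E" "y \<in> U" by (rule frame_at)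
 interpret F: g2frame A g nab \<phi> vol U E by (rule F)
 show "beta p (fcomb r a b) y vs = fcomb r (beta p a) (beta p b) y vs"
 proof (rule F.cv.can_eqI[OF can_beta[OF en.coch_comb[OF a]] cv.can_comb[OF can_beta[OF a(1)] can_beta[OF a(2)]] F(2)])
  fix L :: "7 list" assume "length L = cr p + Suc 0"
  then have L: "length L = Suc (cr p)" by simp
  have "F.beta_ix (F.cov (%L y. F.en.ccf p a L y + r * F.en.ccf p b L y)) L y =
    F.beta_ix (%L y. F.cov (F.en.ccf p a) L y + r * F.cov (F.en.ccf p b) L y) L y"
   by (rule F.beta_ix_cong[OF L], rule F.cov_comb[OF _ F(2) F.en.coch_smt[OF a(1)] F.en.coch_smt[OF a(2)]]) simp
  then show "F.cv.ccf p (beta p (fcomb r a b)) L y = F.cv.ccf p (fcomb r (beta p a) (beta p b)) L y"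
   by (simp add: F.cv.ccf_comb F.ccf_beta'[OF _ F(2) L] a en.coch_comb F.en.ccf_comb F.beta_ix_comb)
 qed
qed

lemma linear_trace: "linear (trace :: real^7^7 => real)"
 by (rule linearI) (simp_all add: trace_def sum.distrib sum_distrib_left)

text \<open>
 A canonical form with values in the endomorphisms is trace-free if its coordinates are.
\<close>

lemma trace_ccf:
 assumes F: "g2frame A g nab \<phi> vol U E" and y: "y \<in> U" and I: "length I = cr p"
 shows "(\<Sigma> u. vbundle_frame.ccf 2 ellE E p a (I @ [u, u]) y) =
  ccl p (%L. trace (a y (map (%i. E i y) L))) I"
proof -
 interpret F: g2frame A g nab \<phi> vol U E by (rule F)
 have "F.en.ccf p a (I @ [u, u]) y = ccl p (%L. g y (E u y) (a y (map (%i. E i y) L) *v E u y)) I" for u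
  using F.en.ccf_append[OF I, of "[u, u]" a y] by (simp add: ellE_def)
 then show ?thesis
  by (simp add: trace_orthonormal[OF F.E_on[OF y]] ccl_sum)
qed

lemma trace_sigma: assumes m: "cv.coch p m" shows "trace (sigma p m y vs) = 0"
proof -
 obtain U E where F: "g2frame A g nab \<phi> vol U E" "y \<in> U" by (rule frame_at)
 interpret F: g2frame A g nab \<phi> vol U E by (rule F)
 show ?thesis
 proof (rule F.en.can_functional_zero[OF can_sigma[OF m] linear_trace F(2)])
  fix I :: "7 list" assume I: "length I = cr p"
  have "F.en.ccf p (sigma p m) (I @ [u, u]) y = 0" for u
   using F.ccf_sigma'[OF m F(2), of "I @ [u, u]"] I by (simp add: F.sigma_ix_def butlast_append)
  then show "ccl p (%L. trace (sigma p m y (map (%i. E i y) L))) I = 0"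
   unfolding trace_ccf[OF F I, symmetric] by simp
 qed
qed

lemma trace_dd:
 assumes a: "en.coch p a" and t: "\<And>y vs. trace (a y vs) = 0" shows "trace (en.dd p a y vs) = 0"
proof (cases "p \<le> 2")
 case True
 obtain U E where F: "g2frame A g nab \<phi> vol U E" "y \<in> U" by (rule frame_at)
 interpret F: g2frame A g nab \<phi> vol U E by (rule F)
 show ?thesis
 proof (rule F.en.can_functional_zero[OF en.can_dd[OF a] linear_trace F(2)])
  fix I :: "7 list" assume I: "length I = cr (Suc p)"
  have "(\<Sigma> u. F.Sy p (F.cov (F.en.ccf p a)) (I @ [u, u]) y) = 0"
   by (rule F.Sy_trace[OF True F.en.coch_smt[OF a] F(2) I])
     (simp add: trace_ccf[OF F(1)] t ccl_linear)
  then show "ccl (Suc p) (%L. trace (en.dd p a y (map (%i. E i y) L))) I = 0"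
   unfolding trace_ccf[OF F I, symmetric] using F.en.ccf_dd[OF True a F(2)] I by simp
 qed
next
 case False then show ?thesis by (simp add: en.dd_high trace_def)
qed

subsection \<open>The couplings are null-homotopic\<close>

text \<open>
 In coordinates this is \<open>f_homotopy\<close>. Above degree \<open>2\<close> all projections vanish.
\<close>

lemma f_null:
 assumes m: "cv.coch p m"
 shows "can_proj \<phi> g (Suc p) (f_op A g nab m) = fcomb (-1) (sigma (Suc p) (cv.dd p m)) (en.dd p (sigma p m))"
proof (cases "p \<le> 2")
 case True
 note d = cv.coch_dd[OF m] and s = coch_sigma[OF m]
 show ?thesis
 proof (intro ext)
  fix y vs
  obtain U E where F: "g2frame A g nab \<phi> vol U E" "y \<in> U" by (rule frame_at)
  interpret F: g2frame A g nab \<phi> vol U E by (rule F)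
  show "can_proj \<phi> g (Suc p) (f_op A g nab m) y vs = fcomb (-1) (sigma (Suc p) (cv.dd p m)) (en.dd p (sigma p m)) y vs"
  proof (rule F.en.can_eqI[OF en.can_can_proj[OF pforms_f[OF cv.cochD(3)[OF m]]]
     en.can_comb[OF can_sigma[OF d] en.can_dd[OF s]] F(2)])
   fix L :: "7 list" assume L: "length L = cr (Suc p) + 2"
   then obtain I J where IJ: "L = I @ J" "length I = cr (Suc p)" "length J = 2" by (rule F.en.split_list)
   then obtain u v where J: "J = [u, v]" by (auto simp: F.length_2)
   have "F.en.ccf (Suc p) (sigma (Suc p) (cv.dd p m)) L y =
     F.sigma_ix (F.cov (F.Sy p (F.cov (F.cv.ccf p m)))) L y"
    unfolding F.ccf_sigma'[OF d F(2) L]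
    by (rule F.sigma_ix_cong[OF L], rule F.cov_cong'[OF _ F(2) F.cv.ccf_dd[OF True m]]) simp_all
   moreover have "F.en.ccf (Suc p) (en.dd p (sigma p m)) L y =
     F.Sy p (F.cov (F.sigma_ix (F.cov (F.cv.ccf p m)))) L y"
    unfolding F.en.ccf_dd[OF True s F(2) L]
    by (rule F.Sy_cov_cong[OF True L F(2)]) (rule F.ccf_sigma'[OF m])
   moreover have "F.Sy p (F.f_ix (F.cv.ccf p m)) (I @ [u, v]) y =
     F.sigma_ix (F.cov (F.Sy p (F.cov (F.cv.ccf p m)))) (I @ [u, v]) y -
     F.Sy p (F.cov (F.sigma_ix (F.cov (F.cv.ccf p m)))) (I @ [u, v]) y"
   proof (rule F.f_homotopy[OF _ True _ F(2)])
    show "F.smt (cr p + 1) (F.cv.ccf p m)" using F.cv.coch_smt[OF m] by simp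
    show "length I = cr (Suc p)" by (rule IJ(2))
   qed
   ultimately show "F.en.ccf (Suc p) (can_proj \<phi> g (Suc p) (f_op A g nab m)) L y =
     F.en.ccf (Suc p) (fcomb (-1) (sigma (Suc p) (cv.dd p m)) (en.dd p (sigma p m))) L y"
    using F.ccf_f[OF True cv.cochD(1)[OF m] F(2) L] unfolding F.en.ccf_comb by (simp add: IJ(1) J)
  qed
 qed
next
 case False
 then show ?thesis by (simp add: can_proj_high sigma_def en.dd_high fcomb_def)
qed

lemma b_null:
 assumes a: "en.coch p a"
 shows "can_proj \<phi> g (Suc p) (b_op A nab a) = fcomb (-1) (beta (Suc p) (en.dd p a)) (cv.dd p (beta p a))"
proof (cases "p \<le> 2")
 case True
 note d = en.coch_dd[OF a] and s = coch_beta[OF a]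
 show ?thesis
 proof (intro ext)
  fix y vs
  obtain U E where F: "g2frame A g nab \<phi> vol U E" "y \<in> U" by (rule frame_at)
  interpret F: g2frame A g nab \<phi> vol U E by (rule F)
  show "can_proj \<phi> g (Suc p) (b_op A nab a) y vs = fcomb (-1) (beta (Suc p) (en.dd p a)) (cv.dd p (beta p a)) y vs"
   unfolding b_op_tw
  proof (rule F.cv.can_eqI[OF cv.can_can_proj[OF pforms_tw[OF en.cochD(3)[OF a]]]
     cv.can_comb[OF can_beta[OF d] cv.can_dd[OF s]] F(2)])
   fix L :: "7 list" assume L: "length L = cr (Suc p) + Suc 0"
   then have L': "length L = Suc (cr (Suc p))" by simp
   from L obtain I J where IJ: "L = I @ J" "length I = cr (Suc p)" "length J = Suc 0" by (rule F.cv.split_list)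
   then obtain z where J: "J = [z]" by (auto simp: F.length_1)
   have "F.cv.ccf (Suc p) (beta (Suc p) (en.dd p a)) L y =
     F.beta_ix (F.cov (F.Sy p (F.cov (F.en.ccf p a)))) L y"
    unfolding F.ccf_beta'[OF d F(2) L']
    by (rule F.beta_ix_cong[OF L'], rule F.cov_cong'[OF _ F(2) F.en.ccf_dd[OF True a]]) simp_all
   moreover have "F.cv.ccf (Suc p) (cv.dd p (beta p a)) L y =
     F.Sy p (F.cov (F.beta_ix (F.cov (F.en.ccf p a)))) L y"
    unfolding F.cv.ccf_dd[OF True s F(2) L]
    by (rule F.Sy_cov_cong[OF True L F(2)]) (simp add: F.ccf_beta'[OF a])
   moreover have "F.Sy p (F.b_ix (F.en.ccf p a)) (I @ [z]) y =
     F.beta_ix (F.cov (F.Sy p (F.cov (F.en.ccf p a)))) (I @ [z]) y -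
     F.Sy p (F.cov (F.beta_ix (F.cov (F.en.ccf p a)))) (I @ [z]) y"
   proof (rule F.b_homotopy[OF _ True _ F(2)])
    show "F.smt (cr p + 2) (F.en.ccf p a)" by (rule F.en.coch_smt[OF a])
    show "length I = cr (Suc p)" by (rule IJ(2))
   qed
   moreover have "F.cv.ccf (Suc p) (can_proj \<phi> g (Suc p) (tw (1/4) a)) L y = F.Sy p (F.b_ix (F.en.ccf p a)) L y"
    using F.ccf_tw[OF True en.cochD(3)[OF a] F(2) L, of "1/4"] by simp
   ultimately show "F.cv.ccf (Suc p) (can_proj \<phi> g (Suc p) (tw (1/4) a)) L y =
     F.cv.ccf (Suc p) (fcomb (-1) (beta (Suc p) (en.dd p a)) (cv.dd p (beta p a))) L y"
    unfolding F.cv.ccf_comb by (simp add: IJ(1) J)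
  qed
 qed
next
 case False
 then show ?thesis by (simp add: can_proj_high beta_def cv.dd_high fcomb_def)
qed

text \<open>
 By \<open>b_sigma_ix\<close>. In the coupling \<open>c\<close> the endomorphism \<open>\<B>(m)\<close> has the coordinates of the covariant
 derivative of \<open>m\<close>, of which only the skew part, and so \<open>sigma\<close>, is seen by the curvature.
\<close>

lemma c_null:
 assumes m: "cv.coch p m"
 shows "can_proj \<phi> g (Suc p) (c_op A g nab m) = fcomb (-1) (%y vs. 0) (can_proj \<phi> g (Suc p) (b_op A nab (sigma p m)))"
proof (cases "p \<le> 2")
 case True
 note s = coch_sigma[OF m]
 have pB: "en.pforms p (B_op A g nab m)" by (rule pforms_B[OF cv.cochD(4)[OF m] cv.cochD(3)[OF m]])
 show ?thesis
 proof (intro ext)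
  fix y vs
  obtain U E where F: "g2frame A g nab \<phi> vol U E" "y \<in> U" by (rule frame_at)
  interpret F: g2frame A g nab \<phi> vol U E by (rule F)
  show "can_proj \<phi> g (Suc p) (c_op A g nab m) y vs =
    fcomb (-1) (%y vs. 0) (can_proj \<phi> g (Suc p) (b_op A nab (sigma p m))) y vs"
   unfolding b_op_tw c_op_tw
  proof (rule F.cv.can_eqI[OF cv.can_can_proj[OF pforms_tw[OF pB]]
     cv.can_comb[OF cv.can_zero cv.can_can_proj[OF pforms_tw[OF en.cochD(3)[OF s]]]] F(2)])
   fix L :: "7 list" assume L: "length L = cr (Suc p) + Suc 0"
   let ?M = "F.cov (F.cv.ccf p m)"
   have "F.Sy p (%L y. 4 * (1/2) * F.b_ix (F.en.ccf p (B_op A g nab m)) L y) L y =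
     F.Sy p (%L y. 0 + (-1) * (4 * (1/4) * F.b_ix (F.en.ccf p (sigma p m)) L y)) L y"
   proof (rule F.Sy_cong[OF True L])
    fix K :: "7 list" assume "length K = Suc (cr p + Suc 0)"
    then obtain k M where K: "K = k # M" "length M = cr p + Suc 0" by (auto simp: length_Suc_conv)
    from K(2) obtain I J where IJ: "M = I @ J" "length I = cr p" "length J = Suc 0" by (rule F.cv.split_list)
    then obtain z where J: "J = [z]" by (auto simp: F.length_1)
    have "2 * F.b_ix (F.en.ccf p (B_op A g nab m)) (k # I @ [z]) y = F.c_ix ?M (k # I @ [z]) y"
     using F.ccf_B[OF cv.cochD(1)[OF m] cv.cochD(2)[OF m] F(2) IJ(2)]
     by (simp add: F.b_ix_def F.c_ix_def butlast_append)
    moreover have "F.b_ix (F.en.ccf p (sigma p m)) (k # I @ [z]) y = F.b_ix (F.sigma_ix ?M) (k # I @ [z]) y"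
     using F.ccf_sigma'[OF m F(2)] IJ(2) by (simp add: F.b_ix_def butlast_append)
    ultimately show "4 * (1/2) * F.b_ix (F.en.ccf p (B_op A g nab m)) K y =
      0 + (-1) * (4 * (1/4) * F.b_ix (F.en.ccf p (sigma p m)) K y)"
     using F.b_sigma_ix[OF F(2), of ?M k I z] by (simp add: K(1) IJ(1) J)
   qed
   also have "... = 0 + (-1) * F.Sy p (%L y. 4 * (1/4) * F.b_ix (F.en.ccf p (sigma p m)) L y) L y"
    unfolding F.Sy_comb by (simp add: F.Sy_def F.KP_def F.KT_def)
   finally show "F.cv.ccf (Suc p) (can_proj \<phi> g (Suc p) (tw (1/2) (B_op A g nab m))) L y =
     F.cv.ccf (Suc p) (fcomb (-1) (%y vs. 0) (can_proj \<phi> g (Suc p) (tw (1/4) (sigma p m)))) L y"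
    unfolding F.cv.ccf_comb F.cv.ccf_zero F.ccf_tw[OF True pB F(2) L] F.ccf_tw[OF True en.cochD(3)[OF s] F(2) L] .
  qed
 qed
next
 case False
 then show ?thesis by (simp add: can_proj_high fcomb_def)
qed

text \<open>Hence the couplings map cochains to cochains.\<close>

lemma coch_f: "cv.coch p m ==> en.coch (Suc p) (can_proj \<phi> g (Suc p) (f_op A g nab m))"
 unfolding f_null by (intro en.coch_comb coch_sigma cv.coch_dd en.coch_dd)

lemma trace_f: "cv.coch p m ==> trace (can_proj \<phi> g (Suc p) (f_op A g nab m) y vs) = 0"
 unfolding f_null
 by (simp add: fcomb_def linear_diff[OF linear_trace] trace_sigma trace_dd coch_sigma cv.coch_dd)

lemma coch_b: "en.coch p a ==> cv.coch (Suc p) (can_proj \<phi> g (Suc p) (b_op A nab a))"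
 unfolding b_null by (intro cv.coch_comb coch_beta en.coch_dd cv.coch_dd)

lemma coch_c: "cv.coch p m ==> cv.coch (Suc p) (can_proj \<phi> g (Suc p) (c_op A g nab m))"
 unfolding c_null by (intro cv.coch_comb cv.coch_zero coch_b coch_sigma)

end

subsection \<open>The modules of cochains\<close>

lemma module_form:
 assumes z: "(%x vs. 0) \<in> C" and c: "\<And>r \<alpha> \<beta>. \<alpha> \<in> C ==> \<beta> \<in> C ==> fcomb r \<alpha> \<beta> \<in> C"
 shows "Module.module real_ring (form_module C)"
proof -
 have add: "(%x vs. \<alpha> x vs + \<beta> x vs) \<in> C" if "\<alpha> \<in> C" "\<beta> \<in> C" for \<alpha> \<beta>
  using c[OF that, of 1] by (simp add: fcomb_def)
 have sm: "(%x vs. r *\<^sub>R \<alpha> x vs) \<in> C" if "\<alpha> \<in> C" for r \<alpha>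
  using c[OF z that, of r] by (simp add: fcomb_def)
 show ?thesis
 proof (rule moduleI)
  show "abelian_group (form_module C)"
  proof (rule abelian_groupI)
   fix \<alpha> assume "\<alpha> \<in> carrier (form_module C)"
   then show "\<exists>\<beta>\<in>carrier (form_module C). \<beta> \<oplus>\<^bsub>form_module C\<^esub> \<alpha> = \<zero>\<^bsub>form_module C\<^esub>"
    using sm[of \<alpha> "-1"] by (intro bexI[of _ "%x vs. (-1) *\<^sub>R \<alpha> x vs"]) (auto simp: form_module_def)
  qed (auto simp: form_module_def z add algebra_simps)
 qed (auto simp: form_module_def real_ring_def cring_real_ring[unfolded real_ring_def] sm algebra_simps)
qed

context g2mfd
begin

lemma carrier_G: "carrier (G_mod A \<phi> k) = {m. cv.coch k m}"
 by (simp add: G_mod_def form_module_def set_eq_iff cv.can_cochains_iff cv.coch_def)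

lemma carrier_E: "carrier (E_mod A \<phi> k) = {a. en.coch k a \<and> (\<forall>x vs. trace (a x vs) = 0)}"
 by (simp add: E_mod_def form_module_def set_eq_iff en.can_cochains_iff en.coch_def)

lemma GE_ops:
 "\<zero>\<^bsub>G_mod A \<phi> k\<^esub> = (%x vs. 0)" "\<alpha> \<oplus>\<^bsub>G_mod A \<phi> k\<^esub> \<beta> = fcomb 1 \<alpha> \<beta>" "r \<odot>\<^bsub>G_mod A \<phi> k\<^esub> \<alpha> = fcomb r (%x vs. 0) \<alpha>"
 "\<zero>\<^bsub>E_mod A \<phi> k\<^esub> = (%x vs. 0)" "a \<oplus>\<^bsub>E_mod A \<phi> k\<^esub> b = fcomb 1 a b" "r \<odot>\<^bsub>E_mod A \<phi> k\<^esub> a = fcomb r (%x vs. 0) a"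
 by (simp_all add: G_mod_def E_mod_def form_module_def fcomb_def)

lemma trace_comb:
 "(\<And>x vs. trace (a x vs) = 0) ==> (\<And>x vs. trace (b x vs) = 0) ==> trace (fcomb r a b x vs) = 0"
 for a b :: "'y => vec7 list => real^7^7"
 by (simp add: fcomb_def linear_add[OF linear_trace] linear_scale[OF linear_trace])

lemma d_map_dd: "d_map A \<phi> g nab k = cv.dd k" and e_map_dd: "e_map A \<phi> g nab k = en.dd k"
 by (simp_all add: d_map_def e_map_def cv.dd_def en.dd_def fun_eq_iff)

lemma trace_zero: "trace (0 :: real^7^7) = 0"
 by (simp add: trace_def)

lemma G_complex: "cochain_complex real_ring (G_mod A \<phi>) (d_map A \<phi> g nab)"
proof (rule cochain_complex.intro)
 fix k
 show "Module.module real_ring (G_mod A \<phi> k)"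
  unfolding G_mod_def
  by (rule module_form) (use cv.coch_zero cv.coch_comb in "auto simp: cv.can_cochains_iff cv.coch_def")
qed (auto simp: carrier_G GE_ops d_map_dd cv.coch_dd cv.dd_comb cv.coch_zero cv.dd_dd cv.dd_zero real_ring_def)

lemma E_complex: "cochain_complex real_ring (E_mod A \<phi>) (e_map A \<phi> g nab)"
proof (rule cochain_complex.intro)
 fix k
 show "Module.module real_ring (E_mod A \<phi> k)"
 proof -
  have "{a \<in> can_cochains A \<phi> (smooth_end A) k. \<forall>x vs. trace (a x vs) = 0} =
    {a. en.coch k a \<and> (\<forall>x vs. trace (a x vs) = 0)}"
   by (auto simp: en.can_cochains_iff en.coch_def)
  then show ?thesis unfolding E_mod_def
   by (simp only:) (rule module_form, auto intro: en.coch_zero en.coch_comb trace_comb simp: trace_zero)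
 qed
qed (auto simp: carrier_E GE_ops e_map_dd en.coch_dd en.dd_comb en.coch_zero en.dd_dd en.dd_zero trace_dd)

text \<open>The inverse of the unipotent automorphism that splits the complex.\<close>

definition Qm :: "nat => (('y => vec7 list => vec7) \<times> ('y => vec7 list => vec7)) \<times> ('y => vec7 list => real^7^7) =>
  (('y => vec7 list => vec7) \<times> ('y => vec7 list => vec7)) \<times> ('y => vec7 list => real^7^7)" where
 "Qm k = (%((m, x), a). ((m, fcomb (-1) x (beta k (fcomb (-1) a (sigma k m)))), fcomb (-1) a (sigma k m)))"

lemma splitting:
 "module_isomorphic real_ring
   (restrict_scalars (%r. (r, 0)) (cohomology (B_tau A \<phi>) (D_map A \<phi> g nab) k))
   (dsum_module (cohomology (%j. eps_part (G_mod A \<phi> j)) (d1_map A \<phi> g nab) k)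
    (dsum_module (cohomology (E_mod A \<phi>) (e_map A \<phi> g nab) k)
          (cohomology (G_mod A \<phi>) (d_map A \<phi> g nab) k))) \<and>
  module_isomorphic dual_ring
   (cohomology (B_tau A \<phi>) (D_map A \<phi> g nab) k)
   (dsum_module (base_change (cohomology (G_mod A \<phi>) (d_map A \<phi> g nab) k))
         (restrict_scalars fst (cohomology (E_mod A \<phi>) (e_map A \<phi> g nab) k)))"
proof -
 let ?B = "%k. dsum_module (base_change (G_mod A \<phi> k)) (restrict_scalars fst (E_mod A \<phi> k))"
 let ?D = "D_map A \<phi> g nab"
 have B: "B_tau A \<phi> = ?B" by (simp add: B_tau_def fun_eq_iff)
 have d1: "d1_map A \<phi> g nab = (%k. apsnd (d_map A \<phi> g nab k))" by (simp add: d1_map_def fun_eq_iff)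
 have inB: "((m, x), a) \<in> carrier (?B k) \<longleftrightarrow>
   cv.coch k m \<and> cv.coch k x \<and> en.coch k a \<and> (\<forall>x vs. trace (a x vs) = 0)" for m x a k
  by (auto simp: dsum_module_def base_change_def restrict_scalars_def carrier_G carrier_E)
 have addB: "((m, x), a) \<oplus>\<^bsub>?B k\<^esub> ((m', x'), a') = ((fcomb 1 m m', fcomb 1 x x'), fcomb 1 a a')" for m x a m' x' a' k
  by (simp add: dsum_module_def base_change_def restrict_scalars_def GE_ops)
 have smB: "(s, t) \<odot>\<^bsub>?B k\<^esub> ((m, x), a) = ((fcomb s (%x vs. 0) m,
   fcomb 1 (fcomb s (%x vs. 0) x) (fcomb t (%x vs. 0) m)), fcomb s (%x vs. 0) a)" for s t m x a k
  by (simp add: dsum_module_def base_change_def restrict_scalars_def GE_ops)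
 have Dz: "?D k ((m, x), a) = ((cv.dd k m, fcomb 1 (fcomb 1 (cv.dd k x) (can_proj \<phi> g (Suc k) (b_op A nab a)))
   (can_proj \<phi> g (Suc k) (c_op A g nab m))), fcomb 1 (en.dd k a) (can_proj \<phi> g (Suc k) (f_op A g nab m)))" for k m x a
  by (simp add: D_map_def d_map_dd e_map_dd fcomb_def)
 note co = cv.coch_comb en.coch_comb cv.coch_dd en.coch_dd coch_sigma coch_beta cv.coch_zero en.coch_zero
 note lin = cv.dd_comb en.dd_comb sigma_comb beta_comb
 have D: "?D k z \<in> carrier (?B (Suc k))" if "z \<in> carrier (?B k)" for k z
 proof -
  obtain m x a where z: "z = ((m, x), a)" by (metis surj_pair)
  show ?thesis using that unfolding z Dz inB
   by (intro conjI allI trace_comb co) (auto simp: coch_b coch_c coch_f trace_f trace_dd)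
 qed
 have Q: "bij_betw (Qm k) (carrier (?B k)) (carrier (?B k))" for k
 proof (rule bij_betw_byWitness[where f' = "%((m, x), a). ((m, fcomb 1 x (beta k a)), fcomb 1 a (sigma k m))"])
  show "\<forall>z\<in>carrier (?B k). (%((m, x), a). ((m, fcomb 1 x (beta k a)), fcomb 1 a (sigma k m))) (Qm k z) = z"
   by (auto simp: Qm_def fcomb_def)
  show "\<forall>z\<in>carrier (?B k). Qm k ((%((m, x), a). ((m, fcomb 1 x (beta k a)), fcomb 1 a (sigma k m))) z) = z"
   by (auto simp: Qm_def fcomb_cancel)
  show "Qm k ` carrier (?B k) \<subseteq> carrier (?B k)"
  proof (rule image_subsetI)
   fix z assume c: "z \<in> carrier (?B k)"
   obtain m x a where z: "z = ((m, x), a)" by (metis surj_pair)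
   show "Qm k z \<in> carrier (?B k)"
    using c unfolding z Qm_def prod.case inB by (intro conjI allI trace_comb co) (auto simp: trace_sigma)
  qed
  show "(%((m, x), a). ((m, fcomb 1 x (beta k a)), fcomb 1 a (sigma k m))) ` carrier (?B k) \<subseteq> carrier (?B k)"
  proof (rule image_subsetI)
   fix z assume c: "z \<in> carrier (?B k)"
   obtain m x a where z: "z = ((m, x), a)" by (metis surj_pair)
   show "(%((m, x), a). ((m, fcomb 1 x (beta k a)), fcomb 1 a (sigma k m))) z \<in> carrier (?B k)"
    using c unfolding z prod.case inB by (intro conjI allI trace_comb co) (auto simp: trace_sigma)
  qed
 qed
 have Q_add: "Qm k (z \<oplus>\<^bsub>?B k\<^esub> w) = Qm k z \<oplus>\<^bsub>?B k\<^esub> Qm k w" if "z \<in> carrier (?B k)" "w \<in> carrier (?B k)" for k z w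
 proof -
  obtain m x a m' x' a' where z: "z = ((m, x), a)" "w = ((m', x'), a')" by (metis surj_pair)
  have c: "cv.coch k m" "cv.coch k m'" "en.coch k a" "en.coch k a'" using that unfolding z inB by auto
  have a: "fcomb (-1) (fcomb 1 a a') (sigma k (fcomb 1 m m')) = fcomb 1 (fcomb (-1) a (sigma k m)) (fcomb (-1) a' (sigma k m'))"
   unfolding sigma_comb[OF c(1,2)] by (simp add: fcomb_def fun_eq_iff)
  have b: "beta k (fcomb 1 (fcomb (-1) a (sigma k m)) (fcomb (-1) a' (sigma k m'))) =
    fcomb 1 (beta k (fcomb (-1) a (sigma k m))) (beta k (fcomb (-1) a' (sigma k m')))"
   by (rule beta_comb) (intro co c)+
  show ?thesis
   unfolding z addB Qm_def prod.case a b by (simp add: fcomb_def fun_eq_iff)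
 qed
 have Q_smult: "Qm k (r \<odot>\<^bsub>?B k\<^esub> z) = r \<odot>\<^bsub>?B k\<^esub> Qm k z" if "z \<in> carrier (?B k)" for k r z
 proof -
  obtain m x a where z: "z = ((m, x), a)" by (metis surj_pair)
  obtain s t where r: "r = (s, t)" by (cases r)
  have c: "cv.coch k m" "en.coch k a" using that unfolding z inB by auto
  have s0: "sigma k (%x vs. 0) = (%x vs. 0)"
   using sigma_comb[OF cv.coch_zero cv.coch_zero, of k 1] by (simp add: fcomb_def fun_eq_iff)
  have b0: "beta k (%x vs. 0) = (%x vs. 0)"
   using beta_comb[OF en.coch_zero en.coch_zero, of k 1] by (simp add: fcomb_def fun_eq_iff)
  have a: "fcomb (-1) (fcomb s (%x vs. 0) a) (sigma k (fcomb s (%x vs. 0) m)) =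
    fcomb s (%x vs. 0) (fcomb (-1) a (sigma k m))"
   unfolding sigma_comb[OF cv.coch_zero c(1)] s0 by (simp add: fcomb_def fun_eq_iff algebra_simps)
  have b: "beta k (fcomb s (%x vs. 0) (fcomb (-1) a (sigma k m))) =
    fcomb s (%x vs. 0) (beta k (fcomb (-1) a (sigma k m)))"
   using c by (subst beta_comb) (auto intro!: co simp: b0)
  show ?thesis
   unfolding z r smB Qm_def prod.case a b by (simp add: fcomb_def fun_eq_iff algebra_simps)
 qed
 have Q_D: "Qm (Suc k) (?D k z) =
   (case Qm k z of ((m, x), a) => ((d_map A \<phi> g nab k m, d_map A \<phi> g nab k x), e_map A \<phi> g nab k a))"
  if "z \<in> carrier (?B k)" for k z
 proof -
  obtain m x a where z: "z = ((m, x), a)" by (metis surj_pair)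
  have c: "cv.coch k m" "cv.coch k x" "en.coch k a" using that unfolding z inB by auto
  note s = coch_sigma[OF c(1)]
  let ?a = "fcomb (-1) a (sigma k m)"
  have c': "en.coch k ?a" by (intro co c)
  have ea: "en.dd k ?a = fcomb (-1) (en.dd k a) (en.dd k (sigma k m))" by (rule en.dd_comb[OF c(3) s])
  have ba: "beta k ?a = fcomb (-1) (beta k a) (beta k (sigma k m))" by (rule beta_comb[OF c(3) s])
  have be: "beta (Suc k) (en.dd k ?a) = fcomb (-1) (beta (Suc k) (en.dd k a)) (beta (Suc k) (en.dd k (sigma k m)))"
   unfolding ea by (rule beta_comb) (intro co c)+
  have db: "cv.dd k (beta k ?a) = fcomb (-1) (cv.dd k (beta k a)) (cv.dd k (beta k (sigma k m)))"
   unfolding ba by (rule cv.dd_comb) (intro co c)+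
  have dx: "cv.dd k (fcomb (-1) x (beta k ?a)) = fcomb (-1) (cv.dd k x) (cv.dd k (beta k ?a))"
   by (rule cv.dd_comb) (intro co c)+
  have a: "fcomb (-1) (fcomb 1 (en.dd k a) (can_proj \<phi> g (Suc k) (f_op A g nab m))) (sigma (Suc k) (cv.dd k m)) = en.dd k ?a"
   unfolding f_null[OF c(1)] ea by (simp add: fcomb_def fun_eq_iff)
  have "fcomb (-1) (fcomb 1 (fcomb 1 (cv.dd k x) (can_proj \<phi> g (Suc k) (b_op A nab a))) (can_proj \<phi> g (Suc k) (c_op A g nab m)))
    (beta (Suc k) (en.dd k ?a)) = cv.dd k (fcomb (-1) x (beta k ?a))"
   unfolding dx db be c_null[OF c(1)] b_null[OF c(3)] b_null[OF s]
   by (simp add: fcomb_def fun_eq_iff algebra_simps)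
  then show ?thesis unfolding z Dz Qm_def prod.case a d_map_dd e_map_dd by simp
 qed
 show ?thesis unfolding B d1
  using split_cohomology[where D = ?D and Q = Qm and k = k, OF G_complex E_complex _ D Q Q_add Q_smult Q_D]
  by (simp add: GE_ops)
qed

end

theorem corollary7p2:
  fixes A :: "'y::{t2_space, second_countable_topology} chart set"
    and \<phi> :: "'y \<Rightarrow> vec7 list \<Rightarrow> real"
    and g :: "'y \<Rightarrow> vec7 \<Rightarrow> vec7 \<Rightarrow> real"
    and vol :: "'y \<Rightarrow> vec7 list \<Rightarrow> real"
    and nab :: "('y \<Rightarrow> vec7) \<Rightarrow> ('y \<Rightarrow> vec7) \<Rightarrow> 'y \<Rightarrow> vec7"
    and k :: nat
  assumes "smooth_atlas A"
    and "g2_structure A \<phi> g vol"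
    and "torsion_free A \<phi> g vol"
    and "levi_civita A g nab"
  shows "module_isomorphic real_ring
           (restrict_scalars (\<lambda>r. (r, 0)) (cohomology (B_tau A \<phi>) (D_map A \<phi> g nab) k))
           (dsum_module (cohomology (\<lambda>j. eps_part (G_mod A \<phi> j)) (d1_map A \<phi> g nab) k)
             (dsum_module (cohomology (E_mod A \<phi>) (e_map A \<phi> g nab) k)
                          (cohomology (G_mod A \<phi>) (d_map A \<phi> g nab) k))) \<and>
         module_isomorphic dual_ring
           (cohomology (B_tau A \<phi>) (D_map A \<phi> g nab) k)
           (dsum_module (base_change (cohomology (G_mod A \<phi>) (d_map A \<phi> g nab) k))
                        (restrict_scalars fst (cohomology (E_mod A \<phi>) (e_map A \<phi> g nab) k)))"
proof -
  have "riemannian_metric A g" using assms(2) by (simp add: g2_structure_def)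
  then interpret g2mfd A g nab \<phi> vol using assms by unfold_locales
  show ?thesis by (rule splitting)
qed

end
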